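(* Let $\mathbb G$ be a group of Heisenberg type and let $\Omega\subset\mathbb G$ be a connected bounded domain of class $C^2$ with partial symmetry. Assume that there exists $\alpha>0$ such that, outside the characteristic set $\Sigma$ of $\Omega$, the horizontal mean curvature of $\partial\Omega$ satisfies $\mathscr H(x)=\alpha|z|$ for $x=(z,\sigma)\in\partial\Omega\setminus\Sigma$. Then there exist $\sigma_0\in\mathbb R^k$ and $R>0$ such that $\Omega$ is the gauge ball $$\Omega=\{(z,\sigma)\in\mathbb G\mid|z|^4+16|\sigma-\sigma_0|^2<R^4\}.$$
   Context: A group of Heisenberg type is a simply connected Lie group $\mathbb G$ whose Lie algebra is $\mathfrak g=\mathfrak h\oplus\mathfrak v$ with $[\mathfrak h,\mathfrak h]=\mathfrak v$, $[\mathfrak h,\mathfrak v]=\{0\}$, equipped with an inner product with $\mathfrak h\perp\mathfrak v$, such that the linear map $J:\mathfrak v\to\operatorname{End}(\mathfrak h)$ defined by $\langle J(\sigma)z,z'\rangle=\langle[z,z'],\sigma\rangle$ satisfies $J(\sigma)^2=-|\sigma|^2I_{\mathfrak h}$ for all $\sigma\in\mathfrak v$. Let $m=\dim\mathfrak h$, $k=\dim\mathfrak v$, and let $\{e_i\}_{i=1}^m$, $\{\varepsilon_\ell\}_{\ell=1}^k$ be orthonormal bases of $\mathfrak h$, $\mathfrak v\cong\mathbb R^k$. Points are written in logarithmic coordinates $x=(z,\sigma)$. Set $X_i=\partial_{z_i}+\frac12\sum_{\ell}\langle J(\varepsilon_\ell)z,e_i\rangle\partial_{\sigma_\ell}$,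 $\nabla_Hf=\sum_iX_if\,X_i$, $\Delta_Hf=\sum_iX_i^2f$, $\Delta_{H,\infty}f=\frac12\langle\nabla_H(|\nabla_Hf|^2),\nabla_Hf\rangle$. The Riemannian metric is the left-invariant one making $X_i$ and $T_\ell=\partial_{\sigma_\ell}$ orthonormal. Partial symmetry: $\Omega$ has partial symmetry if there is an open set $\Omega^\star\subset\mathbb R\times\mathbb R^k$ with $(\xi,\sigma)\in\Omega^\star\iff(-\xi,\sigma)\in\Omega^\star$ and $\Omega=\{(z,\sigma)\in\mathbb G\mid(\frac{|z|^2}4,\sigma)\in\Omega^\star_+\}$, where $\Omega^\star_+=\{(\xi,\sigma)\in\Omega^\star\mid\xi\ge0\}$. In this setting the $C^2$ assumption is understood to mean that $\partial\Omega$ has local defining functions of the form $f(z,\sigma)=g(\frac{|z|^2}4,\sigma)$ with $g$ even in $\xi$ and of class $C^2$. Characteristic set: with $\nu$ the Riemannian outer unit normal, $\Sigma=\{x\in\partial\Omega\mid\sum_{i=1}^m\langle\nu(x),X_i(x)\rangle^2=0\}$. Horizontal mean curvature $\mathscr H$ (the trace of the horizontal shape operator): at points of $\partial\Omega\setminus\Sigma$, in terms of a local defining function $f$ of $\partial\Omega$ (with $f<0$ in $\Omega$), it is given by $|\nabla_Hf|^3\mathscr H=|\nabla_Hf|^2\Delta_Hf-\Delta_{H,\infty}f$. *)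

theory Defs
  imports "HOL-Analysis.Analysis"
begin

text \<open>
  The Lie algebra is the orthogonal sum of the Euclidean spaces \<^typ>\<open>'h\<close> and \<^typ>\<open>'v\<close>, realised as
  the product type, with horizontal layer \<open>{(z, 0)}\<close> and vertical layer \<open>{(0, \<sigma>)}\<close>.  The group is
  simply connected and nilpotent, so the exponential map identifies it with its Lie algebra: a point
  of the group is the pair \<open>(z, \<sigma>)\<close> of its logarithmic coordinates.  The orthonormal bases
  \<open>e\<^sub>i\<close> and \<open>\<epsilon>\<^sub>l\<close> are the library's \<^const>\<open>Basis\<close> of the two layers.
\<close>

definition lie_bracket :: "('a::real_vector \<Rightarrow> 'a \<Rightarrow> 'a) \<Rightarrow> bool" where
  "lie_bracket br \<longleftrightarrow> bilinear br \<and> (\<forall>x. br x x = 0) \<and>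
     (\<forall>x y z. br x (br y z) + br y (br z x) + br z (br x y) = 0)"

definition hbr :: "('h::euclidean_space \<times> 'v::euclidean_space \<Rightarrow> 'h \<times> 'v \<Rightarrow> 'h \<times> 'v) \<Rightarrow> 'h \<Rightarrow> 'h \<Rightarrow> 'v" where
  "hbr br z z' = snd (br (z, 0) (z', 0))"

text \<open>\<open>J(\<sigma>)z\<close> is the vector with \<open>\<langle>J(\<sigma>)z, z'\<rangle> = \<langle>[z, z'], \<sigma>\<rangle>\<close> for all \<open>z'\<close>; see \<open>J_inner\<close> below.\<close>

definition J :: "('h::euclidean_space \<times> 'v::euclidean_space \<Rightarrow> 'h \<times> 'v \<Rightarrow> 'h \<times> 'v) \<Rightarrow> 'v \<Rightarrow> 'h \<Rightarrow> 'h" where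
  "J br \<sigma> z = adjoint (hbr br z) \<sigma>"

definition heisenberg_type :: "('h::euclidean_space \<times> 'v::euclidean_space \<Rightarrow> 'h \<times> 'v \<Rightarrow> 'h \<times> 'v) \<Rightarrow> bool" where
  "heisenberg_type br \<longleftrightarrow> lie_bracket br \<and>
     span {br (z, 0) (z', 0) | z z'. True} = range (\<lambda>\<sigma>. (0, \<sigma>)) \<and>
     (\<forall>z \<sigma>. br (z, 0) (0, \<sigma>) = 0) \<and>
     (\<forall>\<sigma> z. J br \<sigma> (J br \<sigma> z) = - ((norm \<sigma>)\<^sup>2 *\<^sub>R z))"

definition X_field :: "('h::euclidean_space \<times> 'v::euclidean_space \<Rightarrow> 'h \<times> 'v \<Rightarrow> 'h \<times> 'v) \<Rightarrow> 'h \<Rightarrow> 'h \<times> 'v \<Rightarrow> 'h \<times> 'v" where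
  "X_field br e x = (e, (1/2) *\<^sub>R (\<Sum>\<epsilon>\<in>Basis. (J br \<epsilon> (fst x) \<bullet> e) *\<^sub>R \<epsilon>))"

definition T_field :: "'v \<Rightarrow> 'h::euclidean_space \<times> 'v::euclidean_space \<Rightarrow> 'h \<times> 'v" where
  "T_field \<epsilon> x = (0, \<epsilon>)"

definition X_deriv :: "('h::euclidean_space \<times> 'v::euclidean_space \<Rightarrow> 'h \<times> 'v \<Rightarrow> 'h \<times> 'v) \<Rightarrow> 'h \<Rightarrow> ('h \<times> 'v \<Rightarrow> real) \<Rightarrow> 'h \<times> 'v \<Rightarrow> real" where
  "X_deriv br e f x = frechet_derivative f (at x) (X_field br e x)"

text \<open>
  The left-invariant Riemannian metric at \<open>x = (z, \<sigma>)\<close>: the differential of left translation by \<open>x\<close>,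
  at the identity, is \<open>(a, b) \<mapsto> (a, b + [z, a] / 2)\<close>, and \<open>pull_back\<close> is its inverse.  That the \<open>X\<^sub>i\<close>
  and \<open>T\<^sub>l\<close> are orthonormal is \<open>metric_X_X\<close>, \<open>metric_X_T\<close>, \<open>metric_T_T\<close> below.
\<close>

definition pull_back :: "('h::euclidean_space \<times> 'v::euclidean_space \<Rightarrow> 'h \<times> 'v \<Rightarrow> 'h \<times> 'v) \<Rightarrow> 'h \<times> 'v \<Rightarrow> 'h \<times> 'v \<Rightarrow> 'h \<times> 'v" where
  "pull_back br x u = (fst u, snd u - (1/2) *\<^sub>R hbr br (fst x) (fst u))"

definition metric :: "('h::euclidean_space \<times> 'v::euclidean_space \<Rightarrow> 'h \<times> 'v \<Rightarrow> 'h \<times> 'v) \<Rightarrow> 'h \<times> 'v \<Rightarrow> 'h \<times> 'v \<Rightarrow> 'h \<times> 'v \<Rightarrow> real" where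
  "metric br x u w = pull_back br x u \<bullet> pull_back br x w"

definition hgrad :: "('h::euclidean_space \<times> 'v::euclidean_space \<Rightarrow> 'h \<times> 'v \<Rightarrow> 'h \<times> 'v) \<Rightarrow> ('h \<times> 'v \<Rightarrow> real) \<Rightarrow> 'h \<times> 'v \<Rightarrow> 'h \<times> 'v" where
  "hgrad br f x = (\<Sum>e\<in>Basis. X_deriv br e f x *\<^sub>R X_field br e x)"

definition hgrad_norm :: "('h::euclidean_space \<times> 'v::euclidean_space \<Rightarrow> 'h \<times> 'v \<Rightarrow> 'h \<times> 'v) \<Rightarrow> ('h \<times> 'v \<Rightarrow> real) \<Rightarrow> 'h \<times> 'v \<Rightarrow> real" where
  "hgrad_norm br f x = sqrt (metric br x (hgrad br f x) (hgrad br f x))"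

definition hlaplacian :: "('h::euclidean_space \<times> 'v::euclidean_space \<Rightarrow> 'h \<times> 'v \<Rightarrow> 'h \<times> 'v) \<Rightarrow> ('h \<times> 'v \<Rightarrow> real) \<Rightarrow> 'h \<times> 'v \<Rightarrow> real" where
  "hlaplacian br f x = (\<Sum>e\<in>Basis. X_deriv br e (X_deriv br e f) x)"

definition hinf_laplacian :: "('h::euclidean_space \<times> 'v::euclidean_space \<Rightarrow> 'h \<times> 'v \<Rightarrow> 'h \<times> 'v) \<Rightarrow> ('h \<times> 'v \<Rightarrow> real) \<Rightarrow> 'h \<times> 'v \<Rightarrow> real" where
  "hinf_laplacian br f x =
     (1/2) * metric br x (hgrad br (\<lambda>y. (hgrad_norm br f y)\<^sup>2) x) (hgrad br f x)"

definition C2_on :: "'a::real_normed_vector set \<Rightarrow> ('a \<Rightarrow> real) \<Rightarrow> bool" where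
  "C2_on U f \<longleftrightarrow> open U \<and>
     (\<exists>(f' :: 'a \<Rightarrow> 'a \<Rightarrow>\<^sub>L real) (f'' :: 'a \<Rightarrow> 'a \<Rightarrow>\<^sub>L 'a \<Rightarrow>\<^sub>L real).
        (\<forall>x\<in>U. (f has_derivative blinfun_apply (f' x)) (at x)) \<and>
        (\<forall>x\<in>U. (f' has_derivative blinfun_apply (f'' x)) (at x)) \<and>
        continuous_on U f'')"

definition local_defining_function ::
    "'a::real_normed_vector set \<Rightarrow> 'a \<Rightarrow> 'a set \<Rightarrow> ('a \<Rightarrow> real) \<Rightarrow> bool" where
  "local_defining_function \<Omega> p U f \<longleftrightarrow> p \<in> U \<and> C2_on U f \<and>
     (\<forall>x\<in>U. x \<in> \<Omega> \<longleftrightarrow> f x < 0) \<and>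
     (\<forall>x\<in>U. x \<in> frontier \<Omega> \<longleftrightarrow> f x = 0) \<and>
     (\<forall>x\<in>U \<inter> frontier \<Omega>. frechet_derivative f (at x) \<noteq> (\<lambda>_. 0))"

definition partial_symmetry :: "('h::euclidean_space \<times> 'v::euclidean_space) set \<Rightarrow> bool" where
  "partial_symmetry \<Omega> \<longleftrightarrow>
     (\<exists>\<Omega>star :: (real \<times> 'v) set. open \<Omega>star \<and>
        (\<forall>\<xi> \<sigma>. (\<xi>, \<sigma>) \<in> \<Omega>star \<longleftrightarrow> (- \<xi>, \<sigma>) \<in> \<Omega>star) \<and>
        \<Omega> = {(z, \<sigma>). ((norm z)\<^sup>2 / 4, \<sigma>) \<in> {(\<xi>, \<tau>) \<in> \<Omega>star. \<xi> \<ge> 0}})"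

text \<open>Being of class \<open>C\<^sup>2\<close>, in the sense used for partially symmetric sets.\<close>

definition partially_symmetric_C2 :: "('h::euclidean_space \<times> 'v::euclidean_space) set \<Rightarrow> bool" where
  "partially_symmetric_C2 \<Omega> \<longleftrightarrow>
     (\<forall>p\<in>frontier \<Omega>. \<exists>U (V :: (real \<times> 'v) set) g.
        C2_on V g \<and>
        (\<forall>\<xi> \<sigma>. (\<xi>, \<sigma>) \<in> V \<longrightarrow> (- \<xi>, \<sigma>) \<in> V \<and> g (- \<xi>, \<sigma>) = g (\<xi>, \<sigma>)) \<and>
        (\<forall>(z, \<sigma>)\<in>U. ((norm z)\<^sup>2 / 4, \<sigma>) \<in> V) \<and>
        local_defining_function \<Omega> p U (\<lambda>(z, \<sigma>). g ((norm z)\<^sup>2 / 4, \<sigma>)))"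

text \<open>
  The outer unit normal is the normalised Riemannian gradient of a defining function; it does not
  depend on which one is used.
\<close>

definition outer_unit_normal ::
    "('h::euclidean_space \<times> 'v::euclidean_space \<Rightarrow> 'h \<times> 'v \<Rightarrow> 'h \<times> 'v) \<Rightarrow> ('h \<times> 'v) set \<Rightarrow> 'h \<times> 'v \<Rightarrow> 'h \<times> 'v \<Rightarrow> bool" where
  "outer_unit_normal br \<Omega> p \<nu> \<longleftrightarrow> metric br p \<nu> \<nu> = 1 \<and>
     (\<exists>U f c. local_defining_function \<Omega> p U f \<and> c > 0 \<and>
        (\<forall>w. frechet_derivative f (at p) w = c * metric br p \<nu> w))"

definition characteristic_set ::
    "('h::euclidean_space \<times> 'v::euclidean_space \<Rightarrow> 'h \<times> 'v \<Rightarrow> 'h \<times> 'v) \<Rightarrow> ('h \<times> 'v) set \<Rightarrow> ('h \<times> 'v) set" where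
  "characteristic_set br \<Omega> =
     {x \<in> frontier \<Omega>. \<exists>\<nu>. outer_unit_normal br \<Omega> x \<nu> \<and>
        (\<Sum>e\<in>Basis. (metric br x \<nu> (X_field br e x))\<^sup>2) = 0}"

text \<open>
  At a noncharacteristic point \<open>p\<close>, \<open>H\<close> is the horizontal mean curvature of the boundary.  The value
  given by the formula is the same for all local defining functions, so it is asked of each of them;
  the first conjunct excludes the case that there is none.
\<close>

definition has_horizontal_mean_curvature ::
    "('h::euclidean_space \<times> 'v::euclidean_space \<Rightarrow> 'h \<times> 'v \<Rightarrow> 'h \<times> 'v) \<Rightarrow> ('h \<times> 'v) set \<Rightarrow> 'h \<times> 'v \<Rightarrow> real \<Rightarrow> bool" where
  "has_horizontal_mean_curvature br \<Omega> p H \<longleftrightarrow>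
     (\<exists>U f. local_defining_function \<Omega> p U f) \<and>
     (\<forall>U f. local_defining_function \<Omega> p U f \<longrightarrow>
        hgrad_norm br f p ^ 3 * H = (hgrad_norm br f p)\<^sup>2 * hlaplacian br f p - hinf_laplacian br f p)"


lemma bilinear_hbr: "heisenberg_type br \<Longrightarrow> bilinear (hbr br)"
  unfolding heisenberg_type_def lie_bracket_def
proof (elim conjE)
  assume b: "bilinear br"
  have l: "linear (br x)" "linear (\<lambda>y. br y x)" for x
    using b unfolding bilinear_def by blast+
  have i: "linear (\<lambda>z::'a. (z, 0::'b))"
    by (auto intro!: linearI)
  show ?thesis
    unfolding bilinear_def hbr_def
    using linear_compose[OF linear_compose[OF i l(1)] linear_snd]
          linear_compose[OF linear_compose[OF i l(2)] linear_snd]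
    by (simp add: o_def)
qed

lemma J_inner:
  assumes "heisenberg_type br"
  shows "J br \<sigma> z \<bullet> z' = hbr br z z' \<bullet> \<sigma>"
proof -
  have "linear (hbr br z)"
    using bilinear_hbr[OF assms] by (simp add: bilinear_def)
  then show ?thesis
    unfolding J_def using adjoint_works[of "hbr br z" z' \<sigma>] by (simp add: inner_commute)
qed

lemma X_field_eq:
  assumes "heisenberg_type br"
  shows "X_field br e x = (e, (1/2) *\<^sub>R hbr br (fst x) e)"
  unfolding X_field_def J_inner[OF assms] by (simp add: euclidean_representation)

lemma pull_back_X: "heisenberg_type br \<Longrightarrow> pull_back br x (X_field br e x) = (e, 0)"
  by (simp add: X_field_eq pull_back_def)

lemma pull_back_T:
  assumes "heisenberg_type br"
  shows "pull_back br x (T_field \<epsilon> x) = (0, \<epsilon>)"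
  using bilinear_rzero[OF bilinear_hbr[OF assms], of "fst x"]
  by (simp add: T_field_def pull_back_def)

lemma metric_X_X:
  assumes "heisenberg_type br" "e \<in> Basis" "e' \<in> Basis"
  shows "metric br x (X_field br e x) (X_field br e' x) = (if e = e' then 1 else 0)"
  using assms by (simp add: metric_def pull_back_X inner_Basis)

lemma metric_X_T:
  assumes "heisenberg_type br"
  shows "metric br x (X_field br e x) (T_field \<epsilon> x) = 0"
  using assms by (simp add: metric_def pull_back_X pull_back_T)

lemma metric_T_T:
  assumes "heisenberg_type br" "\<epsilon> \<in> Basis" "\<epsilon>' \<in> Basis"
  shows "metric br x (T_field \<epsilon> x) (T_field \<epsilon>' x) = (if \<epsilon> = \<epsilon>' then 1 else 0)"
  using assms by (simp add: metric_def pull_back_T inner_Basis)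

end

theory Submission
  imports Defs
begin

text \<open>
  In the coordinates \<open>\<xi> = |z|\<^sup>2 / 4\<close> and \<open>\<sigma>\<close> the curvature equation becomes, for the set \<open>D\<close> with
  \<open>\<Omega> = {(z, \<sigma>). (|z|\<^sup>2 / 4, \<sigma>) \<in> D}\<close>, the weighted constant mean curvature equation
  \<open>tr A + a \<nu>\<^sub>\<xi> / \<xi> = 2 \<alpha>\<close> with \<open>a = (m - 1) / 2\<close>: the frontier of \<open>D\<close> has constant mean curvature for the
  density \<open>\<xi> powr a\<close>, and the gauge balls correspond to Euclidean balls centred on \<open>\<xi> = 0\<close>.

  Rigidity follows by comparing two integral relations.  Let \<open>c = 2 \<alpha> / (k + a)\<close>, let \<open>d\<close> be the distance to
  the complement of \<open>D\<close> and \<open>u = d - c d\<^sup>2 / 2\<close>.  On \<open>\<xi> > 0\<close> one has \<open>\<Delta>u + a u\<^sub>\<xi> / \<xi> \<le> - (k + a + 1) c\<close> in a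
  weak sense, with a strict gain wherever the nearest frontier point is not umbilic.  Testing
  this with cutoffs of \<open>D\<close> bounds \<open>(k + a + 1) c\<close> times the weighted volume of \<open>D\<close> by the weighted area of its
  frontier; the Minkowski formula, obtained from the divergence theorem on thin layers inside \<open>D\<close>, gives
  the reverse inequality.  Hence the frontier is umbilic with curvature \<open>c\<close>, the vector \<open>\<nu> - c x\<close> is locally
  constant along it, and \<open>D\<close> is a ball of radius \<open>1 / c\<close>.  As \<open>d\<close> is not differentiable, the inequality for \<open>u\<close> is
  one for second difference quotients, and areas are limits of volume integrals over layers.
\<close>

section \<open>Compactly supported integrands and second differences\<close>

text \<open>In a ball of radius 1/c about a point of \<xi> = 0, \<open>u\<close> is the quadratic
  polynomial (1 - c^2 r^2) / (2c), with r the distance to the centre: the differential inequality is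
  an equality there, and the gradient has norm 1 on the sphere. So \<open>u\<close> stands in for
  the solution of a boundary value problem, and no elliptic existence or regularity theory enters.
  Where several frontier points are nearest, \<open>u\<close> has a concave kink, which is harmless:
  each of them supplies a smooth function that touches \<open>u\<close> from above, and nonnegative
  test functions need no more.

  The obstacle is the axis \<xi> = 0, where the weight vanishes and a / \<xi> blows up. The
  integrals are cut off at height \<delta>, at a cost of order \<delta> powr a, negligible because a
  > 0, that is m \<ge> 2. A strict gain is needed on a set of positive volume; it is found around
  the midpoint between a point and its nearest frontier point, where the nearest point is unique and
  stable. Umbilicity is thus reached at frontier points nearest to some point with \<xi> > 0. These
  are dense in \<xi> \<ge> 0, and reflection gives the rest.\<close>

lemma integrable_continuous_compact_support:
  fixes g :: "'a::euclidean_space \<Rightarrow> real"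
  assumes "compact K" "continuous_on UNIV g" "\<And>x. x \<notin> K \<Longrightarrow> g x = 0"
  shows "integrable lborel g"
proof -
  have "integrable lborel (\<lambda>x. indicator K x *\<^sub>R g x)"
    using assms continuous_on_subset by (intro borel_integrable_compact) blast+
  moreover have "(\<lambda>x. indicator K x *\<^sub>R g x) = g"
    using assms(3) by (auto simp: indicator_def fun_eq_iff)
  ultimately show ?thesis by simp
qed

lemma integral_lborel_translate:
  fixes g :: "'a::euclidean_space \<Rightarrow> real"
  assumes "g \<in> borel_measurable borel"
  shows "(\<integral>x. g (x + v) \<partial>lborel) = (\<integral>x. g x \<partial>lborel)"
proof -
  have "(\<integral>x. g x \<partial>lborel) = (\<integral>x. g x \<partial>(distr lborel borel ((+) v)))"
    by (simp add: lborel_distr_plus)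
  also have "\<dots> = (\<integral>x. g (v + x) \<partial>lborel)"
    by (rule integral_distr) (use assms in auto)
  finally show ?thesis by (simp add: add.commute)
qed

lemma compact_support_uniformly_continuous:
  fixes g :: "'a::euclidean_space \<Rightarrow> real"
  assumes "compact K" "continuous_on UNIV g" "\<And>x. x \<notin> K \<Longrightarrow> g x = 0" "\<tau> > 0"
  obtains d where "d > 0" "\<And>x y. norm (x - y) < d \<Longrightarrow> \<bar>g x - g y\<bar> < \<tau>"
proof -
  \<comment> \<open>Two points at distance below 1, one of them in \<open>K\<close>, both lie in
    this compact set, where uniform continuity is available.\<close>
  define K1 where "K1 = {x + y | x y. x \<in> K \<and> y \<in> cball (0::'a) 1}"
  have K1: "compact K1" unfolding K1_def using assms(1) by (intro compact_sums) auto
  have "uniformly_continuous_on K1 g"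
    using K1 assms(2) by (intro compact_uniformly_continuous) (auto intro: continuous_on_subset)
  then obtain d where d: "d > 0" "\<And>x y. x \<in> K1 \<Longrightarrow> y \<in> K1 \<Longrightarrow> dist y x < d \<Longrightarrow> dist (g y) (g x) < \<tau>"
    using \<open>\<tau> > 0\<close> unfolding uniformly_continuous_on_def by meson
  have "\<bar>g x - g y\<bar> < \<tau>" if "norm (x - y) < min d 1" for x y
  proof -
    have in1: "b \<in> K1" if "a \<in> K" "norm (a - b) < min d 1" for a b
      using that unfolding K1_def mem_Collect_eq
      by (intro exI[of _ a] exI[of _ "b - a"]) (auto simp: norm_minus_commute)
    have in2: "a \<in> K1" if "a \<in> K" for a
      using in1[OF that, of a] d(1) by simp
    consider "x \<in> K" | "y \<in> K" | "x \<notin> K" "y \<notin> K" by blast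
    then show ?thesis
    proof cases
      case 1
      then show ?thesis using d(2)[of y x] in1[OF 1] in2[OF 1] that by (auto simp: dist_norm)
    next
      case 2
      then show ?thesis using d(2)[of x y] in1[OF 2, of x] in2[OF 2] that
        by (auto simp: dist_norm norm_minus_commute abs_minus_commute)
    next
      case 3
      then show ?thesis using assms(3,4) by simp
    qed
  qed
  then show thesis using that[of "min d 1"] d(1) by auto
qed

lemma derivative_zero_off_support:
  fixes g :: "'a::euclidean_space \<Rightarrow> real"
  assumes "compact K" "(g has_derivative g') (at x)" "\<And>x. x \<notin> K \<Longrightarrow> g x = 0" "x \<notin> K"
  shows "g' = (\<lambda>_. 0)"
proof -
  have "((\<lambda>_. 0) has_derivative g') (at x)"
    using assms by (intro has_derivative_transform_within_open[OF assms(2), of "- K"])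
      (auto simp: compact_imp_closed open_Compl)
  then show ?thesis
    by (rule has_derivative_unique) (rule has_derivative_const)
qed

lemma difference_quotient_uniform:
  fixes g :: "'a::euclidean_space \<Rightarrow> real"
  assumes K: "compact K" and g: "\<And>x. (g has_derivative g' x) (at x)"
    and c: "continuous_on UNIV (\<lambda>x. g' x e)" and z: "\<And>x. x \<notin> K \<Longrightarrow> g x = 0" and t: "\<tau> > 0"
  obtains h0 where "h0 > 0"
    "\<And>x h. 0 < h \<Longrightarrow> h < h0 \<Longrightarrow> \<bar>(g (x + h *\<^sub>R e) - g x) / h - g' x e\<bar> \<le> \<tau>"
proof -
  have "\<And>x. x \<notin> K \<Longrightarrow> g' x e = 0"
    using derivative_zero_off_support[OF K g z] by (metis)
  from compact_support_uniformly_continuous[OF K c this t]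
  obtain d where d: "d > 0" "\<And>x y. norm (x - y) < d \<Longrightarrow> \<bar>g' x e - g' y e\<bar> < \<tau>" by metis
  have "\<bar>(g (x + h *\<^sub>R e) - g x) / h - g' x e\<bar> \<le> \<tau>" if h: "0 < h" "h < d / (norm e + 1)" for x h
  proof -
    have *: "((\<lambda>t. g (x + t *\<^sub>R e)) has_derivative (\<lambda>s. g' (x + t *\<^sub>R e) (s *\<^sub>R e))) (at t)" for t
      by (rule has_derivative_compose[OF _ g, of "\<lambda>t. x + t *\<^sub>R e", simplified])
        (auto intro!: derivative_eq_intros)
    obtain t where t: "t \<in> {0<..<h}"
      "g (x + h *\<^sub>R e) - g (x + 0 *\<^sub>R e) = g' (x + t *\<^sub>R e) ((h - 0) *\<^sub>R e)"
      using mvt_simple[OF h(1), of "\<lambda>t. g (x + t *\<^sub>R e)" "\<lambda>t s. g' (x + t *\<^sub>R e) (s *\<^sub>R e)"]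
        has_derivative_at_withinI[OF *] by blast
    have "(g (x + h *\<^sub>R e) - g x) / h = g' (x + t *\<^sub>R e) e"
      using t(2) h linear_cmul[OF has_derivative_linear[OF g]] by (simp add: field_simps)
    moreover have "norm (x + t *\<^sub>R e - x) < d"
    proof -
      have "t * (norm e + 1) < d" using t(1) h
        by (smt (verit) greaterThanLessThan_iff norm_ge_zero pos_less_divide_eq)
      then show ?thesis using t(1) by (simp add: algebra_simps)
    qed
    ultimately show ?thesis using d(2) by (metis less_imp_le)
  qed
  then show thesis using that[of "d / (norm e + 1)"] d(1)
    by (metis add_nonneg_pos divide_pos_pos norm_ge_zero zero_less_one)
qed

lemma abs_integral_le_compact_support:
  fixes g :: "'a::euclidean_space \<Rightarrow> real"
  assumes "compact K" "continuous_on UNIV g" "\<And>x. x \<notin> K \<Longrightarrow> g x = 0" "\<And>x. \<bar>g x\<bar> \<le> B"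
  shows "\<bar>\<integral>x. g x \<partial>lborel\<bar> \<le> B * measure lborel K"
proof -
  have i: "integrable lborel g" using assms integrable_continuous_compact_support by blast
  have k: "integrable lborel (indicator K :: 'a \<Rightarrow> real)"
    using emeasure_compact_finite[OF assms(1)] assms(1)
    by (intro integrable_real_indicator) (auto simp: compact_imp_closed)
  have "\<bar>\<integral>x. g x \<partial>lborel\<bar> \<le> (\<integral>x. \<bar>g x\<bar> \<partial>lborel)"
    using integral_abs_bound by blast
  also have "\<dots> \<le> (\<integral>x. B * indicator K x \<partial>lborel)"
  proof (intro integral_mono integrable_abs[OF i] integrable_mult_right[OF k])
    show "\<bar>g x\<bar> \<le> B * indicator K x" for x
      using assms(3,4) by (cases "x \<in> K") auto
  qed
  also have "\<dots> = B * measure lborel K" by simp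
  finally show ?thesis .
qed

text \<open>Translation invariance makes every difference quotient of \<open>g\<close> integrate to
  zero, and the quotients converge uniformly to the derivative, with supports in one compact
  set.\<close>

lemma integral_derivative_zero:
  fixes g :: "'a::euclidean_space \<Rightarrow> real"
  assumes K: "compact K" and g: "\<And>x. (g has_derivative g' x) (at x)"
    and c: "continuous_on UNIV (\<lambda>x. g' x e)" and z: "\<And>x. x \<notin> K \<Longrightarrow> g x = 0"
  shows "(\<integral>x. g' x e \<partial>lborel) = 0"
proof -
  define K1 where "K1 = {x + y | x y. x \<in> K \<and> y \<in> cball (0::'a) (norm e)}"
  have K1: "compact K1" unfolding K1_def using K by (intro compact_sums) auto
  have cg: "continuous_on UNIV g"
    using g has_derivative_continuous continuous_at_imp_continuous_on by blast
  have KK1: "x \<in> K1" if "x + h *\<^sub>R e \<in> K" "0 \<le> h" "h \<le> 1" for x h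
    using that unfolding K1_def mem_Collect_eq
    by (intro exI[of _ "x + h *\<^sub>R e"] exI[of _ "- (h *\<^sub>R e)"]) (auto intro!: mult_left_le_one_le)
  have KK0: "x \<in> K1" if "x \<in> K" for x using KK1[of x 0] that by simp
  have z': "\<And>x. x \<notin> K \<Longrightarrow> g' x e = 0"
    using derivative_zero_off_support[OF K g z] by metis
  have ig: "integrable lborel g" by (rule integrable_continuous_compact_support[OF K cg z])
  have ig': "integrable lborel (\<lambda>x. g' x e)" by (rule integrable_continuous_compact_support[OF K c z'])
  have "\<bar>\<integral>x. g' x e \<partial>lborel\<bar> \<le> \<tau> * measure lborel K1" if \<tau>: "\<tau> > 0" for \<tau>
  proof -
    obtain h0 where h0: "h0 > 0"
      "\<And>x h. 0 < h \<Longrightarrow> h < h0 \<Longrightarrow> \<bar>(g (x + h *\<^sub>R e) - g x) / h - g' x e\<bar> \<le> \<tau>"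
      using difference_quotient_uniform[OF K g c z \<tau>] by blast
    define h where "h = min (h0 / 2) 1"
    have h: "0 < h" "h < h0" "h \<le> 1" using h0(1) by (auto simp: h_def)
    have cs: "continuous_on UNIV (\<lambda>x. g (x + h *\<^sub>R e))"
      by (rule continuous_on_compose2[OF cg]) (auto intro!: continuous_intros)
    have ih: "integrable lborel (\<lambda>x. g (x + h *\<^sub>R e))"
      by (rule integrable_continuous_compact_support[OF K1 cs]) (use KK1 h z in force)
    have "(\<integral>x. (g (x + h *\<^sub>R e) - g x) / h - g' x e \<partial>lborel) = - (\<integral>x. g' x e \<partial>lborel)"
      using ig ih ig' integral_lborel_translate[of g "h *\<^sub>R e"] cg
      by (simp add: borel_measurable_continuous_onI)
    moreover have "\<bar>\<integral>x. (g (x + h *\<^sub>R e) - g x) / h - g' x e \<partial>lborel\<bar> \<le> \<tau> * measure lborel K1"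
    proof (rule abs_integral_le_compact_support[OF K1])
      show "continuous_on UNIV (\<lambda>x. (g (x + h *\<^sub>R e) - g x) / h - g' x e)"
        using h by (intro continuous_intros cs cg c) auto
      show "(g (x + h *\<^sub>R e) - g x) / h - g' x e = 0" if "x \<notin> K1" for x
        using that KK1[of x h] KK0 h z z' by (metis diff_self div_0 less_imp_le)
    qed (use h0 h in auto)
    ultimately show ?thesis by simp
  qed
  then have "\<bar>\<integral>x. g' x e \<partial>lborel\<bar> \<le> 0 + \<epsilon>" if "\<epsilon> > 0" for \<epsilon>
    using that[THEN divide_pos_pos, of "measure lborel K1 + 1"]
    by (smt (verit) divide_pos_pos measure_nonneg mult_less_cancel_left_pos nonzero_eq_divide_eq)
  then show ?thesis using field_le_epsilon by (metis abs_le_zero_iff)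
qed

text \<open>\<open>G\<close> acts as a supergradient: up to O(h) it bounds the forward difference
  quotients of \<open>u\<close> from above and the backward ones from below. \<open>F\<close> is the
  gradient of \<open>\<rho>\<close> without the part due to \<open>\<beta>\<close>. Multiplying the
  inequality for second differences by \<open>\<rho>\<close> and summing by parts leaves the
  integral of \<open>F\<close> against the forward quotients. Replacing these by \<open>G\<close>,
  of norm at most 1, costs the size of \<open>F\<close> times the gap between backward and forward
  quotient, and this gap vanishes in the mean although not pointwise.\<close>

lemma discrete_weak_inequality:
  fixes u \<rho> \<beta> \<Lambda> :: "'a::euclidean_space \<Rightarrow> real" and F :: "'a \<Rightarrow> 'a"
  assumes K: "compact K" and e0: "e0 \<in> Basis"
    and \<rho>0: "\<And>x. \<rho> x \<ge> 0" and \<rho>K: "\<And>x. x \<notin> K \<Longrightarrow> \<rho> x = 0"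
    and \<rho>': "\<And>x. (\<rho> has_derivative \<rho>' x) (at x)"
    and c\<rho>': "\<And>b. b \<in> Basis \<Longrightarrow> continuous_on UNIV (\<lambda>x. \<rho>' x b)"
    and \<beta>0: "\<And>x. x \<in> K \<Longrightarrow> \<beta> x \<ge> 0" and c\<beta>: "continuous_on UNIV (\<lambda>x. \<beta> x * \<rho> x)"
    and F: "\<And>x b. b \<in> Basis \<Longrightarrow> F x \<bullet> b = \<rho>' x b - (if b = e0 then \<beta> x * \<rho> x else 0)"
    and c\<Lambda>: "continuous_on UNIV \<Lambda>"
    and L: "\<And>x y. \<bar>u x - u y\<bar> \<le> L * norm (x - y)"
    and K0: "K0 \<ge> 0"
    and key: "\<And>\<tau>. \<tau> > 0 \<Longrightarrow> \<exists>h0>0. \<forall>x\<in>K. \<forall>h. 0 < h \<and> h < h0 \<longrightarrow> (\<exists>G. norm G \<le> 1 \<and>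
        (\<forall>b\<in>Basis. u (x + h *\<^sub>R b) \<le> u x + h * (G \<bullet> b) + K0 * h\<^sup>2 \<and>
                   u (x - h *\<^sub>R b) \<le> u x - h * (G \<bullet> b) + K0 * h\<^sup>2) \<and>
        (\<Sum>b\<in>Basis. u (x + h *\<^sub>R b) + u (x - h *\<^sub>R b) - 2 * u x) / h\<^sup>2 + \<beta> x * (G \<bullet> e0) \<le> - \<Lambda> x + \<tau>)"
  shows "(\<integral>x. \<rho> x * \<Lambda> x \<partial>lborel) \<le> (\<integral>x. norm (F x) \<partial>lborel)"
proof -
  define K1 where "K1 = {x + y | x y. x \<in> K \<and> y \<in> cball (0::'a) 1}"
  have K1: "compact K1" unfolding K1_def using K by (intro compact_sums) auto
  have KK1: "x \<in> K1" if "x + h *\<^sub>R b \<in> K" "b \<in> Basis" "0 < h" "h < 1" for x h b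
    using that unfolding K1_def mem_Collect_eq
    by (intro exI[of _ "x + h *\<^sub>R b"] exI[of _ "- (h *\<^sub>R b)"]) auto
  have KK0: "x \<in> K1" if "x \<in> K" for x
    using that unfolding K1_def mem_Collect_eq by (intro exI[of _ x] exI[of _ 0]) auto
  have L0: "L \<ge> 0" using L[of e0 0] e0 by simp
  have cu: "continuous_on UNIV u"
    by (rule lipschitz_on_continuous_on[of L]) (use L L0 in \<open>auto simp: lipschitz_on_def dist_norm\<close>)
  have c\<rho>: "continuous_on UNIV \<rho>"
    using \<rho>' has_derivative_continuous continuous_at_imp_continuous_on by blast
  have \<rho>'K: "\<rho>' x b = 0" if "x \<notin> K" for x b
    using derivative_zero_off_support[OF K \<rho>' \<rho>K that] that by metis
  have cF: "continuous_on UNIV F"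
    unfolding continuous_on_componentwise[of _ F]
  proof
    fix i :: 'a assume i: "i \<in> Basis"
    show "continuous_on UNIV (\<lambda>x. F x \<bullet> i)"
      using F[OF i] c\<rho>'[OF i] c\<beta> by (cases "i = e0") (auto intro!: continuous_intros)
  qed
  have FK: "F x = 0" if "x \<notin> K" for x
    by (rule euclidean_eqI) (use F \<rho>'K \<rho>K that in auto)
  define q where "q x = \<beta> x * \<rho> x" for x
  have cq: "continuous_on UNIV q" unfolding q_def by (rule c\<beta>)
  have qK: "q x = 0" if "x \<notin> K" for x unfolding q_def using \<rho>K that by simp
  have q0: "q x \<ge> 0" for x using \<beta>0 \<rho>0 \<rho>K by (cases "x \<in> K") (auto simp: q_def)
  \<comment> \<open>Collects the coefficients of all errors of order \<tau>. It depends neither on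
    \<tau> nor on the step h, so \<tau> can tend to 0.\<close>
  define B where "B = 2 * (real DIM('a) * L * measure lborel K1) + (\<integral>x. q x + \<rho> x \<partial>lborel)
     + 3 * (\<Sum>b\<in>Basis. \<integral>x. \<bar>F x \<bullet> b\<bar> \<partial>lborel)"
  have main: "(\<integral>x. \<rho> x * \<Lambda> x \<partial>lborel) \<le> (\<integral>x. norm (F x) \<partial>lborel) + \<tau> * B" if \<tau>: "\<tau> > 0" for \<tau>
  proof -
    obtain h0 where h0: "h0 > 0" and key': "\<And>x h. x \<in> K \<Longrightarrow> 0 < h \<Longrightarrow> h < h0 \<Longrightarrow> (\<exists>G. norm G \<le> 1 \<and>
        (\<forall>b\<in>Basis. u (x + h *\<^sub>R b) \<le> u x + h * (G \<bullet> b) + K0 * h\<^sup>2 \<and>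
                   u (x - h *\<^sub>R b) \<le> u x - h * (G \<bullet> b) + K0 * h\<^sup>2) \<and>
        (\<Sum>b\<in>Basis. u (x + h *\<^sub>R b) + u (x - h *\<^sub>R b) - 2 * u x) / h\<^sup>2 + \<beta> x * (G \<bullet> e0) \<le> - \<Lambda> x + \<tau>)"
      using key[OF \<tau>] by blast
    have "\<forall>b\<in>Basis. \<exists>h1>0. \<forall>x h. 0 < h \<and> h < h1 \<longrightarrow> \<bar>(\<rho> (x + h *\<^sub>R b) - \<rho> x) / h - \<rho>' x b\<bar> \<le> \<tau>"
    proof
      fix b :: 'a assume b: "b \<in> Basis"
      show "\<exists>h1>0. \<forall>x h. 0 < h \<and> h < h1 \<longrightarrow> \<bar>(\<rho> (x + h *\<^sub>R b) - \<rho> x) / h - \<rho>' x b\<bar> \<le> \<tau>"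
        using difference_quotient_uniform[OF K \<rho>' c\<rho>'[OF b] \<rho>K \<tau>] by metis
    qed
    then obtain h1 where h1: "\<And>b. b \<in> Basis \<Longrightarrow> h1 b > 0"
      "\<And>b x h. b \<in> Basis \<Longrightarrow> 0 < h \<Longrightarrow> h < h1 b \<Longrightarrow> \<bar>(\<rho> (x + h *\<^sub>R b) - \<rho> x) / h - \<rho>' x b\<bar> \<le> \<tau>"
      by metis
    have "\<forall>b\<in>Basis. \<exists>h1>0. \<forall>x h. 0 < h \<and> h < h1 \<longrightarrow> \<bar>\<bar>F (x + h *\<^sub>R b) \<bullet> b\<bar> - \<bar>F x \<bullet> b\<bar>\<bar> \<le> \<tau>"
    proof
      fix b :: 'a assume b: "b \<in> Basis"
      have "continuous_on UNIV (\<lambda>x. \<bar>F x \<bullet> b\<bar>)" by (intro continuous_intros cF)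
      moreover have "\<bar>F x \<bullet> b\<bar> = 0" if "x \<notin> K" for x using FK[OF that] by simp
      ultimately obtain d where "d > 0" "\<And>x y. norm (x - y) < d \<Longrightarrow> \<bar>\<bar>F x \<bullet> b\<bar> - \<bar>F y \<bullet> b\<bar>\<bar> < \<tau>"
        using compact_support_uniformly_continuous[OF K _ _ \<tau>, of "\<lambda>x. \<bar>F x \<bullet> b\<bar>"] by blast
      then show "\<exists>h1>0. \<forall>x h. 0 < h \<and> h < h1 \<longrightarrow> \<bar>\<bar>F (x + h *\<^sub>R b) \<bullet> b\<bar> - \<bar>F x \<bullet> b\<bar>\<bar> \<le> \<tau>"
        using b by (intro exI[of _ d]) (auto intro!: less_imp_le)
    qed
    then obtain h2 where h2: "\<And>b. b \<in> Basis \<Longrightarrow> h2 b > 0"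
      "\<And>b x h. b \<in> Basis \<Longrightarrow> 0 < h \<Longrightarrow> h < h2 b \<Longrightarrow> \<bar>\<bar>F (x + h *\<^sub>R b) \<bullet> b\<bar> - \<bar>F x \<bullet> b\<bar>\<bar> \<le> \<tau>"
      by metis
    define h where "h = Min ({1, h0, \<tau> / (K0 + 1)} \<union> h1 ` Basis \<union> h2 ` Basis) / 2"
    have hpos: "h > 0" unfolding h_def using h0 h1(1) h2(1) \<tau> K0 by auto
    have hlt: "h < z" if "z \<in> {1, h0, \<tau> / (K0 + 1)} \<union> h1 ` Basis \<union> h2 ` Basis" for z
    proof -
      have "2 * h \<le> z" unfolding h_def using Min_le[OF _ that] by simp
      then show ?thesis using hpos by simp
    qed
    have h1': "h < 1" "h < h0" "\<And>b. b \<in> Basis \<Longrightarrow> h < h1 b" "\<And>b. b \<in> Basis \<Longrightarrow> h < h2 b"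
      using hlt by auto
    have hK0: "K0 * h \<le> \<tau>"
    proof -
      have "h * (K0 + 1) < \<tau>" using hlt[of "\<tau> / (K0 + 1)"] K0 by (simp add: pos_less_divide_eq)
      then show ?thesis using hpos by (simp add: algebra_simps)
    qed
    \<comment> \<open>The backward quotient at \<open>x\<close> is
      \<open>D b (x - h *\<^sub>R b)\<close>, so that summation by parts becomes a translation of
      the integration variable (\<open>ipp\<close>).\<close>
    define D where "D b x = (u (x + h *\<^sub>R b) - u x) / h" for b x
    have DL: "\<bar>D b x\<bar> \<le> L" if "b \<in> Basis" for b x
      using L[of "x + h *\<^sub>R b" x] that hpos unfolding D_def by (simp add: field_simps)
    have ct: "continuous_on UNIV (\<lambda>x. g (x + y))" if "continuous_on UNIV g" for g :: "'a \<Rightarrow> real" and y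
      by (rule continuous_on_compose2[OF that]) (auto intro!: continuous_intros)
    have cD: "continuous_on UNIV (D b)" for b
      unfolding D_def using hpos by (intro continuous_intros ct cu) auto
    have cDm: "continuous_on UNIV (\<lambda>x. D b (x - h *\<^sub>R b))" for b
      using ct[OF cD, of b "- (h *\<^sub>R b)"] by simp
    have ipp: "(\<integral>x. g x * D b (x - h *\<^sub>R b) \<partial>lborel) = (\<integral>x. g (x + h *\<^sub>R b) * D b x \<partial>lborel)"
      if "continuous_on UNIV g" for g :: "'a \<Rightarrow> real" and b
    proof -
      have "continuous_on UNIV (\<lambda>x. g x * D b (x - h *\<^sub>R b))"
        by (intro continuous_intros that cDm)
      from integral_lborel_translate[OF borel_measurable_continuous_onI[OF this], of "h *\<^sub>R b"]
      show ?thesis by simp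
    qed
    have I: "integrable lborel g" if "continuous_on UNIV g" "\<And>x. x \<notin> K \<Longrightarrow> g x = 0" for g :: "'a \<Rightarrow> real"
      using integrable_continuous_compact_support[OF K that] .
    have I1: "integrable lborel g" if "continuous_on UNIV g" "\<And>x. x \<notin> K1 \<Longrightarrow> g x = 0" for g :: "'a \<Rightarrow> real"
      using integrable_continuous_compact_support[OF K1 that] .
    have sh0: "\<rho> (x + h *\<^sub>R b) = 0" "F (x + h *\<^sub>R b) = 0" if "x \<notin> K1" "b \<in> Basis" for x b
      using KK1[of x h b] that hpos h1'(1) \<rho>K FK by blast+
    have pw: "\<rho> x * \<Lambda> x \<le> (\<Sum>b\<in>Basis. - (\<rho> x * (D b x - D b (x - h *\<^sub>R b)) / h)) - q x * D e0 x
        + \<tau> * (q x + \<rho> x)" (is ?A)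
      and pw2: "(\<Sum>b\<in>Basis. (F x \<bullet> b) * D b x) \<le> norm (F x)
        + (\<Sum>b\<in>Basis. \<bar>F x \<bullet> b\<bar> * (D b (x - h *\<^sub>R b) - D b x + 3 * \<tau>))" (is ?B) for x
    proof -
      have "?A \<and> ?B"
      proof (cases "x \<in> K")
        case False
        then show ?thesis by (simp add: \<rho>K FK qK)
      next
        case True
        from key'[OF this hpos h1'(2)] obtain G where G: "norm G \<le> 1"
          and up: "\<And>b. b \<in> Basis \<Longrightarrow> u (x + h *\<^sub>R b) \<le> u x + h * (G \<bullet> b) + K0 * h\<^sup>2"
          and dn: "\<And>b. b \<in> Basis \<Longrightarrow> u (x - h *\<^sub>R b) \<le> u x - h * (G \<bullet> b) + K0 * h\<^sup>2"
          and k: "(\<Sum>b\<in>Basis. u (x + h *\<^sub>R b) + u (x - h *\<^sub>R b) - 2 * u x) / h\<^sup>2 + \<beta> x * (G \<bullet> e0) \<le> - \<Lambda> x + \<tau>"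
          by blast
        have Dp: "D b x \<le> G \<bullet> b + \<tau>" if "b \<in> Basis" for b
        proof -
          have "D b x \<le> G \<bullet> b + K0 * h"
            using up[OF that] hpos by (simp add: D_def field_simps power2_eq_square)
          then show ?thesis using hK0 by simp
        qed
        have Dm: "D b (x - h *\<^sub>R b) \<ge> G \<bullet> b - \<tau>" if "b \<in> Basis" for b
        proof -
          have "D b (x - h *\<^sub>R b) \<ge> G \<bullet> b - K0 * h"
            using dn[OF that] hpos by (simp add: D_def field_simps power2_eq_square)
          then show ?thesis using hK0 by simp
        qed
        have "(\<Sum>b\<in>Basis. u (x + h *\<^sub>R b) + u (x - h *\<^sub>R b) - 2 * u x) / h\<^sup>2
            = (\<Sum>b\<in>Basis. (D b x - D b (x - h *\<^sub>R b)) / h)"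
          unfolding sum_divide_distrib using hpos
          by (intro sum.cong refl) (simp add: D_def power2_eq_square diff_divide_distrib add_divide_distrib)
        then have "\<Lambda> x \<le> - (\<Sum>b\<in>Basis. (D b x - D b (x - h *\<^sub>R b)) / h) - \<beta> x * (G \<bullet> e0) + \<tau>"
          using k by simp
        \<comment> \<open>The sign of \<open>\<beta>\<close> decides: \<open>G\<close> controls the
          forward quotient from above only.\<close>
        moreover have "\<beta> x * (G \<bullet> e0) \<ge> \<beta> x * (D e0 x - \<tau>)"
          using Dp[OF e0] \<beta>0[OF True] by (intro mult_left_mono) auto
        ultimately have "\<Lambda> x \<le> - (\<Sum>b\<in>Basis. (D b x - D b (x - h *\<^sub>R b)) / h) - \<beta> x * (D e0 x - \<tau>) + \<tau>"
          by linarith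
        from mult_left_mono[OF this \<rho>0[of x]]
        have "\<rho> x * \<Lambda> x \<le> - (\<rho> x * (\<Sum>b\<in>Basis. (D b x - D b (x - h *\<^sub>R b)) / h)) - q x * D e0 x + \<tau> * (q x + \<rho> x)"
          unfolding q_def by (simp add: algebra_simps)
        moreover have "- (\<rho> x * (\<Sum>b\<in>Basis. (D b x - D b (x - h *\<^sub>R b)) / h))
            = (\<Sum>b\<in>Basis. - (\<rho> x * (D b x - D b (x - h *\<^sub>R b)) / h))"
          unfolding sum_distrib_left sum_negf[symmetric] by simp
        ultimately have A: ?A by simp
        have "(F x \<bullet> b) * D b x \<le> (F x \<bullet> b) * (G \<bullet> b) + \<bar>F x \<bullet> b\<bar> * (D b (x - h *\<^sub>R b) - D b x + 3 * \<tau>)"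
          if b: "b \<in> Basis" for b
        proof -
          \<comment> \<open>For one sign of the difference this is \<open>Dm\<close>. For the other,
            \<open>Dp\<close> gives \<tau>, while backward minus forward quotient is never below -2
            \<tau>; hence the 3 \<tau>.\<close>
          have "\<bar>D b x - G \<bullet> b\<bar> \<le> D b (x - h *\<^sub>R b) - D b x + 3 * \<tau>"
            using Dp[OF b] Dm[OF b] \<tau> by linarith
          then have "\<bar>F x \<bullet> b\<bar> * \<bar>D b x - G \<bullet> b\<bar> \<le> \<bar>F x \<bullet> b\<bar> * (D b (x - h *\<^sub>R b) - D b x + 3 * \<tau>)"
            by (intro mult_left_mono) auto
          moreover have "(F x \<bullet> b) * (D b x - G \<bullet> b) \<le> \<bar>F x \<bullet> b\<bar> * \<bar>D b x - G \<bullet> b\<bar>"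
            by (metis abs_ge_self abs_mult)
          ultimately show ?thesis by (simp add: algebra_simps)
        qed
        then have "(\<Sum>b\<in>Basis. (F x \<bullet> b) * D b x) \<le> F x \<bullet> G
          + (\<Sum>b\<in>Basis. \<bar>F x \<bullet> b\<bar> * (D b (x - h *\<^sub>R b) - D b x + 3 * \<tau>))"
          unfolding euclidean_inner[of "F x" G] sum.distrib[symmetric] by (intro sum_mono) blast
        moreover have "F x \<bullet> G \<le> norm (F x)"
          using norm_cauchy_schwarz[of "F x" G] mult_left_mono[OF G norm_ge_zero[of "F x"]] by simp
        ultimately have ?B by linarith
        with A show ?thesis by blast
      qed
      then show ?A ?B by blast+
    qed
    have i1: "integrable lborel (\<lambda>x. \<rho> x * \<Lambda> x)" by (rule I) (auto intro!: continuous_intros c\<rho> c\<Lambda> simp: \<rho>K)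
    have i2: "integrable lborel (\<lambda>x. - (\<rho> x * (D b x - D b (x - h *\<^sub>R b)) / h))" for b
      using hpos by (intro I) (auto intro!: continuous_intros c\<rho> cD cDm simp: \<rho>K)
    have i3: "integrable lborel (\<lambda>x. q x * D e0 x)" by (rule I) (auto intro!: continuous_intros cq cD simp: qK)
    have i4: "integrable lborel (\<lambda>x. q x + \<rho> x)" by (rule I) (auto intro!: continuous_intros cq c\<rho> simp: qK \<rho>K)
    have i5: "integrable lborel (\<lambda>x. norm (F x))" by (rule I) (auto intro!: continuous_intros cF simp: FK)
    have i6: "integrable lborel (\<lambda>x. \<bar>F x \<bullet> b\<bar> * (D b (x - h *\<^sub>R b) - D b x + 3 * \<tau>))" for b
      by (rule I) (auto intro!: continuous_intros cF cD cDm simp: FK)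
    have i7: "integrable lborel (\<lambda>x. (F x \<bullet> b) * D b x)" for b
      by (rule I) (auto intro!: continuous_intros cF cD simp: FK)
    have i8: "integrable lborel (\<lambda>x. \<rho>' x b * D b x)" if "b \<in> Basis" for b
      by (rule I) (auto intro!: continuous_intros c\<rho>' cD simp: \<rho>'K that)
    have parts: "(\<integral>x. - (\<rho> x * (D b x - D b (x - h *\<^sub>R b)) / h) \<partial>lborel)
        \<le> (\<integral>x. \<rho>' x b * D b x \<partial>lborel) + \<tau> * L * measure lborel K1" if b: "b \<in> Basis" for b
    proof -
      have j1: "integrable lborel (\<lambda>x. \<rho> x * D b (x - h *\<^sub>R b))" "integrable lborel (\<lambda>x. \<rho> x * D b x)"
        by (rule I, auto intro!: continuous_intros c\<rho> cD cDm simp: \<rho>K)+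
      have j2: "integrable lborel (\<lambda>x. \<rho> (x + h *\<^sub>R b) * D b x)"
        by (rule I1) (auto intro!: continuous_intros ct c\<rho> cD simp: sh0 b)
      have "(\<integral>x. - (\<rho> x * (D b x - D b (x - h *\<^sub>R b)) / h) \<partial>lborel)
        = (\<integral>x. (\<rho> x * D b (x - h *\<^sub>R b) - \<rho> x * D b x) / h \<partial>lborel)"
        by (intro Bochner_Integration.integral_cong refl) (simp add: right_diff_distrib diff_divide_distrib)
      also have "\<dots> = (\<integral>x. (\<rho> (x + h *\<^sub>R b) * D b x - \<rho> x * D b x) / h \<partial>lborel)"
        using j1 j2 ipp[OF c\<rho>] by simp
      also have "\<dots> = (\<integral>x. \<rho>' x b * D b x + ((\<rho> (x + h *\<^sub>R b) - \<rho> x) / h - \<rho>' x b) * D b x \<partial>lborel)"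
        by (intro Bochner_Integration.integral_cong refl) (simp add: algebra_simps diff_divide_distrib)
      also have "\<dots> = (\<integral>x. \<rho>' x b * D b x \<partial>lborel)
          + (\<integral>x. ((\<rho> (x + h *\<^sub>R b) - \<rho> x) / h - \<rho>' x b) * D b x \<partial>lborel)"
      proof (intro Bochner_Integration.integral_add i8 b I1)
        show "((\<rho> (x + h *\<^sub>R b) - \<rho> x) / h - \<rho>' x b) * D b x = 0" if "x \<notin> K1" for x
        proof -
          have "x \<notin> K" using that KK0 by blast
          then show ?thesis using that b by (simp add: sh0 \<rho>K \<rho>'K)
        qed
      qed (use hpos in \<open>auto intro!: continuous_intros ct c\<rho> cD c\<rho>' b\<close>)
      finally have eq: "(\<integral>x. - (\<rho> x * (D b x - D b (x - h *\<^sub>R b)) / h) \<partial>lborel) = (\<integral>x. \<rho>' x b * D b x \<partial>lborel)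
          + (\<integral>x. ((\<rho> (x + h *\<^sub>R b) - \<rho> x) / h - \<rho>' x b) * D b x \<partial>lborel)" .
      have "\<bar>\<integral>x. ((\<rho> (x + h *\<^sub>R b) - \<rho> x) / h - \<rho>' x b) * D b x \<partial>lborel\<bar> \<le> (\<tau> * L) * measure lborel K1"
      proof (rule abs_integral_le_compact_support[OF K1])
        show "continuous_on UNIV (\<lambda>x. ((\<rho> (x + h *\<^sub>R b) - \<rho> x) / h - \<rho>' x b) * D b x)"
          using hpos by (auto intro!: continuous_intros ct c\<rho> cD c\<rho>' b)
        show "((\<rho> (x + h *\<^sub>R b) - \<rho> x) / h - \<rho>' x b) * D b x = 0" if "x \<notin> K1" for x
        proof -
          have "x \<notin> K" using that KK0 by blast
          then show ?thesis using that b by (simp add: sh0 \<rho>K \<rho>'K)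
        qed
        show "\<bar>((\<rho> (x + h *\<^sub>R b) - \<rho> x) / h - \<rho>' x b) * D b x\<bar> \<le> \<tau> * L" for x
          unfolding abs_mult using h1(2)[OF b hpos h1'(3)[OF b]] DL[OF b] \<tau> by (intro mult_mono) auto
      qed
      with eq show ?thesis by linarith
    qed
    \<comment> \<open>After a translation the difference falls on the absolute value of
      \<open>F \<bullet> b\<close>, which is uniformly continuous, so the gap of the quotients is
      small in the mean.\<close>
    have Fdiff: "(\<integral>x. \<bar>F x \<bullet> b\<bar> * (D b (x - h *\<^sub>R b) - D b x + 3 * \<tau>) \<partial>lborel)
        \<le> \<tau> * L * measure lborel K1 + 3 * \<tau> * (\<integral>x. \<bar>F x \<bullet> b\<bar> \<partial>lborel)" if b: "b \<in> Basis" for b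
    proof -
      have cFb: "continuous_on UNIV (\<lambda>x. \<bar>F x \<bullet> b\<bar>)" by (intro continuous_intros cF)
      have j1: "integrable lborel (\<lambda>x. \<bar>F x \<bullet> b\<bar> * D b (x - h *\<^sub>R b))" "integrable lborel (\<lambda>x. \<bar>F x \<bullet> b\<bar> * D b x)"
          "integrable lborel (\<lambda>x. \<bar>F x \<bullet> b\<bar>)"
        by (rule I, auto intro!: continuous_intros cFb cD cDm simp: FK)+
      have j2: "integrable lborel (\<lambda>x. \<bar>F (x + h *\<^sub>R b) \<bullet> b\<bar> * D b x)"
        by (rule I1) (auto intro!: continuous_intros ct[OF cFb] cD simp: sh0 b)
      have "(\<integral>x. \<bar>F x \<bullet> b\<bar> * (D b (x - h *\<^sub>R b) - D b x + 3 * \<tau>) \<partial>lborel)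
        = (\<integral>x. \<bar>F x \<bullet> b\<bar> * D b (x - h *\<^sub>R b) - \<bar>F x \<bullet> b\<bar> * D b x + 3 * \<tau> * \<bar>F x \<bullet> b\<bar> \<partial>lborel)"
        by (intro Bochner_Integration.integral_cong) (auto simp: algebra_simps)
      also have "\<dots> = (\<integral>x. \<bar>F (x + h *\<^sub>R b) \<bullet> b\<bar> * D b x \<partial>lborel) - (\<integral>x. \<bar>F x \<bullet> b\<bar> * D b x \<partial>lborel)
           + 3 * \<tau> * (\<integral>x. \<bar>F x \<bullet> b\<bar> \<partial>lborel)"
        using j1 j2 ipp[OF cFb] by simp
      also have "(\<integral>x. \<bar>F (x + h *\<^sub>R b) \<bullet> b\<bar> * D b x \<partial>lborel) - (\<integral>x. \<bar>F x \<bullet> b\<bar> * D b x \<partial>lborel)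
         = (\<integral>x. (\<bar>F (x + h *\<^sub>R b) \<bullet> b\<bar> - \<bar>F x \<bullet> b\<bar>) * D b x \<partial>lborel)"
        using j1 j2 by (simp add: left_diff_distrib)
      finally have eq: "(\<integral>x. \<bar>F x \<bullet> b\<bar> * (D b (x - h *\<^sub>R b) - D b x + 3 * \<tau>) \<partial>lborel)
        = (\<integral>x. (\<bar>F (x + h *\<^sub>R b) \<bullet> b\<bar> - \<bar>F x \<bullet> b\<bar>) * D b x \<partial>lborel)
           + 3 * \<tau> * (\<integral>x. \<bar>F x \<bullet> b\<bar> \<partial>lborel)" .
      have "\<bar>\<integral>x. (\<bar>F (x + h *\<^sub>R b) \<bullet> b\<bar> - \<bar>F x \<bullet> b\<bar>) * D b x \<partial>lborel\<bar> \<le> (\<tau> * L) * measure lborel K1"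
      proof (rule abs_integral_le_compact_support[OF K1])
        show "continuous_on UNIV (\<lambda>x. (\<bar>F (x + h *\<^sub>R b) \<bullet> b\<bar> - \<bar>F x \<bullet> b\<bar>) * D b x)"
          by (auto intro!: continuous_intros ct[OF cFb] cFb cD)
        show "(\<bar>F (x + h *\<^sub>R b) \<bullet> b\<bar> - \<bar>F x \<bullet> b\<bar>) * D b x = 0" if "x \<notin> K1" for x
        proof -
          have "x \<notin> K" using that KK0 by blast
          then show ?thesis using that b by (simp add: sh0 FK)
        qed
        show "\<bar>(\<bar>F (x + h *\<^sub>R b) \<bullet> b\<bar> - \<bar>F x \<bullet> b\<bar>) * D b x\<bar> \<le> \<tau> * L" for x
          unfolding abs_mult using h2(2)[OF b hpos h1'(4)[OF b]] DL[OF b] \<tau> by (intro mult_mono) auto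
      qed
      with eq show ?thesis by linarith
    qed
    have "(\<integral>x. \<rho> x * \<Lambda> x \<partial>lborel) \<le> (\<integral>x. (\<Sum>b\<in>Basis. - (\<rho> x * (D b x - D b (x - h *\<^sub>R b)) / h)) - q x * D e0 x
        + \<tau> * (q x + \<rho> x) \<partial>lborel)"
      by (intro integral_mono i1 Bochner_Integration.integrable_add Bochner_Integration.integrable_diff
          Bochner_Integration.integrable_sum i2 i3 integrable_mult_right i4 pw)
    also have "\<dots> = (\<Sum>b\<in>Basis. (\<integral>x. - (\<rho> x * (D b x - D b (x - h *\<^sub>R b)) / h) \<partial>lborel))
        - (\<integral>x. q x * D e0 x \<partial>lborel) + \<tau> * (\<integral>x. q x + \<rho> x \<partial>lborel)"
      using i2 i3 i4
      by (simp only: Bochner_Integration.integral_add Bochner_Integration.integral_diff Bochner_Integration.integral_sum Bochner_Integration.integrable_add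
         Bochner_Integration.integrable_diff Bochner_Integration.integrable_sum integrable_mult_right integral_mult_right_zero)
    also have "\<dots> \<le> (\<Sum>b\<in>Basis. (\<integral>x. \<rho>' x b * D b x \<partial>lborel) + \<tau> * L * measure lborel K1)
        - (\<integral>x. q x * D e0 x \<partial>lborel) + \<tau> * (\<integral>x. q x + \<rho> x \<partial>lborel)"
      by (intro add_right_mono diff_right_mono sum_mono parts)
    also have "\<dots> = (\<Sum>b\<in>Basis. (\<integral>x. (F x \<bullet> b) * D b x \<partial>lborel)) + \<tau> * (real DIM('a) * L * measure lborel K1)
        + \<tau> * (\<integral>x. q x + \<rho> x \<partial>lborel)"
    proof -
      have "(\<integral>x. (F x \<bullet> b) * D b x \<partial>lborel) = (\<integral>x. \<rho>' x b * D b x \<partial>lborel)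
          - (if b = e0 then (\<integral>x. q x * D e0 x \<partial>lborel) else 0)" if b: "b \<in> Basis" for b
        using i8[OF b] i3 by (auto simp: F[OF b] q_def[symmetric] left_diff_distrib)
      then have "(\<Sum>b\<in>Basis. (\<integral>x. (F x \<bullet> b) * D b x \<partial>lborel)) = (\<Sum>b\<in>Basis. (\<integral>x. \<rho>' x b * D b x \<partial>lborel)
          - (if b = e0 then (\<integral>x. q x * D e0 x \<partial>lborel) else 0))" by (intro sum.cong) auto
      also have "\<dots> = (\<Sum>b\<in>Basis. (\<integral>x. \<rho>' x b * D b x \<partial>lborel)) - (\<integral>x. q x * D e0 x \<partial>lborel)"
        using e0 by (simp add: sum_subtractf)
      finally show ?thesis by (simp add: sum.distrib algebra_simps)
    qed
    also have "(\<Sum>b\<in>Basis. (\<integral>x. (F x \<bullet> b) * D b x \<partial>lborel)) = (\<integral>x. (\<Sum>b\<in>Basis. (F x \<bullet> b) * D b x) \<partial>lborel)"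
      using i7 by simp
    also have "\<dots> \<le> (\<integral>x. norm (F x)
        + (\<Sum>b\<in>Basis. \<bar>F x \<bullet> b\<bar> * (D b (x - h *\<^sub>R b) - D b x + 3 * \<tau>)) \<partial>lborel)"
      by (intro integral_mono Bochner_Integration.integrable_add Bochner_Integration.integrable_sum i5 i6 i7 pw2)
    also have "\<dots> = (\<integral>x. norm (F x) \<partial>lborel)
        + (\<Sum>b\<in>Basis. (\<integral>x. \<bar>F x \<bullet> b\<bar> * (D b (x - h *\<^sub>R b) - D b x + 3 * \<tau>) \<partial>lborel))"
      using i5 i6 by (simp only: Bochner_Integration.integral_add Bochner_Integration.integral_sum Bochner_Integration.integrable_sum)
    also have "(\<Sum>b\<in>Basis. (\<integral>x. \<bar>F x \<bullet> b\<bar> * (D b (x - h *\<^sub>R b) - D b x + 3 * \<tau>) \<partial>lborel))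
       \<le> (\<Sum>b\<in>Basis. \<tau> * L * measure lborel K1 + 3 * \<tau> * (\<integral>x. \<bar>F x \<bullet> b\<bar> \<partial>lborel))"
      by (intro sum_mono Fdiff)
    also have "\<dots> = \<tau> * (real DIM('a) * L * measure lborel K1) + \<tau> * (3 * (\<Sum>b\<in>Basis. \<integral>x. \<bar>F x \<bullet> b\<bar> \<partial>lborel))"
      by (simp add: sum.distrib sum_distrib_left algebra_simps)
    finally show ?thesis unfolding B_def by (simp add: algebra_simps)
  qed
  have "(\<integral>x. \<rho> x * \<Lambda> x \<partial>lborel) \<le> (\<integral>x. norm (F x) \<partial>lborel) + \<epsilon>" if "\<epsilon> > 0" for \<epsilon>
  proof -
    have "\<epsilon> / (\<bar>B\<bar> + 1) * B \<le> \<epsilon>"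
    proof -
      have "B / (\<bar>B\<bar> + 1) \<le> 1" by (intro divide_le_eq_1_pos[THEN iffD2]) linarith+
      from mult_left_mono[OF this less_imp_le[OF that]] show ?thesis by simp
    qed
    then show ?thesis using main[of "\<epsilon> / (\<bar>B\<bar> + 1)"] that by (smt (verit) divide_pos_pos)
  qed
  then show ?thesis by (rule field_le_epsilon)
qed

section \<open>Twice continuously differentiable functions\<close>

text \<open>A Farkas lemma with a single constraint. The part \<open>w\<close> of \<open>b\<close>
  orthogonal to \<open>a\<close> is tested through \<open>w - s *\<^sub>R a\<close>, which lies in
  the half space for every s > 0; letting s tend to 0 forces w = 0.\<close>

lemma nonneg_multiple_of_halfspace:
  fixes a b :: "'a::real_inner"
  assumes "a \<noteq> 0" "\<And>v. a \<bullet> v < 0 \<Longrightarrow> b \<bullet> v \<le> 0"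
  shows "\<exists>l\<ge>0. b = l *\<^sub>R a"
proof -
  define l where "l = (b \<bullet> a) / (a \<bullet> a)"
  define w where "w = b - l *\<^sub>R a"
  have aa: "a \<bullet> a > 0" using assms(1) by simp
  have aw: "a \<bullet> w = 0" using aa by (simp add: w_def l_def inner_diff_right inner_commute)
  have bw: "b \<bullet> w = w \<bullet> w" using aw by (simp add: w_def inner_diff_left inner_diff_right inner_commute)
  have ba: "b \<bullet> a = l * (a \<bullet> a)" using aa by (simp add: l_def)
  have "w \<bullet> w \<le> s * (l * (a \<bullet> a))" if "s > 0" for s
    using assms(2)[of "w - s *\<^sub>R a"] that aa aw bw ba by (simp add: inner_diff_right)
  then have "w \<bullet> w \<le> 0 + e" if "e > 0" for e
    using that[THEN divide_pos_pos, of "\<bar>l * (a \<bullet> a)\<bar> + 1"]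
    by (smt (verit, ccfv_SIG) divide_pos_pos mult_left_mono nonzero_eq_divide_eq that)
  then have "w \<bullet> w \<le> 0" using field_le_epsilon by blast
  then have "w = 0" by (metis inner_eq_zero_iff inner_ge_zero order_antisym)
  then have "b = l *\<^sub>R a" by (simp add: w_def)
  moreover have "l \<ge> 0"
    using assms(2)[of "- a"] aa ba by (simp add: zero_le_mult_iff)
  ultimately show ?thesis by blast
qed

lemma derivative_nonpos_if_nonpos_right:
  fixes f :: "'a::real_normed_vector \<Rightarrow> real"
  assumes "(f has_derivative f') (at p)" "f p = 0" "d > 0"
    "\<And>t. 0 < t \<Longrightarrow> t < d \<Longrightarrow> f (p + t *\<^sub>R v) \<le> 0"
  shows "f' v \<le> 0"
proof (rule ccontr)
  assume "\<not> f' v \<le> 0"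
  have "((\<lambda>t. f (p + t *\<^sub>R v)) has_derivative (\<lambda>s. f' (s *\<^sub>R v))) (at 0)"
    by (rule has_derivative_compose[of "\<lambda>t. p + t *\<^sub>R v", simplified, where f' = "\<lambda>s. s *\<^sub>R v"])
      (auto intro!: derivative_eq_intros assms(1))
  then have D: "DERIV (\<lambda>t. f (p + t *\<^sub>R v)) 0 :> f' v"
  proof -
    have "(\<lambda>s. f' (s *\<^sub>R v)) = (\<lambda>s. f' v * s)"
      using linear_cmul[OF has_derivative_linear[OF assms(1)]] by (auto simp: mult.commute)
    then show ?thesis unfolding has_field_derivative_def using \<open>(_ has_derivative (\<lambda>s. f' (s *\<^sub>R v))) (at 0)\<close> by simp
  qed
  from DERIV_pos_inc_right[OF D] \<open>\<not> f' v \<le> 0\<close>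
  obtain e where e: "e > 0" "\<And>h. 0 < h \<Longrightarrow> h < e \<Longrightarrow> f (p + 0 *\<^sub>R v) < f (p + (0 + h) *\<^sub>R v)" by force
  define t where "t = min d e / 2"
  have "0 < t" "t < d" "t < e" using e(1) assms(3) by (auto simp: t_def)
  then show False
    using e(2)[of t] assms(4)[of t] assms(2) by simp
qed

text \<open>Gradient and Hessian are kept as a vector and as a map on vectors, so that inner
  products, norms and traces can be written directly. Continuity of the Hessian is asked for each
  direction separately, which in finite dimension is the same as norm continuity.\<close>

definition C2_grad :: "'a::euclidean_space set \<Rightarrow> ('a \<Rightarrow> real) \<Rightarrow> ('a \<Rightarrow> 'a) \<Rightarrow> ('a \<Rightarrow> 'a \<Rightarrow> 'a) \<Rightarrow> bool" where
  "C2_grad U f g H \<longleftrightarrow> open U \<and> (\<forall>x\<in>U. (f has_derivative (\<lambda>v. g x \<bullet> v)) (at x)) \<and>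
     (\<forall>x\<in>U. (g has_derivative H x) (at x)) \<and> (\<forall>v. continuous_on U (\<lambda>x. H x v))"

lemma C2_gradD:
  assumes "C2_grad U f g H"
  shows "open U" "\<And>x. x \<in> U \<Longrightarrow> (f has_derivative (\<lambda>v. g x \<bullet> v)) (at x)"
    "\<And>x. x \<in> U \<Longrightarrow> (g has_derivative H x) (at x)" "\<And>v. continuous_on U (\<lambda>x. H x v)"
  using assms by (auto simp: C2_grad_def)

lemma has_real_derivative_along_line:
  fixes f :: "'a::euclidean_space \<Rightarrow> real"
  assumes "(f has_derivative (\<lambda>v. g \<bullet> v)) (at (p + t *\<^sub>R v))"
  shows "((\<lambda>t. f (p + t *\<^sub>R v)) has_real_derivative (g \<bullet> v)) (at t)"
proof -
  have "((\<lambda>t. f (p + t *\<^sub>R v)) has_derivative (\<lambda>s. g \<bullet> (s *\<^sub>R v))) (at t)"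
    by (rule has_derivative_compose[of "\<lambda>t. p + t *\<^sub>R v", simplified, where f' = "\<lambda>s. s *\<^sub>R v"])
      (auto intro!: derivative_eq_intros assms(1))
  moreover have "(\<lambda>s. g \<bullet> (s *\<^sub>R v)) = (\<lambda>s. (g \<bullet> v) * s)" by (auto simp: mult.commute)
  ultimately show ?thesis unfolding has_field_derivative_def by simp
qed

lemma has_real_derivative_along_line_inner:
  fixes g :: "'a::euclidean_space \<Rightarrow> 'a"
  assumes "(g has_derivative H) (at (p + t *\<^sub>R v))"
  shows "((\<lambda>t. g (p + t *\<^sub>R v) \<bullet> w) has_real_derivative (H v \<bullet> w)) (at t)"
proof -
  have "((\<lambda>t. g (p + t *\<^sub>R v)) has_derivative (\<lambda>s. H (s *\<^sub>R v))) (at t)"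
    by (rule has_derivative_compose[of "\<lambda>t. p + t *\<^sub>R v", simplified, where f' = "\<lambda>s. s *\<^sub>R v"])
      (auto intro!: derivative_eq_intros assms(1))
  then have "((\<lambda>t. g (p + t *\<^sub>R v) \<bullet> w) has_derivative (\<lambda>s. H (s *\<^sub>R v) \<bullet> w)) (at t)"
    by (auto intro!: derivative_eq_intros)
  moreover have "(\<lambda>s. H (s *\<^sub>R v) \<bullet> w) = (\<lambda>s. (H v \<bullet> w) * s)"
    using linear_cmul[OF has_derivative_linear[OF assms]] by (auto simp: mult.commute)
  ultimately show ?thesis unfolding has_field_derivative_def by simp
qed

lemma C2_grad_linear:
  assumes "C2_grad U f g H" "x \<in> U"
  shows "linear (H x)"
  using C2_gradD(3)[OF assms] has_derivative_linear by blast

lemma continuous_inner_hessian: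
  assumes "C2_grad U f g H"
  shows "continuous_on U (\<lambda>x. H x v \<bullet> w)"
  by (intro continuous_intros C2_gradD(4)[OF assms])

lemma C2_grad_sum_basis:
  assumes "C2_grad U f g H" "x \<in> U"
  shows "H x v = (\<Sum>b\<in>Basis. (v \<bullet> b) *\<^sub>R H x b)"
proof -
  have "H x (\<Sum>b\<in>Basis. (v \<bullet> b) *\<^sub>R b) = (\<Sum>b\<in>Basis. (v \<bullet> b) *\<^sub>R H x b)"
    using C2_grad_linear[OF assms] by (simp only: linear_sum linear_cmul)
  then show ?thesis by (simp only: euclidean_representation)
qed

lemma continuous_on_hessian_apply:
  assumes "C2_grad U f g H" "continuous_on S \<phi>" "continuous_on S \<psi>" "\<phi> ` S \<subseteq> U"
  shows "continuous_on S (\<lambda>x. H (\<phi> x) (\<psi> x))"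
proof -
  have "continuous_on S (\<lambda>x. \<Sum>b\<in>Basis. (\<psi> x \<bullet> b) *\<^sub>R H (\<phi> x) b)"
    by (intro continuous_intros assms(3) continuous_on_compose2[OF C2_gradD(4)[OF assms(1)] assms(2,4)])
  moreover have "(\<Sum>b\<in>Basis. (\<psi> x \<bullet> b) *\<^sub>R H (\<phi> x) b) = H (\<phi> x) (\<psi> x)" if "x \<in> S" for x
    using C2_grad_sum_basis[OF assms(1)] assms(4) that by (metis image_subset_iff)
  ultimately show ?thesis by (simp cong: continuous_on_cong)
qed

text \<open>The second mixed difference is symmetric in \<open>v\<close> and \<open>w\<close>, and
  two applications of the mean value theorem, in either order, turn it into a value of the Hessian
  at a nearby point.\<close>

lemma C2_grad_symmetric_less:
  assumes C: "C2_grad U f g H" and x: "x \<in> U" and t: "\<tau> > 0"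
  shows "\<bar>H x v \<bullet> w - H x w \<bullet> v\<bar> \<le> \<tau>"
proof -
  have mv: "\<exists>z\<in>ball x r. f (x + t *\<^sub>R v + t *\<^sub>R w) - f (x + t *\<^sub>R v) - (f (x + t *\<^sub>R w) - f x) = t * t * (H z w \<bullet> v)"
    if r: "ball x r \<subseteq> U" "t > 0" "t * norm v + t * norm w < r" for r t v w
  proof -
    have inb: "x + s *\<^sub>R v + q *\<^sub>R w \<in> ball x r" if "0 \<le> s" "s \<le> t" "0 \<le> q" "q \<le> t" for s q
    proof -
      have "norm (s *\<^sub>R v + q *\<^sub>R w) \<le> s * norm v + q * norm w"
        using norm_triangle_ineq[of "s *\<^sub>R v" "q *\<^sub>R w"] that by simp
      also have "\<dots> \<le> t * norm v + t * norm w" using that by (intro add_mono mult_right_mono) auto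
      finally have "norm (s *\<^sub>R v + q *\<^sub>R w) < r" using r(3) by simp
      then have "dist (x + (s *\<^sub>R v + q *\<^sub>R w)) x < r" by (simp only: dist_norm add_diff_cancel_left')
      then show ?thesis by (simp only: mem_ball dist_commute add.assoc)
    qed
    define G where "G s = f (x + t *\<^sub>R w + s *\<^sub>R v) - f (x + s *\<^sub>R v)" for s
    have dG: "(G has_real_derivative (g (x + t *\<^sub>R w + s *\<^sub>R v) \<bullet> v - g (x + s *\<^sub>R v) \<bullet> v)) (at s)"
      if "0 \<le> s" "s \<le> t" for s
      unfolding G_def
    proof (intro DERIV_diff has_real_derivative_along_line C2_gradD(2)[OF C])
      show "x + t *\<^sub>R w + s *\<^sub>R v \<in> U" using inb[of s t] that r by (auto simp: ac_simps)
      show "x + s *\<^sub>R v \<in> U" using inb[of s 0] that r by (auto simp: ac_simps)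
    qed
    obtain s where s: "0 < s" "s < t" "G t - G 0 = (t - 0) * (g (x + t *\<^sub>R w + s *\<^sub>R v) \<bullet> v - g (x + s *\<^sub>R v) \<bullet> v)"
      using MVT2[OF r(2), of G "\<lambda>s. g (x + t *\<^sub>R w + s *\<^sub>R v) \<bullet> v - g (x + s *\<^sub>R v) \<bullet> v"] dG by blast
    have dg: "((\<lambda>q. g (x + s *\<^sub>R v + q *\<^sub>R w) \<bullet> v) has_real_derivative (H (x + s *\<^sub>R v + q *\<^sub>R w) w \<bullet> v)) (at q)"
      if "0 \<le> q" "q \<le> t" for q
      by (intro has_real_derivative_along_line_inner C2_gradD(3)[OF C]) (use inb[of s q] that s r in auto)
    obtain q where q: "0 < q" "q < t"
      "g (x + s *\<^sub>R v + t *\<^sub>R w) \<bullet> v - g (x + s *\<^sub>R v + 0 *\<^sub>R w) \<bullet> v = (t - 0) * (H (x + s *\<^sub>R v + q *\<^sub>R w) w \<bullet> v)"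
      using MVT2[OF r(2), of "\<lambda>q. g (x + s *\<^sub>R v + q *\<^sub>R w) \<bullet> v" "\<lambda>q. H (x + s *\<^sub>R v + q *\<^sub>R w) w \<bullet> v"] dg by blast
    have "G t - G 0 = t * t * (H (x + s *\<^sub>R v + q *\<^sub>R w) w \<bullet> v)"
      using s(3) q(3) by (simp add: ac_simps)
    then show ?thesis
      using inb[of s q] s q by (intro bexI[of _ "x + s *\<^sub>R v + q *\<^sub>R w"]) (auto simp: G_def ac_simps)
  qed
  have "isCont (\<lambda>x. H x v \<bullet> w) x" "isCont (\<lambda>x. H x w \<bullet> v) x"
    using continuous_inner_hessian[OF C] C2_gradD(1)[OF C] x continuous_on_eq_continuous_at by blast+
  then have ex: "\<exists>d>0. \<forall>y. dist y x < d \<longrightarrow> dist (H y v \<bullet> w) (H x v \<bullet> w) < \<tau>/2"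
    "\<exists>d>0. \<forall>y. dist y x < d \<longrightarrow> dist (H y w \<bullet> v) (H x w \<bullet> v) < \<tau>/2"
    unfolding continuous_at_eps_delta using half_gt_zero[OF t] by blast+
  obtain d1 where d1: "d1 > 0" "\<And>y. dist y x < d1 \<Longrightarrow> dist (H y v \<bullet> w) (H x v \<bullet> w) < \<tau>/2"
    using ex(1) by blast
  obtain d2 where d2: "d2 > 0" "\<And>y. dist y x < d2 \<Longrightarrow> dist (H y w \<bullet> v) (H x w \<bullet> v) < \<tau>/2"
    using ex(2) by blast
  note d = d1 d2
  obtain r0 where r0: "r0 > 0" "ball x r0 \<subseteq> U" using C2_gradD(1)[OF C] x open_contains_ball by blast
  define r where "r = min r0 (min d1 d2)"
  have r: "r > 0" "ball x r \<subseteq> U" using r0 d by (auto simp: r_def)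
  define t where "t = r / (2 * (norm v + norm w + 1))"
  have tp: "t > 0" unfolding t_def using r by (auto intro!: divide_pos_pos add_nonneg_pos)
  have "t * norm v + t * norm w < r"
  proof -
    have "norm v + norm w + 1 > 0" by (intro add_nonneg_pos add_nonneg_nonneg) auto
    then have "2 * (norm v + norm w + 1) \<noteq> 0" by (metis less_irrefl mult_eq_0_iff zero_neq_numeral)
    then have "t * (2 * (norm v + norm w + 1)) = r" unfolding t_def by (metis nonzero_eq_divide_eq)
    then have "t * (norm v + norm w + 1) = r / 2" by (simp add: algebra_simps)
    then show ?thesis using tp r by (simp add: algebra_simps)
  qed
  then obtain z1 z2 where z: "z1 \<in> ball x r" "z2 \<in> ball x r"
    "t * t * (H z1 w \<bullet> v) = t * t * (H z2 v \<bullet> w)"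
    using mv[OF r(2) tp, of v w] mv[OF r(2) tp, of w v] by (force simp: algebra_simps)
  then have "H z1 w \<bullet> v = H z2 v \<bullet> w" using tp by simp
  then show ?thesis using d(2)[of z2] d(4)[of z1] z by (auto simp: r_def dist_norm norm_minus_commute) argo
qed

lemma C2_grad_symmetric:
  assumes "C2_grad U f g H" "x \<in> U"
  shows "H x v \<bullet> w = H x w \<bullet> v"
  using C2_grad_symmetric_less[OF assms, of _ v w] field_le_epsilon[of "\<bar>H x v \<bullet> w - H x w \<bullet> v\<bar>" 0] by simp

lemma hessian_uniformly_continuous:
  assumes C: "C2_grad UNIV f g H" and K: "compact K" and t: "\<tau> > 0"
  obtains s where "s > 0" "s \<le> 1" "\<And>x y v. x \<in> K \<Longrightarrow> norm y \<le> s \<Longrightarrow> norm (H (x + y) v - H x v) \<le> \<tau> * norm v"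
proof -
  define K1 where "K1 = {x + y | x y. x \<in> K \<and> y \<in> cball (0::'a) 1}"
  have K1: "compact K1" unfolding K1_def using K by (intro compact_sums) auto
  define \<epsilon> where "\<epsilon> = \<tau> / real DIM('a)"
  have e: "\<epsilon> > 0" using t by (simp add: \<epsilon>_def)
  have "\<exists>s>0. \<forall>x\<in>K1. \<forall>y\<in>K1. dist y x < s \<longrightarrow> dist (H y b) (H x b) < \<epsilon>" for b
    using compact_uniformly_continuous[OF continuous_on_subset[OF C2_gradD(4)[OF C, of b] subset_UNIV] K1] e
    unfolding uniformly_continuous_on_def by meson
  then obtain S where S: "\<And>b. S b > 0" "\<And>b x y. x \<in> K1 \<Longrightarrow> y \<in> K1 \<Longrightarrow> dist y x < S b \<Longrightarrow> dist (H y b) (H x b) < \<epsilon>"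
    by metis
  define s where "s = Min (insert 1 (S ` Basis)) / 2"
  have s: "s > 0" "s \<le> 1" "\<And>b. b \<in> Basis \<Longrightarrow> s < S b"
  proof -
    show sp: "s > 0" using S(1) by (auto simp: s_def)
    have le: "2 * s \<le> z" if "z \<in> insert 1 (S ` Basis)" for z
      unfolding s_def using Min_le[OF _ that] by simp
    show "s \<le> 1" using le[of 1] sp by simp
    show "s < S b" if "b \<in> Basis" for b using le[of "S b"] that sp by simp
  qed
  have "norm (H (x + y) v - H x v) \<le> \<tau> * norm v" if xy: "x \<in> K" "norm y \<le> s" for x y v
  proof -
    have "x \<in> K1" unfolding K1_def using xy by force
    moreover have "x + y \<in> K1" unfolding K1_def using xy s by force
    ultimately have 1: "norm (H (x + y) b - H x b) \<le> \<epsilon>" if "b \<in> Basis" for b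
      using S(2)[of x "x + y" b] s(3)[OF that] xy by (auto simp: dist_norm)
    have "H (x + y) v - H x v = (\<Sum>b\<in>Basis. (v \<bullet> b) *\<^sub>R (H (x + y) b - H x b))"
      using C2_grad_sum_basis[OF C, of _ v] by (simp add: sum_subtractf scaleR_diff_right)
    also have "norm \<dots> \<le> (\<Sum>b\<in>(Basis :: 'a set). norm v * \<epsilon>)"
      using 1 e by (intro sum_norm_le) (auto intro!: mult_mono Basis_le_norm)
    also have "\<dots> = \<tau> * norm v" by (simp add: \<epsilon>_def)
    finally show ?thesis .
  qed
  then show thesis using that s by blast
qed

lemma hessian_bounded:
  assumes C: "C2_grad UNIV f g H" and K: "compact K"
  obtains B where "B > 0" "\<And>x v. x \<in> K \<Longrightarrow> norm (H x v) \<le> B * norm v"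
proof -
  have "\<exists>B. \<forall>x\<in>K. norm (H x b) \<le> B" for b
    using compact_imp_bounded[OF compact_continuous_image[OF continuous_on_subset[OF C2_gradD(4)[OF C, of b] subset_UNIV] K]]
    unfolding bounded_iff by auto
  then obtain B where B: "\<And>x b. x \<in> K \<Longrightarrow> norm (H x b) \<le> B b" by metis
  define B' where "B' = (\<Sum>b\<in>Basis. \<bar>B b\<bar>) + 1"
  have "norm (H x v) \<le> B' * norm v" if "x \<in> K" for x v
  proof -
    have "norm (H x v) \<le> (\<Sum>b\<in>Basis. norm v * \<bar>B b\<bar>)"
      unfolding C2_grad_sum_basis[OF C, of x v, simplified]
    proof (intro sum_norm_le)
      fix b :: 'a assume "b \<in> Basis"
      then have "\<bar>v \<bullet> b\<bar> \<le> norm v" "norm (H x b) \<le> \<bar>B b\<bar>" using Basis_le_norm B[OF that, of b] by auto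
      then show "norm ((v \<bullet> b) *\<^sub>R H x b) \<le> norm v * \<bar>B b\<bar>" by (simp add: mult_mono)
    qed
    also have "\<dots> \<le> B' * norm v" by (simp add: B'_def sum_distrib_left[symmetric] algebra_simps)
    finally show ?thesis .
  qed
  moreover have "B' > 0" unfolding B'_def by (intro add_nonneg_pos sum_nonneg) auto
  ultimately show thesis using that by blast
qed

text \<open>The Lagrange remainder evaluates the Hessian on the segment from p to p + v; the
  uniformity in p comes from uniform continuity of the Hessian near \<open>K\<close>.\<close>

lemma taylor2_uniform:
  assumes C: "C2_grad UNIV f g H" and K: "compact K" and t: "\<tau> > 0"
  obtains s where "s > 0" "s \<le> 1"
    "\<And>p v. p \<in> K \<Longrightarrow> norm v \<le> s \<Longrightarrow> \<bar>f (p + v) - f p - g p \<bullet> v - (H p v \<bullet> v) / 2\<bar> \<le> \<tau> * (norm v)\<^sup>2"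
proof -
  obtain s where s: "s > 0" "s \<le> 1" "\<And>x y v. x \<in> K \<Longrightarrow> norm y \<le> s \<Longrightarrow> norm (H (x + y) v - H x v) \<le> \<tau> * norm v"
    by (rule hessian_uniformly_continuous[OF C K t]) blast
  have "\<bar>f (p + v) - f p - g p \<bullet> v - (H p v \<bullet> v) / 2\<bar> \<le> \<tau> * (norm v)\<^sup>2" if p: "p \<in> K" "norm v \<le> s" for p v
  proof -
    define diff where "diff m t = (if m = 0 then f (p + t *\<^sub>R v) else if m = 1 then g (p + t *\<^sub>R v) \<bullet> v else H (p + t *\<^sub>R v) v \<bullet> v)"
      for m :: nat and t :: real
    have "\<exists>t>0. t \<le> 1 \<and> diff 0 1 = (\<Sum>m<2. diff m 0 / fact m * 1 ^ m) + diff 2 t / fact 2 * 1 ^ 2"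
    proof (rule Maclaurin2)
      show "\<forall>m t. m < 2 \<and> 0 \<le> t \<and> t \<le> 1 \<longrightarrow> DERIV (diff m) t :> diff (Suc m) t"
      proof (intro allI impI)
        fix m t assume "m < (2::nat) \<and> 0 \<le> t \<and> t \<le> (1::real)"
        then consider "m = 0" | "m = 1" by linarith
        then show "DERIV (diff m) t :> diff (Suc m) t"
        proof cases
          case 1
          then show ?thesis
            using has_real_derivative_along_line[OF C2_gradD(2)[OF C], of p t v] by (simp add: diff_def[abs_def])
        next
          case 2
          then show ?thesis
            using has_real_derivative_along_line_inner[OF C2_gradD(3)[OF C], of p t v v] by (simp add: diff_def[abs_def])
        qed
      qed
    qed auto
    then obtain t where t: "t > 0" "t \<le> 1" "f (p + v) = f p + g p \<bullet> v + (H (p + t *\<^sub>R v) v \<bullet> v) / 2"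
      by (auto simp: diff_def numeral_2_eq_2)
    have "norm (t *\<^sub>R v) \<le> s" using t p mult_left_le_one_le[of "norm v" t] by simp
    from s(3)[OF p(1) this, of v] have "\<bar>(H (p + t *\<^sub>R v) v - H p v) \<bullet> v\<bar> \<le> \<tau> * norm v * norm v"
      by (meson Cauchy_Schwarz_ineq2 mult_right_mono norm_ge_zero order_trans)
    moreover have "\<tau> * norm v * norm v \<ge> 0" using \<open>\<tau> > 0\<close> by simp
    ultimately show ?thesis using t(3) by (simp add: inner_diff_left power2_eq_square)
  qed
  then show thesis using that s by blast
qed

lemma sum_Basis_inner_scaleR_linear:
  fixes n :: "'a::euclidean_space"
  assumes "linear T"
  shows "(\<Sum>b\<in>Basis. (n \<bullet> b) *\<^sub>R T b) = T n"
proof -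
  have "T (\<Sum>b\<in>Basis. (n \<bullet> b) *\<^sub>R b) = (\<Sum>b\<in>Basis. (n \<bullet> b) *\<^sub>R T b)"
    using assms by (simp only: linear_sum linear_cmul)
  then show ?thesis by (simp only: euclidean_representation)
qed

text \<open>The vectors are the columns of B = \<beta> (I - n n^T) + t v v^T, so the sum is the
  trace of B^T T B: a multiple of the tangential projection, changed along the tangential direction
  \<open>v\<close> only. Such a B describes the frontier displacements in the estimate for
  \<open>u\<close>.\<close>

lemma trace_rank_one_update:
  fixes n v :: "'a::euclidean_space"
  assumes T: "linear T" and n: "norm n = 1" and vn: "v \<bullet> n = 0"
  shows "(\<Sum>e\<in>Basis. T (\<beta> *\<^sub>R (e - (n \<bullet> e) *\<^sub>R n) + (t * (v \<bullet> e)) *\<^sub>R v)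
            \<bullet> (\<beta> *\<^sub>R (e - (n \<bullet> e) *\<^sub>R n) + (t * (v \<bullet> e)) *\<^sub>R v))
     = \<beta>\<^sup>2 * ((\<Sum>e\<in>Basis. T e \<bullet> e) - T n \<bullet> n) + (2 * \<beta> * t + t\<^sup>2 * (v \<bullet> v)) * (T v \<bullet> v)"
proof -
  have nn: "n \<bullet> n = 1" using n by (simp add: dot_square_norm)
  have s1: "(\<Sum>e\<in>Basis. (w \<bullet> e) * (T e \<bullet> z)) = T w \<bullet> z" for w z
    using sum_Basis_inner_scaleR_linear[OF T, of w] by (metis (no_types, lifting) inner_scaleR_left inner_sum_left sum.cong)
  have s2: "(\<Sum>e\<in>Basis. (w \<bullet> e) * (z \<bullet> e)) = w \<bullet> z" for w z :: 'a
    by (rule euclidean_inner[symmetric])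
  have TT: "T (\<beta> *\<^sub>R (e - (n \<bullet> e) *\<^sub>R n) + (t * (v \<bullet> e)) *\<^sub>R v)
      = \<beta> *\<^sub>R T e - (\<beta> * (n \<bullet> e)) *\<^sub>R T n + (t * (v \<bullet> e)) *\<^sub>R T v" for e
    using T by (simp add: linear_add linear_diff linear_cmul scaleR_diff_right)
  have "T (\<beta> *\<^sub>R (e - (n \<bullet> e) *\<^sub>R n) + (t * (v \<bullet> e)) *\<^sub>R v) \<bullet> (\<beta> *\<^sub>R (e - (n \<bullet> e) *\<^sub>R n) + (t * (v \<bullet> e)) *\<^sub>R v)
    = \<beta>\<^sup>2 * (T e \<bullet> e) - \<beta>\<^sup>2 * ((n \<bullet> e) * (T e \<bullet> n)) - \<beta>\<^sup>2 * ((n \<bullet> e) * (T n \<bullet> e))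
      + \<beta>\<^sup>2 * (T n \<bullet> n) * ((n \<bullet> e) * (n \<bullet> e))
      + \<beta> * t * ((v \<bullet> e) * (T e \<bullet> v)) + \<beta> * t * ((v \<bullet> e) * (T v \<bullet> e))
      - \<beta> * t * (T n \<bullet> v + T v \<bullet> n) * ((v \<bullet> e) * (n \<bullet> e)) + t\<^sup>2 * (T v \<bullet> v) * ((v \<bullet> e) * (v \<bullet> e))" for e
    unfolding TT
    by (simp add: inner_diff_left inner_diff_right inner_add_left inner_add_right algebra_simps power2_eq_square)
  then show ?thesis
    by (simp only: sum.distrib sum_subtractf sum_distrib_left[symmetric] s1 s2 nn vn)
      (simp add: inner_commute algebra_simps power2_eq_square)
qed

section \<open>Weighted constant mean curvature domains\<close>

lemma closure_reflect:
  fixes D :: "(real \<times> 'v::euclidean_space) set"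
  assumes even: "\<And>\<xi> \<sigma>. (- \<xi>, \<sigma>) \<in> D \<longleftrightarrow> (\<xi>, \<sigma>) \<in> D"
  shows "(- fst x, snd x) \<in> closure D \<longleftrightarrow> x \<in> closure D"
proof -
  have lin: "linear (\<lambda>x::real \<times> 'v. (- fst x, snd x))" by (auto intro!: linearI simp: prod_eq_iff)
  have inj: "inj (\<lambda>x::real \<times> 'v. (- fst x, snd x))" by (auto simp: inj_on_def prod_eq_iff)
  have im: "(\<lambda>x. (- fst x, snd x)) ` D = D"
    using even by (force simp: image_iff)
  have "closure D = (\<lambda>x. (- fst x, snd x)) ` closure D"
    using closure_injective_linear_image[OF lin inj, of D] im by simp
  then have 1: "(- fst y, snd y) \<in> closure D" if "y \<in> closure D" for y
    using that by force
  show ?thesis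
    using 1[of x] 1[of "(- fst x, snd x)"] by auto
qed

lemma frontier_reflect:
  fixes D :: "(real \<times> 'v::euclidean_space) set"
  assumes "open D" and even: "\<And>\<xi> \<sigma>. (- \<xi>, \<sigma>) \<in> D \<longleftrightarrow> (\<xi>, \<sigma>) \<in> D"
  shows "(- fst x, snd x) \<in> frontier D \<longleftrightarrow> x \<in> frontier D"
  using closure_reflect[of D x, OF even] even[of "fst x" "snd x"] assms(1)
  by (simp add: frontier_def interior_open)

text \<open>\<open>cmc\<close> is the curvature equation multiplied by the cube of the norm of the
  gradient. It is asked for \<xi> > 0 only: the coefficient is singular at 0, and evenness carries
  the consequences to \<xi> < 0. The function \<open>f\<close> is defined everywhere, but its zeros
  are tied to the frontier only near the frontier (\<open>f_local\<close>).\<close>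

locale weighted_cmc_domain =
  fixes D :: "(real \<times> 'v::euclidean_space) set" and f :: "real \<times> 'v \<Rightarrow> real"
    and g :: "real \<times> 'v \<Rightarrow> real \<times> 'v" and H :: "real \<times> 'v \<Rightarrow> real \<times> 'v \<Rightarrow> real \<times> 'v" and a C :: real
  assumes open_D: "open D" and bounded_D: "bounded D" and nonempty_D: "D \<noteq> {}"
    and C2: "C2_grad UNIV f g H"
    and f_neg: "\<And>x. x \<in> D \<Longrightarrow> f x < 0"
    and f_zero: "\<And>x. x \<in> frontier D \<Longrightarrow> f x = 0"
    and g_nonzero: "\<And>x. x \<in> frontier D \<Longrightarrow> g x \<noteq> 0"
    and f_local: "\<And>x. x \<in> frontier D \<Longrightarrow> \<exists>s>0. \<forall>y\<in>ball x s. (f y < 0 \<longleftrightarrow> y \<in> D) \<and> (f y = 0 \<longleftrightarrow> y \<in> frontier D)"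
    and f_even: "\<And>\<xi> \<sigma>. f (- \<xi>, \<sigma>) = f (\<xi>, \<sigma>)"
    and D_even: "\<And>\<xi> \<sigma>. (- \<xi>, \<sigma>) \<in> D \<longleftrightarrow> (\<xi>, \<sigma>) \<in> D"
    and a_pos: "a > 0" and C_pos: "C > 0"
    and cmc: "\<And>x. x \<in> frontier D \<Longrightarrow> fst x > 0 \<Longrightarrow>
      (norm (g x))\<^sup>2 * (\<Sum>b\<in>Basis. H x b \<bullet> b) - H x (g x) \<bullet> g x + a / fst x * fst (g x) * (norm (g x))\<^sup>2
        = C * norm (g x) ^ 3"
begin

text \<open>On a sphere of curvature c centred on \<xi> = 0 the k principal curvatures equal c, and
  so does the quotient of the \<xi>-component of the normal by \<xi>, which enters a times.
  \<open>N\<close> is therefore the effective number of principal curvatures and \<open>c\<close>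
  their common value in the model.\<close>

definition N :: real where "N = real DIM('v) + a"
definition c :: real where "c = C / N"
definition nu :: "real \<times> 'v \<Rightarrow> real \<times> 'v" where "nu p = (1 / norm (g p)) *\<^sub>R g p"
text \<open>On vectors orthogonal to \<open>nu p\<close> this is the second fundamental form with
  respect to the outer normal, positive for balls; on other vectors it has no geometric
  meaning.\<close>

definition A :: "real \<times> 'v \<Rightarrow> real \<times> 'v \<Rightarrow> real" where "A p v = (H p v \<bullet> v) / norm (g p)"
definition d :: "real \<times> 'v \<Rightarrow> real" where "d x = infdist x (- D)"
definition u :: "real \<times> 'v \<Rightarrow> real" where "u x = d x - c / 2 * (d x)\<^sup>2"
definition nearest :: "real \<times> 'v \<Rightarrow> real \<times> 'v \<Rightarrow> bool" where
  "nearest x p \<longleftrightarrow> p \<in> frontier D \<and> norm (x - p) = d x"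

lemma N_pos: "N > 0" unfolding N_def using a_pos DIM_positive[where 'a='v] by linarith
lemma c_pos: "c > 0" unfolding c_def using N_pos C_pos by simp

lemma compact_frontier_D: "compact (frontier D)"
  using bounded_D by (simp add: compact_frontier_bounded)

lemma frontier_not_D: "p \<in> frontier D \<Longrightarrow> p \<notin> D"
  using open_D by (auto simp: frontier_def interior_open)

lemma compl_D: "closed (- D)" "- D \<noteq> {}"
proof -
  show "closed (- D)" using open_D by (simp add: closed_Compl)
  show "- D \<noteq> {}"
  proof
    assume "- D = {}"
    then have "D = UNIV" by blast
    then show False using bounded_D not_bounded_UNIV[where 'a="real \<times> 'v"] by simp
  qed
qed

lemma deriv_f: "(f has_derivative (\<lambda>v. g x \<bullet> v)) (at x)"
  and deriv_g: "(g has_derivative H x) (at x)"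
  and linear_H: "linear (H x)"
  and symmetric_H: "H x v \<bullet> w = H x w \<bullet> v"
  using C2_gradD(2,3)[OF C2] C2_grad_linear[OF C2] C2_grad_symmetric[OF C2] by auto

lemma continuous_f: "continuous_on S f" and continuous_g: "continuous_on S g"
  by (rule continuous_at_imp_continuous_on, blast intro: has_derivative_continuous[OF deriv_f] has_derivative_continuous[OF deriv_g])+

lemma g_even: "g (- \<xi>, \<sigma>) = (- fst (g (\<xi>, \<sigma>)), snd (g (\<xi>, \<sigma>)))"
proof -
  have *: "((\<lambda>x::real \<times> 'v. (- fst x, snd x)) has_derivative (\<lambda>v. (- fst v, snd v))) (at x)" for x
    by (auto intro!: derivative_eq_intros)
  have "((\<lambda>x. f (- fst x, snd x)) has_derivative (\<lambda>v. g (- \<xi>, \<sigma>) \<bullet> (- fst v, snd v))) (at (\<xi>, \<sigma>))"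
    using has_derivative_compose[OF *, of f "\<lambda>v. g (- \<xi>, \<sigma>) \<bullet> v" "(\<xi>, \<sigma>)"] deriv_f by simp
  moreover have "(\<lambda>x. f (- fst x, snd x)) = f" using f_even by (auto simp: fun_eq_iff)
  ultimately have "(\<lambda>v. g (- \<xi>, \<sigma>) \<bullet> (- fst v, snd v)) = (\<lambda>v. g (\<xi>, \<sigma>) \<bullet> v)"
    using has_derivative_unique deriv_f by metis
  then have e: "g (- \<xi>, \<sigma>) \<bullet> (- fst v, snd v) = g (\<xi>, \<sigma>) \<bullet> v" for v by meson
  have "- fst (g (- \<xi>, \<sigma>)) = fst (g (\<xi>, \<sigma>))" using e[of "(1, 0)"] by (simp add: inner_prod_def)
  moreover have "snd (g (- \<xi>, \<sigma>)) = snd (g (\<xi>, \<sigma>))"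
    by (rule vector_eq_rdot[THEN iffD1]) (use e[of "(0, _)"] in \<open>auto simp: inner_prod_def\<close>)
  ultimately show ?thesis by (simp add: prod_eq_iff)
qed

lemma g_fst_zero: "fst x = 0 \<Longrightarrow> fst (g x) = 0"
proof -
  assume "fst x = 0"
  then obtain s where "x = (0, s)" by (cases x) auto
  moreover have "fst (g (0, s)) = - fst (g (0, s))" using g_even[of 0 s] by (metis fst_conv minus_zero)
  ultimately show ?thesis by simp
qed

lemma frontier_even: "(- \<xi>, \<sigma>) \<in> frontier D \<longleftrightarrow> (\<xi>, \<sigma>) \<in> frontier D"
  using frontier_reflect[OF open_D D_even, of "(\<xi>, \<sigma>)"] by simp

lemma norm_nu: "p \<in> frontier D \<Longrightarrow> norm (nu p) = 1"
  using g_nonzero by (simp add: nu_def)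

lemma g_lower_bound: obtains m0 where "m0 > 0" "\<And>p. p \<in> frontier D \<Longrightarrow> norm (g p) \<ge> m0"
proof (cases "frontier D = {}")
  case True
  then show ?thesis using that[of 1] by auto
next
  case False
  have "continuous_on (frontier D) (\<lambda>p. norm (g p))" by (intro continuous_intros continuous_g)
  from continuous_attains_inf[OF compact_frontier_D False this]
  obtain q where "q \<in> frontier D" "\<forall>p\<in>frontier D. norm (g q) \<le> norm (g p)" by blast
  then show ?thesis using that[of "norm (g q)"] g_nonzero by auto
qed

lemma A_bounded: obtains a1 where "a1 > 0" "\<And>p v. p \<in> frontier D \<Longrightarrow> \<bar>A p v\<bar> \<le> a1 * (norm v)\<^sup>2"
proof -
  obtain m0 where m0: "m0 > 0" "\<And>p. p \<in> frontier D \<Longrightarrow> norm (g p) \<ge> m0" by (rule g_lower_bound) blast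
  obtain B where B: "B > 0" "\<And>x v. x \<in> frontier D \<Longrightarrow> norm (H x v) \<le> B * norm v"
    by (rule hessian_bounded[OF C2 compact_frontier_D]) blast
  have "\<bar>A p v\<bar> \<le> B / m0 * (norm v)\<^sup>2" if p: "p \<in> frontier D" for p v
  proof -
    have "\<bar>H p v \<bullet> v\<bar> \<le> B * norm v * norm v"
      using Cauchy_Schwarz_ineq2[of "H p v" v] mult_right_mono[OF B(2)[OF p, of v] norm_ge_zero[of v]] by linarith
    then have "\<bar>A p v\<bar> \<le> (B * norm v * norm v) / m0"
      unfolding A_def abs_divide using m0(1) m0(2)[OF p] B(1) by (intro frac_le) auto
    then show ?thesis by (simp add: power2_eq_square)
  qed
  then show thesis using that[of "B / m0"] B(1) m0(1) by simp
qed

text \<open>To second order the frontier is the graph of - A p w / 2 over its tangent plane at p.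
  Raising the graph by \<tau> times the squared norm of w outweighs the Taylor remainder, uniformly
  in p by compactness. No implicit function is needed, since f \<ge> 0 already excludes a point from
  \<open>D\<close>.\<close>

lemma graph_point_not_in_D:
  assumes t: "\<tau> > 0"
  obtains s where "s > 0" "\<And>p w. p \<in> frontier D \<Longrightarrow> w \<bullet> nu p = 0 \<Longrightarrow> norm w \<le> s \<Longrightarrow>
     p + w + (- A p w / 2 + \<tau> * (norm w)\<^sup>2) *\<^sub>R nu p \<notin> D"
proof -
  obtain m0 where m0: "m0 > 0" "\<And>p. p \<in> frontier D \<Longrightarrow> norm (g p) \<ge> m0" by (rule g_lower_bound) blast
  obtain B where B: "B > 0" "\<And>x v. x \<in> frontier D \<Longrightarrow> norm (H x v) \<le> B * norm v"
    by (rule hessian_bounded[OF C2 compact_frontier_D]) blast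
  obtain a1 where a1: "a1 > 0" "\<And>p v. p \<in> frontier D \<Longrightarrow> \<bar>A p v\<bar> \<le> a1 * (norm v)\<^sup>2" by (rule A_bounded) blast
  define g1 where "g1 = a1 / 2 + \<tau>"
  have g1: "g1 > 0" using a1 t by (simp add: g1_def)
  \<comment> \<open>The raise contributes at least m0 \<tau> |w|^2 to f. With |v|^2 \<le> (1 + g1^2)
    |w|^2, this choice lets the Taylor remainder consume one half of it; the other half pays for the
    cubic terms with coefficient \<open>K\<close>.\<close>
  define \<tau>1 where "\<tau>1 = m0 * \<tau> / (2 * (1 + g1\<^sup>2))"
  have t1: "\<tau>1 > 0" unfolding \<tau>1_def using m0 t by (intro divide_pos_pos) (auto simp: add_pos_nonneg)
  have t1': "\<tau>1 * (1 + g1\<^sup>2) = m0 * \<tau> / 2"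
    unfolding \<tau>1_def using g1 by (simp add: field_simps add_pos_nonneg less_imp_neq[symmetric])
  obtain s where s: "s > 0" "s \<le> 1"
    "\<And>p v. p \<in> frontier D \<Longrightarrow> norm v \<le> s \<Longrightarrow> \<bar>f (p + v) - f p - g p \<bullet> v - (H p v \<bullet> v) / 2\<bar> \<le> \<tau>1 * (norm v)\<^sup>2"
    by (rule taylor2_uniform[OF C2 compact_frontier_D t1]) blast
  define K where "K = B * (2 * g1 + g1\<^sup>2)"
  have K: "K > 0" using B g1 by (simp add: K_def add_pos_pos)
  define s' where "s' = min (s / (1 + g1)) (min 1 (m0 * \<tau> / K))"
  have s': "s' > 0" "s' \<le> 1" "(1 + g1) * s' \<le> s" "K * s' \<le> m0 * \<tau>"
  proof -
    show "s' > 0" using s g1 m0 t K by (simp add: s'_def)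
    show "s' \<le> 1" by (simp add: s'_def)
    have "s' \<le> s / (1 + g1)" by (simp add: s'_def)
    then show "(1 + g1) * s' \<le> s" using g1 by (simp add: field_simps)
    have "s' \<le> m0 * \<tau> / K" by (simp add: s'_def)
    then show "K * s' \<le> m0 * \<tau>" using K by (simp add: field_simps)
  qed
  have "p + w + (- A p w / 2 + \<tau> * (norm w)\<^sup>2) *\<^sub>R nu p \<notin> D"
    if p: "p \<in> frontier D" and w: "w \<bullet> nu p = 0" and ws: "norm w \<le> s'" for p w
  proof -
    define W where "W = norm w"
    define n where "n = nu p"
    define \<gamma> where "\<gamma> = - A p w / 2 + \<tau> * W\<^sup>2"
    define v where "v = w + \<gamma> *\<^sub>R n"
    have W: "W \<ge> 0" "W \<le> 1" using ws s' by (auto simp: W_def)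
    have n: "norm n = 1" using norm_nu[OF p] by (simp add: n_def)
    have gp: "g p = norm (g p) *\<^sub>R n" using g_nonzero[OF p] by (simp add: n_def nu_def)
    have wn: "w \<bullet> n = 0" using w by (simp add: n_def)
    have \<gamma>: "\<bar>\<gamma>\<bar> \<le> g1 * W\<^sup>2"
    proof -
      have "\<bar>\<gamma>\<bar> \<le> \<bar>A p w\<bar> / 2 + \<tau> * W\<^sup>2"
      proof -
        have "\<tau> * W\<^sup>2 \<ge> 0" using t by simp
        then show ?thesis unfolding \<gamma>_def by linarith
      qed
      then show ?thesis using a1(2)[OF p, of w] by (simp add: g1_def W_def algebra_simps)
    qed
    have W2: "W\<^sup>2 \<le> W" using W by (simp add: power2_eq_square mult_left_le)
    have \<gamma>W: "\<bar>\<gamma>\<bar> \<le> g1 * W" using \<gamma> W2 g1 by (meson mult_left_mono less_imp_le order_trans)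
    have "norm v \<le> W + \<bar>\<gamma>\<bar>" unfolding v_def W_def using n norm_triangle_ineq[of w "\<gamma> *\<^sub>R n"] by simp
    also have "\<dots> \<le> (1 + g1) * W" using \<gamma>W by (simp add: algebra_simps)
    also have "\<dots> \<le> s" using s'(3) ws g1 mult_left_mono[of W s' "1 + g1"] unfolding W_def by linarith
    finally have vs: "norm v \<le> s" .
    have vv: "(norm v)\<^sup>2 = W\<^sup>2 + \<gamma>\<^sup>2"
      unfolding v_def W_def power2_norm_eq_inner using wn n norm_eq_1[of n]
      by (simp add: inner_add_left inner_add_right inner_commute power2_eq_square[of \<gamma>])
    have \<gamma>2: "\<gamma>\<^sup>2 \<le> g1\<^sup>2 * W\<^sup>2"
      using \<gamma>W by (metis abs_le_square_iff abs_of_nonneg power_mult_distrib W(1) g1 less_imp_le mult_nonneg_nonneg)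
    have gv: "g p \<bullet> v = norm (g p) * \<gamma>"
      by (subst gp) (use wn n in \<open>simp add: v_def inner_add_right inner_commute dot_square_norm\<close>)
    have "H p v \<bullet> v = H p w \<bullet> w + 2 * \<gamma> * (H p n \<bullet> w) + \<gamma>\<^sup>2 * (H p n \<bullet> n)"
      unfolding v_def using linear_H[of p] symmetric_H[of p w n]
      by (simp add: linear_add linear_cmul inner_add_left inner_add_right algebra_simps power2_eq_square)
    moreover have "\<bar>2 * \<gamma> * (H p n \<bullet> w)\<bar> \<le> 2 * (g1 * W\<^sup>2) * (B * W)"
    proof -
      have "\<bar>H p n \<bullet> w\<bar> \<le> B * W"
        using Cauchy_Schwarz_ineq2[of "H p n" w] mult_right_mono[OF B(2)[OF p, of n] norm_ge_zero[of w]] n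
        by (simp add: W_def)
      then show ?thesis unfolding abs_mult using \<gamma> g1 by (intro mult_mono) auto
    qed
    moreover have "\<bar>\<gamma>\<^sup>2 * (H p n \<bullet> n)\<bar> \<le> (g1\<^sup>2 * W\<^sup>2 * W) * B"
    proof -
      have "\<bar>H p n \<bullet> n\<bar> \<le> B"
        using Cauchy_Schwarz_ineq2[of "H p n" n] B(2)[OF p, of n] n by simp
      moreover have "\<bar>\<gamma>\<^sup>2\<bar> \<le> g1\<^sup>2 * W\<^sup>2 * W"
      proof -
        have "\<gamma>\<^sup>2 \<le> (g1 * W\<^sup>2) * (g1 * W)"
          unfolding power2_eq_square[of \<gamma>] abs_mult_self_eq[of \<gamma>, symmetric]
          using g1 W by (intro mult_mono \<gamma> \<gamma>W) auto
        then show ?thesis by (simp add: power2_eq_square algebra_simps)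
      qed
      ultimately show ?thesis unfolding abs_mult using W by (intro mult_mono) auto
    qed
    moreover have "K * W * W\<^sup>2 = 2 * (g1 * W\<^sup>2) * (B * W) + (g1\<^sup>2 * W\<^sup>2 * W) * B"
      by (simp add: K_def algebra_simps)
    ultimately have Hv: "H p v \<bullet> v \<ge> H p w \<bullet> w - K * W * W\<^sup>2"
      by linarith
    have fpv: "f (p + v) \<ge> g p \<bullet> v + (H p v \<bullet> v) / 2 - \<tau>1 * (norm v)\<^sup>2"
      using s(3)[OF p vs] f_zero[OF p] by linarith
    have "\<tau>1 * (norm v)\<^sup>2 \<le> \<tau>1 * (W\<^sup>2 + g1\<^sup>2 * W\<^sup>2)" unfolding vv using \<gamma>2 t1 by simp
    also have "\<tau>1 * (W\<^sup>2 + g1\<^sup>2 * W\<^sup>2) = m0 * \<tau> / 2 * W\<^sup>2" unfolding t1'[symmetric] by (simp add: algebra_simps)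
    finally have "f (p + v) \<ge> g p \<bullet> v + (H p v \<bullet> v) / 2 - m0 * \<tau> / 2 * W\<^sup>2" using fpv by linarith
    moreover have "g p \<bullet> v = - (H p w \<bullet> w) / 2 + norm (g p) * \<tau> * W\<^sup>2"
      unfolding gv \<gamma>_def A_def using g_nonzero[OF p] by (simp add: field_simps)
    moreover have "norm (g p) * \<tau> * W\<^sup>2 \<ge> m0 * \<tau> * W\<^sup>2"
      using m0(2)[OF p] t by (intro mult_right_mono) auto
    moreover have "K * W * W\<^sup>2 \<le> m0 * \<tau> * W\<^sup>2"
      using s'(4) ws K by (intro mult_right_mono order_trans[OF mult_left_mono s'(4)]) (auto simp: W_def)
    ultimately have "f (p + v) \<ge> 0" using Hv by simp
    then show ?thesis using f_neg[of "p + v"] by (auto simp: v_def \<gamma>_def n_def W_def add.assoc)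
  qed
  then show thesis using that s'(1) by blast
qed

section \<open>Distance to the complement and nearest frontier points\<close>

lemma d_pos: "x \<in> D \<Longrightarrow> d x > 0"
  unfolding d_def using compl_D by (simp add: infdist_pos_not_in_closed)

lemma d_le: "q \<notin> D \<Longrightarrow> d x \<le> norm (x - q)"
  unfolding d_def by (metis ComplI dist_norm infdist_le)

lemma nearest_exists:
  assumes "x \<in> D"
  obtains p where "nearest x p"
proof -
  obtain q where q: "q \<in> - D" "d x = dist x q" using infdist_attains_inf[OF compl_D] unfolding d_def by blast
  have "ball x (d x) \<subseteq> D" using d_le[of _ x] by (force simp: dist_norm)
  then have "closure (ball x (d x)) \<subseteq> closure D" by (rule closure_mono)
  moreover have "q \<in> closure (ball x (d x))" using d_pos[OF assms] q by simp
  ultimately have "q \<in> frontier D" using q open_D by (auto simp: frontier_def interior_open)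
  then show thesis using that q by (auto simp: nearest_def dist_norm)
qed

text \<open>The open ball of radius \<open>d x\<close> about \<open>x\<close> lies in
  \<open>D\<close> and touches the frontier at \<open>p\<close>. As f < 0 in it, f does not increase
  in any direction pointing into the ball, so the gradient at \<open>p\<close> is a positive
  multiple of p - x.\<close>

lemma nearest_normal:
  assumes "x \<in> D" "nearest x p"
  shows "p - x = d x *\<^sub>R nu p"
proof -
  have p: "p \<in> frontier D" and r: "norm (x - p) = d x" using assms(2) by (auto simp: nearest_def)
  have "p - x \<noteq> 0" using d_pos[OF assms(1)] r by auto
  moreover have "g p \<bullet> v \<le> 0" if v: "(p - x) \<bullet> v < 0" for v
  proof (rule derivative_nonpos_if_nonpos_right[OF deriv_f f_zero[OF p]])
    have v0: "v \<noteq> 0" using v by auto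
    \<comment> \<open>The parameter at which the ray from \<open>p\<close> in direction
      \<open>v\<close> leaves the ball around \<open>x\<close> again.\<close>
    define e where "e = - 2 * ((p - x) \<bullet> v) / (v \<bullet> v)"
    show "e > 0" unfolding e_def using v v0 by (intro divide_pos_pos) auto
    show "f (p + t *\<^sub>R v) \<le> 0" if t: "0 < t" "t < e" for t
    proof -
      have "t * (v \<bullet> v) < - 2 * ((p - x) \<bullet> v)"
        using t(2) v0 pos_less_divide_eq[of "v \<bullet> v" t "- 2 * ((p - x) \<bullet> v)"] unfolding e_def by simp
      then have "t * (t * (v \<bullet> v) + 2 * ((p - x) \<bullet> v)) < 0" using t(1) by (simp add: mult_pos_neg)
      then have "(norm (p - x + t *\<^sub>R v))\<^sup>2 < (norm (p - x))\<^sup>2"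
        unfolding power2_norm_eq_inner by (simp add: inner_add_left inner_add_right inner_commute algebra_simps)
      then have "norm (p - x + t *\<^sub>R v) < d x" using r by (metis norm_ge_zero norm_minus_commute power2_less_imp_less)
      moreover have "norm (x - (p + t *\<^sub>R v)) = norm (p - x + t *\<^sub>R v)"
        by (metis norm_minus_commute diff_add_eq add_diff_eq)
      ultimately have "p + t *\<^sub>R v \<in> D" using d_le[of "p + t *\<^sub>R v" x] by fastforce
      then show ?thesis using f_neg less_imp_le by blast
    qed
  qed
  ultimately obtain l where l: "l \<ge> 0" "g p = l *\<^sub>R (p - x)" using nonneg_multiple_of_halfspace by blast
  have "l > 0" using l g_nonzero[OF p] by (cases "l = 0") auto
  then have "nu p = (1 / d x) *\<^sub>R (p - x)"
    unfolding nu_def l(2) using r by (simp add: norm_minus_commute)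
  then show ?thesis using d_pos[OF assms(1)] by simp
qed

text \<open>If \<open>p\<close> lay in \<xi> < 0, its mirror image would be a strictly nearer
  frontier point. If it lay on \<xi> = 0, evenness would make the normal there tangential to \<xi> =
  0, and x = p - d \<nu> would lie on it as well.\<close>

lemma nearest_fst_pos:
  assumes x: "x \<in> D" "fst x > 0" and p: "nearest x p"
  shows "fst p > 0"
proof (rule ccontr)
  assume n: "\<not> fst p > 0"
  have pf: "p \<in> frontier D" using p by (simp add: nearest_def)
  show False
  proof (cases "fst p = 0")
    case True
    have "fst (p - x) = 0" unfolding nearest_normal[OF x(1) p] nu_def using g_fst_zero[OF True] by simp
    then show ?thesis using x(2) True by simp
  next
    case False
    then have neg: "fst p < 0" using n by simp
    have "(- fst p, snd p) \<in> frontier D" using frontier_even[of "fst p" "snd p"] pf by simp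
    then have "norm (x - p) \<le> norm (x - (- fst p, snd p))"
      using d_le frontier_not_D p unfolding nearest_def by metis
    then have "(norm (x - p))\<^sup>2 \<le> (norm (x - (- fst p, snd p)))\<^sup>2" by (simp add: power_mono)
    then have "(fst x - fst p)\<^sup>2 \<le> (fst x + fst p)\<^sup>2"
      unfolding power2_norm_eq_inner by (simp add: inner_prod_def power2_eq_square)
    then have "fst x * fst p \<ge> 0" by (simp add: power2_eq_square algebra_simps)
    then show ?thesis using x(2) neg by (simp add: zero_le_mult_iff)
  qed
qed

section \<open>Second fundamental form and touching balls\<close>

definition P :: "real \<times> 'v \<Rightarrow> real \<times> 'v \<Rightarrow> real \<times> 'v" where "P p y = y - (nu p \<bullet> y) *\<^sub>R nu p"

definition trA :: "real \<times> 'v \<Rightarrow> real" where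
  "trA p = ((\<Sum>b\<in>Basis. H p b \<bullet> b) - H p (nu p) \<bullet> nu p) / norm (g p)"

lemma nu_nu: "p \<in> frontier D \<Longrightarrow> nu p \<bullet> nu p = 1"
  using norm_nu norm_eq_1 by blast

lemma P_nu: "p \<in> frontier D \<Longrightarrow> P p y \<bullet> nu p = 0"
  using nu_nu[of p] by (simp add: P_def inner_diff_left inner_commute[of "nu p" y])

lemma norm_P_le: "p \<in> frontier D \<Longrightarrow> norm (P p y) \<le> norm y"
proof -
  assume p: "p \<in> frontier D"
  have "(norm (P p y))\<^sup>2 = y \<bullet> y - (nu p \<bullet> y)\<^sup>2"
    unfolding power2_norm_eq_inner P_def using nu_nu[OF p]
    by (simp add: inner_diff_left inner_diff_right inner_commute power2_eq_square[of "y \<bullet> nu p"])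
  then have "(norm (P p y))\<^sup>2 \<le> (norm y)\<^sup>2" by (simp add: power2_norm_eq_inner)
  then show ?thesis by (simp add: power2_le_iff_abs_le)
qed

lemma A_scaleR: "A p (t *\<^sub>R v) = t\<^sup>2 * A p v"
  using linear_H[of p] by (simp add: A_def linear_cmul power2_eq_square)

lemma A_zero [simp]: "A p 0 = 0"
  by (simp add: A_def)

lemma trA_eq:
  assumes p: "p \<in> frontier D" "fst p > 0"
  shows "trA p = C - a * (fst (nu p) / fst p)"
proof -
  define G where "G = norm (g p)"
  have G: "G > 0" using g_nonzero[OF p(1)] by (simp add: G_def)
  have gp: "g p = G *\<^sub>R nu p" using G by (simp add: nu_def G_def)
  have "H p (g p) \<bullet> g p = G\<^sup>2 * (H p (nu p) \<bullet> nu p)"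
    unfolding gp using linear_H[of p] by (simp add: linear_cmul power2_eq_square)
  moreover have "fst (g p) = G * fst (nu p)" unfolding gp by simp
  ultimately have "G\<^sup>2 * (\<Sum>b\<in>Basis. H p b \<bullet> b) - G\<^sup>2 * (H p (nu p) \<bullet> nu p) + a / fst p * (G * fst (nu p)) * G\<^sup>2 = C * G ^ 3"
    using cmc[OF p] unfolding G_def by simp
  then have "G\<^sup>2 * ((\<Sum>b\<in>Basis. H p b \<bullet> b) - (H p (nu p) \<bullet> nu p) + a / fst p * fst (nu p) * G) = G\<^sup>2 * (C * G)"
    by (simp add: algebra_simps power2_eq_square power3_eq_cube)
  then have "(\<Sum>b\<in>Basis. H p b \<bullet> b) - (H p (nu p) \<bullet> nu p) + a / fst p * fst (nu p) * G = C * G"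
    using G by simp
  then have "(\<Sum>b\<in>Basis. H p b \<bullet> b) - (H p (nu p) \<bullet> nu p) = G * (C - a * (fst (nu p) / fst p))"
    using G by (simp add: algebra_simps)
  then show ?thesis unfolding trA_def G_def[symmetric] using G by simp
qed

lemma sum_A_rank_one_update:
  assumes p: "p \<in> frontier D" and v: "v \<bullet> nu p = 0"
  shows "(\<Sum>e\<in>Basis. A p (\<beta> *\<^sub>R P p e + (t * (v \<bullet> e)) *\<^sub>R v)) = \<beta>\<^sup>2 * trA p + (2 * \<beta> * t + t\<^sup>2 * (v \<bullet> v)) * A p v"
  unfolding A_def P_def sum_divide_distrib[symmetric] trace_rank_one_update[OF linear_H norm_nu[OF p] v] trA_def
  by (simp add: add_divide_distrib)

lemma sum_norm2_rank_one_update: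
  assumes p: "p \<in> frontier D" and v: "v \<bullet> nu p = 0"
  shows "(\<Sum>e\<in>Basis. (norm (\<beta> *\<^sub>R P p e + (t * (v \<bullet> e)) *\<^sub>R v))\<^sup>2)
     = \<beta>\<^sup>2 * real DIM('v) + (2 * \<beta> * t + t\<^sup>2 * (v \<bullet> v)) * (v \<bullet> v)"
proof -
  have "(\<Sum>e\<in>Basis. (norm (\<beta> *\<^sub>R P p e + (t * (v \<bullet> e)) *\<^sub>R v))\<^sup>2)
    = \<beta>\<^sup>2 * ((\<Sum>e\<in>(Basis :: (real \<times> 'v) set). e \<bullet> e) - nu p \<bullet> nu p) + (2 * \<beta> * t + t\<^sup>2 * (v \<bullet> v)) * (v \<bullet> v)"
    unfolding P_def power2_norm_eq_inner using trace_rank_one_update[OF linear_id norm_nu[OF p] v, of \<beta> t] by simp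
  also have "(\<Sum>e\<in>(Basis :: (real \<times> 'v) set). e \<bullet> e) = real DIM(real \<times> 'v)" by simp
  finally show ?thesis using nu_nu[OF p] by simp
qed

text \<open>Comparison with the touching interior ball: the graph points over l v lie outside
  \<open>D\<close>, hence outside the ball of radius \<open>d x\<close> about \<open>x\<close>.
  Comparing second order terms as l tends to 0 bounds each principal curvature by 1 / d x.\<close>

lemma A_le_if_nearest:
  assumes x: "x \<in> D" and np: "nearest x p" and v: "v \<bullet> nu p = 0"
  shows "A p v \<le> (v \<bullet> v) / d x"
proof -
  define r where "r = d x"
  have r: "r > 0" using d_pos[OF x] by (simp add: r_def)
  have p: "p \<in> frontier D" using np by (simp add: nearest_def)
  have xp: "x = p - r *\<^sub>R nu p" using nearest_normal[OF x np] by (simp add: r_def algebra_simps)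
  define V where "V = v \<bullet> v"
  have V0: "V \<ge> 0" by (simp add: V_def)
  have "r * A p v \<le> V + 2 * r * \<tau> * V" if t: "\<tau> > 0" for \<tau>
  proof -
    obtain s where s: "s > 0" "\<And>p w. p \<in> frontier D \<Longrightarrow> w \<bullet> nu p = 0 \<Longrightarrow> norm w \<le> s \<Longrightarrow>
     p + w + (- A p w / 2 + \<tau> * (norm w)\<^sup>2) *\<^sub>R nu p \<notin> D" by (rule graph_point_not_in_D[OF t]) blast
    define \<kappa> where "\<kappa> = - A p v / 2 + \<tau> * V"
    have ineq: "2 * r * \<kappa> + V + (l * \<kappa>)\<^sup>2 \<ge> 0" if l: "l > 0" "l * norm v \<le> s" for l
    proof -
      define w where "w = l *\<^sub>R v"
      have "- A p w / 2 + \<tau> * (norm w)\<^sup>2 = l\<^sup>2 * \<kappa>"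
        unfolding w_def A_scaleR \<kappa>_def V_def by (simp add: power_mult_distrib power2_norm_eq_inner algebra_simps)
      then have "p + w + (l\<^sup>2 * \<kappa>) *\<^sub>R nu p \<notin> D"
        using s(2)[OF p, of w] v l by (simp add: w_def)
      from d_le[OF this, of x] have "r\<^sup>2 \<le> (norm (x - (p + w + (l\<^sup>2 * \<kappa>) *\<^sub>R nu p)))\<^sup>2"
        using r by (simp add: r_def power_mono)
      also have "x - (p + w + (l\<^sup>2 * \<kappa>) *\<^sub>R nu p) = - ((r + l\<^sup>2 * \<kappa>) *\<^sub>R nu p + l *\<^sub>R v)"
        unfolding xp w_def by (simp add: algebra_simps)
      also have "(norm \<dots>)\<^sup>2 = (r + l\<^sup>2 * \<kappa>)\<^sup>2 + l\<^sup>2 * V"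
        unfolding norm_minus_cancel power2_norm_eq_inner V_def using v nu_nu[OF p]
        by (simp add: inner_add_left inner_add_right inner_commute power2_eq_square)
      finally have "0 \<le> l\<^sup>2 * (2 * r * \<kappa> + V + (l * \<kappa>)\<^sup>2)" by (simp add: power2_eq_square algebra_simps)
      then show ?thesis using l(1) by (simp add: zero_le_mult_iff)
    qed
    have "2 * r * \<kappa> + V \<ge> 0 - e" if e: "e > 0" for e
    proof -
      define l where "l = min (s / (norm v + 1)) (min 1 (e / (\<kappa>\<^sup>2 + 1)))"
      have l: "l > 0" "l \<le> 1" "l \<le> s / (norm v + 1)" "l \<le> e / (\<kappa>\<^sup>2 + 1)"
        using s(1) e by (auto simp: l_def intro!: divide_pos_pos add_nonneg_pos)
      have "l * (norm v + 1) \<le> s" using l(3) pos_le_divide_eq[of "norm v + 1" l s] by (simp add: add_nonneg_pos)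
      then have "l * norm v \<le> s" using l(1) by (simp add: algebra_simps)
      then have "2 * r * \<kappa> + V + (l * \<kappa>)\<^sup>2 \<ge> 0" using ineq l(1) by blast
      moreover have "(l * \<kappa>)\<^sup>2 \<le> e"
      proof -
        have "(l * \<kappa>)\<^sup>2 \<le> l * \<kappa>\<^sup>2" using l(1,2) mult_right_mono[of "l\<^sup>2" l "\<kappa>\<^sup>2"]
          by (simp add: power_mult_distrib power2_eq_square[of l] mult_left_le)
        also have "\<dots> \<le> l * (\<kappa>\<^sup>2 + 1)" using l(1) by simp
        also have "\<dots> \<le> e" using l(4) pos_le_divide_eq[of "\<kappa>\<^sup>2 + 1" l e] by (simp add: add_nonneg_pos)
        finally show ?thesis .
      qed
      ultimately show ?thesis by linarith
    qed
    then have "2 * r * \<kappa> + V \<ge> 0" by (metis add.commute diff_le_eq field_le_epsilon)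
    then show ?thesis by (simp add: \<kappa>_def algebra_simps)
  qed
  then have "r * A p v \<le> V + e" if "e > 0" for e
  proof -
    have pos: "2 * r * V + 1 > 0" using r V0 by (simp add: add_nonneg_pos)
    have "2 * r * (e / (2 * r * V + 1)) * V = e * ((2 * r * V) / (2 * r * V + 1))" by simp
    also have "\<dots> \<le> e * 1" using pos that by (intro mult_left_mono) auto
    finally show ?thesis using \<open>\<And>\<tau>. \<tau> > 0 \<Longrightarrow> r * A p v \<le> V + 2 * r * \<tau> * V\<close>[of "e / (2 * r * V + 1)"] that pos
      by force
  qed
  then have "r * A p v \<le> V" by (rule field_le_epsilon)
  then show ?thesis using r by (simp add: V_def r_def field_simps)
qed

text \<open>Take the trace of the touching ball bound: k principal curvatures are at most 1/d.
  Positivity of \<xi> at x = p - d \<nu> says that the remaining curvature, the \<xi>-component of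
  the normal over \<xi>, is less than 1/d, and it counts a times; so C < N / d. Thus t - c t^2 / 2
  is increasing on the range of d.\<close>

lemma d_c_less_1:
  assumes x: "x \<in> D" "fst x > 0"
  shows "c * d x < 1"
proof -
  obtain p where np: "nearest x p" using nearest_exists[OF x(1)] .
  have p: "p \<in> frontier D" using np by (simp add: nearest_def)
  define r where "r = d x"
  have r: "r > 0" using d_pos[OF x(1)] by (simp add: r_def)
  have pp: "fst p > 0" by (rule nearest_fst_pos[OF x np])
  have "fst x = fst p - r * fst (nu p)" using nearest_normal[OF x(1) np] by (simp add: r_def prod_eq_iff)
  then have \<kappa>: "fst (nu p) / fst p < 1 / r" using x(2) pp r by (simp add: field_simps)
  have "trA p = (\<Sum>e\<in>Basis. A p (P p e))" using sum_A_rank_one_update[OF p, of 0 1 0] by simp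
  also have "\<dots> \<le> (\<Sum>e\<in>Basis. (norm (P p e))\<^sup>2 / r)"
    using A_le_if_nearest[OF x(1) np P_nu[OF p]] by (intro sum_mono) (simp add: r_def power2_norm_eq_inner)
  also have "\<dots> = real DIM('v) / r"
    using sum_norm2_rank_one_update[OF p, of 0 1 0] by (simp add: sum_divide_distrib[symmetric])
  finally have "C - a * (fst (nu p) / fst p) \<le> real DIM('v) / r" using trA_eq[OF p pp] by simp
  moreover have "a * (fst (nu p) / fst p) < a * (1 / r)" using \<kappa> a_pos by (rule mult_strict_left_mono)
  ultimately have "C < N / r" by (simp add: N_def add_divide_distrib)
  then show ?thesis using r N_pos by (simp add: c_def r_def field_simps)
qed

section \<open>One-sided second order bounds for u\<close>

lemma d_lipschitz: "\<bar>d x - d y\<bar> \<le> norm (x - y)"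
  unfolding d_def using infdist_triangle_abs[of x "- D" y] by (simp add: dist_norm)

lemma d_nonneg: "d x \<ge> 0"
  unfolding d_def by (rule infdist_nonneg)

lemma d_zero: "x \<notin> D \<Longrightarrow> d x = 0"
  unfolding d_def by simp

lemma d_bounded: obtains R where "R \<ge> 0" "\<And>x. d x \<le> R"
proof -
  obtain q where q: "q \<notin> D" using compl_D by blast
  obtain B where B: "\<And>x. x \<in> D \<Longrightarrow> norm x \<le> B" using bounded_D unfolding bounded_iff by blast
  have "d x \<le> \<bar>B\<bar> + norm q" for x
  proof (cases "x \<in> D")
    case True
    then show ?thesis using d_le[OF q, of x] norm_triangle_ineq4[of x q] B[OF True] by linarith
  qed (simp add: d_zero)
  then show thesis using that[of "\<bar>B\<bar> + norm q"] by simp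
qed

lemma u_lipschitz: obtains L where "L \<ge> 0" "\<And>x y. \<bar>u x - u y\<bar> \<le> L * norm (x - y)"
proof -
  obtain R where R: "R \<ge> 0" "\<And>x. d x \<le> R" by (rule d_bounded) blast
  have "\<bar>u x - u y\<bar> \<le> (1 + c * R) * norm (x - y)" for x y
  proof -
    have "u x - u y = (d x - d y) * (1 - c / 2 * (d x + d y))"
      by (simp add: u_def field_simps power2_eq_square)
    moreover have "\<bar>1 - c / 2 * (d x + d y)\<bar> \<le> 1 + c * R"
    proof -
      have "c / 2 * (d x + d y) \<le> c / 2 * (R + R)"
        using R(2)[of x] R(2)[of y] c_pos by (intro mult_left_mono) auto
      moreover have "c / 2 * (d x + d y) \<ge> 0" using c_pos d_nonneg[of x] d_nonneg[of y] by simp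
      ultimately show ?thesis by (simp add: abs_le_iff)
    qed
    ultimately show ?thesis using d_lipschitz[of x y]
      by (simp add: abs_mult mult.commute mult_mono)
  qed
  moreover have "1 + c * R \<ge> 0" using c_pos R(1) by simp
  ultimately show thesis using that by blast
qed

text \<open>The distance from \<open>x + y\<close> is estimated by that to the point of the frontier graph lying over \<open>p + w\<close>,
  where the tangential displacement \<open>w\<close> can be chosen in dependence on \<open>y\<close>.\<close>

lemma barrier:
  assumes r0: "r0 > 0" and r1: "c * r1 < 1" and Q: "Q \<ge> 0" and t: "\<tau> > 0"
  obtains s where "s > 0"
    "\<And>x p y w. x \<in> D \<Longrightarrow> nearest x p \<Longrightarrow> r0 \<le> d x \<Longrightarrow> d x \<le> r1 \<Longrightarrow> norm y \<le> s \<Longrightarrow> w \<bullet> nu p = 0 \<Longrightarrow> norm w \<le> Q * norm y \<Longrightarrow>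
       u (x + y) \<le> u x - (1 - c * d x) * (nu p \<bullet> y)
          + (1 - c * d x) * (- A p w / 2 + (norm (P p y - w))\<^sup>2 / (2 * d x)) - c / 2 * (nu p \<bullet> y)\<^sup>2 + \<tau> * (norm y)\<^sup>2"
proof -
  obtain a1 where a1: "a1 > 0" "\<And>p v. p \<in> frontier D \<Longrightarrow> \<bar>A p v\<bar> \<le> a1 * (norm v)\<^sup>2" by (rule A_bounded) blast
  define \<tau>1 where "\<tau>1 = \<tau> / (2 * (Q\<^sup>2 + 1))"
  have q1: "Q\<^sup>2 + 1 > 0" by (simp add: add_nonneg_pos)
  have t1: "\<tau>1 > 0" "\<tau>1 * Q\<^sup>2 \<le> \<tau> / 2"
  proof -
    show t1: "\<tau>1 > 0" unfolding \<tau>1_def using t q1 by (intro divide_pos_pos) auto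
    have "\<tau>1 * (Q\<^sup>2 + 1) = \<tau> / 2" unfolding \<tau>1_def using q1 by (simp add: field_simps)
    then show "\<tau>1 * Q\<^sup>2 \<le> \<tau> / 2" using t1 by (simp add: algebra_simps)
  qed
  obtain s1 where s1: "s1 > 0" "\<And>p w. p \<in> frontier D \<Longrightarrow> w \<bullet> nu p = 0 \<Longrightarrow> norm w \<le> s1 \<Longrightarrow>
     p + w + (- A p w / 2 + \<tau>1 * (norm w)\<^sup>2) *\<^sub>R nu p \<notin> D" by (rule graph_point_not_in_D[OF t1(1)]) blast
  \<comment> \<open>In units of |y|^2, \<open>K1\<close> bounds the height \<gamma> of the graph
    point and the squared tangential gap, and \<open>K2\<close> the second order part E of the
    distance. \<open>K3\<close> is the coefficient of the cubic remainder.\<close>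
  define K1 where "K1 = (a1 / 2 + \<tau>1) * Q\<^sup>2 + (1 + Q)\<^sup>2"
  have K1: "K1 \<ge> 0" using a1 t1 by (simp add: K1_def)
  define K2 where "K2 = K1 + (K1\<^sup>2 + K1) / r0"
  have K2: "K2 \<ge> 0" using K1 r0 by (simp add: K2_def)
  define K3 where "K3 = K1\<^sup>2 / r0 + K1 / r0\<^sup>2 + c * K2"
  have K3: "K3 \<ge> 0" using K1 K2 r0 c_pos by (simp add: K3_def)
  define s where "s = Min {s1 / (Q + 1), 1, r0 / 2, (1 - c * r1) / (c * (1 + K2)), \<tau> / (2 * (K3 + 1))}"
  have s: "s > 0" "s \<le> 1" "s \<le> r0 / 2" "(Q + 1) * s \<le> s1" "c * ((1 + K2) * s) \<le> 1 - c * r1" "K3 * s \<le> \<tau> / 2"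
  proof -
    show sp: "s > 0" unfolding s_def using s1 Q r0 r1 c_pos K2 K3 t by (auto intro!: divide_pos_pos mult_pos_pos)
    have le: "s \<le> z" if "z \<in> {s1 / (Q + 1), 1, r0 / 2, (1 - c * r1) / (c * (1 + K2)), \<tau> / (2 * (K3 + 1))}" for z
      unfolding s_def using that by (intro Min_le) auto
    show "s \<le> 1" "s \<le> r0 / 2" by (rule le, simp)+
    have "s \<le> s1 / (Q + 1)" by (rule le) simp
    then show "(Q + 1) * s \<le> s1" using Q pos_le_divide_eq[of "Q + 1" s s1] by (simp add: mult.commute)
    have "s \<le> (1 - c * r1) / (c * (1 + K2))" by (rule le) simp
    then show "c * ((1 + K2) * s) \<le> 1 - c * r1"
      using c_pos K2 pos_le_divide_eq[of "c * (1 + K2)" s "1 - c * r1"] by (simp add: ac_simps)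
    have "s \<le> \<tau> / (2 * (K3 + 1))" by (rule le) simp
    then have "s * (2 * (K3 + 1)) \<le> \<tau>" using K3 pos_le_divide_eq[of "2 * (K3 + 1)" s \<tau>] by simp
    then show "K3 * s \<le> \<tau> / 2" using sp by (simp add: algebra_simps)
  qed
  have "u (x + y) \<le> u x - (1 - c * d x) * (nu p \<bullet> y)
          + (1 - c * d x) * (- A p w / 2 + (norm (P p y - w))\<^sup>2 / (2 * d x)) - c / 2 * (nu p \<bullet> y)\<^sup>2 + \<tau> * (norm y)\<^sup>2"
    if x: "x \<in> D" and np: "nearest x p" and dx: "r0 \<le> d x" "d x \<le> r1" and ys: "norm y \<le> s"
      and w: "w \<bullet> nu p = 0" and wQ: "norm w \<le> Q * norm y" for x p y w
  proof -
    define r where "r = d x"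
    define n where "n = nu p"
    define Y where "Y = norm y"
    define yn where "yn = nu p \<bullet> y"
    define t2 where "t2 = (norm (P p y - w))\<^sup>2"
    define \<gamma> where "\<gamma> = - A p w / 2 + \<tau>1 * (norm w)\<^sup>2"
    have p: "p \<in> frontier D" using np by (simp add: nearest_def)
    have r: "r > 0" "r0 \<le> r" "r \<le> r1" using dx r0 by (auto simp: r_def)
    have cr: "c * r < 1" "c * r \<ge> 0"
    proof -
      have "c * r \<le> c * r1" using mult_left_mono[OF r(3), of c] c_pos by simp
      then show "c * r < 1" using r1 by linarith
      show "c * r \<ge> 0" using c_pos r(1) by simp
    qed
    have n: "n \<bullet> n = 1" "norm n = 1" using nu_nu[OF p] norm_nu[OF p] by (auto simp: n_def)
    have Y: "Y \<ge> 0" "Y \<le> s" using ys by (auto simp: Y_def)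
    have Y1: "Y \<le> 1" "Y \<le> r0 / 2" using Y s by auto
    have yn: "\<bar>yn\<bar> \<le> Y" using Cauchy_Schwarz_ineq2[of n y] n by (simp add: yn_def n_def Y_def)
    have t2: "t2 \<ge> 0" "t2 \<le> K1 * Y\<^sup>2"
    proof -
      show "t2 \<ge> 0" by (simp add: t2_def)
      have "norm (P p y - w) \<le> (1 + Q) * Y"
        using norm_triangle_ineq4[of "P p y" w] norm_P_le[OF p, of y] wQ by (simp add: Y_def algebra_simps)
      then have "t2 \<le> ((1 + Q) * Y)\<^sup>2" unfolding t2_def by (intro power_mono) auto
      also have "\<dots> = (1 + Q)\<^sup>2 * Y\<^sup>2" by (rule power_mult_distrib)
      also have "\<dots> \<le> K1 * Y\<^sup>2" using a1 t1 by (intro mult_right_mono) (auto simp: K1_def)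
      finally show "t2 \<le> K1 * Y\<^sup>2" .
    qed
    have w2: "(norm w)\<^sup>2 \<le> Q\<^sup>2 * Y\<^sup>2"
      using wQ power_mono[of "norm w" "Q * Y" 2] by (simp add: Y_def power_mult_distrib)
    have \<gamma>: "\<bar>\<gamma>\<bar> \<le> K1 * Y\<^sup>2"
    proof -
      have "\<tau>1 * (norm w)\<^sup>2 \<ge> 0" using t1 by simp
      then have "\<bar>\<gamma>\<bar> \<le> \<bar>A p w\<bar> / 2 + \<tau>1 * (norm w)\<^sup>2" unfolding \<gamma>_def by linarith
      also have "\<dots> \<le> (a1 / 2 + \<tau>1) * (norm w)\<^sup>2" using a1(2)[OF p, of w] by (simp add: algebra_simps)
      also have "\<dots> \<le> (a1 / 2 + \<tau>1) * (Q\<^sup>2 * Y\<^sup>2)" using w2 a1 t1 by (intro mult_left_mono) auto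
      also have "\<dots> \<le> K1 * Y\<^sup>2" by (simp add: K1_def algebra_simps)
      finally show ?thesis .
    qed
    define q where "q = p + w + \<gamma> *\<^sub>R n"
    have "norm w \<le> s1"
    proof -
      have "norm w \<le> (Q + 1) * s" using wQ Q Y mult_mono[of Q "Q + 1" Y s] by (simp add: Y_def)
      then show ?thesis using s(4) by simp
    qed
    then have "q \<notin> D" using s1(2)[OF p w] by (simp add: q_def \<gamma>_def n_def)
    then have dq: "d (x + y) \<le> norm (x + y - q)" by (rule d_le)
    define D0 where "D0 = norm (x + y - q)"
    define m where "m = r - yn"
    have m: "m \<ge> r0 / 2" "m > 0" using yn Y1 r r0 unfolding m_def by linarith+
    have xp: "x = p - r *\<^sub>R n" using nearest_normal[OF x np] by (simp add: r_def n_def algebra_simps)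
    have "x + y - q = (P p y - w) - (m + \<gamma>) *\<^sub>R n"
      unfolding xp q_def P_def m_def yn_def n_def by (simp add: algebra_simps)
    moreover have "(P p y - w) \<bullet> n = 0" using P_nu[OF p, of y] w by (simp add: inner_diff_left n_def)
    ultimately have D02: "D0\<^sup>2 = (m + \<gamma>)\<^sup>2 + t2"
      unfolding D0_def t2_def power2_norm_eq_inner using n
      by (simp add: inner_diff_left inner_diff_right inner_commute power2_eq_square[of "m + \<gamma>"])
    define E where "E = \<gamma> + (\<gamma>\<^sup>2 + t2) / (2 * m)"
    \<comment> \<open>The inequality 2 m D0 \<le> D0^2 + m^2 replaces the square root in the
      distance by its tangent at m^2, which makes the upper bound polynomial apart from the factor 1
      / (2 m).\<close>
    have D0le: "D0 \<le> r - yn + E"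
    proof -
      have "2 * m * D0 \<le> D0\<^sup>2 + m\<^sup>2" using sum_squares_bound[of m D0] by (simp add: ac_simps)
      also have "\<dots> = 2 * m * (m + \<gamma>) + (\<gamma>\<^sup>2 + t2)" unfolding D02 by (simp add: power2_eq_square algebra_simps)
      also have "\<dots> = 2 * m * (m + E)" unfolding E_def using m(2) by (simp add: field_simps)
      finally show ?thesis using m(2) by (simp add: m_def)
    qed
    have \<gamma>2: "\<gamma>\<^sup>2 \<le> K1\<^sup>2 * Y\<^sup>2 * Y\<^sup>2"
    proof -
      have "\<gamma>\<^sup>2 \<le> (K1 * Y\<^sup>2)\<^sup>2" using \<gamma> K1 by (simp add: abs_le_square_iff[symmetric])
      then show ?thesis by (simp add: power2_eq_square algebra_simps)
    qed
    have Y2: "Y\<^sup>2 \<le> Y" "Y\<^sup>2 \<le> 1" using Y Y1 by (auto simp: power2_eq_square mult_left_le mult_le_one)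
    have im: "1 / (2 * m) \<le> 1 / r0" using m r0 by (simp add: field_simps)
    have E_up: "E \<le> (- A p w / 2 + t2 / (2 * r)) + \<tau> / 2 * Y\<^sup>2 + (K1\<^sup>2 / r0 + K1 / r0\<^sup>2) * Y * Y\<^sup>2"
    proof -
      have e1: "\<gamma> \<le> - A p w / 2 + \<tau> / 2 * Y\<^sup>2"
      proof -
        have "\<tau>1 * (norm w)\<^sup>2 \<le> \<tau>1 * (Q\<^sup>2 * Y\<^sup>2)" using w2 t1 by simp
        also have "\<dots> \<le> \<tau> / 2 * Y\<^sup>2" using mult_right_mono[OF t1(2), of "Y\<^sup>2"] by (simp add: ac_simps)
        finally show ?thesis by (simp add: \<gamma>_def)
      qed
      have e2: "\<gamma>\<^sup>2 / (2 * m) \<le> K1\<^sup>2 / r0 * Y * Y\<^sup>2"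
      proof -
        have "\<gamma>\<^sup>2 * (1 / (2 * m)) \<le> (K1\<^sup>2 * Y\<^sup>2 * Y\<^sup>2) * (1 / r0)"
          using \<gamma>2 im m K1 by (intro mult_mono) auto
        also have "\<dots> \<le> (K1\<^sup>2 * Y * Y\<^sup>2) * (1 / r0)"
          using r0 Y2 by (intro mult_right_mono mult_left_mono) auto
        finally show ?thesis by simp
      qed
      have e3: "t2 / (2 * m) \<le> t2 / (2 * r) + K1 / r0\<^sup>2 * Y * Y\<^sup>2"
      proof -
        have "1 / (2 * m) - 1 / (2 * r) = yn / (2 * m * r)" using m r by (simp add: m_def field_simps)
        also have "\<dots> \<le> Y / (r0 * r0)"
        proof (rule frac_le)
          show "r0 * r0 \<le> 2 * m * r" using m r r0 by (intro mult_mono) auto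
        qed (use yn Y r0 in auto)
        finally have "t2 * (1 / (2 * m) - 1 / (2 * r)) \<le> (K1 * Y\<^sup>2) * (Y / (r0 * r0))"
          using t2 Y r0 K1 by (intro order_trans[OF mult_left_mono mult_right_mono]) auto
        then show ?thesis by (simp add: algebra_simps power2_eq_square)
      qed
      show ?thesis using e1 e2 e3 unfolding E_def by (simp add: add_divide_distrib algebra_simps)
    qed
    have E_abs: "\<bar>E\<bar> \<le> K2 * Y\<^sup>2"
    proof -
      have "(\<gamma>\<^sup>2 + t2) * (1 / (2 * m)) \<le> (K1\<^sup>2 * Y\<^sup>2 + K1 * Y\<^sup>2) * (1 / r0)"
      proof (intro mult_mono add_mono)
        show "\<gamma>\<^sup>2 \<le> K1\<^sup>2 * Y\<^sup>2"
          using \<gamma>2 mult_left_mono[OF Y2(2), of "K1\<^sup>2 * Y\<^sup>2"] by simp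
      qed (use t2 im m K1 in auto)
      moreover have "(\<gamma>\<^sup>2 + t2) * (1 / (2 * m)) \<ge> 0" using t2 m by simp
      ultimately have "\<bar>E\<bar> \<le> \<bar>\<gamma>\<bar> + (K1\<^sup>2 * Y\<^sup>2 + K1 * Y\<^sup>2) * (1 / r0)" unfolding E_def by simp
      then show ?thesis using \<gamma> by (simp add: K2_def algebra_simps add_divide_distrib)
    qed
    define z where "z = r - yn + E"
    have z: "d (x + y) \<le> z" using dq D0le by (simp add: D0_def z_def)
    \<comment> \<open>The function t - c t^2 / 2 increases only up to t = 1/c, so an upper bound for
      d may be inserted only once it is known to stay below.\<close>
    have cz: "c * z \<le> 1"
    proof -
      have "K2 * Y\<^sup>2 \<le> K2 * Y" using K2 Y2 by (intro mult_left_mono) auto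
      then have "z \<le> r1 + (1 + K2) * Y" using yn E_abs r unfolding z_def by (simp add: algebra_simps)
      also have "\<dots> \<le> r1 + (1 + K2) * s" using Y K2 by simp
      finally have "c * z \<le> c * r1 + c * ((1 + K2) * s)" using c_pos mult_left_mono[of z _ c] by (simp add: distrib_left[symmetric])
      then show ?thesis using s(5) by simp
    qed
    have "u (x + y) \<le> z - c / 2 * z\<^sup>2"
    proof -
      have "z - c / 2 * z\<^sup>2 - u (x + y) = (z - d (x + y)) * (1 - c / 2 * (z + d (x + y)))"
        by (simp add: u_def field_simps power2_eq_square)
      moreover have "c * (z + d (x + y)) \<le> c * (z + z)" using z c_pos by (intro mult_left_mono) auto
      then have "1 - c / 2 * (z + d (x + y)) \<ge> 0" using cz by (simp add: algebra_simps)
      ultimately have "z - c / 2 * z\<^sup>2 - u (x + y) \<ge> 0" using z by simp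
      then show ?thesis by simp
    qed
    also have "\<dots> = u x - (1 - c * r) * yn + (1 - c * r) * E - c / 2 * yn\<^sup>2 + (c * (yn * E) - c / 2 * E\<^sup>2)"
      by (simp add: z_def u_def r_def[symmetric] power2_eq_square field_simps)
    also have "c * (yn * E) - c / 2 * E\<^sup>2 \<le> c * K2 * Y * Y\<^sup>2"
    proof -
      have "yn * E \<le> \<bar>yn\<bar> * \<bar>E\<bar>" by (metis abs_ge_self abs_mult)
      also have "\<dots> \<le> Y * (K2 * Y\<^sup>2)" using yn E_abs Y by (intro mult_mono) auto
      finally have "c * (yn * E) \<le> c * (Y * (K2 * Y\<^sup>2))" using c_pos by simp
      moreover have "c / 2 * E\<^sup>2 \<ge> 0" using c_pos by simp
      ultimately show ?thesis by (simp add: algebra_simps)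
    qed
    also have "(1 - c * r) * E \<le> (1 - c * r) * (- A p w / 2 + t2 / (2 * r)) + (\<tau> / 2 * Y\<^sup>2 + (K1\<^sup>2 / r0 + K1 / r0\<^sup>2) * Y * Y\<^sup>2)"
    proof -
      define X where "X = \<tau> / 2 * Y\<^sup>2 + (K1\<^sup>2 / r0 + K1 / r0\<^sup>2) * Y * Y\<^sup>2"
      have X: "X \<ge> 0" unfolding X_def using t K1 r0 Y by (intro add_nonneg_nonneg mult_nonneg_nonneg) auto
      have "(1 - c * r) * E \<le> (1 - c * r) * ((- A p w / 2 + t2 / (2 * r)) + X)"
        using E_up cr by (intro mult_left_mono) (auto simp: X_def)
      also have "\<dots> \<le> (1 - c * r) * (- A p w / 2 + t2 / (2 * r)) + X"
        using cr X mult_right_mono[of "1 - c * r" 1 X] by (simp add: distrib_left)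
      finally show ?thesis by (simp add: X_def)
    qed
    finally have "u (x + y) \<le> u x - (1 - c * r) * yn + (1 - c * r) * (- A p w / 2 + t2 / (2 * r)) - c / 2 * yn\<^sup>2
       + (\<tau> / 2 * Y\<^sup>2 + K3 * Y * Y\<^sup>2)"
      by (simp add: K3_def algebra_simps)
    moreover have "K3 * Y * Y\<^sup>2 \<le> \<tau> / 2 * Y\<^sup>2"
      using s(6) Y K3 mult_left_mono[of Y s K3] by (intro mult_right_mono) auto
    ultimately have "u (x + y) \<le> u x - (1 - c * r) * yn + (1 - c * r) * (- A p w / 2 + t2 / (2 * r)) - c / 2 * yn\<^sup>2
       + \<tau> * Y\<^sup>2" by linarith
    then show ?thesis unfolding r_def yn_def t2_def Y_def .
  qed
  then show thesis using that s(1) by blast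
qed

text \<open>The improvement of the Laplacian bound for \<open>u\<close> when the optimal displacement \<open>w\<close>, the tangential part of \<open>y\<close> times
  \<open>1 / (1 - c d)\<close>, is changed by \<open>t (v \<bullet> y) v\<close>.  It is positive for a small \<open>t\<close> of the right sign unless
  \<open>A p v = c (v \<bullet> v)\<close>.\<close>

definition gain :: "real \<times> 'v \<Rightarrow> real \<times> 'v \<Rightarrow> real \<times> 'v \<Rightarrow> real \<Rightarrow> real" where
  "gain x p v t = (1 - c * norm (x - p)) *
     (2 * (1 / (1 - c * norm (x - p))) * t * (A p v - c * (v \<bullet> v)) + t\<^sup>2 * (v \<bullet> v) * (A p v - (v \<bullet> v) / norm (x - p)))"

text \<open>The displacement factor \<beta> = 1 / (1 - c r) is the best one when all curvatures
  equal c. The weight term is then treated as if it were a further principal curvatures \<kappa>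
  with the same \<beta>, and C = N c turns the total into -(N + 1) c; the extra -c is the second
  derivative of u in the normal direction. What remains is linear and quadratic in t: the
  gain.\<close>

lemma operator_bound_algebra:
  fixes r \<kappa> q k \<xi> V Av t trA' :: real
  defines "\<beta> \<equiv> 1 / (1 - c * r)"
  assumes r: "r > 0" "c * r < 1" and q: "1 - r * \<kappa> > 0" and tr: "trA' = C - a * \<kappa>"
  shows "(1 - c * r) * (- (\<beta>\<^sup>2 * trA' + (2 * \<beta> * t + t\<^sup>2 * V) * Av)
         + ((1 - \<beta>)\<^sup>2 * real DIM('v) + (2 * (1 - \<beta>) * (- t) + (- t)\<^sup>2 * V) * V) / r) - c
       - (1 - c * r) * (a * (\<kappa> / (1 - r * \<kappa>)))
     \<le> - ((N + 1) * c) - (1 - c * r) * (2 * \<beta> * t * (Av - c * V) + t\<^sup>2 * V * (Av - V / r))"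
proof -
  define q where "q = 1 - r * \<kappa>"
  have qp: "q > 0" using assms by (simp add: q_def)
  have \<kappa>: "\<kappa> = (1 - q) / r" using r by (simp add: q_def)
  define e where "e = 1 - c * r"
  have e: "e > 0" using r by (simp add: e_def)
  have \<beta>e: "\<beta> * e = 1" using e by (simp add: \<beta>_def e_def)
  have b1: "1 - \<beta> = - (c * r * \<beta>)" using \<beta>e by (simp add: e_def algebra_simps)
  \<comment> \<open>Over all real \<beta> the left side has maximum \<kappa> / q, at \<beta> = 1 /
    q, where \<kappa> / q is the corresponding curvature of the parallel surface through x; the
    defect is a square.\<close>
  have k: "\<beta>\<^sup>2 * \<kappa> - (1 - \<beta>)\<^sup>2 / r \<le> \<kappa> / q"
  proof -
    have "\<kappa> / q - (\<beta>\<^sup>2 * \<kappa> - (1 - \<beta>)\<^sup>2 / r) = (\<beta> * q - 1)\<^sup>2 / (q * r)"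
      unfolding \<kappa> using qp r by (simp add: field_simps power2_eq_square)
    also have "\<dots> \<ge> 0" using qp r by simp
    finally show ?thesis by simp
  qed
  have sq: "(1 - \<beta>)\<^sup>2 / r = c * (c * r) * \<beta>\<^sup>2"
    unfolding b1 using r by (simp add: power2_eq_square)
  have "e * (- (\<beta>\<^sup>2 * (C - a * \<kappa>)) + real DIM('v) * ((1 - \<beta>)\<^sup>2 / r)) - c - e * (a * (\<kappa> / q))
     \<le> e * (- (\<beta>\<^sup>2 * (C - a * \<kappa>)) + real DIM('v) * ((1 - \<beta>)\<^sup>2 / r)) - c - e * (a * (\<beta>\<^sup>2 * \<kappa> - (1 - \<beta>)\<^sup>2 / r))"
  proof -
    have "e * (a * (\<beta>\<^sup>2 * \<kappa> - (1 - \<beta>)\<^sup>2 / r)) \<le> e * (a * (\<kappa> / q))"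
      using e a_pos by (intro mult_left_mono k) auto
    then show ?thesis by linarith
  qed
  also have "\<dots> = e * \<beta>\<^sup>2 * (- C + c * (c * r) * N) - c"
    unfolding sq N_def by (simp add: algebra_simps)
  also have "- C + c * (c * r) * N = - (c * N) * e"
    using N_pos by (simp add: c_def e_def algebra_simps)
  also have "e * \<beta>\<^sup>2 * (- (c * N) * e) = - (c * N) * (\<beta> * e)\<^sup>2" by (simp add: power2_eq_square)
  finally have main: "e * (- (\<beta>\<^sup>2 * (C - a * \<kappa>)) + real DIM('v) * ((1 - \<beta>)\<^sup>2 / r)) - c - e * (a * (\<kappa> / q)) \<le> - ((N + 1) * c)"
    unfolding \<beta>e by (simp add: algebra_simps)
  have "((1 - \<beta>)\<^sup>2 * real DIM('v) + (2 * (1 - \<beta>) * (- t) + (- t)\<^sup>2 * V) * V) / r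
     = real DIM('v) * ((1 - \<beta>)\<^sup>2 / r) + 2 * c * \<beta> * t * V + t\<^sup>2 * V * (V / r)"
    unfolding b1 using r by (simp add: field_simps power2_eq_square)
  then show ?thesis using main unfolding tr e_def[symmetric] q_def[symmetric] by (simp add: algebra_simps)
qed

text \<open>Two barriers with the same linear part \<open>G\<close>, which equals the gradient of
  \<open>u\<close> wherever d is differentiable. The one with w = 0 and tolerance 1 gives the
  one-sided first order bounds with a constant \<open>K0\<close> independent of \<tau>; the one with
  the rank one displacement and small tolerance gives the sum of second differences. On the compact
  set K, d stays away from 0 and from 1/c, which makes both uniform.\<close>

lemma operator_bound:
  assumes K: "compact K" "\<And>x. x \<in> K \<Longrightarrow> x \<in> D \<and> fst x > 0"
  obtains K0 where "K0 \<ge> 0"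
    "\<And>\<tau>. \<tau> > 0 \<Longrightarrow> \<exists>h0>0. \<forall>x\<in>K. \<forall>h. 0 < h \<and> h < h0 \<longrightarrow> (\<forall>p v t. nearest x p \<and> v \<bullet> nu p = 0 \<and> norm v \<le> 1 \<and> \<bar>t\<bar> \<le> 1 \<longrightarrow>
      (\<exists>G. norm G \<le> 1 \<and>
        (\<forall>b\<in>Basis. u (x + h *\<^sub>R b) \<le> u x + h * (G \<bullet> b) + K0 * h\<^sup>2 \<and>
                   u (x - h *\<^sub>R b) \<le> u x - h * (G \<bullet> b) + K0 * h\<^sup>2) \<and>
        (\<Sum>b\<in>Basis. u (x + h *\<^sub>R b) + u (x - h *\<^sub>R b) - 2 * u x) / h\<^sup>2 + a / fst x * fst G
          \<le> - ((N + 1) * c) - gain x p v t + \<tau>))"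
proof (cases "K = {}")
  case True
  show ?thesis by (rule that[of 1]) (use True in \<open>auto intro!: exI[of _ 1]\<close>)
next
  case False
  have cd: "continuous_on K d" unfolding d_def by (intro continuous_intros)
  obtain x0 where x0: "x0 \<in> K" "\<And>x. x \<in> K \<Longrightarrow> d x0 \<le> d x" using continuous_attains_inf[OF K(1) False cd] by blast
  obtain x1 where x1: "x1 \<in> K" "\<And>x. x \<in> K \<Longrightarrow> d x \<le> d x1" using continuous_attains_sup[OF K(1) False cd] by blast
  define r0 where "r0 = d x0"
  define r1 where "r1 = d x1"
  have r0: "r0 > 0" using x0 K d_pos by (simp add: r0_def)
  have r1: "c * r1 < 1" using d_c_less_1 x1 K by (simp add: r1_def)
  \<comment> \<open>The tangential term of the barrier with w = 0, at distance at least r0, plus the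
    tolerance 1.\<close>
  define K0 where "K0 = 1 / (2 * r0) + 1"
  \<comment> \<open>Bounds the displacement of a basis vector: at most 1 / (1 - c r1) from the
    tangential part and 1 from the rank one change.\<close>
  define Q where "Q = 1 / (1 - c * r1) + 1"
  have Q: "Q \<ge> 0" using r1 by (simp add: Q_def)
  obtain s1 where s1: "s1 > 0"
    "\<And>x p y w. x \<in> D \<Longrightarrow> nearest x p \<Longrightarrow> r0 \<le> d x \<Longrightarrow> d x \<le> r1 \<Longrightarrow> norm y \<le> s1 \<Longrightarrow> w \<bullet> nu p = 0 \<Longrightarrow> norm w \<le> Q * norm y \<Longrightarrow>
       u (x + y) \<le> u x - (1 - c * d x) * (nu p \<bullet> y)
          + (1 - c * d x) * (- A p w / 2 + (norm (P p y - w))\<^sup>2 / (2 * d x)) - c / 2 * (nu p \<bullet> y)\<^sup>2 + 1 * (norm y)\<^sup>2"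
    by (rule barrier[OF r0 r1 Q zero_less_one]) blast
  have "\<exists>h0>0. \<forall>x\<in>K. \<forall>h. 0 < h \<and> h < h0 \<longrightarrow> (\<forall>p v t. nearest x p \<and> v \<bullet> nu p = 0 \<and> norm v \<le> 1 \<and> \<bar>t\<bar> \<le> 1 \<longrightarrow>
      (\<exists>G. norm G \<le> 1 \<and>
        (\<forall>b\<in>Basis. u (x + h *\<^sub>R b) \<le> u x + h * (G \<bullet> b) + K0 * h\<^sup>2 \<and>
                   u (x - h *\<^sub>R b) \<le> u x - h * (G \<bullet> b) + K0 * h\<^sup>2) \<and>
        (\<Sum>b\<in>Basis. u (x + h *\<^sub>R b) + u (x - h *\<^sub>R b) - 2 * u x) / h\<^sup>2 + a / fst x * fst G
          \<le> - ((N + 1) * c) - gain x p v t + \<tau>))" if \<tau>: "\<tau> > 0" for \<tau>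
  proof -
    define \<tau>2 where "\<tau>2 = \<tau> / (2 * real DIM(real \<times> 'v))"
    have dim: "real DIM(real \<times> 'v) > 0" using DIM_positive of_nat_0_less_iff by blast
    have t2: "\<tau>2 > 0" "2 * (real DIM(real \<times> 'v) * \<tau>2) = \<tau>"
      unfolding \<tau>2_def using \<tau> dim by (auto simp del: DIM_prod)
    obtain s2 where s2: "s2 > 0"
      "\<And>x p y w. x \<in> D \<Longrightarrow> nearest x p \<Longrightarrow> r0 \<le> d x \<Longrightarrow> d x \<le> r1 \<Longrightarrow> norm y \<le> s2 \<Longrightarrow> w \<bullet> nu p = 0 \<Longrightarrow> norm w \<le> Q * norm y \<Longrightarrow>
       u (x + y) \<le> u x - (1 - c * d x) * (nu p \<bullet> y)
          + (1 - c * d x) * (- A p w / 2 + (norm (P p y - w))\<^sup>2 / (2 * d x)) - c / 2 * (nu p \<bullet> y)\<^sup>2 + \<tau>2 * (norm y)\<^sup>2"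
      by (rule barrier[OF r0 r1 Q t2(1)]) blast
    have "\<exists>G. norm G \<le> 1 \<and>
        (\<forall>b\<in>Basis. u (x + h *\<^sub>R b) \<le> u x + h * (G \<bullet> b) + K0 * h\<^sup>2 \<and>
                   u (x - h *\<^sub>R b) \<le> u x - h * (G \<bullet> b) + K0 * h\<^sup>2) \<and>
        (\<Sum>b\<in>Basis. u (x + h *\<^sub>R b) + u (x - h *\<^sub>R b) - 2 * u x) / h\<^sup>2 + a / fst x * fst G
          \<le> - ((N + 1) * c) - gain x p v t + \<tau>"
      if xK: "x \<in> K" and h: "0 < h" "h < min s1 s2" and np: "nearest x p" and v: "v \<bullet> nu p = 0" "norm v \<le> 1" and t: "\<bar>t\<bar> \<le> 1"
      for x h p v t
    proof -
      have x: "x \<in> D" "fst x > 0" using K(2)[OF xK] by auto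
      have p: "p \<in> frontier D" using np by (simp add: nearest_def)
      have dx: "r0 \<le> d x" "d x \<le> r1" using x0(2)[OF xK] x1(2)[OF xK] by (auto simp: r0_def r1_def)
      define r where "r = d x"
      have r: "r > 0" "c * r < 1" using d_pos[OF x(1)] d_c_less_1[OF x] by (auto simp: r_def)
      have cr0: "c * r \<ge> 0" using r c_pos by simp
      have xr: "norm (x - p) = r" using np by (simp add: nearest_def r_def)
      define \<beta> where "\<beta> = 1 / (1 - c * r)"
      define G where "G = - ((1 - c * r) *\<^sub>R nu p)"
      have nG: "norm G \<le> 1" using r cr0 norm_nu[OF p] by (simp add: G_def)
      have Gb: "(1 - c * r) * (nu p \<bullet> (z *\<^sub>R b)) = - (z * (G \<bullet> b))" for z b by (simp add: G_def)
      have one: "u (x + z *\<^sub>R b) \<le> u x + z * (G \<bullet> b) + K0 * h\<^sup>2" if b: "b \<in> Basis" and z: "\<bar>z\<bar> = h" for b z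
      proof -
        have y: "norm (z *\<^sub>R b) = h" using b z by simp
        have "u (x + z *\<^sub>R b) \<le> u x - (1 - c * r) * (nu p \<bullet> (z *\<^sub>R b))
          + (1 - c * r) * ((norm (P p (z *\<^sub>R b)))\<^sup>2 / (2 * r)) - c / 2 * (nu p \<bullet> (z *\<^sub>R b))\<^sup>2 + h\<^sup>2"
          using s1(2)[OF x(1) np dx, of "z *\<^sub>R b" 0] h y Q unfolding r_def by simp
        moreover have "(1 - c * r) * ((norm (P p (z *\<^sub>R b)))\<^sup>2 / (2 * r)) \<le> 1 * (h\<^sup>2 / (2 * r0))"
        proof (intro mult_mono frac_le power_mono)
          show "norm (P p (z *\<^sub>R b)) \<le> h" using norm_P_le[OF p, of "z *\<^sub>R b"] y by simp
        qed (use r r0 cr0 dx r_def in auto)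
        moreover have "c / 2 * (nu p \<bullet> (z *\<^sub>R b))\<^sup>2 \<ge> 0" using c_pos by simp
        ultimately show ?thesis unfolding Gb K0_def by (simp add: distrib_right)
      qed
      define B where "B e = \<beta> *\<^sub>R P p e + (t * (v \<bullet> e)) *\<^sub>R v" for e
      have Bn: "B e \<bullet> nu p = 0" for e using P_nu[OF p] v by (simp add: B_def inner_add_left)
      have \<beta>Q: "0 \<le> \<beta>" "\<beta> \<le> Q - 1"
      proof -
        show "0 \<le> \<beta>" using r by (simp add: \<beta>_def)
        have "c * r \<le> c * r1" using dx c_pos by (simp add: r_def)
        then show "\<beta> \<le> Q - 1" unfolding \<beta>_def Q_def using r1 by (auto intro!: frac_le)
      qed
      have BQ: "norm (B b) \<le> Q" if b: "b \<in> Basis" for b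
      proof -
        have "norm (B b) \<le> \<beta> * norm (P p b) + \<bar>t\<bar> * \<bar>v \<bullet> b\<bar> * norm v"
          unfolding B_def using norm_triangle_ineq[of "\<beta> *\<^sub>R P p b" "(t * (v \<bullet> b)) *\<^sub>R v"] \<beta>Q by (simp add: abs_mult)
        also have "\<dots> \<le> \<beta> * 1 + 1 * 1 * 1"
        proof (intro add_mono mult_mono)
          show "norm (P p b) \<le> 1" using norm_P_le[OF p, of b] b by simp
          show "\<bar>v \<bullet> b\<bar> \<le> 1" using Basis_le_norm[OF b, of v] v by simp
        qed (use \<beta>Q t v in auto)
        finally show ?thesis using \<beta>Q by simp
      qed
      have two: "u (x + z *\<^sub>R b) \<le> u x + z * (G \<bullet> b)
          + h\<^sup>2 * ((1 - c * r) * (- A p (B b) / 2 + (norm (P p b - B b))\<^sup>2 / (2 * r)) - c / 2 * (nu p \<bullet> b)\<^sup>2 + \<tau>2)"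
        if b: "b \<in> Basis" and z: "\<bar>z\<bar> = h" for b z
      proof -
        have y: "norm (z *\<^sub>R b) = h" using b z by simp
        have z2: "z\<^sup>2 = h\<^sup>2" using z by (metis power2_abs)
        have wn: "(z *\<^sub>R B b) \<bullet> nu p = 0" using Bn by simp
        have wQ: "norm (z *\<^sub>R B b) \<le> Q * norm (z *\<^sub>R b)"
          unfolding y using z h BQ[OF b] by (simp add: mult.commute mult_left_mono)
        have Pz: "P p (z *\<^sub>R b) - z *\<^sub>R B b = z *\<^sub>R (P p b - B b)"
          by (simp add: P_def algebra_simps)
        have "u (x + z *\<^sub>R b) \<le> u x - (1 - c * r) * (nu p \<bullet> (z *\<^sub>R b))
          + (1 - c * r) * (- A p (z *\<^sub>R B b) / 2 + (norm (z *\<^sub>R (P p b - B b)))\<^sup>2 / (2 * r)) - c / 2 * (nu p \<bullet> (z *\<^sub>R b))\<^sup>2 + \<tau>2 * h\<^sup>2"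
          using s2(2)[OF x(1) np dx _ wn wQ] h y unfolding r_def Pz by simp
        moreover have e: "(norm (z *\<^sub>R (P p b - B b)))\<^sup>2 = h\<^sup>2 * (norm (P p b - B b))\<^sup>2"
          "(nu p \<bullet> (z *\<^sub>R b))\<^sup>2 = h\<^sup>2 * (nu p \<bullet> b)\<^sup>2"
          using z2 by (simp_all add: power_mult_distrib)
        ultimately show ?thesis unfolding A_scaleR Gb e unfolding z2 by (simp add: algebra_simps)
      qed
      have "(\<Sum>b\<in>Basis. u (x + h *\<^sub>R b) + u (x - h *\<^sub>R b) - 2 * u x)
        \<le> (\<Sum>b\<in>(Basis::(real \<times> 'v) set). h\<^sup>2 * ((1 - c * r) * (- A p (B b) + (norm (P p b - B b))\<^sup>2 / r) - c * ((nu p \<bullet> b) * (nu p \<bullet> b)) + 2 * \<tau>2))"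
      proof (intro sum_mono)
        fix b :: "real \<times> 'v" assume b: "b \<in> Basis"
        have "u (x + h *\<^sub>R b) + u (x - h *\<^sub>R b) - 2 * u x
          \<le> 2 * (h\<^sup>2 * ((1 - c * r) * (- A p (B b) / 2 + (norm (P p b - B b))\<^sup>2 / (2 * r)) - c / 2 * (nu p \<bullet> b)\<^sup>2 + \<tau>2))"
          using two[OF b, of h] two[OF b, of "- h"] h by simp
        also have "\<dots> = h\<^sup>2 * ((1 - c * r) * (- A p (B b) + (norm (P p b - B b))\<^sup>2 / r) - c * ((nu p \<bullet> b) * (nu p \<bullet> b)) + 2 * \<tau>2)"
          using r by (simp add: field_simps power2_eq_square[of "nu p \<bullet> b"])
        finally show "u (x + h *\<^sub>R b) + u (x - h *\<^sub>R b) - 2 * u x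
          \<le> h\<^sup>2 * ((1 - c * r) * (- A p (B b) + (norm (P p b - B b))\<^sup>2 / r) - c * ((nu p \<bullet> b) * (nu p \<bullet> b)) + 2 * \<tau>2)" .
      qed
      also have "\<dots> = h\<^sup>2 * ((1 - c * r) * (- (\<Sum>b\<in>Basis. A p (B b)) + (\<Sum>b\<in>Basis. (norm (P p b - B b))\<^sup>2) / r)
          - c * (nu p \<bullet> nu p) + \<tau>)"
        unfolding euclidean_inner[of "nu p" "nu p"] t2(2)[symmetric]
        by (simp add: sum_distrib_left[symmetric] sum.distrib sum_subtractf sum_negf sum_divide_distrib[symmetric])
      also have "(\<Sum>b\<in>Basis. A p (B b)) = \<beta>\<^sup>2 * trA p + (2 * \<beta> * t + t\<^sup>2 * (v \<bullet> v)) * A p v"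
        unfolding B_def by (rule sum_A_rank_one_update[OF p v(1)])
      also have "(\<Sum>b\<in>Basis. (norm (P p b - B b))\<^sup>2)
          = (1 - \<beta>)\<^sup>2 * real DIM('v) + (2 * (1 - \<beta>) * (- t) + (- t)\<^sup>2 * (v \<bullet> v)) * (v \<bullet> v)"
      proof -
        have "P p b - B b = (1 - \<beta>) *\<^sub>R P p b + (- t * (v \<bullet> b)) *\<^sub>R v" for b
          by (simp add: B_def algebra_simps)
        then show ?thesis using sum_norm2_rank_one_update[OF p v(1), of "1 - \<beta>" "- t"] by simp
      qed
      finally have S: "(\<Sum>b\<in>Basis. u (x + h *\<^sub>R b) + u (x - h *\<^sub>R b) - 2 * u x) / h\<^sup>2
         \<le> (1 - c * r) * (- (\<beta>\<^sup>2 * trA p + (2 * \<beta> * t + t\<^sup>2 * (v \<bullet> v)) * A p v)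
         + ((1 - \<beta>)\<^sup>2 * real DIM('v) + (2 * (1 - \<beta>) * (- t) + (- t)\<^sup>2 * (v \<bullet> v)) * (v \<bullet> v)) / r) - c + \<tau>"
        using h nu_nu[OF p] by (simp add: divide_le_eq mult.commute)
      have pp: "fst p > 0" by (rule nearest_fst_pos[OF x np])
      define \<kappa> where "\<kappa> = fst (nu p) / fst p"
      have fx: "fst x = fst p * (1 - r * \<kappa>)"
      proof -
        have "fst x = fst p - r * fst (nu p)" using nearest_normal[OF x(1) np] by (simp add: r_def prod_eq_iff)
        also have "\<dots> = fst p * (1 - r * \<kappa>)" using pp by (simp add: \<kappa>_def field_simps)
        finally show ?thesis .
      qed
      have q: "1 - r * \<kappa> > 0" using fx x(2) pp by (simp add: zero_less_mult_iff)
      have "a / fst x * fst G = - ((1 - c * r) * (a * (\<kappa> / (1 - r * \<kappa>))))"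
      proof -
        have "fst (nu p) = fst p * \<kappa>" using pp by (simp add: \<kappa>_def)
        then show ?thesis unfolding fx G_def using pp q by (simp add: field_simps)
      qed
      with operator_bound_algebra[OF r q trA_eq[OF p pp, folded \<kappa>_def], of t "v \<bullet> v" "A p v", folded \<beta>_def] S
      have "(\<Sum>b\<in>Basis. u (x + h *\<^sub>R b) + u (x - h *\<^sub>R b) - 2 * u x) / h\<^sup>2 + a / fst x * fst G
          \<le> - ((N + 1) * c) - gain x p v t + \<tau>"
        unfolding gain_def xr \<beta>_def by linarith
      moreover have "u (x - h *\<^sub>R b) \<le> u x - h * (G \<bullet> b) + K0 * h\<^sup>2" if "b \<in> Basis" for b
        using one[OF that, of "- h"] h by simp
      ultimately show ?thesis using nG one h by (intro exI[of _ G]) simp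
    qed
    then show ?thesis using s1(1) s2(1) by (intro exI[of _ "min s1 s2"]) auto
  qed
  moreover have "K0 \<ge> 0" using r0 by (simp add: K0_def)
  ultimately show thesis using that by blast
qed

end

section \<open>Cutoff functions\<close>

lemma DERIV_pos_part_power:
  "((\<lambda>t::real. max 0 t ^ Suc (Suc n)) has_real_derivative (real (Suc (Suc n)) * max 0 t ^ Suc n)) (at t)"
proof (cases t "0::real" rule: linorder_cases)
  case less
  have "((\<lambda>t::real. 0) has_real_derivative 0) (at t)" by simp
  then have "((\<lambda>t::real. max 0 t ^ Suc (Suc n)) has_real_derivative 0) (at t)"
    by (rule has_field_derivative_transform_within_open[of _ _ _ "{..<0}"]) (use less in auto)
  then show ?thesis using less by simp
next
  case equal
  have "\<exists>g. (\<forall>z::real. max 0 z ^ Suc (Suc n) - max 0 0 ^ Suc (Suc n) = g z * (z - 0)) \<and> isCont g 0 \<and> g 0 = 0"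
  proof (intro exI[of _ "\<lambda>z. max 0 z ^ Suc n"] conjI allI)
    show "isCont (\<lambda>z::real. max 0 z ^ Suc n) 0" by (intro continuous_intros)
  qed (auto simp: max_def)
  then show ?thesis using equal by (simp add: CARAT_DERIV)
next
  case greater
  have "((\<lambda>t::real. t ^ Suc (Suc n)) has_real_derivative (real (Suc (Suc n)) * t ^ Suc n)) (at t)"
    by (rule derivative_eq_intros refl)+ simp
  then have "((\<lambda>t::real. max 0 t ^ Suc (Suc n)) has_real_derivative (real (Suc (Suc n)) * t ^ Suc n)) (at t)"
    by (rule has_field_derivative_transform_within_open[of _ _ _ "{0<..}"]) (use greater in auto)
  then show ?thesis using greater by simp
qed

lemma DERIV_pos_part_power_shift:
  assumes "n \<ge> 2"
  shows "((\<lambda>t::real. max 0 (t - z) ^ n) has_real_derivative (real n * max 0 (t - z) ^ (n - 1))) (at t)"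
proof -
  obtain m where m: "n = Suc (Suc m)" using assms by (metis add_2_eq_Suc le_Suc_ex)
  have "((\<lambda>t. t - z) has_real_derivative 1) (at t)" by (auto intro!: derivative_eq_intros)
  from DERIV_chain2[OF DERIV_pos_part_power[of m "t - z"] this] show ?thesis by (simp add: m)
qed

text \<open>The \<open>C\<^sup>2\<close> step that equals \<open>10 t\<^sup>3 - 15 t\<^sup>4 + 6 t\<^sup>5\<close> on the unit interval; the powers of the positive part
  of \<open>t - 1\<close> come from expanding this polynomial at \<open>1\<close>.\<close>

definition step :: "real \<Rightarrow> real" where
  "step t = 10 * max 0 (t - 0) ^ 3 - 15 * max 0 (t - 0) ^ 4 + 6 * max 0 (t - 0) ^ 5
     - (10 * max 0 (t - 1) ^ 3 + 15 * max 0 (t - 1) ^ 4 + 6 * max 0 (t - 1) ^ 5)"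

definition step' :: "real \<Rightarrow> real" where
  "step' t = 30 * max 0 (t - 0) ^ 2 - 60 * max 0 (t - 0) ^ 3 + 30 * max 0 (t - 0) ^ 4
     - (30 * max 0 (t - 1) ^ 2 + 60 * max 0 (t - 1) ^ 3 + 30 * max 0 (t - 1) ^ 4)"

definition step'' :: "real \<Rightarrow> real" where
  "step'' t = 60 * max 0 (t - 0) - 180 * max 0 (t - 0) ^ 2 + 120 * max 0 (t - 0) ^ 3
     - (60 * max 0 (t - 1) + 180 * max 0 (t - 1) ^ 2 + 120 * max 0 (t - 1) ^ 3)"

lemma DERIV_step: "(step has_real_derivative step' t) (at t)"
proof -
  have "(step has_real_derivative (10 * (real 3 * max 0 (t - 0) ^ (3 - 1)) - 15 * (real 4 * max 0 (t - 0) ^ (4 - 1)) + 6 * (real 5 * max 0 (t - 0) ^ (5 - 1))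
     - (10 * (real 3 * max 0 (t - 1) ^ (3 - 1)) + 15 * (real 4 * max 0 (t - 1) ^ (4 - 1)) + 6 * (real 5 * max 0 (t - 1) ^ (5 - 1))))) (at t)"
    unfolding step_def[abs_def] by (intro DERIV_diff DERIV_add DERIV_cmult DERIV_pos_part_power_shift) auto
  then show ?thesis unfolding step'_def by (simp add: eval_nat_numeral)
qed

lemma DERIV_step': "(step' has_real_derivative step'' t) (at t)"
proof -
  have "(step' has_real_derivative (30 * (real 2 * max 0 (t - 0) ^ (2 - 1)) - 60 * (real 3 * max 0 (t - 0) ^ (3 - 1)) + 30 * (real 4 * max 0 (t - 0) ^ (4 - 1))
     - (30 * (real 2 * max 0 (t - 1) ^ (2 - 1)) + 60 * (real 3 * max 0 (t - 1) ^ (3 - 1)) + 30 * (real 4 * max 0 (t - 1) ^ (4 - 1))))) (at t)"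
    unfolding step'_def[abs_def] by (intro DERIV_diff DERIV_add DERIV_cmult DERIV_pos_part_power_shift) auto
  then show ?thesis unfolding step''_def by (simp add: eval_nat_numeral)
qed

lemma continuous_step: "continuous_on UNIV step" "continuous_on UNIV step'" "continuous_on UNIV step''"
  unfolding step_def[abs_def] step'_def[abs_def] step''_def[abs_def] by (intro continuous_intros)+

lemma step_zero: "t \<le> 0 \<Longrightarrow> step t = 0" "t \<le> 0 \<Longrightarrow> step' t = 0" "t \<le> 0 \<Longrightarrow> step'' t = 0"
  by (auto simp: step_def step'_def step''_def max_def)

lemma step_one: "t \<ge> 1 \<Longrightarrow> step t = 1" "t \<ge> 1 \<Longrightarrow> step' t = 0"
  by (auto simp: step_def step'_def max_def power2_eq_square eval_nat_numeral algebra_simps)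

lemma step''_one: "t \<ge> 1 \<Longrightarrow> step'' t = 0"
  by (auto simp: step''_def max_def power2_eq_square eval_nat_numeral algebra_simps)

lemma step'_mid: "0 \<le> t \<Longrightarrow> t \<le> 1 \<Longrightarrow> step' t = 30 * (t * (1 - t))\<^sup>2"
  by (auto simp: step'_def max_def power2_eq_square eval_nat_numeral algebra_simps)

lemma step'_nonneg: "step' t \<ge> 0"
  using step_zero(2)[of t] step_one(2)[of t] step'_mid[of t] by (cases "t \<le> 0"; cases "t \<ge> 1") auto

lemma step'_le: "step' t \<le> 30"
proof -
  have "(t * (1 - t))\<^sup>2 \<le> 1" if "0 \<le> t" "t \<le> 1"
    using that by (simp add: abs_square_le_1 abs_mult mult_le_one)
  then show ?thesis
    using step_zero(2)[of t] step_one(2)[of t] step'_mid[of t] by (cases "t \<le> 0"; cases "t \<ge> 1") auto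
qed

lemma step_bounds: "0 \<le> step t" "step t \<le> 1"
proof -
  have mono: "step x \<le> step y" if "x \<le> y" for x y
    using that DERIV_step step'_nonneg by (intro DERIV_nonneg_imp_nondecreasing[of x y step]) blast+
  show "0 \<le> step t" using mono[of 0 t] step_zero(1)[of t] step_zero(1)[of 0] by (cases "t \<le> 0") auto
  show "step t \<le> 1" using mono[of t 1] step_one(1)[of t] step_one(1)[of 1] by (cases "t \<ge> 1") auto
qed

section \<open>Layers inside the domain, the truncated weight and the divergence theorem\<close>

lemma divergence_theorem_compact_support:
  fixes V :: "'a::euclidean_space \<Rightarrow> 'a"
  assumes K: "compact K" and V: "\<And>x. (V has_derivative V' x) (at x)"
    and c: "\<And>b. b \<in> Basis \<Longrightarrow> continuous_on UNIV (\<lambda>x. V' x b)" and z: "\<And>x. x \<notin> K \<Longrightarrow> V x = 0"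
  shows "(\<integral>x. (\<Sum>b\<in>Basis. V' x b \<bullet> b) \<partial>lborel) = 0"
proof -
  have dV: "((\<lambda>x. V x \<bullet> b) has_derivative (\<lambda>v. V' x v \<bullet> b)) (at x)" for x b
    by (auto intro!: derivative_eq_intros V)
  have cV: "continuous_on UNIV (\<lambda>x. V' x b \<bullet> b)" if "b \<in> Basis" for b
    by (intro continuous_intros c that)
  have z': "V' x b \<bullet> b = 0" if "x \<notin> K" for x b
    using derivative_zero_off_support[OF K dV, of b x] z that by (metis inner_zero_left)
  have "(\<integral>x. (\<Sum>b\<in>Basis. V' x b \<bullet> b) \<partial>lborel) = (\<Sum>b\<in>Basis. (\<integral>x. V' x b \<bullet> b \<partial>lborel))"
    using integrable_continuous_compact_support[OF K cV z'] by (intro Bochner_Integration.integral_sum) blast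
  also have "\<dots> = 0"
    using integral_derivative_zero[OF K dV cV] z by (intro sum.neutral ballI) auto
  finally show ?thesis .
qed

lemma continuous_on_UNIV_cover:
  fixes f :: "'a::topological_space \<Rightarrow> 'b::topological_space"
  assumes "open A" "open B" "A \<union> B = UNIV" "continuous_on A f" "continuous_on B f"
  shows "continuous_on UNIV f"
  using continuous_on_open_Un[OF assms(1,2,4,5)] assms(3) by simp

context weighted_cmc_domain
begin

text \<open>On the compact set closure D - U the function f has a negative maximum, so values of f
  near 0 force a point of \<open>D\<close> into U. This carries open conditions from the frontier to
  thin layers.\<close>

lemma layer_near_frontier:
  assumes "open U" "frontier D \<subseteq> U"
  obtains \<epsilon> where "\<epsilon> > 0" "\<And>x. x \<in> D \<Longrightarrow> f x \<ge> - \<epsilon> \<Longrightarrow> x \<in> U"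
proof (cases "closure D - U = {}")
  case True
  then show ?thesis using that[of 1] closure_subset by fastforce
next
  case False
  have c: "compact (closure D - U)" using bounded_D assms(1) by (simp add: compact_closure compact_diff)
  from continuous_attains_sup[OF c False continuous_f]
  obtain z where z: "z \<in> closure D - U" "\<And>y. y \<in> closure D - U \<Longrightarrow> f y \<le> f z" by blast
  have "z \<in> D" using z(1) assms(2) open_D by (auto simp: frontier_def interior_open)
  then have "f z < 0" by (rule f_neg)
  moreover have "x \<in> U" if "x \<in> D" "f x \<ge> f z / 2" for x
    using z(2)[of x] that closure_subset[of D] \<open>f z < 0\<close> by (smt (verit) DiffI field_sum_of_halves in_mono)
  ultimately show ?thesis using that[of "- f z / 2"] by auto
qed

lemma gradient_bounded_below_near_frontier:
  obtains m \<epsilon> where "m > 0" "\<epsilon> > 0" "\<And>x. x \<in> D \<Longrightarrow> f x \<ge> - \<epsilon> \<Longrightarrow> norm (g x) > m"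
proof -
  obtain m0 where m0: "m0 > 0" "\<And>p. p \<in> frontier D \<Longrightarrow> norm (g p) \<ge> m0" by (rule g_lower_bound) blast
  have "open {x. norm (g x) > m0 / 2}" by (intro open_Collect_less continuous_intros continuous_g)
  moreover have "frontier D \<subseteq> {x. norm (g x) > m0 / 2}" using m0 by force
  ultimately show thesis using layer_near_frontier[of "{x. norm (g x) > m0 / 2}"] that[of "m0 / 2"] m0(1)
    by (metis half_gt_zero mem_Collect_eq)
qed

definition sublevel :: "real \<Rightarrow> (real \<times> 'v) set" where "sublevel \<epsilon> = {x \<in> closure D. f x \<le> - \<epsilon>}"

lemma compact_sublevel: "compact (sublevel \<epsilon>)"
proof -
  have "sublevel \<epsilon> = closure D \<inter> {x. f x \<le> - \<epsilon>}" by (auto simp: sublevel_def)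
  moreover have "closed {x. f x \<le> - \<epsilon>}" by (intro closed_Collect_le continuous_intros continuous_f)
  ultimately show ?thesis using bounded_D by (simp add: compact_Int_closed compact_closure)
qed

lemma sublevel_subset_D: "\<epsilon> > 0 \<Longrightarrow> sublevel \<epsilon> \<subseteq> D"
  using f_zero open_D by (force simp: sublevel_def frontier_def interior_open)

text \<open>The argument is 0 on f = -\<epsilon> and 1 on f = -2 \<epsilon>. The shift by 1 keeps
  the support in f \<le> -\<epsilon>, at a distance from the frontier, so that the extension by 0
  loses no smoothness; it serves \<open>step\<close> and its two derivatives alike.\<close>

definition cut :: "(real \<Rightarrow> real) \<Rightarrow> real \<Rightarrow> real \<times> 'v \<Rightarrow> real" where
  "cut \<phi> \<epsilon> x = (if x \<in> D then \<phi> (- f x / \<epsilon> - 1) else 0)"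

lemma cut_zero:
  assumes "\<epsilon> > 0" "\<And>t. t \<le> 0 \<Longrightarrow> \<phi> t = 0" "x \<notin> sublevel \<epsilon>"
  shows "cut \<phi> \<epsilon> x = 0"
proof (cases "x \<in> D")
  case True
  then have "f x > - \<epsilon>" using assms(3) closure_subset[of D] by (auto simp: sublevel_def)
  then have "- f x / \<epsilon> - 1 \<le> 0" using assms(1) by (simp add: field_simps)
  then show ?thesis using assms(2) by (simp add: cut_def)
qed (simp add: cut_def)

lemma cut_deriv:
  assumes e: "\<epsilon> > 0" and \<phi>: "\<And>t. (\<phi> has_real_derivative \<phi>' t) (at t)" and z: "\<And>t. t \<le> 0 \<Longrightarrow> \<phi> t = 0"
  shows "(cut \<phi> \<epsilon> has_derivative (\<lambda>v. - (cut \<phi>' \<epsilon> x / \<epsilon>) * (g x \<bullet> v))) (at x)"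
proof (cases "x \<in> D")
  case True
  have "((\<lambda>x. - f x / \<epsilon> - 1) has_derivative (\<lambda>v. - (g x \<bullet> v) / \<epsilon>)) (at x)"
    using e by (auto intro!: derivative_eq_intros deriv_f)
  from has_derivative_compose[OF this \<phi>[unfolded has_field_derivative_def]]
  have "((\<lambda>x. \<phi> (- f x / \<epsilon> - 1)) has_derivative (\<lambda>v. - (cut \<phi>' \<epsilon> x / \<epsilon>) * (g x \<bullet> v))) (at x)"
    using True by (simp add: cut_def mult.commute)
  then show ?thesis
    by (rule has_derivative_transform_within_open[OF _ open_D True]) (simp add: cut_def)
next
  case False
  have "x \<notin> sublevel \<epsilon>" using sublevel_subset_D[OF e] False by blast
  moreover have "open (- sublevel \<epsilon>)" using compact_sublevel by (simp add: compact_imp_closed open_Compl)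
  ultimately have "(cut \<phi> \<epsilon> has_derivative (\<lambda>v. 0)) (at x)"
    by (intro has_derivative_transform_within_open[OF has_derivative_const[of 0]])
      (auto simp: cut_zero[OF e z])
  then show ?thesis using False by (simp add: cut_def)
qed

lemma continuous_cut:
  assumes e: "\<epsilon> > 0" and \<phi>: "continuous_on UNIV \<phi>" and z: "\<And>t. t \<le> 0 \<Longrightarrow> \<phi> t = 0"
  shows "continuous_on UNIV (cut \<phi> \<epsilon>)"
proof (rule continuous_on_UNIV_cover[OF open_D, of "- sublevel \<epsilon>"])
  show "open (- sublevel \<epsilon>)" using compact_sublevel by (simp add: compact_imp_closed open_Compl)
  show "D \<union> - sublevel \<epsilon> = UNIV" using sublevel_subset_D[OF e] by blast
  have "continuous_on D (\<lambda>x. \<phi> (- f x / \<epsilon> - 1))"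
    by (rule continuous_on_compose2[OF \<phi>]) (auto intro!: continuous_intros continuous_f simp: e less_imp_neq[OF e, symmetric])
  then show "continuous_on D (cut \<phi> \<epsilon>)" by (rule continuous_on_eq) (simp add: cut_def)
  have "continuous_on (- sublevel \<epsilon>) (\<lambda>_. 0::real)" by simp
  then show "continuous_on (- sublevel \<epsilon>) (cut \<phi> \<epsilon>)" by (rule continuous_on_eq) (auto simp: cut_zero[OF e z])
qed

definition wt :: "real \<Rightarrow> real \<Rightarrow> real" where
  "wt \<delta> \<xi> = (if \<xi> > 0 then \<xi> powr a * step (\<xi> / \<delta> - 1) else 0)"

definition wt_err :: "real \<Rightarrow> real \<Rightarrow> real" where
  "wt_err \<delta> \<xi> = (if \<xi> > 0 then \<xi> powr a * step' (\<xi> / \<delta> - 1) / \<delta> else 0)"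

lemma wt_zero: "\<delta> > 0 \<Longrightarrow> \<xi> \<le> \<delta> \<Longrightarrow> wt \<delta> \<xi> = 0" "\<delta> > 0 \<Longrightarrow> \<xi> \<le> \<delta> \<Longrightarrow> wt_err \<delta> \<xi> = 0"
  by (auto simp: wt_def wt_err_def step_zero field_simps)

lemma wt_nonneg: "wt \<delta> \<xi> \<ge> 0" "\<delta> > 0 \<Longrightarrow> wt_err \<delta> \<xi> \<ge> 0"
  by (auto simp: wt_def wt_err_def step_bounds step'_nonneg)

lemma wt_deriv:
  assumes d: "\<delta> > 0"
  shows "(wt \<delta> has_real_derivative (a / \<xi> * wt \<delta> \<xi> + wt_err \<delta> \<xi>)) (at \<xi>)"
proof (cases "\<xi> > 0")
  case True
  have "((\<lambda>\<xi>. \<xi> powr a) has_real_derivative (a * \<xi> powr (a - 1))) (at \<xi>)"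
    using True by (rule has_real_derivative_powr)
  moreover have "((\<lambda>\<xi>. step (\<xi> / \<delta> - 1)) has_real_derivative (step' (\<xi> / \<delta> - 1) * (1 / \<delta>))) (at \<xi>)"
    by (rule DERIV_chain2[OF DERIV_step]) (use d in \<open>auto intro!: derivative_eq_intros\<close>)
  ultimately have "((\<lambda>\<xi>. \<xi> powr a * step (\<xi> / \<delta> - 1)) has_real_derivative
      (a * \<xi> powr (a - 1)) * step (\<xi> / \<delta> - 1) + (step' (\<xi> / \<delta> - 1) * (1 / \<delta>)) * \<xi> powr a) (at \<xi>)"
    by (rule DERIV_mult)
  then have "(wt \<delta> has_real_derivative
      (a * \<xi> powr (a - 1)) * step (\<xi> / \<delta> - 1) + (step' (\<xi> / \<delta> - 1) * (1 / \<delta>)) * \<xi> powr a) (at \<xi>)"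
    by (rule has_field_derivative_transform_within_open[of _ _ _ "{0<..}"]) (use True in \<open>auto simp: wt_def\<close>)
  moreover have "(a * \<xi> powr (a - 1)) * step (\<xi> / \<delta> - 1) + (step' (\<xi> / \<delta> - 1) * (1 / \<delta>)) * \<xi> powr a
     = a / \<xi> * wt \<delta> \<xi> + wt_err \<delta> \<xi>"
    using True by (simp add: wt_def wt_err_def powr_diff field_simps)
  ultimately show ?thesis by simp
next
  case False
  have "((\<lambda>_. 0) has_real_derivative 0) (at \<xi>)" by simp
  then have "(wt \<delta> has_real_derivative 0) (at \<xi>)"
    by (rule has_field_derivative_transform_within_open[of _ _ _ "{..<\<delta>}"]) (use False d in \<open>auto simp: wt_zero\<close>)
  then show ?thesis using False by (simp add: wt_def wt_err_def)
qed

lemma continuous_wt: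
  assumes d: "\<delta> > 0"
  shows "continuous_on UNIV (wt \<delta>)" "continuous_on UNIV (wt_err \<delta>)" "continuous_on UNIV (\<lambda>\<xi>. a / \<xi> * wt \<delta> \<xi>)"
proof -
  have cv: "continuous_on UNIV h" if "\<And>\<xi>. \<xi> < \<delta> \<Longrightarrow> h \<xi> = 0" "continuous_on {0<..} h" for h :: "real \<Rightarrow> real"
  proof (rule continuous_on_UNIV_cover[of "{..<\<delta>}" "{0<..}"])
    have "continuous_on {..<\<delta>} (\<lambda>_. 0::real)" by simp
    then show "continuous_on {..<\<delta>} h" by (rule continuous_on_eq) (use that(1) in auto)
    show "{..<\<delta>} \<union> {0<..} = UNIV" using d by auto
  qed (use that in auto)
  have cs: "continuous_on {0<..} (\<lambda>\<xi>. step (\<xi> / \<delta> - 1))" "continuous_on {0<..} (\<lambda>\<xi>. step' (\<xi> / \<delta> - 1))"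
    using d by (auto intro!: continuous_on_compose2[OF continuous_step(1)] continuous_on_compose2[OF continuous_step(2)] continuous_intros)
  have p: "continuous_on {0<..} (\<lambda>\<xi>. \<xi> powr a)" by (intro continuous_intros) auto
  have c1: "continuous_on {0<..} (wt \<delta>)"
    by (rule continuous_on_eq[OF continuous_on_mult[OF p cs(1)]]) (simp add: wt_def)
  show "continuous_on UNIV (wt \<delta>)" by (rule cv[OF _ c1]) (simp add: wt_zero d)
  have "continuous_on {0<..} (\<lambda>\<xi>. \<xi> powr a * step' (\<xi> / \<delta> - 1) / \<delta>)"
    using d by (intro continuous_on_divide continuous_on_mult p cs) auto
  then have c2: "continuous_on {0<..} (wt_err \<delta>)" by (rule continuous_on_eq) (simp add: wt_err_def)
  show "continuous_on UNIV (wt_err \<delta>)" by (rule cv[OF _ c2]) (simp add: wt_zero d)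
  show "continuous_on UNIV (\<lambda>\<xi>. a / \<xi> * wt \<delta> \<xi>)"
    by (rule cv) (auto intro!: continuous_intros c1 simp: wt_zero d)
qed

text \<open>\<open>wt_err\<close> lives between \<delta> and 2 \<delta> and has size \<delta> powr
  (a - 1) there. Hence its product with \<xi>, and its integral over a bounded set, are of order
  \<delta> powr a, which tends to 0 since a > 0.\<close>

lemma wt_err_le:
  assumes d: "\<delta> > 0"
  shows "wt_err \<delta> \<xi> \<le> (2 * \<delta>) powr a * 30 / \<delta>" "\<xi> \<ge> 2 * \<delta> \<Longrightarrow> wt_err \<delta> \<xi> = 0"
    "wt_err \<delta> \<xi> * \<bar>\<xi>\<bar> \<le> 60 * (2 * \<delta>) powr a"
proof -
  show z: "wt_err \<delta> \<xi> = 0" if "\<xi> \<ge> 2 * \<delta>" for \<xi>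
    using that d step_one(2)[of "\<xi> / \<delta> - 1"] by (simp add: wt_err_def field_simps)
  show l: "wt_err \<delta> \<xi> \<le> (2 * \<delta>) powr a * 30 / \<delta>" for \<xi>
  proof (cases "\<xi> > 0 \<and> \<xi> < 2 * \<delta>")
    case True
    have "\<xi> powr a * step' (\<xi> / \<delta> - 1) \<le> (2 * \<delta>) powr a * 30"
      using True a_pos step'_le step'_nonneg by (intro mult_mono powr_mono2) auto
    then show ?thesis using True d by (simp add: wt_err_def divide_right_mono)
  next
    case False
    then have "wt_err \<delta> \<xi> = 0" using z[of \<xi>] by (auto simp: wt_err_def)
    then show ?thesis using d by simp
  qed
  show "wt_err \<delta> \<xi> * \<bar>\<xi>\<bar> \<le> 60 * (2 * \<delta>) powr a"
  proof (cases "\<xi> > 0 \<and> \<xi> < 2 * \<delta>")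
    case True
    then have "wt_err \<delta> \<xi> * \<bar>\<xi>\<bar> \<le> ((2 * \<delta>) powr a * 30 / \<delta>) * (2 * \<delta>)"
      using l wt_nonneg(2)[OF d] d by (intro mult_mono) auto
    then show ?thesis using d by simp
  next
    case False
    then have "wt_err \<delta> \<xi> = 0" using z[of \<xi>] by (auto simp: wt_err_def)
    then show ?thesis by simp
  qed
qed

definition trH :: "real \<times> 'v \<Rightarrow> real" where "trH x = (\<Sum>b\<in>Basis. H x b \<bullet> b)"

lemma continuous_H: "continuous_on S (\<lambda>x. H x v)"
  using C2_gradD(4)[OF C2] continuous_on_subset by blast

lemma continuous_H_g: "continuous_on S (\<lambda>x. H x (g x))"
  by (rule continuous_on_hessian_apply[OF C2]) (auto intro: continuous_g)

lemma continuous_trH: "continuous_on S trH"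
  unfolding trH_def[abs_def] by (intro continuous_intros continuous_H)

lemma continuous_fst_wt:
  assumes "\<delta> > 0"
  shows "continuous_on S (\<lambda>x::real \<times> 'v. wt \<delta> (fst x))" "continuous_on S (\<lambda>x::real \<times> 'v. wt_err \<delta> (fst x))"
    "continuous_on S (\<lambda>x::real \<times> 'v. a / fst x * wt \<delta> (fst x))"
proof -
  have cf: "continuous_on S (fst :: real \<times> 'v \<Rightarrow> real)" by (rule continuous_on_fst[OF continuous_on_id])
  show "continuous_on S (\<lambda>x::real \<times> 'v. wt \<delta> (fst x))" "continuous_on S (\<lambda>x::real \<times> 'v. wt_err \<delta> (fst x))"
    "continuous_on S (\<lambda>x::real \<times> 'v. a / fst x * wt \<delta> (fst x))"
    using continuous_on_compose2[OF continuous_wt(1)[OF assms] cf]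
      continuous_on_compose2[OF continuous_wt(2)[OF assms] cf]
      continuous_on_compose2[OF continuous_wt(3)[OF assms] cf] by simp_all
qed

lemma wt_fst_deriv:
  assumes "\<delta> > 0"
  shows "((\<lambda>x::real \<times> 'v. wt \<delta> (fst x)) has_derivative (\<lambda>v. (a / fst x * wt \<delta> (fst x) + wt_err \<delta> (fst x)) * fst v)) (at x)"
  using has_derivative_compose[OF has_derivative_fst[OF has_derivative_ident] wt_deriv[OF assms, unfolded has_field_derivative_def]]
  by simp

text \<open>Minus \<open>psi \<epsilon>\<close> times g is the gradient of the cutoff. As \<epsilon>
  tends to 0, integration against psi times the norm of g tends to integration over the
  frontier.\<close>

definition psi :: "real \<Rightarrow> real \<times> 'v \<Rightarrow> real" where "psi \<epsilon> x = cut step' \<epsilon> x / \<epsilon>"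

lemma psi_nonneg: "\<epsilon> > 0 \<Longrightarrow> psi \<epsilon> x \<ge> 0"
  by (simp add: psi_def cut_def step'_nonneg)

lemma psi_zero: "\<epsilon> > 0 \<Longrightarrow> x \<notin> sublevel \<epsilon> \<Longrightarrow> psi \<epsilon> x = 0"
  by (simp add: psi_def cut_zero step_zero)

lemma continuous_psi: "\<epsilon> > 0 \<Longrightarrow> continuous_on UNIV (psi \<epsilon>)"
  unfolding psi_def[abs_def] by (intro continuous_intros continuous_cut continuous_step step_zero) auto

lemma psi_deriv:
  assumes "\<epsilon> > 0"
  shows "(psi \<epsilon> has_derivative (\<lambda>v. - (cut step'' \<epsilon> x / \<epsilon>\<^sup>2) * (g x \<bullet> v))) (at x)"
proof -
  from has_derivative_mult_right[OF cut_deriv[OF assms DERIV_step' step_zero(2)], of "1 / \<epsilon>" x]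
  show ?thesis by (simp add: psi_def[abs_def] power2_eq_square)
qed

lemma cut_step_deriv:
  assumes "\<epsilon> > 0"
  shows "(cut step \<epsilon> has_derivative (\<lambda>v. - psi \<epsilon> x * (g x \<bullet> v))) (at x)"
  unfolding psi_def by (rule cut_deriv[OF assms DERIV_step step_zero(1)])

lemma continuous_cut_step: "\<epsilon> > 0 \<Longrightarrow> continuous_on UNIV (cut step \<epsilon>)"
  by (intro continuous_cut continuous_step step_zero) auto

lemma cut_step_zero: "\<epsilon> > 0 \<Longrightarrow> x \<notin> sublevel \<epsilon> \<Longrightarrow> cut step \<epsilon> x = 0"
  by (simp add: cut_zero step_zero)

lemma cut_step_bounds: "0 \<le> cut step \<epsilon> x" "cut step \<epsilon> x \<le> 1"
  by (auto simp: cut_def step_bounds)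

text \<open>The divergence theorem for the cutoff times g. Its use is that the right side is bounded
  independently of \<epsilon>, so that errors on the layer can be measured by the left side.\<close>

lemma integral_psi_norm_g:
  assumes e: "\<epsilon> > 0"
  shows "(\<integral>x. psi \<epsilon> x * (norm (g x))\<^sup>2 \<partial>lborel) = (\<integral>x. cut step \<epsilon> x * trH x \<partial>lborel)"
proof -
  have "(\<integral>x. (\<Sum>b\<in>Basis. (cut step \<epsilon> x *\<^sub>R H x b + (- psi \<epsilon> x * (g x \<bullet> b)) *\<^sub>R g x) \<bullet> b) \<partial>lborel) = 0"
  proof (rule divergence_theorem_compact_support[OF compact_sublevel[of \<epsilon>], of "\<lambda>x. cut step \<epsilon> x *\<^sub>R g x"])
    show "((\<lambda>x. cut step \<epsilon> x *\<^sub>R g x) has_derivative (\<lambda>v. cut step \<epsilon> x *\<^sub>R H x v + (- psi \<epsilon> x * (g x \<bullet> v)) *\<^sub>R g x)) (at x)" for x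
      by (intro has_derivative_scaleR cut_step_deriv e deriv_g)
    show "continuous_on UNIV (\<lambda>x. cut step \<epsilon> x *\<^sub>R H x b + (- psi \<epsilon> x * (g x \<bullet> b)) *\<^sub>R g x)" for b
      using e by (intro continuous_intros continuous_cut_step continuous_H continuous_psi continuous_g)
  qed (simp add: cut_step_zero e)
  also have "(\<lambda>x. \<Sum>b\<in>Basis. (cut step \<epsilon> x *\<^sub>R H x b + (- psi \<epsilon> x * (g x \<bullet> b)) *\<^sub>R g x) \<bullet> b)
    = (\<lambda>x. cut step \<epsilon> x * trH x - psi \<epsilon> x * (norm (g x))\<^sup>2)"
  proof
    fix x
    have "(\<Sum>b\<in>Basis. (cut step \<epsilon> x *\<^sub>R H x b + (- psi \<epsilon> x * (g x \<bullet> b)) *\<^sub>R g x) \<bullet> b)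
      = (\<Sum>b\<in>Basis. cut step \<epsilon> x * (H x b \<bullet> b) - psi \<epsilon> x * ((g x \<bullet> b) * (g x \<bullet> b)))"
      by (intro sum.cong refl) (simp add: inner_diff_left)
    also have "\<dots> = cut step \<epsilon> x * trH x - psi \<epsilon> x * (norm (g x))\<^sup>2"
      unfolding sum_subtractf sum_distrib_left[symmetric] euclidean_inner[of "g x" "g x", symmetric] trH_def power2_norm_eq_inner ..
    finally show "(\<Sum>b\<in>Basis. (cut step \<epsilon> x *\<^sub>R H x b + (- psi \<epsilon> x * (g x \<bullet> b)) *\<^sub>R g x) \<bullet> b)
      = cut step \<epsilon> x * trH x - psi \<epsilon> x * (norm (g x))\<^sup>2" .
  qed
  also have "(\<integral>x. cut step \<epsilon> x * trH x - psi \<epsilon> x * (norm (g x))\<^sup>2 \<partial>lborel)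
    = (\<integral>x. cut step \<epsilon> x * trH x \<partial>lborel) - (\<integral>x. psi \<epsilon> x * (norm (g x))\<^sup>2 \<partial>lborel)"
    using e by (intro Bochner_Integration.integral_diff integrable_continuous_compact_support[OF compact_sublevel[of \<epsilon>]]
        continuous_intros continuous_cut_step continuous_trH continuous_psi continuous_g) (auto simp: cut_step_zero psi_zero)
  finally show ?thesis by simp
qed

text \<open>The divergence theorem for the weighted position field: the weight
  \<open>\<xi> powr a\<close> is homogeneous of degree a in dimension k + 1, whence the factor k + 1
  + a = N + 1.\<close>

lemma integral_psi_position:
  assumes e: "\<epsilon> > 0" and dl: "\<delta> > 0"
  shows "(\<integral>x. wt \<delta> (fst x) * psi \<epsilon> x * (x \<bullet> g x) \<partial>lborel)
    = (N + 1) * (\<integral>x. cut step \<epsilon> x * wt \<delta> (fst x) \<partial>lborel) + (\<integral>x. cut step \<epsilon> x * (wt_err \<delta> (fst x) * fst x) \<partial>lborel)"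
proof -
  define s where "s = cut step \<epsilon>"
  define w where "w x = wt \<delta> (fst x)" for x :: "real \<times> 'v"
  define w' where "w' x = a / fst x * wt \<delta> (fst x) + wt_err \<delta> (fst x)" for x :: "real \<times> 'v"
  have cw: "continuous_on UNIV w" "continuous_on UNIV w'"
    unfolding w_def[abs_def] w'_def[abs_def] by (intro continuous_on_add continuous_fst_wt dl)+
  have cs: "continuous_on UNIV s" unfolding s_def by (rule continuous_cut_step[OF e])
  have cp: "continuous_on UNIV (psi \<epsilon>)" by (rule continuous_psi[OF e])
  have z: "s x = 0" "psi \<epsilon> x = 0" if "x \<notin> sublevel \<epsilon>" for x
    using that e by (auto simp: s_def cut_step_zero psi_zero)
  have "(\<integral>x. (\<Sum>b\<in>Basis. ((s x * w x) *\<^sub>R b + (s x * (w' x * fst b) + (- psi \<epsilon> x * (g x \<bullet> b)) * w x) *\<^sub>R x) \<bullet> b) \<partial>lborel) = 0"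
  proof (rule divergence_theorem_compact_support[OF compact_sublevel[of \<epsilon>], of "\<lambda>x. (s x * w x) *\<^sub>R x"])
    show "((\<lambda>x. (s x * w x) *\<^sub>R x) has_derivative
       (\<lambda>v. (s x * w x) *\<^sub>R v + (s x * (w' x * fst v) + (- psi \<epsilon> x * (g x \<bullet> v)) * w x) *\<^sub>R x)) (at x)" for x
      unfolding s_def w_def w'_def
      by (intro has_derivative_scaleR has_derivative_mult cut_step_deriv e wt_fst_deriv dl has_derivative_ident)
    show "continuous_on UNIV (\<lambda>x. (s x * w x) *\<^sub>R b + (s x * (w' x * fst b) + (- psi \<epsilon> x * (g x \<bullet> b)) * w x) *\<^sub>R x)" for b
      by (intro continuous_intros cw cs cp continuous_g)
  qed (simp add: z)
  also have "(\<lambda>x. \<Sum>b\<in>Basis. ((s x * w x) *\<^sub>R b + (s x * (w' x * fst b) + (- psi \<epsilon> x * (g x \<bullet> b)) * w x) *\<^sub>R x) \<bullet> b)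
    = (\<lambda>x. (N + 1) * (s x * w x) + s x * (wt_err \<delta> (fst x) * fst x) - w x * psi \<epsilon> x * (x \<bullet> g x))"
  proof
    fix x :: "real \<times> 'v"
    have f1: "(\<Sum>b\<in>(Basis::(real \<times> 'v) set). fst b * (x \<bullet> b)) = fst x"
    proof -
      have "fst b = (1, 0) \<bullet> b" for b :: "real \<times> 'v" by (simp add: inner_prod_def)
      then have "(\<Sum>b\<in>(Basis::(real \<times> 'v) set). fst b * (x \<bullet> b)) = (\<Sum>b\<in>(Basis::(real \<times> 'v) set). ((1, 0) \<bullet> b) * (x \<bullet> b))" by simp
      also have "\<dots> = (1, 0) \<bullet> x" by (rule euclidean_inner[symmetric])
      finally show ?thesis by (simp add: inner_prod_def)
    qed
    have "(\<Sum>b\<in>Basis. ((s x * w x) *\<^sub>R b + (s x * (w' x * fst b) + (- psi \<epsilon> x * (g x \<bullet> b)) * w x) *\<^sub>R x) \<bullet> b)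
      = (\<Sum>b\<in>(Basis::(real \<times> 'v) set). (s x * w x) * (b \<bullet> b) + s x * w' x * (fst b * (x \<bullet> b)) - psi \<epsilon> x * w x * ((g x \<bullet> b) * (x \<bullet> b)))"
      by (intro sum.cong refl) (simp add: inner_add_left algebra_simps)
    also have "\<dots> = (s x * w x) * real DIM(real \<times> 'v) + s x * w' x * fst x - psi \<epsilon> x * w x * (g x \<bullet> x)"
      unfolding sum.distrib sum_subtractf sum_distrib_left[symmetric] f1 euclidean_inner[of "g x" x, symmetric] by simp
    also have "s x * w' x * fst x = s x * (a * w x) + s x * (wt_err \<delta> (fst x) * fst x)"
      by (cases "fst x = 0") (auto simp: w'_def w_def field_simps wt_def)
    finally show "(\<Sum>b\<in>Basis. ((s x * w x) *\<^sub>R b + (s x * (w' x * fst b) + (- psi \<epsilon> x * (g x \<bullet> b)) * w x) *\<^sub>R x) \<bullet> b)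
      = (N + 1) * (s x * w x) + s x * (wt_err \<delta> (fst x) * fst x) - w x * psi \<epsilon> x * (x \<bullet> g x)"
      by (simp add: N_def inner_commute algebra_simps)
  qed
  also have "(\<integral>x. (N + 1) * (s x * w x) + s x * (wt_err \<delta> (fst x) * fst x) - w x * psi \<epsilon> x * (x \<bullet> g x) \<partial>lborel)
    = (\<integral>x. (N + 1) * (s x * w x) \<partial>lborel) + (\<integral>x. s x * (wt_err \<delta> (fst x) * fst x) \<partial>lborel) - (\<integral>x. w x * psi \<epsilon> x * (x \<bullet> g x) \<partial>lborel)"
  proof -
    have "integrable lborel (\<lambda>x. (N + 1) * (s x * w x))"
      by (rule integrable_continuous_compact_support[OF compact_sublevel[of \<epsilon>]]) (auto intro!: continuous_intros cw cs simp: z)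
    moreover have "integrable lborel (\<lambda>x. s x * (wt_err \<delta> (fst x) * fst x))"
      by (rule integrable_continuous_compact_support[OF compact_sublevel[of \<epsilon>]])
        (auto intro!: continuous_intros cs continuous_fst_wt dl simp: z)
    moreover have "integrable lborel (\<lambda>x. w x * psi \<epsilon> x * (x \<bullet> g x))"
      by (rule integrable_continuous_compact_support[OF compact_sublevel[of \<epsilon>]])
        (auto intro!: continuous_intros cw cp continuous_g simp: z)
    ultimately show ?thesis
      by (simp only: Bochner_Integration.integral_diff Bochner_Integration.integral_add Bochner_Integration.integrable_add)
  qed
  finally show ?thesis unfolding s_def w_def by simp
qed

text \<open>The weighted mean curvature of the level set of f through x; it is defined off the
  frontier as well, because the Minkowski formula is integrated over layers.\<close>

definition hcurv :: "real \<times> 'v \<Rightarrow> real" where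
  "hcurv x = (trH x - H x (g x) \<bullet> g x / (norm (g x))\<^sup>2) / norm (g x) + a / fst x * (fst (g x) / norm (g x))"

text \<open>The divergence of wt psi V, where V = |g| x - (x . g) g / |g| is |g| times the part of
  the position vector tangential to the level sets of f. The second summand is the error of
  truncation.\<close>

definition minkowski_integrand :: "real \<Rightarrow> real \<Rightarrow> real \<times> 'v \<Rightarrow> real" where
  "minkowski_integrand \<delta> \<epsilon> x = wt \<delta> (fst x) * psi \<epsilon> x * (N * norm (g x) - (x \<bullet> g x) * hcurv x)
     + wt_err \<delta> (fst x) * psi \<epsilon> x * (norm (g x) * fst x - (x \<bullet> g x) / norm (g x) * fst (g x))"

lemma continuous_hcurv: "continuous_on {x. g x \<noteq> 0 \<and> fst x > 0} hcurv"
  unfolding hcurv_def[abs_def]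
  by (intro continuous_intros continuous_trH continuous_H_g continuous_g) auto

text \<open>Since V is tangential to the level sets, differentiating the cutoff contributes nothing,
  and what is left is N |g| minus (x . g) times the weighted mean curvature. V contains only first
  derivatives of f, so C^2 is enough for the divergence theorem. The singularity of V at zeros of g
  is avoided because psi vanishes where |g| \<le> m.\<close>

lemma minkowski_identity:
  assumes e: "\<epsilon> > 0" and dl: "\<delta> > 0" and m: "m > 0"
    and layer: "\<And>x. x \<in> D \<Longrightarrow> f x \<ge> - (2 * \<epsilon>) \<Longrightarrow> norm (g x) > m"
  shows "(\<integral>x. minkowski_integrand \<delta> \<epsilon> x \<partial>lborel) = 0"
    "continuous_on UNIV (minkowski_integrand \<delta> \<epsilon>)"
proof -
  define w where "w x = wt \<delta> (fst x)" for x :: "real \<times> 'v"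
  define w' where "w' x = a / fst x * wt \<delta> (fst x) + wt_err \<delta> (fst x)" for x :: "real \<times> 'v"
  define p2 where "p2 x = cut step'' \<epsilon> x / \<epsilon>\<^sup>2" for x
  have cw: "continuous_on S w" "continuous_on S w'" for S
    unfolding w_def[abs_def] w'_def[abs_def] by (intro continuous_on_add continuous_fst_wt dl)+
  have cp: "continuous_on S (psi \<epsilon>)" for S using continuous_psi[OF e] continuous_on_subset by blast
  have cp2: "continuous_on S p2" for S
  proof -
    have "continuous_on UNIV (cut step'' \<epsilon>)"
      by (rule continuous_cut[OF e continuous_step(3)]) (rule step_zero(3))
    then show ?thesis unfolding p2_def[abs_def] using e
      by (intro continuous_intros) (auto intro: continuous_on_subset)
  qed
  have z: "psi \<epsilon> x = 0" "p2 x = 0" if "x \<notin> sublevel \<epsilon>" for x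
    using that e by (auto simp: psi_zero p2_def cut_zero step_zero)
  have zg: "psi \<epsilon> x = 0" "p2 x = 0" if "norm (g x) \<le> m" for x
  proof -
    have "psi \<epsilon> x = 0 \<and> p2 x = 0"
    proof (cases "x \<in> D")
      case True
      then have "f x < - (2 * \<epsilon>)" using layer[OF True] that by linarith
      then have "- f x / \<epsilon> - 1 \<ge> 1" using e by (simp add: field_simps)
      then show ?thesis by (simp add: psi_def p2_def cut_def step_one step''_one)
    qed (simp add: psi_def p2_def cut_def)
    then show "psi \<epsilon> x = 0" "p2 x = 0" by auto
  qed
  define G where "G x = norm (g x)" for x
  define V where "V x = G x *\<^sub>R x - ((x \<bullet> g x) / G x) *\<^sub>R g x" for x
  define DV where "DV x v = G x *\<^sub>R v + (H x v \<bullet> g x / G x) *\<^sub>R x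
      - (((x \<bullet> g x) / G x) *\<^sub>R H x v + ((v \<bullet> g x + x \<bullet> H x v) / G x - (x \<bullet> g x) * (H x v \<bullet> g x) / (G x ^ 3)) *\<^sub>R g x)" for x v
  define X where "X x = (w x * psi \<epsilon> x) *\<^sub>R V x" for x
  define DX where "DX x v = (w x * psi \<epsilon> x) *\<^sub>R DV x v + (w x * (- p2 x * (g x \<bullet> v)) + (w' x * fst v) * psi \<epsilon> x) *\<^sub>R V x" for x v
  \<comment> \<open>Differentiability and continuity are checked on two open sets: where g is small
    the cutoff vanishes identically, elsewhere V is differentiable.\<close>
  have cover: "{x. norm (g x) < m} \<union> {x. g x \<noteq> 0} = UNIV" using m by auto
  have opens: "open {x. norm (g x) < m}" "open {x. g x \<noteq> 0}"
    by (intro open_Collect_less open_Collect_neq continuous_intros continuous_g)+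
  have dV: "(V has_derivative DV x) (at x)" if gx: "g x \<noteq> 0" for x
  proof -
    have dG: "(G has_derivative (\<lambda>v. H x v \<bullet> g x / G x)) (at x)"
      unfolding G_def[abs_def] using has_derivative_compose[OF deriv_g has_derivative_norm[OF gx]]
      by (simp add: sgn_div_norm divide_inverse mult.commute)
    have Gx: "G x \<noteq> 0" using gx by (simp add: G_def)
    have dq: "((\<lambda>x. (x \<bullet> g x) / G x) has_derivative
       (\<lambda>v. ((v \<bullet> g x + x \<bullet> H x v) / G x - (x \<bullet> g x) * (H x v \<bullet> g x) / (G x ^ 3)))) (at x)"
      by (rule derivative_eq_intros dG deriv_g refl Gx)+ (use Gx in \<open>auto simp: fun_eq_iff field_simps power3_eq_cube power2_eq_square\<close>)
    show ?thesis unfolding V_def[abs_def] DV_def[abs_def]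
      by (intro has_derivative_diff has_derivative_scaleR dG dq deriv_g has_derivative_ident)
  qed
  have dX: "(X has_derivative DX x) (at x)" for x
  proof (cases "norm (g x) < m")
    case True
    have "(X has_derivative (\<lambda>_. 0)) (at x)"
      by (rule has_derivative_transform_within_open[OF has_derivative_const opens(1)]) (use True zg in \<open>auto simp: X_def\<close>)
    moreover have "DX x = (\<lambda>_. 0)" using True zg[of x] by (auto simp: DX_def)
    ultimately show ?thesis by simp
  next
    case False
    then have "g x \<noteq> 0" using m by auto
    then show ?thesis
      unfolding X_def[abs_def] DX_def[abs_def] w_def w'_def p2_def
      by (intro has_derivative_scaleR has_derivative_mult psi_deriv e wt_fst_deriv dl dV)
  qed
  have cH: "continuous_on S (\<lambda>x. H x b \<bullet> g x)" for S b by (intro continuous_intros continuous_H continuous_g)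
  have cDX: "continuous_on UNIV (\<lambda>x. DX x b)" for b
  proof (rule continuous_on_UNIV_cover[OF opens cover])
    have "continuous_on {x. norm (g x) < m} (\<lambda>_. 0::real \<times> 'v)" by simp
    then show "continuous_on {x. norm (g x) < m} (\<lambda>x. DX x b)"
      by (rule continuous_on_eq) (use zg in \<open>auto simp: DX_def\<close>)
    show "continuous_on {x. g x \<noteq> 0} (\<lambda>x. DX x b)"
      unfolding DX_def DV_def V_def G_def
      by (intro continuous_intros cw cp cp2 continuous_g continuous_H cH) auto
  qed
  have tr: "(\<Sum>b\<in>Basis. DX x b \<bullet> b) = minkowski_integrand \<delta> \<epsilon> x" for x
  proof (cases "norm (g x) < m")
    case True
    then show ?thesis using zg[of x] by (simp add: DX_def minkowski_integrand_def)
  next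
    case False
    then have gx: "g x \<noteq> 0" using m by auto
    then have Gx: "G x > 0" by (simp add: G_def)
    have gg: "g x \<bullet> g x = G x * G x" by (simp add: G_def dot_square_norm power2_eq_square)
    have s0: "(\<Sum>b\<in>(Basis::(real \<times> 'v) set). b \<bullet> b) = real DIM('v) + 1" by simp
    have s1: "(\<Sum>b\<in>Basis. (y \<bullet> b) * (z \<bullet> b)) = y \<bullet> z" for y z :: "real \<times> 'v"
      by (rule euclidean_inner[symmetric])
    have s2: "(\<Sum>b\<in>Basis. (y \<bullet> b) * (H x b \<bullet> z)) = H x y \<bullet> z" for y z
    proof -
      have "(\<Sum>b\<in>Basis. (y \<bullet> b) * (H x b \<bullet> z)) = (\<Sum>b\<in>Basis. (y \<bullet> b) *\<^sub>R H x b) \<bullet> z" by (simp add: inner_sum_left)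
      then show ?thesis by (simp only: sum_Basis_inner_scaleR_linear[OF linear_H])
    qed
    have s3: "(\<Sum>b\<in>(Basis::(real \<times> 'v) set). fst b * (y \<bullet> b)) = fst y" for y
    proof -
      have "fst b = (1, 0) \<bullet> b" for b :: "real \<times> 'v" by (simp add: inner_prod_def)
      then have "(\<Sum>b\<in>(Basis::(real \<times> 'v) set). fst b * (y \<bullet> b)) = (\<Sum>b\<in>(Basis::(real \<times> 'v) set). ((1, 0) \<bullet> b) * (y \<bullet> b))" by simp
      also have "\<dots> = (1, 0) \<bullet> y" by (rule s1)
      finally show ?thesis by (simp add: inner_prod_def)
    qed
    have "DV x b \<bullet> b = G x * (b \<bullet> b) + 1 / G x * ((x \<bullet> b) * (H x b \<bullet> g x)) - (x \<bullet> g x) / G x * (H x b \<bullet> b)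
       - 1 / G x * ((g x \<bullet> b) * (g x \<bullet> b)) - 1 / G x * ((g x \<bullet> b) * (H x b \<bullet> x))
       + (x \<bullet> g x) / (G x ^ 3) * ((g x \<bullet> b) * (H x b \<bullet> g x))" for b
      unfolding DV_def inner_diff_left inner_add_left inner_scaleR_left inner_commute[of b "g x"] inner_commute[of x "H x b"]
      by (simp add: algebra_simps add_divide_distrib)
    then have "(\<Sum>b\<in>Basis. DV x b \<bullet> b) = G x * (real DIM('v) + 1) + 1 / G x * (H x x \<bullet> g x) - (x \<bullet> g x) / G x * trH x
       - 1 / G x * (g x \<bullet> g x) - 1 / G x * (H x (g x) \<bullet> x) + (x \<bullet> g x) / (G x ^ 3) * (H x (g x) \<bullet> g x)"
      unfolding trH_def by (simp only: sum.distrib sum_subtractf sum_distrib_left[symmetric] s0 s1 s2)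
    also have "H x x \<bullet> g x = H x (g x) \<bullet> x" by (rule symmetric_H)
    finally have trDV: "(\<Sum>b\<in>Basis. DV x b \<bullet> b) = real DIM('v) * G x
         - (x \<bullet> g x) * ((trH x - H x (g x) \<bullet> g x / (G x)\<^sup>2) / G x)"
      unfolding gg using Gx by (simp add: field_simps power2_eq_square power3_eq_cube)
    \<comment> \<open>This orthogonality removes the term with the second derivative of the cutoff,
      which carries the factor 1 / \<epsilon>^2.\<close>
    have gV: "g x \<bullet> V x = 0" unfolding V_def using Gx gg by (simp add: inner_diff_right inner_commute)
    have "(\<Sum>b\<in>Basis. DX x b \<bullet> b) = (w x * psi \<epsilon> x) * (\<Sum>b\<in>Basis. DV x b \<bullet> b)
       - w x * p2 x * (\<Sum>b\<in>Basis. (g x \<bullet> b) * (V x \<bullet> b)) + w' x * psi \<epsilon> x * (\<Sum>b\<in>Basis. fst b * (V x \<bullet> b))"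
      unfolding DX_def sum_distrib_left sum.distrib[symmetric] sum_subtractf[symmetric]
      by (intro sum.cong refl) (simp add: inner_add_left algebra_simps)
    also have "\<dots> = (w x * psi \<epsilon> x) * (real DIM('v) * G x
         - (x \<bullet> g x) * ((trH x - H x (g x) \<bullet> g x / (G x)\<^sup>2) / G x)) + w' x * psi \<epsilon> x * fst (V x)"
      unfolding trDV s1 s3 gV by simp
    also have "w' x * psi \<epsilon> x * fst (V x)
       = w x * psi \<epsilon> x * (a * G x - (x \<bullet> g x) * (a / fst x * (fst (g x) / G x))) + wt_err \<delta> (fst x) * psi \<epsilon> x * fst (V x)"
    proof (cases "fst x = 0")
      case True
      then show ?thesis by (simp add: w_def w'_def wt_def)
    next
      case False
      then show ?thesis unfolding w'_def w_def[symmetric] V_def by (simp add: field_simps)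
    qed
    finally show ?thesis
      unfolding minkowski_integrand_def hcurv_def w_def[symmetric] G_def[symmetric] N_def
      by (simp add: V_def algebra_simps)
  qed
  have "(\<integral>x. (\<Sum>b\<in>Basis. DX x b \<bullet> b) \<partial>lborel) = 0"
    by (rule divergence_theorem_compact_support[OF compact_sublevel[of \<epsilon>] dX cDX]) (simp add: X_def z)
  then show "(\<integral>x. minkowski_integrand \<delta> \<epsilon> x \<partial>lborel) = 0" by (simp add: tr)
  have "continuous_on UNIV (\<lambda>x. \<Sum>b\<in>Basis. DX x b \<bullet> b)" by (intro continuous_intros cDX)
  then show "continuous_on UNIV (minkowski_integrand \<delta> \<epsilon>)" by (simp add: tr)
qed

end

section \<open>Minkowski estimate, tested inequality and umbilicity\<close>

lemma measure_lborel_slab: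
  assumes "l \<le> h"
  shows "measure lborel ({l..h} \<times> cball (0::'b::euclidean_space) R) = (h - l) * measure lborel (cball (0::'b) R)"
proof -
  have "emeasure lborel ({l..h} \<times> cball (0::'b) R) = emeasure (lborel \<Otimes>\<^sub>M lborel) ({l..h} \<times> cball (0::'b) R)"
    by (simp add: lborel_prod)
  also have "\<dots> = emeasure lborel {l..h} * emeasure lborel (cball (0::'b) R)"
    by (rule lborel.emeasure_pair_measure_Times) auto
  finally show ?thesis using assms by (simp add: measure_def enn2real_mult)
qed

context weighted_cmc_domain
begin

lemma D_in_cball: obtains R where "R > 0" "D \<subseteq> cball 0 R"
proof -
  obtain R where "\<forall>x\<in>D. norm x \<le> R" using bounded_D unfolding bounded_iff by blast
  then show thesis using that[of "\<bar>R\<bar> + 1"] by force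
qed

text \<open>By evenness the \<xi>-component of g vanishes on \<xi> = 0, so it is of order \<xi>.
  That extra factor compensates the size \<delta> powr (a - 1) of \<open>wt_err\<close> in the
  truncation error of the Minkowski formula.\<close>

lemma fst_g_bound:
  assumes B: "\<And>x v. x \<in> cball 0 R \<Longrightarrow> norm (H x v) \<le> B * norm v" and x: "x \<in> cball 0 R"
  shows "\<bar>fst (g x)\<bar> \<le> B * \<bar>fst x\<bar>"
proof -
  define p where "p = (0::real, snd x)"
  define v where "v = (fst x, 0::'v)"
  define e where "e = (1::real, 0::'v)"
  have fe: "y \<bullet> e = fst y" for y :: "real \<times> 'v" by (simp add: e_def inner_prod_def)
  have x_eq: "p + 1 *\<^sub>R v = x" by (simp add: p_def v_def prod_eq_iff)
  have "\<exists>t. 0 < t \<and> t < 1 \<and> g (p + 1 *\<^sub>R v) \<bullet> e - g (p + 0 *\<^sub>R v) \<bullet> e = (1 - 0) * (H (p + t *\<^sub>R v) v \<bullet> e)"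
    using MVT2[of 0 1 "\<lambda>t. g (p + t *\<^sub>R v) \<bullet> e" "\<lambda>t. H (p + t *\<^sub>R v) v \<bullet> e"]
      has_real_derivative_along_line_inner[OF deriv_g] by auto
  then obtain t where t: "0 < t" "t < 1" "g (p + 1 *\<^sub>R v) \<bullet> e - g (p + 0 *\<^sub>R v) \<bullet> e = (1 - 0) * (H (p + t *\<^sub>R v) v \<bullet> e)"
    by blast
  have "fst (g p) = 0" by (rule g_fst_zero) (simp add: p_def)
  then have eq: "fst (g x) = H (p + t *\<^sub>R v) v \<bullet> e" using t(3) unfolding x_eq fe by simp
  have "(norm (p + t *\<^sub>R v))\<^sup>2 \<le> (norm x)\<^sup>2"
  proof -
    have "(t * fst x) * (t * fst x) \<le> fst x * fst x"
      using t(1,2) mult_left_le_one_le[of "fst x * fst x" "t * t"] by (simp add: mult_le_one algebra_simps)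
    then show ?thesis unfolding power2_norm_eq_inner by (simp add: p_def v_def inner_prod_def)
  qed
  then have "norm (p + t *\<^sub>R v) \<le> norm x" by (simp add: power2_le_iff_abs_le)
  then have "p + t *\<^sub>R v \<in> cball 0 R" using x by simp
  then have "norm (H (p + t *\<^sub>R v) v) \<le> B * norm v" by (rule B)
  moreover have "norm v = \<bar>fst x\<bar>" by (simp add: v_def norm_Pair)
  moreover have "\<bar>H (p + t *\<^sub>R v) v \<bullet> e\<bar> \<le> norm (H (p + t *\<^sub>R v) v)"
    using Cauchy_Schwarz_ineq2[of "H (p + t *\<^sub>R v) v" e] by (simp add: e_def norm_Pair)
  ultimately show ?thesis unfolding eq by simp
qed

lemma hcurv_frontier:
  assumes p: "p \<in> frontier D" "fst p > 0"
  shows "hcurv p = C"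
proof -
  have G: "norm (g p) > 0" using g_nonzero[OF p(1)] by simp
  have "H p (nu p) \<bullet> nu p = H p (g p) \<bullet> g p / (norm (g p))\<^sup>2"
    unfolding nu_def using linear_H[of p] by (simp add: linear_cmul power2_eq_square)
  then have "trA p = (trH p - H p (g p) \<bullet> g p / (norm (g p))\<^sup>2) / norm (g p)"
    by (simp add: trA_def trH_def)
  moreover have "fst (nu p) = fst (g p) / norm (g p)" by (simp add: nu_def)
  ultimately have "hcurv p = trA p + a * (fst (nu p) / fst p)" by (simp add: hcurv_def mult.commute)
  then show ?thesis using trA_eq[OF p] by simp
qed

lemma integral_wt_err:
  assumes R: "D \<subseteq> cball 0 R" and e: "\<epsilon> > 0" and dl: "\<delta> > 0"
  shows "(\<integral>x. cut step \<epsilon> x * wt_err \<delta> (fst x) \<partial>lborel) \<le> 30 * measure lborel (cball (0::'v) R) * (2 * \<delta>) powr a"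
proof -
  have "\<bar>\<integral>x. cut step \<epsilon> x * wt_err \<delta> (fst x) \<partial>lborel\<bar>
      \<le> ((2 * \<delta>) powr a * 30 / \<delta>) * measure lborel ({\<delta>..2 * \<delta>} \<times> cball (0::'v) R)"
  proof (rule abs_integral_le_compact_support)
    show "compact ({\<delta>..2 * \<delta>} \<times> cball (0::'v) R)" by (intro compact_Times) auto
    show "continuous_on UNIV (\<lambda>x. cut step \<epsilon> x * wt_err \<delta> (fst x))"
      by (intro continuous_on_mult continuous_cut_step e continuous_fst_wt dl)
    show "cut step \<epsilon> x * wt_err \<delta> (fst x) = 0" if "x \<notin> {\<delta>..2 * \<delta>} \<times> cball (0::'v) R" for x
    proof (cases "x \<in> D")
      case True
      then have "norm x \<le> R" using R by auto
      then have "norm (snd x) \<le> R" by (metis norm_snd_le order_trans prod.collapse)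
      then have "fst x < \<delta> \<or> fst x > 2 * \<delta>" using that by (cases x) auto
      then show ?thesis using wt_zero(2)[OF dl] wt_err_le(2)[OF dl] by auto
    qed (simp add: cut_def)
    show "\<bar>cut step \<epsilon> x * wt_err \<delta> (fst x)\<bar> \<le> (2 * \<delta>) powr a * 30 / \<delta>" for x
      using cut_step_bounds[of \<epsilon> x] wt_nonneg(2)[OF dl, of "fst x"] wt_err_le(1)[OF dl, of "fst x"]
        mult_mono[of "cut step \<epsilon> x" 1 "wt_err \<delta> (fst x)" "(2 * \<delta>) powr a * 30 / \<delta>"] by (simp add: abs_mult)
  qed
  also have "\<dots> = 30 * measure lborel (cball (0::'v) R) * (2 * \<delta>) powr a"
    using dl by (simp add: measure_lborel_slab)
  finally show ?thesis by simp
qed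

text \<open>For fixed \<delta> and \<tau> the layer is taken so thin that \<open>hcurv\<close>
  differs from C by at most \<tau> where the weight lives. Then the Minkowski identity bounds the
  weighted area through the integral of x . g over the layer, which the position field turns into N
  + 1 times the volume. The constants \<open>K\<close> and \<open>R\<close> are fixed before
  \<delta> and \<tau>, so both errors can be made small independently; only the thickness depends on
  them.\<close>

lemma minkowski_estimate:
  obtains K R where "K \<ge> 0" "R > 0"
    "\<And>\<delta> \<tau>. \<delta> > 0 \<Longrightarrow> \<tau> > 0 \<Longrightarrow> \<exists>\<epsilon>0>0. \<forall>\<epsilon>. 0 < \<epsilon> \<and> \<epsilon> < \<epsilon>0 \<longrightarrow>
       (N - \<tau> * R) * (\<integral>x. wt \<delta> (fst x) * psi \<epsilon> x * norm (g x) \<partial>lborel)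
         \<le> C * (N + 1) * (\<integral>x. cut step \<epsilon> x * wt \<delta> (fst x) \<partial>lborel) + K * (2 * \<delta>) powr a \<and>
       (\<integral>x. cut step \<epsilon> x * wt_err \<delta> (fst x) \<partial>lborel) \<le> K * (2 * \<delta>) powr a"
proof -
  obtain R where R: "R > 0" "D \<subseteq> cball 0 R" by (rule D_in_cball)
  obtain B where B: "B > 0" "\<And>x v. x \<in> cball 0 R \<Longrightarrow> norm (H x v) \<le> B * norm v"
    using hessian_bounded[OF C2 compact_cball[of 0 R]] by metis
  obtain m \<epsilon>1 where m: "m > 0" and e1: "\<epsilon>1 > 0" "\<And>x. x \<in> D \<Longrightarrow> f x \<ge> - \<epsilon>1 \<Longrightarrow> norm (g x) > m"
    by (rule gradient_bounded_below_near_frontier) blast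
  define vol where "vol = measure lborel (cball (0::real \<times> 'v) R)"
  define K1 where "K1 = 60 * (1 / m + R * B / m\<^sup>2)"
  define T where "T = real DIM(real \<times> 'v) * B"
  define K where "K = K1 * (T * vol) + C * (60 * vol) + 30 * measure lborel (cball (0::'v) R)"
  have vol: "vol \<ge> 0" by (simp add: vol_def)
  have K1: "K1 \<ge> 0" using m R B by (simp add: K1_def)
  have T: "T \<ge> 0" using B by (simp add: T_def)
  have K: "K \<ge> 0" using K1 T vol C_pos by (simp add: K_def)
  have off: "cut step \<epsilon> x = 0" "psi \<epsilon> x = 0" if "x \<notin> cball 0 R" for x \<epsilon>
    using that R by (auto simp: cut_def psi_def)
  have "\<exists>\<epsilon>0>0. \<forall>\<epsilon>. 0 < \<epsilon> \<and> \<epsilon> < \<epsilon>0 \<longrightarrow>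
       (N - \<tau> * R) * (\<integral>x. wt \<delta> (fst x) * psi \<epsilon> x * norm (g x) \<partial>lborel)
         \<le> C * (N + 1) * (\<integral>x. cut step \<epsilon> x * wt \<delta> (fst x) \<partial>lborel) + K * (2 * \<delta>) powr a \<and>
       (\<integral>x. cut step \<epsilon> x * wt_err \<delta> (fst x) \<partial>lborel) \<le> K * (2 * \<delta>) powr a"
    if dl: "\<delta> > 0" and t: "\<tau> > 0" for \<delta> \<tau>
  proof -
    define Z where "Z = {x::real \<times> 'v. g x \<noteq> 0 \<and> fst x > 0}"
    have oZ: "open Z"
    proof -
      have "Z = {x. g x \<noteq> 0} \<inter> {x. fst x > 0}" by (auto simp: Z_def)
      moreover have "open {x. g x \<noteq> 0}" by (intro open_Collect_neq continuous_intros continuous_g)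
      moreover have "open {x::real \<times> 'v. fst x > 0}" by (intro open_Collect_less continuous_intros)
      ultimately show ?thesis by auto
    qed
    define U where "U = {x::real \<times> 'v. fst x < \<delta>} \<union> (Z \<inter> hcurv -` ball C \<tau>)"
    have "open {x::real \<times> 'v. fst x < \<delta>}" by (intro open_Collect_less continuous_intros)
    moreover have "open (Z \<inter> hcurv -` ball C \<tau>)"
      using continuous_hcurv oZ unfolding Z_def[symmetric] by (intro continuous_open_preimage) auto
    ultimately have oU: "open U" unfolding U_def by auto
    have "frontier D \<subseteq> U"
    proof
      fix p assume p: "p \<in> frontier D"
      show "p \<in> U"
      proof (cases "fst p < \<delta>")
        case False
        then have "fst p > 0" using dl by simp
        then show ?thesis using hcurv_frontier[OF p] g_nonzero[OF p] t by (simp add: U_def Z_def)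
      qed (simp add: U_def)
    qed
    from layer_near_frontier[OF oU this]
    obtain \<epsilon>2 where e2: "\<epsilon>2 > 0" "\<And>x. x \<in> D \<Longrightarrow> f x \<ge> - \<epsilon>2 \<Longrightarrow> x \<in> U" by blast
    define \<epsilon>0 where "\<epsilon>0 = min \<epsilon>1 \<epsilon>2 / 2"
    have "(N - \<tau> * R) * (\<integral>x. wt \<delta> (fst x) * psi \<epsilon> x * norm (g x) \<partial>lborel)
         \<le> C * (N + 1) * (\<integral>x. cut step \<epsilon> x * wt \<delta> (fst x) \<partial>lborel) + K * (2 * \<delta>) powr a \<and>
       (\<integral>x. cut step \<epsilon> x * wt_err \<delta> (fst x) \<partial>lborel) \<le> K * (2 * \<delta>) powr a"
      if e: "0 < \<epsilon>" "\<epsilon> < \<epsilon>0" for \<epsilon>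
    proof
      have e': "2 * \<epsilon> \<le> \<epsilon>1" "2 * \<epsilon> \<le> \<epsilon>2" using e by (auto simp: \<epsilon>0_def)
      have layer: "norm (g x) > m" if "x \<in> D" "f x \<ge> - (2 * \<epsilon>)" for x
        using e1(2)[OF that(1)] that(2) e'(1) by linarith
      define P2 where "P2 = (2 * \<delta>) powr a"
      have P2: "P2 \<ge> 0" by (simp add: P2_def)
      have pw: "minkowski_integrand \<delta> \<epsilon> x \<ge> (N - \<tau> * R) * (wt \<delta> (fst x) * psi \<epsilon> x * norm (g x))
          - C * (wt \<delta> (fst x) * psi \<epsilon> x * (x \<bullet> g x)) - K1 * P2 * (psi \<epsilon> x * (norm (g x))\<^sup>2)" for x
      proof (cases "psi \<epsilon> x = 0")
        case True
        then show ?thesis by (simp add: minkowski_integrand_def)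
      next
        case False
        then have xD: "x \<in> D" and "step' (- f x / \<epsilon> - 1) \<noteq> 0" by (auto simp: psi_def cut_def split: if_splits)
        then have "- f x / \<epsilon> - 1 < 1" using step_one(2) not_le by blast
        then have fx: "f x \<ge> - (2 * \<epsilon>)" using e(1) by (simp add: field_simps)
        define G where "G = norm (g x)"
        define q where "q = x \<bullet> g x"
        have G: "G > m" using layer[OF xD fx] by (simp add: G_def)
        have xR: "x \<in> cball 0 R" "norm x \<le> R" using xD R by auto
        have q: "\<bar>q\<bar> \<le> R * G"
          using Cauchy_Schwarz_ineq2[of x "g x"] mult_right_mono[OF xR(2) norm_ge_zero[of "g x"]] by (simp add: q_def G_def)
        have p0: "psi \<epsilon> x \<ge> 0" by (rule psi_nonneg[OF e(1)])
        have w0: "wt \<delta> (fst x) \<ge> 0" by (rule wt_nonneg)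
        have one: "wt \<delta> (fst x) * psi \<epsilon> x * (N * G - q * hcurv x) \<ge> wt \<delta> (fst x) * psi \<epsilon> x * ((N - \<tau> * R) * G - C * q)"
        proof (cases "fst x < \<delta>")
          case True
          then show ?thesis using wt_zero(1)[OF dl, of "fst x"] by simp
        next
          case False
          have "x \<in> U" using e2(2)[OF xD] fx e'(2) by linarith
          then have "\<bar>hcurv x - C\<bar> \<le> \<tau>" using False by (simp add: U_def dist_real_def abs_minus_commute)
          then have "\<bar>q\<bar> * \<bar>hcurv x - C\<bar> \<le> (R * G) * \<tau>" using q R G m by (intro mult_mono) auto
          then have "q * (hcurv x - C) \<le> (R * G) * \<tau>" by (metis abs_ge_self abs_mult order_trans)
          then have "(N - \<tau> * R) * G - C * q \<le> N * G - q * hcurv x" by (simp add: algebra_simps)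
          then show ?thesis using p0 w0 by (intro mult_left_mono) auto
        qed
        have two: "wt_err \<delta> (fst x) * psi \<epsilon> x * (G * fst x - q / G * fst (g x)) \<ge> - (K1 * P2 * (psi \<epsilon> x * G\<^sup>2))"
        proof -
          have G0: "G > 0" using G m by simp
          have "\<bar>q / G\<bar> \<le> R" using q G0 by (simp add: abs_divide divide_le_eq)
          then have "\<bar>q / G * fst (g x)\<bar> \<le> R * (B * \<bar>fst x\<bar>)"
            unfolding abs_mult using fst_g_bound[OF B(2) xR(1)] R by (intro mult_mono) auto
          then have "\<bar>G * fst x - q / G * fst (g x)\<bar> \<le> (G + R * B) * \<bar>fst x\<bar>"
            using abs_triangle_ineq4[of "G * fst x" "q / G * fst (g x)"] G0 by (simp add: abs_mult algebra_simps)
          then have "wt_err \<delta> (fst x) * \<bar>G * fst x - q / G * fst (g x)\<bar> \<le> wt_err \<delta> (fst x) * ((G + R * B) * \<bar>fst x\<bar>)"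
            using wt_nonneg(2)[OF dl] by (intro mult_left_mono) auto
          also have "\<dots> = (G + R * B) * (wt_err \<delta> (fst x) * \<bar>fst x\<bar>)" by simp
          also have "\<dots> \<le> (G\<^sup>2 * (1 / m + R * B / m\<^sup>2)) * (60 * P2)"
          proof (rule mult_mono)
            \<comment> \<open>On the layer G > m, which allows all powers of G to be raised to G^2,
              the one whose psi-integral is bounded uniformly in \<epsilon>.\<close>
            have "1 \<le> G / m" using G m by simp
            then have "1 \<le> (G / m)\<^sup>2" by (rule one_le_power)
            then have "R * B * 1 \<le> R * B * (G / m)\<^sup>2" using R B by (intro mult_left_mono) auto
            moreover have "G * 1 \<le> G * (G / m)" using G0 \<open>1 \<le> G / m\<close> by (intro mult_left_mono) auto
            ultimately show "G + R * B \<le> G\<^sup>2 * (1 / m + R * B / m\<^sup>2)"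
              by (simp add: power_divide power2_eq_square algebra_simps)
            show "wt_err \<delta> (fst x) * \<bar>fst x\<bar> \<le> 60 * P2" unfolding P2_def by (rule wt_err_le(3)[OF dl])
          qed (use wt_nonneg(2)[OF dl] m R B in auto)
          also have "\<dots> = K1 * P2 * G\<^sup>2" by (simp add: K1_def)
          finally have "wt_err \<delta> (fst x) * (G * fst x - q / G * fst (g x)) \<ge> - (K1 * P2 * G\<^sup>2)"
            using wt_nonneg(2)[OF dl, of "fst x"] by (smt (verit) abs_ge_minus_self minus_mult_right mult_left_mono)
          from mult_left_mono[OF this p0] show ?thesis by (simp add: algebra_simps)
        qed
        show ?thesis using one two unfolding minkowski_integrand_def G_def[symmetric] q_def[symmetric]
          by (simp add: algebra_simps)
      qed
      have cp: "continuous_on UNIV (psi \<epsilon>)" by (rule continuous_psi[OF e(1)])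
      note IS = integrable_continuous_compact_support[OF compact_sublevel[of \<epsilon>]]
      have z: "psi \<epsilon> x = 0" if "x \<notin> sublevel \<epsilon>" for x using that e by (simp add: psi_zero)
      have i1: "integrable lborel (\<lambda>x. wt \<delta> (fst x) * psi \<epsilon> x * norm (g x))"
        by (rule IS) (auto intro!: continuous_intros continuous_fst_wt dl cp continuous_g simp: z)
      have i2: "integrable lborel (\<lambda>x. wt \<delta> (fst x) * psi \<epsilon> x * (x \<bullet> g x))"
        by (rule IS) (auto intro!: continuous_intros continuous_fst_wt dl cp continuous_g simp: z)
      have i3: "integrable lborel (\<lambda>x. psi \<epsilon> x * (norm (g x))\<^sup>2)"
        by (rule IS) (auto intro!: continuous_intros cp continuous_g simp: z)
      have i4: "integrable lborel (minkowski_integrand \<delta> \<epsilon>)"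
        by (rule IS[OF minkowski_identity(2)[OF e(1) dl m layer]]) (auto simp: minkowski_integrand_def z)
      have "(\<integral>x. (N - \<tau> * R) * (wt \<delta> (fst x) * psi \<epsilon> x * norm (g x))
          - C * (wt \<delta> (fst x) * psi \<epsilon> x * (x \<bullet> g x)) - K1 * P2 * (psi \<epsilon> x * (norm (g x))\<^sup>2) \<partial>lborel)
         \<le> (\<integral>x. minkowski_integrand \<delta> \<epsilon> x \<partial>lborel)"
        by (intro integral_mono Bochner_Integration.integrable_diff integrable_mult_right i1 i2 i3 i4 pw)
      also have "\<dots> = 0" by (rule minkowski_identity(1)[OF e(1) dl m layer])
      finally have main: "(N - \<tau> * R) * (\<integral>x. wt \<delta> (fst x) * psi \<epsilon> x * norm (g x) \<partial>lborel)
         \<le> C * (\<integral>x. wt \<delta> (fst x) * psi \<epsilon> x * (x \<bullet> g x) \<partial>lborel) + K1 * P2 * (\<integral>x. psi \<epsilon> x * (norm (g x))\<^sup>2 \<partial>lborel)"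
        using i1 i2 i3 by (simp only: Bochner_Integration.integral_diff Bochner_Integration.integrable_diff
            integrable_mult_right integral_mult_right_zero)
      have psiG: "(\<integral>x. psi \<epsilon> x * (norm (g x))\<^sup>2 \<partial>lborel) \<le> T * vol"
      proof -
        have "\<bar>\<integral>x. cut step \<epsilon> x * trH x \<partial>lborel\<bar> \<le> T * measure lborel (cball (0::real \<times> 'v) R)"
        proof (rule abs_integral_le_compact_support[OF compact_cball])
          show "continuous_on UNIV (\<lambda>x. cut step \<epsilon> x * trH x)"
            by (intro continuous_on_mult continuous_cut_step e continuous_trH)
          show "cut step \<epsilon> x * trH x = 0" if "x \<notin> cball 0 R" for x using off[OF that] by simp
          show "\<bar>cut step \<epsilon> x * trH x\<bar> \<le> T" for x
          proof (cases "x \<in> cball 0 R")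
            case True
            have "\<bar>trH x\<bar> \<le> (\<Sum>b\<in>(Basis::(real \<times> 'v) set). B)" unfolding trH_def
            proof (rule order_trans[OF sum_abs], rule sum_mono)
              fix b :: "real \<times> 'v" assume b: "b \<in> Basis"
              show "\<bar>H x b \<bullet> b\<bar> \<le> B"
                using Cauchy_Schwarz_ineq2[of "H x b" b] B(2)[OF True, of b] b by simp
            qed
            then have "\<bar>trH x\<bar> \<le> T" by (simp add: T_def)
            then have "cut step \<epsilon> x * \<bar>trH x\<bar> \<le> 1 * T" using cut_step_bounds by (intro mult_mono) auto
            then show ?thesis using cut_step_bounds[of \<epsilon> x] by (simp add: abs_mult)
          next
            case False
            then show ?thesis using off[OF False] T by simp
          qed
        qed
        then show ?thesis unfolding integral_psi_norm_g[OF e(1)] vol_def by linarith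
      qed
      have err: "(\<integral>x. cut step \<epsilon> x * (wt_err \<delta> (fst x) * fst x) \<partial>lborel) \<le> 60 * P2 * vol"
      proof -
        have "\<bar>\<integral>x. cut step \<epsilon> x * (wt_err \<delta> (fst x) * fst x) \<partial>lborel\<bar> \<le> (60 * P2) * measure lborel (cball (0::real \<times> 'v) R)"
        proof (rule abs_integral_le_compact_support[OF compact_cball])
          show "continuous_on UNIV (\<lambda>x. cut step \<epsilon> x * (wt_err \<delta> (fst x) * fst x))"
            by (intro continuous_intros continuous_cut_step e continuous_fst_wt dl)
          show "cut step \<epsilon> x * (wt_err \<delta> (fst x) * fst x) = 0" if "x \<notin> cball 0 R" for x using off[OF that] by simp
          show "\<bar>cut step \<epsilon> x * (wt_err \<delta> (fst x) * fst x)\<bar> \<le> 60 * P2" for x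
          proof -
            have "cut step \<epsilon> x * (wt_err \<delta> (fst x) * \<bar>fst x\<bar>) \<le> 1 * (60 * P2)"
              unfolding P2_def by (rule mult_mono[OF _ wt_err_le(3)[OF dl]]) (use cut_step_bounds wt_nonneg(2)[OF dl] in auto)
            then show ?thesis using cut_step_bounds[of \<epsilon> x] wt_nonneg(2)[OF dl, of "fst x"] by (simp add: abs_mult)
          qed
        qed
        then show ?thesis unfolding vol_def by linarith
      qed
      have "C * (\<integral>x. wt \<delta> (fst x) * psi \<epsilon> x * (x \<bullet> g x) \<partial>lborel)
        \<le> C * ((N + 1) * (\<integral>x. cut step \<epsilon> x * wt \<delta> (fst x) \<partial>lborel) + 60 * P2 * vol)"
        unfolding integral_psi_position[OF e(1) dl] using err C_pos by (intro mult_left_mono) auto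
      moreover have "K1 * P2 * (\<integral>x. psi \<epsilon> x * (norm (g x))\<^sup>2 \<partial>lborel) \<le> K1 * P2 * (T * vol)"
        using psiG K1 P2 by (intro mult_left_mono) auto
      moreover have "30 * measure lborel (cball (0::'v) R) * P2 \<ge> 0" using P2 by simp
      ultimately show "(N - \<tau> * R) * (\<integral>x. wt \<delta> (fst x) * psi \<epsilon> x * norm (g x) \<partial>lborel)
         \<le> C * (N + 1) * (\<integral>x. cut step \<epsilon> x * wt \<delta> (fst x) \<partial>lborel) + K * (2 * \<delta>) powr a"
        using main unfolding P2_def[symmetric] K_def by (simp add: algebra_simps)
      have "0 \<le> (K1 * (T * vol) + C * (60 * vol)) * P2" using K1 T vol C_pos P2 by simp
      then show "(\<integral>x. cut step \<epsilon> x * wt_err \<delta> (fst x) \<partial>lborel) \<le> K * (2 * \<delta>) powr a"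
        using integral_wt_err[OF R(2) e(1) dl] unfolding P2_def[symmetric] K_def by (simp add: algebra_simps)
    qed
    then show ?thesis using e1(1) e2(1) by (intro exI[of _ \<epsilon>0]) (auto simp: \<epsilon>0_def)
  qed
  then show thesis using that K R(1) by blast
qed

text \<open>The weak inequality for \<open>u\<close>, tested with a cutoff of \<open>D\<close> times a cutoff of \<open>\<xi> powr a\<close>.\<close>

lemma heintze_karcher_tested:
  assumes e: "\<epsilon> > 0" and dl: "\<delta> > 0" and \<theta>: "continuous_on UNIV \<theta>"
    and gn: "\<And>x p. x \<in> D \<Longrightarrow> fst x > 0 \<Longrightarrow> nearest x p \<Longrightarrow>
      \<exists>v t. v \<bullet> nu p = 0 \<and> norm v \<le> 1 \<and> \<bar>t\<bar> \<le> 1 \<and> gain x p v t \<ge> \<theta> x"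
  shows "(\<integral>x. cut step \<epsilon> x * wt \<delta> (fst x) * ((N + 1) * c + \<theta> x) \<partial>lborel)
    \<le> (\<integral>x. wt \<delta> (fst x) * psi \<epsilon> x * norm (g x) \<partial>lborel) + (\<integral>x. cut step \<epsilon> x * wt_err \<delta> (fst x) \<partial>lborel)"
proof -
  define K where "K = sublevel \<epsilon> \<inter> {x. fst x \<ge> \<delta>}"
  have "closed {x::real \<times> 'v. fst x \<ge> \<delta>}" by (intro closed_Collect_le continuous_intros)
  then have cK: "compact K" unfolding K_def by (intro compact_Int_closed compact_sublevel)
  have KD: "x \<in> D \<and> fst x > 0" if "x \<in> K" for x
    using that sublevel_subset_D[OF e] dl by (auto simp: K_def)
  obtain K0 where K0: "K0 \<ge> 0" and key: "\<And>\<tau>. \<tau> > 0 \<Longrightarrow> \<exists>h0>0. \<forall>x\<in>K. \<forall>h. 0 < h \<and> h < h0 \<longrightarrow> (\<forall>p v t. nearest x p \<and> v \<bullet> nu p = 0 \<and> norm v \<le> 1 \<and> \<bar>t\<bar> \<le> 1 \<longrightarrow>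
      (\<exists>G. norm G \<le> 1 \<and>
        (\<forall>b\<in>Basis. u (x + h *\<^sub>R b) \<le> u x + h * (G \<bullet> b) + K0 * h\<^sup>2 \<and>
                   u (x - h *\<^sub>R b) \<le> u x - h * (G \<bullet> b) + K0 * h\<^sup>2) \<and>
        (\<Sum>b\<in>Basis. u (x + h *\<^sub>R b) + u (x - h *\<^sub>R b) - 2 * u x) / h\<^sup>2 + a / fst x * fst G
          \<le> - ((N + 1) * c) - gain x p v t + \<tau>))"
    by (rule operator_bound[OF cK KD], assumption, rule that, assumption, drule meta_spec, drule meta_mp, assumption, assumption)
  obtain L where L: "L \<ge> 0" "\<And>x y. \<bar>u x - u y\<bar> \<le> L * norm (x - y)" by (rule u_lipschitz) blast
  define \<rho> where "\<rho> x = cut step \<epsilon> x * wt \<delta> (fst x)" for x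
  define \<rho>' where "\<rho>' x v = cut step \<epsilon> x * ((a / fst x * wt \<delta> (fst x) + wt_err \<delta> (fst x)) * fst v)
      + (- psi \<epsilon> x * (g x \<bullet> v)) * wt \<delta> (fst x)" for x v
  define e1 where "e1 = (1::real, 0::'v)"
  have e1: "e1 \<in> Basis" by (simp add: e1_def Basis_prod_def)
  have fe: "x \<bullet> e1 = fst x" for x :: "real \<times> 'v" by (simp add: e1_def inner_prod_def)
  \<comment> \<open>The gradient of the test function minus a / \<xi> times it in direction \<xi>:
    the singular part of the derivative of the weight cancels, leaving the layer term and the
    truncation error.\<close>
  define F where "F x = - ((wt \<delta> (fst x) * psi \<epsilon> x) *\<^sub>R g x) + (cut step \<epsilon> x * wt_err \<delta> (fst x)) *\<^sub>R e1" for x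
  have cF: "continuous_on UNIV F" unfolding F_def[abs_def]
    by (intro continuous_intros continuous_fst_wt dl continuous_psi e continuous_g continuous_cut_step)
  have Fz: "F x = 0" if "x \<notin> sublevel \<epsilon>" for x
    using that e by (simp add: F_def psi_zero cut_step_zero)
  have "(\<integral>x. \<rho> x * ((N + 1) * c + \<theta> x) \<partial>lborel) \<le> (\<integral>x. norm (F x) \<partial>lborel)"
  proof (rule discrete_weak_inequality[OF cK e1, where \<rho>' = \<rho>' and \<beta> = "\<lambda>x. a / fst x" and u = u and L = L and ?K0.0 = K0])
    show "\<rho> x \<ge> 0" for x using cut_step_bounds wt_nonneg by (simp add: \<rho>_def)
    show "\<rho> x = 0" if "x \<notin> K" for x
    proof (cases "x \<in> sublevel \<epsilon>")
      case True
      then have "fst x \<le> \<delta>" using that by (simp add: K_def)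
      then show ?thesis using wt_zero(1)[OF dl] by (simp add: \<rho>_def)
    qed (simp add: \<rho>_def cut_step_zero e)
    show "(\<rho> has_derivative \<rho>' x) (at x)" for x
      unfolding \<rho>_def[abs_def] \<rho>'_def[abs_def]
      by (intro has_derivative_mult cut_step_deriv e wt_fst_deriv dl)
    show "continuous_on UNIV (\<lambda>x. \<rho>' x b)" for b
      unfolding \<rho>'_def by (intro continuous_intros continuous_fst_wt dl continuous_psi e continuous_g continuous_cut_step)
    show "a / fst x \<ge> 0" if "x \<in> K" for x using KD[OF that] a_pos by simp
    have "continuous_on UNIV (\<lambda>x. cut step \<epsilon> x * (a / fst x * wt \<delta> (fst x)))"
      by (intro continuous_on_mult continuous_cut_step e continuous_fst_wt dl)
    then show "continuous_on UNIV (\<lambda>x. a / fst x * \<rho> x)" by (simp add: \<rho>_def ac_simps)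
    show "F x \<bullet> b = \<rho>' x b - (if b = e1 then a / fst x * \<rho> x else 0)" if b: "b \<in> Basis" for x b
    proof (cases "b = e1")
      case True
      then show ?thesis unfolding F_def \<rho>'_def \<rho>_def
        by (simp add: inner_add_left fe e1_def algebra_simps)
    next
      case False
      have "fst b = e1 \<bullet> b" by (simp add: e1_def inner_prod_def)
      then have "fst b = 0" "e1 \<bullet> b = 0" using inner_Basis[OF e1 b] False by auto
      then show ?thesis using False unfolding F_def \<rho>'_def by (simp add: inner_add_left inner_diff_left)
    qed
    show "continuous_on UNIV (\<lambda>x. (N + 1) * c + \<theta> x)" by (intro continuous_intros \<theta>)
    show "\<exists>h0>0. \<forall>x\<in>K. \<forall>h. 0 < h \<and> h < h0 \<longrightarrow> (\<exists>G. norm G \<le> 1 \<and>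
        (\<forall>b\<in>Basis. u (x + h *\<^sub>R b) \<le> u x + h * (G \<bullet> b) + K0 * h\<^sup>2 \<and>
                   u (x - h *\<^sub>R b) \<le> u x - h * (G \<bullet> b) + K0 * h\<^sup>2) \<and>
        (\<Sum>b\<in>Basis. u (x + h *\<^sub>R b) + u (x - h *\<^sub>R b) - 2 * u x) / h\<^sup>2 + a / fst x * (G \<bullet> e1) \<le> - ((N + 1) * c + \<theta> x) + \<tau>)"
      if t: "\<tau> > 0" for \<tau>
    proof -
      from key[OF t] obtain h0 where h0: "h0 > 0" and kk: "\<forall>x\<in>K. \<forall>h. 0 < h \<and> h < h0 \<longrightarrow> (\<forall>p v t. nearest x p \<and> v \<bullet> nu p = 0 \<and> norm v \<le> 1 \<and> \<bar>t\<bar> \<le> 1 \<longrightarrow>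
      (\<exists>G. norm G \<le> 1 \<and>
        (\<forall>b\<in>Basis. u (x + h *\<^sub>R b) \<le> u x + h * (G \<bullet> b) + K0 * h\<^sup>2 \<and>
                   u (x - h *\<^sub>R b) \<le> u x - h * (G \<bullet> b) + K0 * h\<^sup>2) \<and>
        (\<Sum>b\<in>Basis. u (x + h *\<^sub>R b) + u (x - h *\<^sub>R b) - 2 * u x) / h\<^sup>2 + a / fst x * fst G
          \<le> - ((N + 1) * c) - gain x p v t + \<tau>))"
        by (elim exE conjE) (rule that)
      show ?thesis
      proof (intro exI[of _ h0] conjI h0 ballI allI impI)
        fix x h assume xK: "x \<in> K" and h: "0 < h \<and> h < h0"
        obtain p where np: "nearest x p" using nearest_exists KD[OF xK] by blast
        obtain v t where vt: "v \<bullet> nu p = 0" "norm v \<le> 1" "\<bar>t\<bar> \<le> 1" "gain x p v t \<ge> \<theta> x"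
          using gn[OF _ _ np] KD[OF xK] by blast
        obtain G where G: "norm G \<le> 1"
          "\<forall>b\<in>Basis. u (x + h *\<^sub>R b) \<le> u x + h * (G \<bullet> b) + K0 * h\<^sup>2 \<and>
                   u (x - h *\<^sub>R b) \<le> u x - h * (G \<bullet> b) + K0 * h\<^sup>2"
          "(\<Sum>b\<in>Basis. u (x + h *\<^sub>R b) + u (x - h *\<^sub>R b) - 2 * u x) / h\<^sup>2 + a / fst x * fst G
          \<le> - ((N + 1) * c) - gain x p v t + \<tau>"
          using kk[rule_format, OF xK h, of p v t] np vt(1-3) by blast
        show "\<exists>G. norm G \<le> 1 \<and>
        (\<forall>b\<in>Basis. u (x + h *\<^sub>R b) \<le> u x + h * (G \<bullet> b) + K0 * h\<^sup>2 \<and>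
                   u (x - h *\<^sub>R b) \<le> u x - h * (G \<bullet> b) + K0 * h\<^sup>2) \<and>
        (\<Sum>b\<in>Basis. u (x + h *\<^sub>R b) + u (x - h *\<^sub>R b) - 2 * u x) / h\<^sup>2 + a / fst x * (G \<bullet> e1) \<le> - ((N + 1) * c + \<theta> x) + \<tau>"
          using G vt(4) by (intro exI[of _ G]) (simp add: fe)
      qed
    qed
  qed (use K0 L in auto)
  also have "(\<integral>x. norm (F x) \<partial>lborel) \<le> (\<integral>x. wt \<delta> (fst x) * psi \<epsilon> x * norm (g x) + cut step \<epsilon> x * wt_err \<delta> (fst x) \<partial>lborel)"
  proof (rule integral_mono)
    show "integrable lborel (\<lambda>x. norm (F x))"
      by (rule integrable_continuous_compact_support[OF compact_sublevel[of \<epsilon>]]) (auto intro!: continuous_intros cF simp: Fz)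
    show "integrable lborel (\<lambda>x. wt \<delta> (fst x) * psi \<epsilon> x * norm (g x) + cut step \<epsilon> x * wt_err \<delta> (fst x))"
      by (rule integrable_continuous_compact_support[OF compact_sublevel[of \<epsilon>]])
        (auto intro!: continuous_intros continuous_fst_wt dl continuous_psi e continuous_g continuous_cut_step simp: psi_zero cut_step_zero e)
    show "norm (F x) \<le> wt \<delta> (fst x) * psi \<epsilon> x * norm (g x) + cut step \<epsilon> x * wt_err \<delta> (fst x)" for x
      unfolding F_def
      by (rule order_trans[OF norm_triangle_ineq])
        (use wt_nonneg(1)[of \<delta> "fst x"] wt_nonneg(2)[OF dl, of "fst x"] psi_nonneg[OF e, of x] cut_step_bounds[of \<epsilon> x] in
          \<open>simp add: e1_def norm_Pair\<close>)
  qed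
  also have "\<dots> = (\<integral>x. wt \<delta> (fst x) * psi \<epsilon> x * norm (g x) \<partial>lborel) + (\<integral>x. cut step \<epsilon> x * wt_err \<delta> (fst x) \<partial>lborel)"
    by (intro Bochner_Integration.integral_add integrable_continuous_compact_support[OF compact_sublevel[of \<epsilon>]])
      (auto intro!: continuous_intros continuous_fst_wt dl continuous_psi e continuous_g continuous_cut_step simp: psi_zero cut_step_zero e)
  finally show ?thesis by (simp add: \<rho>_def)
qed

text \<open>With a gain \<theta> everywhere, the tested inequality reads (N + 1) c Q + J \<le> I +
  E, where Q is the weighted volume, I the weighted area, E the truncation error and J the integral
  of \<theta>. The Minkowski estimate gives N I \<le> C (N + 1) Q up to small errors, and C = N c.
  So J would be arbitrarily small, although it is bounded below by the positive
  \<open>J0\<close>.\<close>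

lemma no_uniform_gain:
  assumes \<theta>: "continuous_on UNIV \<theta>" "\<And>x. \<theta> x \<ge> 0" and x1: "x1 \<in> D" "fst x1 > 0" "\<theta> x1 > 0"
  shows "\<exists>x p. x \<in> D \<and> fst x > 0 \<and> nearest x p \<and>
      \<not> (\<exists>v t. v \<bullet> nu p = 0 \<and> norm v \<le> 1 \<and> \<bar>t\<bar> \<le> 1 \<and> gain x p v t \<ge> \<theta> x)"
proof (rule ccontr)
  assume "\<not> ?thesis"
  then have gn: "\<exists>v t. v \<bullet> nu p = 0 \<and> norm v \<le> 1 \<and> \<bar>t\<bar> \<le> 1 \<and> gain x p v t \<ge> \<theta> x"
    if "x \<in> D" "fst x > 0" "nearest x p" for x p using that by blast
  obtain R where R: "R > 0" "D \<subseteq> cball 0 R" by (rule D_in_cball)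
  obtain K R1 where K: "K \<ge> 0" "R1 > 0" and mk: "\<And>\<delta> \<tau>. \<delta> > 0 \<Longrightarrow> \<tau> > 0 \<Longrightarrow> \<exists>\<epsilon>0>0. \<forall>\<epsilon>. 0 < \<epsilon> \<and> \<epsilon> < \<epsilon>0 \<longrightarrow>
       (N - \<tau> * R1) * (\<integral>x. wt \<delta> (fst x) * psi \<epsilon> x * norm (g x) \<partial>lborel)
         \<le> C * (N + 1) * (\<integral>x. cut step \<epsilon> x * wt \<delta> (fst x) \<partial>lborel) + K * (2 * \<delta>) powr a \<and>
       (\<integral>x. cut step \<epsilon> x * wt_err \<delta> (fst x) \<partial>lborel) \<le> K * (2 * \<delta>) powr a"
    by (rule minkowski_estimate) blast
  define y1 where "y1 = \<theta> x1 / 2"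
  have y1: "y1 > 0" using x1 by (simp add: y1_def)
  have "open (D \<inter> {x. fst x > fst x1 / 2} \<inter> {x. f x < f x1 / 2} \<inter> {x. \<theta> x > y1})"
    by (intro open_Int open_D open_Collect_less continuous_intros continuous_f \<theta>)
  moreover have "x1 \<in> D \<inter> {x. fst x > fst x1 / 2} \<inter> {x. f x < f x1 / 2} \<inter> {x. \<theta> x > y1}"
    using x1 f_neg[OF x1(1)] by (simp add: y1_def)
  ultimately obtain s where s: "s > 0" "cball x1 s \<subseteq> D \<inter> {x. fst x > fst x1 / 2} \<inter> {x. f x < f x1 / 2} \<inter> {x. \<theta> x > y1}"
    using open_contains_cball by meson
  define \<xi>0 where "\<xi>0 = fst x1 / 2"
  define J0 where "J0 = \<xi>0 powr a * y1 * measure lborel (cball x1 s)"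
  have \<xi>0: "\<xi>0 > 0" using x1 by (simp add: \<xi>0_def)
  have "measure lborel (cball x1 s) > 0" using s(1) by (simp add: content_cball_pos)
  then have J0: "J0 > 0" using \<xi>0 y1 by (simp add: J0_def)
  define W where "W = R powr a * measure lborel (cball (0::real \<times> 'v) R)"
  have W: "W \<ge> 0" by (simp add: W_def)
  \<comment> \<open>The first entry keeps N - \<tau> R1 at least N / 2. The second holds the error
    from \<tau> to N J0 / 8, and \<open>q\<close> does the same for the error from \<delta>;
    together they stay below the N J0 / 2 which J contributes.\<close>
  define \<tau> where "\<tau> = min (N / (2 * R1)) (N * J0 / (8 * (R1 * (N + 1) * c * W + 1)))"
  have pos1: "R1 * (N + 1) * c * W + 1 > 0" using K W N_pos c_pos by (intro add_nonneg_pos) auto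
  have \<tau>: "\<tau> > 0" unfolding \<tau>_def using K N_pos J0 pos1 by (auto intro!: divide_pos_pos mult_pos_pos)
  have \<tau>R: "\<tau> * R1 \<le> N / 2"
  proof -
    have "\<tau> \<le> N / (2 * R1)" by (simp add: \<tau>_def)
    then show ?thesis using K by (simp add: field_simps)
  qed
  have \<tau>W: "\<tau> * (R1 * (N + 1) * c * W) \<le> N * J0 / 8"
  proof -
    have "\<tau> \<le> N * J0 / (8 * (R1 * (N + 1) * c * W + 1))" by (simp add: \<tau>_def)
    then have "\<tau> * (8 * (R1 * (N + 1) * c * W + 1)) \<le> N * J0"
      using pos1 pos_le_divide_eq[of "8 * (R1 * (N + 1) * c * W + 1)"] by simp
    then show ?thesis using \<tau> by (simp add: algebra_simps)
  qed
  define q where "q = N * J0 / (8 * (K * (1 + N) + 1))"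
  have pos2: "K * (1 + N) + 1 > 0" using K N_pos by (intro add_nonneg_pos) auto
  have q: "q > 0" unfolding q_def using N_pos J0 pos2 by (auto intro!: divide_pos_pos mult_pos_pos)
  have Kq: "K * (1 + N) * q \<le> N * J0 / 8"
  proof -
    have "(K * (1 + N) + 1) * q = N * J0 / 8" unfolding q_def using pos2 by (simp add: field_simps)
    then show ?thesis using q by (simp add: algebra_simps)
  qed
  \<comment> \<open>The first entry keeps the weight untruncated on the ball about
    \<open>x1\<close>, the second makes (2 \<delta>) powr a at most \<open>q\<close>.\<close>
  define \<delta> where "\<delta> = min (\<xi>0 / 2) (q powr (1 / a) / 2)"
  have \<delta>: "\<delta> > 0" "2 * \<delta> \<le> \<xi>0" using \<xi>0 q by (auto simp: \<delta>_def)
  have "(2 * \<delta>) powr a \<le> (q powr (1 / a)) powr a"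
    using \<delta> a_pos by (intro powr_mono2) (auto simp: \<delta>_def)
  then have \<delta>q: "(2 * \<delta>) powr a \<le> q" using q a_pos by (simp add: powr_powr)
  obtain \<epsilon>0 where e0: "\<epsilon>0 > 0" and mk': "\<And>\<epsilon>. 0 < \<epsilon> \<Longrightarrow> \<epsilon> < \<epsilon>0 \<Longrightarrow>
       (N - \<tau> * R1) * (\<integral>x. wt \<delta> (fst x) * psi \<epsilon> x * norm (g x) \<partial>lborel)
         \<le> C * (N + 1) * (\<integral>x. cut step \<epsilon> x * wt \<delta> (fst x) \<partial>lborel) + K * (2 * \<delta>) powr a \<and>
       (\<integral>x. cut step \<epsilon> x * wt_err \<delta> (fst x) \<partial>lborel) \<le> K * (2 * \<delta>) powr a"
    using mk[OF \<delta>(1) \<tau>] by blast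
  \<comment> \<open>On the ball f < f x1 / 2 \<le> -2 \<epsilon>, so the cutoff equals 1 there and
    the lower bound \<open>J0\<close> does not depend on \<epsilon>.\<close>
  define \<epsilon> where "\<epsilon> = min (\<epsilon>0 / 2) (- f x1 / 4)"
  have \<epsilon>: "0 < \<epsilon>" "\<epsilon> < \<epsilon>0" "4 * \<epsilon> \<le> - f x1" using e0 f_neg[OF x1(1)] by (auto simp: \<epsilon>_def)
  define I where "I = (\<integral>x. wt \<delta> (fst x) * psi \<epsilon> x * norm (g x) \<partial>lborel)"
  define E where "E = (\<integral>x. cut step \<epsilon> x * wt_err \<delta> (fst x) \<partial>lborel)"
  define Q where "Q = (\<integral>x. cut step \<epsilon> x * wt \<delta> (fst x) \<partial>lborel)"
  define J where "J = (\<integral>x. cut step \<epsilon> x * wt \<delta> (fst x) * \<theta> x \<partial>lborel)"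
  have m1: "(N - \<tau> * R1) * I \<le> C * (N + 1) * Q + K * q" "E \<le> K * q"
    using mk'[OF \<epsilon>(1,2)] mult_left_mono[OF \<delta>q K(1)] unfolding I_def Q_def E_def by linarith+
  have cc: "continuous_on UNIV (cut step \<epsilon>)" by (rule continuous_cut_step[OF \<epsilon>(1)])
  note IS = integrable_continuous_compact_support[OF compact_sublevel[of \<epsilon>]]
  have z: "cut step \<epsilon> x = 0" if "x \<notin> sublevel \<epsilon>" for x using that \<epsilon>(1) by (simp add: cut_step_zero)
  have i1: "integrable lborel (\<lambda>x. cut step \<epsilon> x * wt \<delta> (fst x))"
    by (rule IS) (auto intro!: continuous_intros cc continuous_fst_wt \<delta> simp: z)
  have i2: "integrable lborel (\<lambda>x. cut step \<epsilon> x * wt \<delta> (fst x) * \<theta> x)"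
    by (rule IS) (auto intro!: continuous_intros cc continuous_fst_wt \<delta> \<theta> simp: z)
  have "(\<integral>x. cut step \<epsilon> x * wt \<delta> (fst x) * ((N + 1) * c + \<theta> x) \<partial>lborel)
     = (\<integral>x. (N + 1) * c * (cut step \<epsilon> x * wt \<delta> (fst x)) + cut step \<epsilon> x * wt \<delta> (fst x) * \<theta> x \<partial>lborel)"
    by (intro Bochner_Integration.integral_cong refl) (simp add: algebra_simps)
  also have "\<dots> = (N + 1) * c * Q + J" unfolding Q_def J_def using i1 i2 by simp
  finally have hk: "(N + 1) * c * Q + J \<le> I + E"
    using heintze_karcher_tested[OF \<epsilon>(1) \<delta>(1) \<theta>(1) gn] unfolding I_def E_def by simp
  have rho0: "cut step \<epsilon> x * wt \<delta> (fst x) \<ge> 0" for x using cut_step_bounds wt_nonneg by simp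
  have QW: "Q \<le> W"
  proof -
    have "\<bar>Q\<bar> \<le> R powr a * measure lborel (cball (0::real \<times> 'v) R)" unfolding Q_def
    proof (rule abs_integral_le_compact_support[OF compact_cball])
      show "continuous_on UNIV (\<lambda>x. cut step \<epsilon> x * wt \<delta> (fst x))" by (intro continuous_on_mult cc continuous_fst_wt \<delta>)
      show "cut step \<epsilon> x * wt \<delta> (fst x) = 0" if "x \<notin> cball 0 R" for x using that R by (auto simp: cut_def)
      show "\<bar>cut step \<epsilon> x * wt \<delta> (fst x)\<bar> \<le> R powr a" for x
      proof (cases "x \<in> D \<and> fst x > 0")
        case True
        then have "norm x \<le> R" using R by auto
        then have "fst x \<le> R" using norm_fst_le[of "fst x" "snd x"] True by simp
        then have "fst x powr a \<le> R powr a" using True a_pos by (intro powr_mono2) auto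
        then have "fst x powr a * step (fst x / \<delta> - 1) \<le> R powr a * 1"
          using step_bounds[of "fst x / \<delta> - 1"] by (intro mult_mono) auto
        then have "wt \<delta> (fst x) \<le> R powr a" using True by (simp add: wt_def)
        then have "cut step \<epsilon> x * wt \<delta> (fst x) \<le> 1 * R powr a"
          using cut_step_bounds wt_nonneg by (intro mult_mono) auto
        then show ?thesis using rho0[of x] by simp
      next
        case False
        then have "cut step \<epsilon> x * wt \<delta> (fst x) = 0" by (auto simp: cut_def wt_def)
        then show ?thesis by (simp only: abs_zero powr_ge_zero)
      qed
    qed
    then show ?thesis by (simp add: W_def)
  qed
  have JJ: "J \<ge> J0"
  proof -
    have k: "integrable lborel (indicator (cball x1 s) :: real \<times> 'v \<Rightarrow> real)"
      using emeasure_compact_finite[OF compact_cball] by (intro integrable_real_indicator) auto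
    have "J0 = (\<integral>x. \<xi>0 powr a * y1 * indicator (cball x1 s) x \<partial>lborel)" by (simp add: J0_def)
    also have "\<dots> \<le> J" unfolding J_def
    proof (rule integral_mono[OF integrable_mult_right[OF k] i2])
      fix x
      show "\<xi>0 powr a * y1 * indicator (cball x1 s) x \<le> cut step \<epsilon> x * wt \<delta> (fst x) * \<theta> x"
      proof (cases "x \<in> cball x1 s")
        case True
        then have x: "x \<in> D" "fst x > \<xi>0" "f x < f x1 / 2" "\<theta> x > y1" using s(2) by (auto simp: \<xi>0_def)
        have "- f x / \<epsilon> - 1 \<ge> 1" using x(3) \<epsilon> by (simp add: field_simps)
        then have c1: "cut step \<epsilon> x = 1" using x(1) by (simp add: cut_def step_one)
        have "fst x / \<delta> - 1 \<ge> 1" using x(2) \<delta> by (simp add: field_simps)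
        then have w1: "wt \<delta> (fst x) = fst x powr a" using x(2) \<xi>0 by (simp add: wt_def step_one)
        have "\<xi>0 powr a * y1 \<le> fst x powr a * \<theta> x"
          using x \<xi>0 y1 a_pos by (intro mult_mono powr_mono2) auto
        then show ?thesis using True c1 w1 by simp
      next
        case False
        then show ?thesis using rho0[of x] \<theta>(2)[of x] by simp
      qed
    qed
    finally show ?thesis .
  qed
  have CN: "C * (N + 1) * Q = N * ((N + 1) * c * Q)" using N_pos by (simp add: c_def)
  have Nt: "N - \<tau> * R1 \<ge> N / 2" using \<tau>R by linarith
  have Q0: "Q \<ge> 0" unfolding Q_def using rho0 by (intro Bochner_Integration.integral_nonneg) auto
  have "(N - \<tau> * R1) * ((N + 1) * c * Q + J) \<le> (N - \<tau> * R1) * (I + K * q)"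
    using hk m1(2) Nt N_pos by (intro mult_left_mono) auto
  also have "\<dots> \<le> C * (N + 1) * Q + K * q + N * (K * q)"
  proof -
    have "(N - \<tau> * R1) * (K * q) \<le> N * (K * q)" using \<tau> K q by (intro mult_right_mono) auto
    then show ?thesis using m1(1) by (simp add: distrib_left)
  qed
  finally have "(N - \<tau> * R1) * J \<le> \<tau> * R1 * ((N + 1) * c * Q) + K * (1 + N) * q"
    unfolding CN by (simp add: algebra_simps)
  also have "\<tau> * R1 * ((N + 1) * c * Q) \<le> \<tau> * R1 * ((N + 1) * c * W)"
    using QW \<tau> K N_pos c_pos by (intro mult_left_mono) auto
  also have "\<dots> \<le> N * J0 / 8" using \<tau>W by (simp add: ac_simps)
  finally have "(N - \<tau> * R1) * J \<le> N * J0 / 4" using Kq by linarith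
  moreover have "N / 2 * J0 \<le> (N - \<tau> * R1) * J" using Nt JJ J0 N_pos by (intro mult_mono) auto
  moreover have "N * J0 > 0" using N_pos J0 by simp
  ultimately show False by simp
qed

text \<open>If A p v differs from c, some small t gives a positive gain at the midpoint of
  \<open>x0\<close> and \<open>p\<close>. Nearest points of points close to this midpoint are close
  to \<open>p\<close>, so the same t and the projection of the same v keep the gain positive on a
  small ball. Elsewhere v = 0 and t = 0 give gain 0. A tent function below these gains contradicts
  \<open>no_uniform_gain\<close>.\<close>

lemma umbilic_at_nearest:
  assumes x0: "x0 \<in> D" "fst x0 > 0" and np: "nearest x0 p" and v: "v \<bullet> nu p = 0" "norm v = 1"
  shows "A p v = c"
proof (rule ccontr)
  assume ne: "A p v \<noteq> c"
  have p: "p \<in> frontier D" using np by (simp add: nearest_def)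
  define r where "r = d x0"
  have r: "r > 0" "c * r < 1" using d_pos[OF x0(1)] d_c_less_1[OF x0] by (auto simp: r_def)
  have px: "norm (x0 - p) = r" using np by (simp add: nearest_def r_def)
  define x1 where "x1 = (1/2) *\<^sub>R (x0 + p)"
  have half: "(1/2) *\<^sub>R y + (1/2) *\<^sub>R y = y" for y :: "real \<times> 'v" by (simp add: scaleR_left_distrib[symmetric])
  have x1p: "x1 - p = (1/2) *\<^sub>R (x0 - p)" by (simp add: x1_def algebra_simps half)
  have n1: "norm (x1 - p) = r / 2" unfolding x1p using px by simp
  have x1D: "x1 \<in> D"
  proof (rule ccontr)
    assume "x1 \<notin> D"
    from d_le[OF this, of x0] have "r \<le> norm (x0 - x1)" by (simp add: r_def)
    also have "x0 - x1 = (1/2) *\<^sub>R (x0 - p)" by (simp add: x1_def algebra_simps half)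
    finally show False using px r by simp
  qed
  have fx1: "fst x1 > 0" using nearest_fst_pos[OF x0 np] x0 by (simp add: x1_def)
  define \<kappa> where "\<kappa> = A p v - c"
  define M where "M = \<bar>A p v - 1 / (r / 2)\<bar>"
  \<comment> \<open>At the midpoint the gain is 2 t \<kappa> plus a term of size at most t^2 M; with
    t0 M \<le> |\<kappa>| the linear term wins once t has the sign of \<kappa>.\<close>
  define t0 where "t0 = min 1 (\<bar>\<kappa>\<bar> / (M + 1))"
  define t where "t = sgn \<kappa> * t0"
  have \<kappa>: "\<kappa> \<noteq> 0" using ne by (simp add: \<kappa>_def)
  have M: "M \<ge> 0" by (simp add: M_def)
  have t0: "t0 > 0" "t0 \<le> 1" "t0 * M \<le> \<bar>\<kappa>\<bar>"
  proof -
    show tp: "t0 > 0" "t0 \<le> 1" using \<kappa> M by (auto simp: t0_def)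
    have "t0 \<le> \<bar>\<kappa>\<bar> / (M + 1)" by (simp add: t0_def)
    then have "t0 * (M + 1) \<le> \<bar>\<kappa>\<bar>" using M by (simp add: pos_le_divide_eq)
    then show "t0 * M \<le> \<bar>\<kappa>\<bar>" using tp by (simp add: algebra_simps)
  qed
  have ta: "\<bar>t\<bar> \<le> 1" using t0 \<kappa> by (simp add: t_def abs_mult)
  \<comment> \<open>The gain contains norm (x - p) in place of d x, so it is a continuous function
    of the pair (x, p), and the tangential vector is obtained by projecting the fixed
    \<open>v\<close> at the varying p.\<close>
  define \<Gamma> where "\<Gamma> z = gain (fst z) (snd z) (P (snd z) v) t" for z
  have Pv: "P p v = v" using v by (simp add: P_def inner_commute)
  have vv: "v \<bullet> v = 1" using v(2) norm_eq_1 by blast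
  have cr2: "1 - c * (r / 2) > 0" "1 - c * (r / 2) \<le> 1" using r c_pos by auto
  have \<Gamma>1: "\<Gamma> (x1, p) > 0"
  proof -
    have "\<Gamma> (x1, p) = 2 * t * \<kappa> + (1 - c * (r / 2)) * (t\<^sup>2 * (A p v - 1 / (r / 2)))"
      unfolding \<Gamma>_def gain_def fst_conv snd_conv Pv n1 vv using cr2(1) by (simp add: \<kappa>_def field_simps)
    moreover have "t * \<kappa> = t0 * \<bar>\<kappa>\<bar>" by (simp add: t_def abs_sgn mult.commute)
    moreover have "(1 - c * (r / 2)) * (t\<^sup>2 * (A p v - 1 / (r / 2))) \<ge> - (t0 * \<bar>\<kappa>\<bar>)"
    proof -
      have t2: "t\<^sup>2 = t0 * t0" using \<kappa> by (simp add: t_def power_mult_distrib sgn_if power2_eq_square)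
      have "\<bar>(1 - c * (r / 2)) * (t\<^sup>2 * (A p v - 1 / (r / 2)))\<bar> \<le> 1 * (t0 * t0 * M)"
        unfolding abs_mult t2 M_def using cr2 t0 by (intro mult_mono) auto
      also have "\<dots> \<le> t0 * \<bar>\<kappa>\<bar>" using mult_left_mono[OF t0(3), of t0] t0(1) by simp
      finally show ?thesis by linarith
    qed
    moreover have "t0 * \<bar>\<kappa>\<bar> > 0" using t0 \<kappa> by simp
    ultimately show ?thesis by linarith
  qed
  define Z where "Z = {z::(real \<times> 'v) \<times> (real \<times> 'v). g (snd z) \<noteq> 0 \<and> fst z \<noteq> snd z \<and> 1 - c * norm (fst z - snd z) \<noteq> 0}"
  have cg: "continuous_on S (\<lambda>z::(real \<times> 'v) \<times> (real \<times> 'v). g (snd z))" for S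
    by (rule continuous_on_compose2[OF continuous_g[of UNIV]]) (auto intro!: continuous_intros)
  have "Z = {z. g (snd z) \<noteq> 0} \<inter> ({z. fst z \<noteq> snd z} \<inter> {z. 1 - c * norm (fst z - snd z) \<noteq> 0})" by (auto simp: Z_def)
  moreover have "open {z::(real \<times> 'v) \<times> (real \<times> 'v). g (snd z) \<noteq> 0}" by (intro open_Collect_neq continuous_intros cg)
  moreover have "open {z::(real \<times> 'v) \<times> (real \<times> 'v). fst z \<noteq> snd z}" by (intro open_Collect_neq continuous_intros)
  moreover have "open {z::(real \<times> 'v) \<times> (real \<times> 'v). 1 - c * norm (fst z - snd z) \<noteq> 0}" by (intro open_Collect_neq continuous_intros)
  ultimately have oZ: "open Z" by (simp add: open_Int)
  have cnu: "continuous_on Z (\<lambda>z. nu (snd z))" unfolding nu_def by (intro continuous_intros cg) (auto simp: Z_def)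
  have cP: "continuous_on Z (\<lambda>z. P (snd z) v)" unfolding P_def by (intro continuous_intros cnu)
  have cA: "continuous_on Z (\<lambda>z. A (snd z) (P (snd z) v))" unfolding A_def
  proof (intro continuous_intros cP cg)
    show "continuous_on Z (\<lambda>z. H (snd z) (P (snd z) v))"
      by (rule continuous_on_hessian_apply[OF C2 _ cP]) (auto intro!: continuous_intros)
  qed (auto simp: Z_def)
  have c\<Gamma>: "continuous_on Z \<Gamma>" unfolding \<Gamma>_def gain_def
    by (intro continuous_intros cA cP) (auto simp: Z_def)
  have z1: "(x1, p) \<in> Z" using g_nonzero[OF p] n1 r cr2 by (auto simp: Z_def)
  define y where "y = \<Gamma> (x1, p) / 2"
  have y: "y > 0" using \<Gamma>1 by (simp add: y_def)
  have "open (Z \<inter> \<Gamma> -` {y<..})" by (rule continuous_open_preimage[OF c\<Gamma> oZ]) auto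
  moreover have "(x1, p) \<in> Z \<inter> \<Gamma> -` {y<..}" using z1 \<Gamma>1 by (simp add: y_def)
  ultimately obtain e where e: "e > 0" "ball (x1, p) e \<subseteq> Z \<inter> \<Gamma> -` {y<..}" using open_contains_ball by meson
  define s where "s = min (e / 2) (min 1 (e\<^sup>2 / (16 * (4 * r + 8))))"
  have s: "s > 0" "s \<le> e / 2" "s \<le> 1" "(4 * r + 8) * s \<le> e\<^sup>2 / 16"
  proof -
    show "s > 0" using e r by (simp add: s_def)
    show "s \<le> e / 2" "s \<le> 1" unfolding s_def by linarith+
    have "s \<le> e\<^sup>2 / (16 * (4 * r + 8))" by (simp add: s_def)
    then have "s * (16 * (4 * r + 8)) \<le> e\<^sup>2" using r pos_le_divide_eq[of "16 * (4 * r + 8)" s "e\<^sup>2"] by simp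
    then show "(4 * r + 8) * s \<le> e\<^sup>2 / 16" by (simp add: algebra_simps)
  qed
  have close: "\<Gamma> (x', p') > y" if x': "norm (x' - x1) < s" and np': "nearest x' p'" for x' p'
  proof -
    have p': "p' \<in> frontier D" using np' by (simp add: nearest_def)
    have "norm (x' - p') \<le> norm (x' - p)" using np' d_le[OF frontier_not_D[OF p], of x'] by (simp add: nearest_def)
    also have "\<dots> \<le> norm (x' - x1) + norm (x1 - p)" using norm_triangle_ineq[of "x' - x1" "x1 - p"] by simp
    finally have "norm (x' - p') \<le> s + r / 2" using x' n1 by simp
    moreover have "norm (p' - x1) \<le> norm (x' - p') + norm (x' - x1)"
      using norm_triangle_ineq4[of "x' - x1" "x' - p'"] by (simp add: norm_minus_commute)
    ultimately have q1: "norm (p' - x1) \<le> r / 2 + 2 * s" using x' by linarith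
    have q2: "norm (p' - x0) \<ge> r" using d_le[OF frontier_not_D[OF p'], of x0] by (simp add: r_def norm_minus_commute)
    \<comment> \<open>The parallelogram law for the midpoint \<open>x1\<close> of \<open>x0\<close>
      and \<open>p\<close>. Since p' is at distance at least r from \<open>x0\<close> and barely
      more than r / 2 from \<open>x1\<close>, it must be close to \<open>p\<close>; here the passage
      to the midpoint pays off.\<close>
    have "(norm (p' - p))\<^sup>2 + (norm (p' - x0))\<^sup>2 = 2 * (norm (p' - x1))\<^sup>2 + 2 * (norm (x1 - p))\<^sup>2"
      unfolding power2_norm_eq_inner x1_def
      by (simp add: inner_diff_left inner_diff_right inner_add_left inner_add_right inner_commute field_simps)
    moreover have "(norm (p' - x0))\<^sup>2 \<ge> r\<^sup>2" using q2 r by (intro power_mono) auto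
    moreover have "(norm (p' - x1))\<^sup>2 \<le> (r / 2 + 2 * s)\<^sup>2" using q1 by (intro power_mono) auto
    ultimately have "(norm (p' - p))\<^sup>2 \<le> 2 * (r / 2 + 2 * s)\<^sup>2 + 2 * (r / 2)\<^sup>2 - r\<^sup>2" using n1 by simp
    also have "\<dots> = (4 * r + 8 * s) * s" by (simp add: power2_eq_square field_simps)
    also have "\<dots> \<le> (4 * r + 8) * s" using s by (intro mult_right_mono) auto
    also have "\<dots> \<le> (e / 4)\<^sup>2" using s(4) by (simp add: power_divide)
    finally have "norm (p' - p) \<le> e / 4" using e(1) by (simp add: power2_le_iff_abs_le)
    then have "dist (x1, p) (x', p') < e"
      using x' s(2) e(1) norm_Pair_le[of "x1 - x'" "p - p'"] by (simp add: dist_norm norm_minus_commute)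
    then show ?thesis using e(2) by auto
  qed
  \<comment> \<open>A tent of height y about \<open>x1\<close>, zero outside the ball of radius s on
    which the gain exceeds y.\<close>
  define \<theta> where "\<theta> x = y * max 0 (1 - norm (x - x1) / s)" for x :: "real \<times> 'v"
  have c\<theta>: "continuous_on UNIV \<theta>" unfolding \<theta>_def[abs_def] using s(1) by (intro continuous_intros) auto
  have \<theta>0: "\<theta> x \<ge> 0" for x using y by (simp add: \<theta>_def)
  have \<theta>1: "\<theta> x1 > 0" using y by (simp add: \<theta>_def)
  obtain x' p' where x': "x' \<in> D" "fst x' > 0" "nearest x' p'"
    and no: "\<not> (\<exists>v t. v \<bullet> nu p' = 0 \<and> norm v \<le> 1 \<and> \<bar>t\<bar> \<le> 1 \<and> gain x' p' v t \<ge> \<theta> x')"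
    using no_uniform_gain[OF c\<theta> \<theta>0 x1D fx1 \<theta>1] by blast
  have p': "p' \<in> frontier D" using x'(3) by (simp add: nearest_def)
  show False
  proof (cases "norm (x' - x1) < s")
    case True
    have "\<theta> x' \<le> y * 1" unfolding \<theta>_def using y s by (intro mult_left_mono) auto
    then have "gain x' p' (P p' v) t \<ge> \<theta> x'" using close[OF True x'(3)] by (simp add: \<Gamma>_def)
    moreover have "P p' v \<bullet> nu p' = 0" by (rule P_nu[OF p'])
    moreover have "norm (P p' v) \<le> 1" using norm_P_le[OF p', of v] v by simp
    ultimately show False using no ta by blast
  next
    case False
    then have "norm (x' - x1) / s \<ge> 1" using s(1) by simp
    then have "\<theta> x' = 0" by (simp add: \<theta>_def)
    moreover have "gain x' p' 0 0 = 0" by (simp add: gain_def)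
    ultimately show False using no by (metis abs_zero inner_zero_left norm_zero order_refl zero_le_one)
  qed
qed

end

section \<open>Umbilic frontiers are spheres\<close>

lemma has_derivative_zero_lipschitz_path:
  fixes \<gamma> :: "real \<Rightarrow> 'a::real_normed_vector"
  assumes Y: "(Y has_derivative (\<lambda>_. 0)) (at (\<gamma> t))" and K: "K \<ge> 0"
    "\<And>t'. t' \<in> S \<Longrightarrow> norm (\<gamma> t' - \<gamma> t) \<le> K * \<bar>t' - t\<bar>"
  shows "((\<lambda>t. Y (\<gamma> t)) has_derivative (\<lambda>_. 0)) (at t within S)"
  unfolding has_derivative_within_alt
proof (intro conjI allI impI)
  show "bounded_linear (\<lambda>_::real. 0)" by simp
  fix e :: real assume e: "e > 0"
  have "e / (K + 1) > 0" using e K by simp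
  then obtain d where d: "d > 0" "\<And>y. norm (y - \<gamma> t) < d \<Longrightarrow> norm (Y y - Y (\<gamma> t)) \<le> e / (K + 1) * norm (y - \<gamma> t)"
    using Y unfolding has_derivative_within_alt by auto
  show "\<exists>d>0. \<forall>y\<in>S. norm (y - t) < d \<longrightarrow> norm (Y (\<gamma> y) - Y (\<gamma> t) - 0) \<le> e * norm (y - t)"
  proof (intro exI[of _ "d / (K + 1)"] conjI ballI impI)
    show "d / (K + 1) > 0" using d K by simp
    fix t' assume t': "t' \<in> S" "norm (t' - t) < d / (K + 1)"
    have k: "norm (\<gamma> t' - \<gamma> t) \<le> (K + 1) * \<bar>t' - t\<bar>" using K(2)[OF t'(1)] by (simp add: distrib_right)
    also have "\<dots> < d" using t'(2) K(1) by (simp add: pos_less_divide_eq mult.commute)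
    finally have "norm (Y (\<gamma> t') - Y (\<gamma> t)) \<le> e / (K + 1) * norm (\<gamma> t' - \<gamma> t)" by (rule d(2))
    also have "\<dots> \<le> e / (K + 1) * ((K + 1) * \<bar>t' - t\<bar>)" using k e K by (intro mult_left_mono) auto
    also have "\<dots> = e * norm (t' - t)" using K by simp
    finally show "norm (Y (\<gamma> t') - Y (\<gamma> t) - 0) \<le> e * norm (t' - t)" by simp
  qed
qed

context weighted_cmc_domain
begin

lemma H_even: "H (- fst x, snd x) (- fst v, snd v) = (- fst (H x v), snd (H x v))"
proof -
  have *: "((\<lambda>x::real \<times> 'v. (- fst x, snd x)) has_derivative (\<lambda>v. (- fst v, snd v))) (at x)" for x
    by (auto intro!: derivative_eq_intros)
  have d1: "((\<lambda>x. g (- fst x, snd x)) has_derivative (\<lambda>v. H (- fst x, snd x) (- fst v, snd v))) (at x)"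
    by (rule has_derivative_compose[OF * deriv_g])
  have "((\<lambda>x. (- fst (g x), snd (g x))) has_derivative (\<lambda>v. (- fst (H x v), snd (H x v)))) (at x)"
    by (intro has_derivative_Pair has_derivative_minus has_derivative_fst has_derivative_snd deriv_g)
  moreover have "(\<lambda>x. (- fst (g x), snd (g x))) = (\<lambda>x. g (- fst x, snd x))"
    using g_even by (auto simp: fun_eq_iff)
  ultimately have d2: "((\<lambda>x. g (- fst x, snd x)) has_derivative (\<lambda>v. (- fst (H x v), snd (H x v)))) (at x)" by simp
  show ?thesis by (rule fun_cong[OF has_derivative_unique[OF d1 d2]])
qed

lemma norm_reflect: "norm (- fst x, snd x) = norm (x :: real \<times> 'v)"
  by (simp add: norm_prod_def)

text \<open>Nearest points are dense in the part \<xi> \<ge> 0 of the frontier: approach p from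
  \<open>D\<close>, reflect into \<xi> \<ge> 0, shift slightly to \<xi> > 0, and note that the
  nearest frontier point is at most twice as far from p as the point found. So continuous identities
  pass to all of that part, including \<xi> = 0.\<close>

lemma frontier_limit_of_nearest:
  assumes p: "p \<in> frontier D" "fst p \<ge> 0" and \<Phi>: "continuous_on {q. g q \<noteq> 0} \<Phi>"
    and z: "\<And>x q. x \<in> D \<Longrightarrow> fst x > 0 \<Longrightarrow> nearest x q \<Longrightarrow> \<Phi> q = (0::real)"
  shows "\<Phi> p = 0"
proof (rule ccontr)
  assume ne: "\<Phi> p \<noteq> 0"
  have og: "open {q. g q \<noteq> 0}" by (intro open_Collect_neq continuous_intros continuous_g)
  have "open ({q. g q \<noteq> 0} \<inter> \<Phi> -` (- {0}))" by (rule continuous_open_preimage[OF \<Phi> og]) auto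
  moreover have "p \<in> {q. g q \<noteq> 0} \<inter> \<Phi> -` (- {0})" using ne g_nonzero[OF p(1)] by simp
  ultimately obtain e where e: "e > 0" "ball p e \<subseteq> {q. g q \<noteq> 0} \<inter> \<Phi> -` (- {0})"
    using open_contains_ball by meson
  have "p \<in> closure D" using p(1) by (simp add: frontier_def)
  then have "\<exists>y\<in>D. dist y p < e / 4" using e(1) unfolding closure_approachable by (metis divide_pos_pos zero_less_numeral)
  then obtain y where y: "y \<in> D" "norm (y - p) < e / 4" unfolding dist_norm by blast
  define y' where "y' = (\<bar>fst y\<bar>, snd y)"
  have y'D: "y' \<in> D" using y(1) D_even[of "fst y" "snd y"] by (auto simp: y'_def abs_if)
  have "norm (y' - p) \<le> norm (y - p)"
  proof -
    have "\<bar>\<bar>fst y\<bar> - fst p\<bar> \<le> \<bar>fst y - fst p\<bar>" using p(2) by linarith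
    then have "(\<bar>fst y\<bar> - fst p)\<^sup>2 \<le> (fst y - fst p)\<^sup>2" by (simp add: abs_le_square_iff)
    then show ?thesis by (simp add: norm_prod_def y'_def)
  qed
  then have y'p: "norm (y' - p) < e / 4" using y(2) by simp
  obtain r where r: "r > 0" "ball y' r \<subseteq> D" using open_D y'D open_contains_ball by blast
  define h where "h = min (r / 2) (e / 8)"
  have h: "h > 0" "h < r" "h < e / 4" using r e by (auto simp: h_def)
  define x where "x = y' + (h, 0)"
  have hn: "norm (h, 0::'v) = h" using h by (simp add: norm_Pair)
  have xD: "x \<in> D"
  proof -
    have "dist y' x = norm (h, 0::'v)" unfolding x_def dist_norm by (metis add_diff_cancel_left' norm_minus_commute)
    then have "x \<in> ball y' r" using h hn by simp
    then show ?thesis using r(2) by blast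
  qed
  have fx: "fst x > 0" using h by (simp add: x_def y'_def add_nonneg_pos)
  have xp: "norm (x - p) < e / 2"
    using norm_triangle_ineq[of "y' - p" "(h, 0)"] y'p h hn by (simp add: x_def algebra_simps)
  obtain q where q: "nearest x q" using nearest_exists[OF xD] .
  have "norm (x - q) \<le> norm (x - p)" using q d_le[OF frontier_not_D[OF p(1)]] by (simp add: nearest_def)
  then have "norm (p - q) < e" using xp norm_triangle_ineq4[of "x - q" "x - p"] by (simp add: norm_minus_commute)
  then have "q \<in> ball p e" by (simp add: dist_norm)
  then have "\<Phi> q \<noteq> 0" using e(2) by auto
  then show False using z[OF xD fx q] by simp
qed

lemma continuous_nu: "continuous_on {q. g q \<noteq> 0} nu"
  unfolding nu_def[abs_def] by (intro continuous_intros continuous_g) auto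

text \<open>The second equation comes out of the trace: once all k principal curvatures equal c, the
  curvature equation leaves C - k c = a c for the weight term. It puts the centres of curvature on
  \<xi> = 0.\<close>

lemma umbilic_nonneg:
  assumes p: "p \<in> frontier D" "fst p \<ge> 0"
  shows "v \<bullet> nu p = 0 \<Longrightarrow> A p v = c * (v \<bullet> v)" "fst (nu p) = c * fst p"
proof -
  have um: "A q w = c * (w \<bullet> w)" if x: "x \<in> D" "fst x > 0" "nearest x q" and w: "w \<bullet> nu q = 0" for x q w
  proof (cases "w = 0")
    case False
    have "A q ((1 / norm w) *\<^sub>R w) = c"
      by (rule umbilic_at_nearest[OF x]) (use w False in auto)
    then show ?thesis using False unfolding A_scaleR by (simp add: power2_norm_eq_inner[symmetric] field_simps)
  qed simp
  have cP: "continuous_on {q. g q \<noteq> 0} (\<lambda>q. P q v)" for v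
    unfolding P_def by (intro continuous_intros continuous_nu)
  have cA: "continuous_on {q. g q \<noteq> 0} (\<lambda>q. A q (P q v))" for v
    unfolding A_def
  proof (intro continuous_intros cP continuous_g)
    show "continuous_on {q. g q \<noteq> 0} (\<lambda>x. H x (P x v))"
      by (rule continuous_on_hessian_apply[OF C2 _ cP]) auto
  qed auto
  have "A p (P p v) - c * (P p v \<bullet> P p v) = 0" for v
  proof (rule frontier_limit_of_nearest[OF p])
    show "continuous_on {q. g q \<noteq> 0} (\<lambda>q. A q (P q v) - c * (P q v \<bullet> P q v))"
      by (intro continuous_intros cA cP)
    show "A q (P q v) - c * (P q v \<bullet> P q v) = 0" if x: "x \<in> D" "fst x > 0" "nearest x q" for x q
      using um[OF x P_nu] x(3) by (simp add: nearest_def)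
  qed
  then show "A p v = c * (v \<bullet> v)" if "v \<bullet> nu p = 0"
    using that by (metis (no_types, opaque_lifting) P_def diff_zero eq_iff_diff_eq_0 inner_commute scale_zero_left)
  have "fst (nu p) - c * fst p = 0"
  proof (rule frontier_limit_of_nearest[OF p])
    show "continuous_on {q. g q \<noteq> 0} (\<lambda>q. fst (nu q) - c * fst q)"
      by (intro continuous_intros continuous_nu)
    show "fst (nu q) - c * fst q = 0" if x: "x \<in> D" "fst x > 0" "nearest x q" for x q
    proof -
      have q: "q \<in> frontier D" "fst q > 0" using x(3) nearest_fst_pos[OF x] by (auto simp: nearest_def)
      have "trA q = (\<Sum>e\<in>Basis. A q (P q e))" using sum_A_rank_one_update[OF q(1), of 0 1 0] by simp
      also have "\<dots> = (\<Sum>e\<in>Basis. c * (norm (P q e))\<^sup>2)"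
        using um[OF x P_nu[OF q(1)]] by (simp add: power2_norm_eq_inner)
      also have "\<dots> = c * real DIM('v)"
        using sum_norm2_rank_one_update[OF q(1), of 0 1 0] by (simp add: sum_distrib_left[symmetric])
      finally have "a * (fst (nu q) / fst q) = C - c * real DIM('v)" using trA_eq[OF q] by simp
      also have "\<dots> = a * c"
      proof -
        have "c * N = C" using N_pos by (simp add: c_def)
        then show ?thesis by (simp add: N_def algebra_simps)
      qed
      finally show ?thesis using a_pos q(2) by (simp add: field_simps)
    qed
  qed
  then show "fst (nu p) = c * fst p" by simp
qed

lemma umbilic:
  assumes p: "p \<in> frontier D"
  shows "v \<bullet> nu p = 0 \<Longrightarrow> A p v = c * (v \<bullet> v)" "fst (nu p) = c * fst p"
proof -
  have "(v \<bullet> nu p = 0 \<longrightarrow> A p v = c * (v \<bullet> v)) \<and> fst (nu p) = c * fst p"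
  proof (cases "fst p \<ge> 0")
    case True
    then show ?thesis using umbilic_nonneg[OF p] by blast
  next
    case False
    define p' where "p' = (- fst p, snd p)"
    define v' where "v' = (- fst v, snd v)"
    have p': "p' \<in> frontier D" "fst p' \<ge> 0"
      using p frontier_even[of "fst p" "snd p"] False by (auto simp: p'_def)
    have gp: "g p' = (- fst (g p), snd (g p))" using g_even[of "fst p" "snd p"] by (simp add: p'_def)
    have ng: "norm (g p') = norm (g p)" unfolding gp by (rule norm_reflect)
    have nu': "nu p' = (- fst (nu p), snd (nu p))" unfolding nu_def ng unfolding gp by (simp add: prod_eq_iff)
    have "H p' v' = (- fst (H p v), snd (H p v))" unfolding p'_def v'_def by (rule H_even)
    then have "A p' v' = A p v" unfolding A_def ng by (simp add: v'_def inner_prod_def)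
    moreover have "v' \<bullet> nu p' = v \<bullet> nu p" "v' \<bullet> v' = v \<bullet> v" unfolding nu' by (simp_all add: v'_def inner_prod_def)
    ultimately show ?thesis using umbilic_nonneg(1)[OF p', of v'] umbilic_nonneg(2)[OF p'] unfolding nu' by (auto simp: p'_def)
  qed
  then show "v \<bullet> nu p = 0 \<Longrightarrow> A p v = c * (v \<bullet> v)" "fst (nu p) = c * fst p" by auto
qed

text \<open>\<open>Z\<close> is constant on a sphere of radius \<open>1 / c\<close>, namely \<open>- c\<close> times its centre.\<close>

definition Z :: "real \<times> 'v \<Rightarrow> real \<times> 'v" where "Z q = nu q - c *\<^sub>R q"

text \<open>By umbilicity, polarised, the derivative of \<open>Z\<close> vanishes on tangential
  vectors and hence factors through the derivative of f. Subtracting a multiple of f removes it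
  completely without changing the values on the frontier, so that paths in the frontier can be
  handled without charts.\<close>

lemma Z_deriv_minus_f:
  assumes p: "p \<in> frontier D"
  obtains w where "((\<lambda>x. Z x - f x *\<^sub>R w) has_derivative (\<lambda>_. 0)) (at p)"
proof -
  define G where "G = norm (g p)"
  define n where "n = nu p"
  have G: "G > 0" using g_nonzero[OF p] by (simp add: G_def)
  have gp: "g p = G *\<^sub>R n" using G by (simp add: n_def nu_def G_def)
  have n: "n \<bullet> n = 1" using nu_nu[OF p] by (simp add: n_def)
  have dG: "((\<lambda>x. norm (g x)) has_derivative (\<lambda>v. H p v \<bullet> n)) (at p)"
    using has_derivative_compose[OF deriv_g has_derivative_norm[OF g_nonzero[OF p]]]
    by (simp add: sgn_div_norm n_def nu_def divide_inverse)
  define L where "L v = (1 / G) *\<^sub>R (H p v - (H p v \<bullet> n) *\<^sub>R n) - c *\<^sub>R v" for v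
  have dq: "((\<lambda>x. 1 / norm (g x)) has_derivative (\<lambda>v. - (H p v \<bullet> n) / G\<^sup>2)) (at p)"
    by (rule derivative_eq_intros dG refl)+ (use G in \<open>auto simp: G_def power2_eq_square field_simps\<close>)
  have "(nu has_derivative (\<lambda>v. (1 / norm (g p)) *\<^sub>R H p v + (- (H p v \<bullet> n) / G\<^sup>2) *\<^sub>R g p)) (at p)"
    unfolding nu_def[abs_def] by (intro has_derivative_scaleR dq deriv_g)
  then have "(Z has_derivative (\<lambda>v. (1 / norm (g p)) *\<^sub>R H p v + (- (H p v \<bullet> n) / G\<^sup>2) *\<^sub>R g p - c *\<^sub>R v)) (at p)"
    unfolding Z_def[abs_def] by (auto intro!: derivative_eq_intros)
  moreover have "(1 / norm (g p)) *\<^sub>R H p v + (- (H p v \<bullet> n) / G\<^sup>2) *\<^sub>R g p - c *\<^sub>R v = L v" for v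
    unfolding L_def G_def[symmetric] unfolding gp using G by (simp add: power2_eq_square scaleR_diff_right)
  ultimately have dZ: "(Z has_derivative L) (at p)" by simp
  have linL: "linear L" by (rule has_derivative_linear[OF dZ])
  have tang: "L v = 0" if v: "v \<bullet> n = 0" for v
  proof -
    have Hq: "H p w \<bullet> w = G * c * (w \<bullet> w)" if "w \<bullet> n = 0" for w
      using umbilic(1)[OF p, of w] that G unfolding A_def G_def[symmetric] n_def by (simp add: field_simps)
    have pol: "H p v \<bullet> w = G * c * (v \<bullet> w)" if w: "w \<bullet> n = 0" for w
    proof -
      have "(v + w) \<bullet> n = 0" using v w by (simp add: inner_add_left)
      from Hq[OF this] Hq[OF v] Hq[OF w] symmetric_H[of p v w] show ?thesis
        using linear_H[of p] by (simp add: linear_add inner_add_left inner_add_right inner_commute algebra_simps)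
    qed
    define w where "w = H p v - (H p v \<bullet> n) *\<^sub>R n - (G * c) *\<^sub>R v"
    have wn: "w \<bullet> n = 0" using v n by (simp add: w_def inner_diff_left)
    have "w \<bullet> w = H p v \<bullet> w - (H p v \<bullet> n) * (n \<bullet> w) - G * c * (v \<bullet> w)"
      by (subst (1) w_def) (simp add: inner_diff_left)
    then have "w = 0" using pol[OF wn] wn by (simp add: inner_commute)
    then have "H p v - (H p v \<bullet> n) *\<^sub>R n = (G * c) *\<^sub>R v" by (simp add: w_def)
    then show ?thesis unfolding L_def using G by simp
  qed
  have dD: "((\<lambda>x. Z x - f x *\<^sub>R ((1 / G) *\<^sub>R L n)) has_derivative (\<lambda>v. L v - (g p \<bullet> v) *\<^sub>R ((1 / G) *\<^sub>R L n))) (at p)"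
    by (intro has_derivative_diff dZ has_derivative_scaleR_left deriv_f)
  have e0: "L v - (g p \<bullet> v) *\<^sub>R ((1 / G) *\<^sub>R L n) = 0" for v
  proof -
    have "L (v - (n \<bullet> v) *\<^sub>R n) = 0" by (rule tang) (use n in \<open>simp add: inner_diff_left inner_commute[of v n]\<close>)
    then have "L v = (n \<bullet> v) *\<^sub>R L n" using linL by (simp add: linear_diff linear_cmul)
    then show ?thesis unfolding gp using G by simp
  qed
  show thesis by (rule that[OF dD[unfolded e0]])
qed

text \<open>Near p the function f increases strictly along the direction \<open>nu p\<close>, so
  each line in that direction meets the frontier at most once there; the bounds give the Lipschitz
  constant of the graph.\<close>

lemma frontier_graph:
  assumes p: "p \<in> frontier D"
  obtains s m G where "s > 0" "m > 0" "G > 0"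
    "\<forall>x\<in>ball p s. g x \<bullet> nu p \<ge> m \<and> norm (g x) \<le> G"
    "\<forall>x\<in>ball p s. (f x < 0 \<longleftrightarrow> x \<in> D) \<and> (f x = 0 \<longleftrightarrow> x \<in> frontier D)"
proof -
  obtain s1 where s1: "s1 > 0" "\<forall>y\<in>ball p s1. (f y < 0 \<longleftrightarrow> y \<in> D) \<and> (f y = 0 \<longleftrightarrow> y \<in> frontier D)"
    using f_local[OF p] by blast
  have gp: "g p \<bullet> nu p = norm (g p)" using g_nonzero[OF p] by (simp add: nu_def dot_square_norm power2_eq_square)
  have G: "norm (g p) > 0" using g_nonzero[OF p] by simp
  have "open ({x. g x \<bullet> nu p > norm (g p) / 2} \<inter> {x. norm (g x) < norm (g p) + 1})"
    by (intro open_Int open_Collect_less continuous_intros continuous_g)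
  moreover have "p \<in> {x. g x \<bullet> nu p > norm (g p) / 2} \<inter> {x. norm (g x) < norm (g p) + 1}" using gp G by simp
  ultimately have "\<exists>s2>0. ball p s2 \<subseteq> {x. g x \<bullet> nu p > norm (g p) / 2} \<inter> {x. norm (g x) < norm (g p) + 1}"
    by (rule open_contains_ball[THEN iffD1, rule_format])
  then obtain s2 where s2: "s2 > 0"
    "ball p s2 \<subseteq> {x. g x \<bullet> nu p > norm (g p) / 2} \<inter> {x. norm (g x) < norm (g p) + 1}" by blast
  show thesis
  proof (rule that[of "min s1 s2" "norm (g p) / 2" "norm (g p) + 1"])
    show "\<forall>x\<in>ball p (min s1 s2). g x \<bullet> nu p \<ge> norm (g p) / 2 \<and> norm (g x) \<le> norm (g p) + 1"
      using s2(2) by (force simp: subset_iff)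
  qed (use s1 s2 G in \<open>auto intro: add_pos_pos\<close>)
qed

lemma f_mean_value:
  assumes "x \<in> ball p s" "x + v \<in> ball p s"
  obtains z where "z \<in> ball p s" "f (x + v) - f x = g z \<bullet> v"
proof -
  obtain t where t: "0 < t" "t < 1" "f (x + 1 *\<^sub>R v) - f (x + 0 *\<^sub>R v) = (1 - 0) * (g (x + t *\<^sub>R v) \<bullet> v)"
    using MVT2[of 0 1 "\<lambda>t. f (x + t *\<^sub>R v)" "\<lambda>t. g (x + t *\<^sub>R v) \<bullet> v"] has_real_derivative_along_line[OF deriv_f] by auto
  have "x + t *\<^sub>R v = (1 - t) *\<^sub>R x + t *\<^sub>R (x + v)" by (simp add: algebra_simps)
  also have "\<dots> \<in> ball p s" using convexD_alt[OF convex_ball assms] t by simp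
  finally show thesis using that t(3) by simp
qed

text \<open>The intermediate value theorem on normal lines: f has opposite signs at x + r \<nu> and
  x - r \<nu>, for x = p and therefore for all x near p.\<close>

lemma frontier_over_tangent_plane:
  assumes p: "p \<in> frontier D" and s: "s > 0"
  obtains s' where "s' > 0" "s' \<le> s" "\<And>x. x \<in> ball p s' \<Longrightarrow> \<exists>t. \<bar>t\<bar> < s \<and> x + t *\<^sub>R nu p \<in> ball p s \<inter> frontier D"
proof -
  obtain s0 m G where s0: "s0 > 0" "m > 0" "G > 0"
    "\<forall>x\<in>ball p s0. g x \<bullet> nu p \<ge> m \<and> norm (g x) \<le> G"
    "\<forall>x\<in>ball p s0. (f x < 0 \<longleftrightarrow> x \<in> D) \<and> (f x = 0 \<longleftrightarrow> x \<in> frontier D)"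
    by (rule frontier_graph[OF p], rule that)
  define e where "e = nu p"
  have ne: "norm e = 1" using norm_nu[OF p] by (simp add: e_def)
  define r where "r = min s s0 / 2"
  have r: "r > 0" "r < s" "r < s0" "2 * r \<le> s" "2 * r \<le> s0" using s s0(1) by (auto simp: r_def)
  have pin: "p + t *\<^sub>R e \<in> ball p s0" if "\<bar>t\<bar> \<le> r" for t using that r ne by (simp add: dist_norm)
  have plus: "f (p + r *\<^sub>R e) > 0"
  proof -
    obtain z where z: "z \<in> ball p s0" "f (p + r *\<^sub>R e) - f p = g z \<bullet> (r *\<^sub>R e)"
      by (rule f_mean_value[of p p s0 "r *\<^sub>R e"]) (use pin[of r] pin[of 0] r in auto)
    have "g z \<bullet> e > 0" using s0(2) s0(4)[rule_format, OF z(1)] by (simp add: e_def)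
    then show ?thesis using z(2) f_zero[OF p] r by simp
  qed
  have minus: "f (p + (- r) *\<^sub>R e) < 0"
  proof -
    obtain z where z: "z \<in> ball p s0" "f (p + (- r) *\<^sub>R e) - f p = g z \<bullet> ((- r) *\<^sub>R e)"
      by (rule f_mean_value[of p p s0 "(- r) *\<^sub>R e"]) (use pin[of "- r"] pin[of 0] r in auto)
    have "g z \<bullet> e > 0" using s0(2) s0(4)[rule_format, OF z(1)] by (simp add: e_def)
    then show ?thesis using z(2) f_zero[OF p] r by simp
  qed
  have "open ({x. f (x + r *\<^sub>R e) > 0} \<inter> {x. f (x + (- r) *\<^sub>R e) < 0})"
    by (intro open_Int open_Collect_less continuous_intros continuous_on_compose2[OF continuous_f[of UNIV]]) auto
  then obtain s1 where s1: "s1 > 0" "ball p s1 \<subseteq> {x. f (x + r *\<^sub>R e) > 0} \<inter> {x. f (x + (- r) *\<^sub>R e) < 0}"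
    using plus minus open_contains_ball by (metis (no_types, lifting) IntI mem_Collect_eq)
  show thesis
  proof (rule that[of "min s1 r"])
    show "min s1 r > 0" "min s1 r \<le> s" using s1 r by auto
    fix x assume x: "x \<in> ball p (min s1 r)"
    have "x \<in> {x. f (x + r *\<^sub>R e) > 0} \<inter> {x. f (x + (- r) *\<^sub>R e) < 0}" using s1(2) x by auto
    then have fx: "f (x + (- r) *\<^sub>R e) \<le> 0" "0 \<le> f (x + r *\<^sub>R e)" by auto
    have "\<exists>t\<ge>- r. t \<le> r \<and> f (x + t *\<^sub>R e) = 0"
      by (rule IVT'[of "\<lambda>t. f (x + t *\<^sub>R e)", OF fx]) (use r in \<open>auto intro!: continuous_on_compose2[OF continuous_f[of UNIV]] continuous_intros\<close>)
    then obtain t where t: "- r \<le> t" "t \<le> r" "f (x + t *\<^sub>R e) = 0" by blast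
    have "norm (p - (x + t *\<^sub>R e)) \<le> norm (p - x) + norm (t *\<^sub>R e)" using norm_triangle_ineq4[of "p - x" "t *\<^sub>R e"] by (simp add: algebra_simps)
    also have "\<dots> < 2 * r"
    proof -
      have "norm (p - x) < r" using x by (simp add: dist_norm)
      moreover have "norm (t *\<^sub>R e) \<le> r" using t ne by (simp add: abs_le_iff)
      ultimately show ?thesis by linarith
    qed
    finally have "x + t *\<^sub>R e \<in> ball p s" "x + t *\<^sub>R e \<in> ball p s0" using r by (auto simp: dist_norm)
    then show "\<exists>t. \<bar>t\<bar> < s \<and> x + t *\<^sub>R nu p \<in> ball p s \<inter> frontier D"
      using t r s0(5) by (intro exI[of _ t]) (auto simp: e_def)
  qed
qed

text \<open>The segment from p to q is pushed onto the frontier along \<open>nu p\<close>. The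
  heights are picked by choice, but f vanishes at both ends of every chord, and the mean value
  theorem then makes the pushed path Lipschitz; along it \<open>Z\<close> has derivative 0.
  Uniqueness of the heights fixes the end points.\<close>

lemma Z_locally_constant:
  assumes p: "p \<in> frontier D"
  obtains s where "s > 0" "\<And>q. q \<in> frontier D \<Longrightarrow> q \<in> ball p s \<Longrightarrow> Z q = Z p"
proof -
  obtain s0 m G where s0: "s0 > 0" "m > 0" "G > 0"
    "\<forall>x\<in>ball p s0. g x \<bullet> nu p \<ge> m \<and> norm (g x) \<le> G"
    "\<forall>x\<in>ball p s0. (f x < 0 \<longleftrightarrow> x \<in> D) \<and> (f x = 0 \<longleftrightarrow> x \<in> frontier D)"
    by (rule frontier_graph[OF p], rule that)
  define e where "e = nu p"
  have ne: "norm e = 1" using norm_nu[OF p] by (simp add: e_def)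
  obtain s where s: "s > 0" "s \<le> s0" and up: "\<And>x. x \<in> ball p s \<Longrightarrow> \<exists>t. \<bar>t\<bar> < s0 \<and> x + t *\<^sub>R e \<in> ball p s0 \<inter> frontier D"
    unfolding e_def by (rule frontier_over_tangent_plane[OF p s0(1)]) blast
  have uniq: "t = 0" if "x \<in> ball p s0 \<inter> frontier D" "x + t *\<^sub>R e \<in> ball p s0 \<inter> frontier D" for x t
  proof -
    have xb: "x \<in> ball p s0" "x + t *\<^sub>R e \<in> ball p s0" using that by auto
    obtain z where z: "z \<in> ball p s0" "f (x + t *\<^sub>R e) - f x = g z \<bullet> (t *\<^sub>R e)"
      by (rule f_mean_value[OF xb])
    have "g z \<bullet> e > 0" using s0(2) s0(4)[rule_format, OF z(1)] by (simp add: e_def)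
    then show ?thesis using z(2) f_zero that by simp
  qed
  have "Z q = Z p" if q: "q \<in> frontier D" "q \<in> ball p s" for q
  proof -
    define v where "v = q - p"
    have inb: "p + \<tau> *\<^sub>R v \<in> ball p s" if "\<tau> \<in> {0..1}" for \<tau>
    proof -
      have "norm (\<tau> *\<^sub>R v) \<le> norm v" using that by (auto intro!: mult_left_le_one_le)
      moreover have "norm v < s" using q(2) by (simp add: v_def dist_norm norm_minus_commute)
      ultimately show ?thesis by (simp add: dist_norm)
    qed
    have "\<forall>\<tau>\<in>{0..1}. \<exists>t. p + \<tau> *\<^sub>R v + t *\<^sub>R e \<in> ball p s0 \<inter> frontier D" using up[OF inb] by blast
    then obtain \<eta> where \<eta>: "\<And>\<tau>. \<tau> \<in> {0..1} \<Longrightarrow> p + \<tau> *\<^sub>R v + \<eta> \<tau> *\<^sub>R e \<in> ball p s0 \<inter> frontier D" by metis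
    define \<gamma> where "\<gamma> \<tau> = p + \<tau> *\<^sub>R v + \<eta> \<tau> *\<^sub>R e" for \<tau>
    have \<gamma>: "\<gamma> \<tau> \<in> ball p s0 \<inter> frontier D" if "\<tau> \<in> {0..1}" for \<tau> using \<eta>[OF that] by (simp add: \<gamma>_def)
    have \<gamma>0: "\<gamma> 0 = p"
    proof -
      have "\<eta> 0 = 0" by (rule uniq[of p]) (use p s0(1) \<eta>[of 0] in auto)
      then show ?thesis by (simp add: \<gamma>_def)
    qed
    have \<gamma>1: "\<gamma> 1 = q"
    proof -
      have "\<eta> 1 = 0" by (rule uniq[of q]) (use q s \<eta>[of 1] in \<open>auto simp: v_def\<close>)
      then show ?thesis by (simp add: \<gamma>_def v_def)
    qed
    define K where "K = norm v + G * norm v / m"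
    have K: "K \<ge> 0" using s0 by (simp add: K_def)
    have lip: "norm (\<gamma> \<tau>' - \<gamma> \<tau>) \<le> K * \<bar>\<tau>' - \<tau>\<bar>" if \<tau>: "\<tau> \<in> {0..1}" "\<tau>' \<in> {0..1}" for \<tau> \<tau>'
    proof -
      have d: "\<gamma> \<tau>' - \<gamma> \<tau> = (\<tau>' - \<tau>) *\<^sub>R v + (\<eta> \<tau>' - \<eta> \<tau>) *\<^sub>R e" by (simp add: \<gamma>_def algebra_simps)
      obtain z where z: "z \<in> ball p s0" "f (\<gamma> \<tau> + (\<gamma> \<tau>' - \<gamma> \<tau>)) - f (\<gamma> \<tau>) = g z \<bullet> (\<gamma> \<tau>' - \<gamma> \<tau>)"
        by (rule f_mean_value[of "\<gamma> \<tau>" p s0 "\<gamma> \<tau>' - \<gamma> \<tau>"]) (use \<gamma>[OF \<tau>(1)] \<gamma>[OF \<tau>(2)] in auto)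
      have "f (\<gamma> \<tau>) = 0" "f (\<gamma> \<tau>') = 0" using \<gamma>[OF \<tau>(1)] \<gamma>[OF \<tau>(2)] f_zero by auto
      then have "0 = g z \<bullet> (\<gamma> \<tau>' - \<gamma> \<tau>)" using z(2) by simp
      then have eq: "(\<eta> \<tau>' - \<eta> \<tau>) * (g z \<bullet> e) = - ((\<tau>' - \<tau>) * (g z \<bullet> v))" unfolding d by (simp add: inner_add_right)
      have ge: "g z \<bullet> e \<ge> m" "norm (g z) \<le> G" using s0(4)[rule_format, OF z(1)] by (auto simp: e_def)
      have "\<bar>\<eta> \<tau>' - \<eta> \<tau>\<bar> * m \<le> \<bar>\<eta> \<tau>' - \<eta> \<tau>\<bar> * \<bar>g z \<bullet> e\<bar>" using ge by (intro mult_left_mono) auto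
      also have "\<dots> = \<bar>\<tau>' - \<tau>\<bar> * \<bar>g z \<bullet> v\<bar>" using eq by (metis abs_minus_cancel abs_mult)
      also have "\<dots> \<le> \<bar>\<tau>' - \<tau>\<bar> * (G * norm v)"
        using Cauchy_Schwarz_ineq2[of "g z" v] mult_right_mono[OF ge(2) norm_ge_zero[of v]] by (intro mult_left_mono) auto
      finally have "\<bar>\<eta> \<tau>' - \<eta> \<tau>\<bar> \<le> \<bar>\<tau>' - \<tau>\<bar> * (G * norm v) / m" using s0(2) by (simp add: pos_le_divide_eq)
      moreover have "norm (\<gamma> \<tau>' - \<gamma> \<tau>) \<le> \<bar>\<tau>' - \<tau>\<bar> * norm v + \<bar>\<eta> \<tau>' - \<eta> \<tau>\<bar>"
        unfolding d using norm_triangle_ineq[of "(\<tau>' - \<tau>) *\<^sub>R v" "(\<eta> \<tau>' - \<eta> \<tau>) *\<^sub>R e"] ne by simp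
      ultimately show ?thesis by (simp add: K_def algebra_simps)
    qed
    have "((\<lambda>\<tau>. Z (\<gamma> \<tau>)) has_derivative (\<lambda>_. 0)) (at \<tau> within {0..1})" if \<tau>: "\<tau> \<in> {0..1}" for \<tau>
    proof -
      have gf: "\<gamma> \<tau> \<in> frontier D" using \<gamma>[OF \<tau>] by blast
      obtain w where "((\<lambda>x. Z x - f x *\<^sub>R w) has_derivative (\<lambda>_. 0)) (at (\<gamma> \<tau>))" using Z_deriv_minus_f[OF gf] .
      from has_derivative_zero_lipschitz_path[OF this K lip[OF \<tau>]]
      have "((\<lambda>\<tau>. Z (\<gamma> \<tau>) - f (\<gamma> \<tau>) *\<^sub>R w) has_derivative (\<lambda>_. 0)) (at \<tau> within {0..1})" .
      then show ?thesis
        by (rule has_derivative_transform_within[OF _ zero_less_one \<tau>]) (use \<gamma> f_zero in auto)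
    qed
    then obtain k where "\<And>\<tau>. \<tau> \<in> {0..1} \<Longrightarrow> Z (\<gamma> \<tau>) = k"
      using has_derivative_zero_constant[of "{0..1::real}" "\<lambda>\<tau>. Z (\<gamma> \<tau>)"] by auto
    then have "Z (\<gamma> 1) = Z (\<gamma> 0)" by simp
    then show ?thesis by (simp add: \<gamma>0 \<gamma>1)
  qed
  then show thesis using that s(1) by blast
qed

text \<open>The frontier points on which \<open>Z\<close> takes the value Z p lie on one sphere, and
  the set of them is closed. It is open in the sphere because near such a point a normal line
  through a point of the sphere also meets the frontier, necessarily at the same point. Spheres are
  connected in dimension k + 1 \<ge> 2, so the set is the whole sphere.\<close>

lemma sphere_subset_frontier:
  assumes p: "p \<in> frontier D"
  defines "y \<equiv> p - (1 / c) *\<^sub>R nu p"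
  shows "sphere y (1 / c) \<subseteq> frontier D" "fst y = 0"
proof -
  show "fst y = 0" unfolding y_def using umbilic(2)[OF p] c_pos by simp
  define T where "T = {q \<in> frontier D. Z q = Z p}"
  have Tq: "q = y + (1 / c) *\<^sub>R nu q" if "q \<in> T" for q
  proof -
    have "nu q - c *\<^sub>R q = nu p - c *\<^sub>R p" using that by (simp add: T_def Z_def)
    then have "c *\<^sub>R (q - (y + (1 / c) *\<^sub>R nu q)) = 0" unfolding y_def using c_pos
      by (simp add: scaleR_diff_right scaleR_add_right algebra_simps)
    then show ?thesis using c_pos by simp
  qed
  have TM: "q \<in> frontier D" if "q \<in> T" for q using that by (simp add: T_def)
  have TS: "T \<subseteq> sphere y (1 / c)"
  proof
    fix q assume q: "q \<in> T"
    have "norm (y - q) = norm ((1 / c) *\<^sub>R nu q)" using Tq[OF q] by (metis add_diff_cancel_left' norm_minus_commute)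
    then show "q \<in> sphere y (1 / c)" using norm_nu[OF TM[OF q]] c_pos by (simp add: dist_norm)
  qed
  have pT: "p \<in> T" using p by (simp add: T_def)
  have cZ: "continuous_on (frontier D) Z" unfolding Z_def[abs_def]
    by (intro continuous_intros continuous_on_subset[OF continuous_nu]) (use g_nonzero in auto)
  have "closed T"
  proof -
    have "T = frontier D \<inter> Z -` {Z p}" by (auto simp: T_def)
    then show ?thesis using continuous_closed_preimage[OF cZ frontier_closed closed_singleton] by simp
  qed
  then have cl: "closedin (top_of_set (sphere y (1 / c))) T" using TS by (simp add: closed_subset)
  have "openin (top_of_set (sphere y (1 / c))) T"
    unfolding openin_contains_ball
  proof (intro conjI TS ballI)
    fix q assume q: "q \<in> T"
    obtain s1 where s1: "s1 > 0" "\<And>z. z \<in> frontier D \<Longrightarrow> z \<in> ball q s1 \<Longrightarrow> Z z = Z q"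
      using Z_locally_constant[OF TM[OF q]] by metis
    define s where "s = min s1 (1 / (2 * c))"
    have s: "s > 0" "s \<le> s1" "s \<le> 1 / (2 * c)" using s1 c_pos by (auto simp: s_def)
    obtain s' where s': "s' > 0" "s' \<le> s" "\<And>x. x \<in> ball q s' \<Longrightarrow> \<exists>t. \<bar>t\<bar> < s \<and> x + t *\<^sub>R nu q \<in> ball q s \<inter> frontier D"
      using frontier_over_tangent_plane[OF TM[OF q] s(1)] by metis
    show "\<exists>e>0. ball q e \<inter> sphere y (1 / c) \<subseteq> T"
    proof (intro exI[of _ s'] conjI s' subsetI)
      fix x assume x: "x \<in> ball q s' \<inter> sphere y (1 / c)"
      obtain t where t: "\<bar>t\<bar> < s" "x + t *\<^sub>R nu q \<in> ball q s \<inter> frontier D" using s'(3) x by blast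
      define n where "n = nu q"
      have n: "n \<bullet> n = 1" "norm n = 1" using nu_nu[OF TM[OF q]] norm_nu[OF TM[OF q]] by (auto simp: n_def)
      have xt: "x + t *\<^sub>R n \<in> T" using t(2) s s1(2)[of "x + t *\<^sub>R n"] q by (auto simp: T_def n_def)
      have e1: "(x - y) \<bullet> (x - y) = (1 / c)\<^sup>2" using x by (simp add: dist_norm norm_minus_commute power2_norm_eq_inner[symmetric])
      have "x + t *\<^sub>R n \<in> sphere y (1 / c)" using xt TS by blast
      then have "norm (x + t *\<^sub>R n - y) = 1 / c" by (simp add: dist_norm norm_minus_commute)
      then have "(x + t *\<^sub>R n - y) \<bullet> (x + t *\<^sub>R n - y) = (1 / c)\<^sup>2" by (simp add: power2_norm_eq_inner[symmetric])
      moreover have "x + t *\<^sub>R n - y = (x - y) + t *\<^sub>R n" by simp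
      moreover have "(z + t *\<^sub>R n) \<bullet> (z + t *\<^sub>R n) = z \<bullet> z + t * (2 * (z \<bullet> n) + t)" for z
        using n by (simp add: inner_add_left inner_add_right inner_commute[of n z] distrib_left)
      ultimately have "t * (2 * ((x - y) \<bullet> n) + t) = 0" using e1 by simp
      \<comment> \<open>The other root t would be the second intersection of the normal line with
        the sphere, on the far side. It is excluded because x is within 1 / (2 c) of q, where (q -
        y) . n = 1 / c.\<close>
      moreover have "2 * ((x - y) \<bullet> n) + t > 0"
      proof -
        have "(x - y) \<bullet> n = (q - y) \<bullet> n + (x - q) \<bullet> n" by (simp add: inner_diff_left)
        moreover have "(q - y) \<bullet> n = 1 / c"
        proof -
          have "q - y = (1 / c) *\<^sub>R n" using Tq[OF q] unfolding n_def by (metis add_diff_cancel_left')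
          then show ?thesis using n by simp
        qed
        moreover have "(x - q) \<bullet> n \<ge> - s"
        proof -
          have "norm (x - q) < s'" using x by (simp add: dist_norm norm_minus_commute)
          then show ?thesis using Cauchy_Schwarz_ineq2[of "x - q" n] s'(2) unfolding n(2) by linarith
        qed
        moreover have "1 / c \<ge> 2 * s" using s(3) c_pos by (simp add: field_simps)
        ultimately show ?thesis using t(1) s(1) by linarith
      qed
      ultimately have "t = 0" by simp
      then show "x \<in> T" using xt by simp
    qed
  qed
  moreover have "connected (sphere y (1 / c))"
    by (rule connected_sphere) (simp add: DIM_positive Suc_leI)
  ultimately have "T = sphere y (1 / c)" using cl pT unfolding connected_clopen by blast
  then show "sphere y (1 / c) \<subseteq> frontier D" using TM by blast
qed

text \<open>Connectedness is available only for the half \<xi> \<ge> 0, the image of the domain in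
  the group, so inclusions are proved there and reflected. The half cannot leave the ball, for it
  would cross the sphere, which is frontier. Conversely a frontier point inside the ball would carry
  a second sphere of the same radius contained in the closed ball, hence the same sphere, which does
  not pass through the interior.\<close>

theorem D_eq_ball:
  assumes con: "connected {x \<in> D. fst x \<ge> 0}"
  shows "\<exists>\<sigma>0. D = ball (0, \<sigma>0) (1 / c)"
proof -
  obtain x0 where x0: "x0 \<in> D" using nonempty_D by blast
  obtain p where "nearest x0 p" using nearest_exists[OF x0] .
  then have p: "p \<in> frontier D" by (simp add: nearest_def)
  define y where "y = p - (1 / c) *\<^sub>R nu p"
  have S: "sphere y (1 / c) \<subseteq> frontier D" and fy: "fst y = 0"
    unfolding y_def by (rule sphere_subset_frontier[OF p])+
  define B where "B = ball y (1 / c)"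
  have refl: "(- fst x, snd x) \<in> B \<longleftrightarrow> x \<in> B" for x
    using fy by (simp add: B_def dist_norm norm_prod_def)
  obtain s0 m G where s0: "s0 > 0" "m > 0" "G > 0"
    "\<forall>x\<in>ball p s0. g x \<bullet> nu p \<ge> m \<and> norm (g x) \<le> G"
    "\<forall>x\<in>ball p s0. (f x < 0 \<longleftrightarrow> x \<in> D) \<and> (f x = 0 \<longleftrightarrow> x \<in> frontier D)"
    by (rule frontier_graph[OF p], rule that)
  define t where "t = min (s0 / 2) (1 / c)"
  have t: "t > 0" "t < s0" "t \<le> 1 / c" using s0 c_pos by (auto simp: t_def)
  define x1 where "x1 = p + (- t) *\<^sub>R nu p"
  have x1b: "x1 \<in> ball p s0" using t norm_nu[OF p] by (simp add: x1_def dist_norm)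
  have x1D: "x1 \<in> D"
  proof -
    obtain z where z: "z \<in> ball p s0" "f x1 - f p = g z \<bullet> ((- t) *\<^sub>R nu p)"
      unfolding x1_def by (rule f_mean_value[of p p s0 "(- t) *\<^sub>R nu p"]) (use x1b s0(1) in \<open>auto simp: x1_def\<close>)
    have "g z \<bullet> nu p > 0" using s0(2) s0(4)[rule_format, OF z(1)] by linarith
    then have "f x1 < 0" using z(2) f_zero[OF p] t by simp
    then show ?thesis using s0(5)[rule_format, OF x1b] by blast
  qed
  have x1B: "x1 \<in> B"
  proof -
    have "x1 - y = (1 / c - t) *\<^sub>R nu p" by (simp add: x1_def y_def algebra_simps)
    then show ?thesis using norm_nu[OF p] t by (simp add: B_def dist_norm norm_minus_commute)
  qed
  define Dp where "Dp = {x \<in> D. fst x \<ge> 0}"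
  have sub: "Dp \<subseteq> B"
  proof (rule ccontr)
    assume "\<not> Dp \<subseteq> B"
    moreover have "Dp \<inter> B \<noteq> {}"
    proof (cases "fst x1 \<ge> 0")
      case True
      then show ?thesis using x1D x1B by (auto simp: Dp_def)
    next
      case False
      then have "(- fst x1, snd x1) \<in> Dp" using x1D D_even[of "fst x1" "snd x1"] by (simp add: Dp_def)
      then show ?thesis using x1B refl[of x1] by blast
    qed
    ultimately have "Dp \<inter> frontier B \<noteq> {}" using connected_Int_frontier[of Dp B] con unfolding Dp_def by blast
    moreover have "frontier B = sphere y (1 / c)" using c_pos by (simp add: B_def)
    ultimately show False using S frontier_not_D by (auto simp: Dp_def)
  qed
  have DB: "D \<subseteq> B"
  proof
    fix x assume x: "x \<in> D"
    show "x \<in> B"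
    proof (cases "fst x \<ge> 0")
      case True
      then show ?thesis using sub x by (auto simp: Dp_def)
    next
      case False
      then have "(- fst x, snd x) \<in> Dp" using x D_even[of "fst x" "snd x"] by (simp add: Dp_def)
      then show ?thesis using sub refl by blast
    qed
  qed
  have BD: "B \<subseteq> D"
  proof (rule ccontr)
    assume "\<not> B \<subseteq> D"
    moreover have "B \<inter> D \<noteq> {}" using x1D x1B by blast
    moreover have "connected B" by (simp add: B_def)
    ultimately obtain p' where p': "p' \<in> frontier D" "p' \<in> B" using connected_Int_frontier[of B D] by blast
    define y' where "y' = p' - (1 / c) *\<^sub>R nu p'"
    have S': "sphere y' (1 / c) \<subseteq> frontier D" unfolding y'_def by (rule sphere_subset_frontier[OF p'(1)])
    have cB: "closure D \<subseteq> cball y (1 / c)" using closure_mono[OF DB] c_pos by (simp add: B_def)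
    have frD: "frontier D \<subseteq> closure D" by (auto simp: frontier_def)
    have p'S: "norm (p' - y') = 1 / c" using norm_nu[OF p'(1)] c_pos by (simp add: y'_def)
    show False
    proof (cases "y' = y")
      case True
      then show False using p'S p'(2) by (simp add: B_def dist_norm norm_minus_commute)
    next
      case False
      \<comment> \<open>The point of the second sphere in this direction is the one farthest from y,
        at distance 1 / c plus that of the centres.\<close>
      define w where "w = (1 / norm (y' - y)) *\<^sub>R (y' - y)"
      have nw: "norm w = 1" using False by (simp add: w_def)
      have "y' + (1 / c) *\<^sub>R w \<in> sphere y' (1 / c)" using nw c_pos by (simp add: dist_norm)
      then have "y' + (1 / c) *\<^sub>R w \<in> cball y (1 / c)" using S' cB frD by blast
      moreover have "y' + (1 / c) *\<^sub>R w - y = (norm (y' - y) + 1 / c) *\<^sub>R w"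
      proof -
        have "y' - y = norm (y' - y) *\<^sub>R w" using False by (simp add: w_def)
        then show ?thesis by (simp add: scaleR_add_left algebra_simps)
      qed
      then have "norm (y' + (1 / c) *\<^sub>R w - y) = norm (y' - y) + 1 / c" using nw c_pos by simp
      ultimately show False using False by (simp add: dist_norm norm_minus_commute)
    qed
  qed
  have "D = ball (0, snd y) (1 / c)" using DB BD fy unfolding B_def by (metis prod.collapse subset_antisym)
  then show ?thesis by blast
qed

end

section \<open>Defining functions\<close>

lemma C2_on_imp_C2_grad:
  fixes f :: "'a::euclidean_space \<Rightarrow> real"
  assumes "C2_on U f"
  obtains g H where "C2_grad U f g H"
proof -
  obtain f' :: "'a \<Rightarrow> 'a \<Rightarrow>\<^sub>L real" and f'' :: "'a \<Rightarrow> 'a \<Rightarrow>\<^sub>L 'a \<Rightarrow>\<^sub>L real" where o: "open U"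
    and d1: "\<And>x. x \<in> U \<Longrightarrow> (f has_derivative blinfun_apply (f' x)) (at x)"
    and d2: "\<And>x. x \<in> U \<Longrightarrow> (f' has_derivative blinfun_apply (f'' x)) (at x)"
    and cf: "continuous_on U f''"
    using assms unfolding C2_on_def by blast
  define g where "g x = (\<Sum>b\<in>Basis. f' x b *\<^sub>R b)" for x
  define H where "H x v = (\<Sum>b\<in>Basis. f'' x v b *\<^sub>R b)" for x v
  have "C2_grad U f g H" unfolding C2_grad_def
  proof (intro conjI o ballI allI)
    fix x assume x: "x \<in> U"
    have "blinfun_apply (f' x) v = g x \<bullet> v" for v
    proof -
      have "blinfun_apply (f' x) (\<Sum>b\<in>Basis. (v \<bullet> b) *\<^sub>R b) = (\<Sum>b\<in>Basis. (v \<bullet> b) * f' x b)"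
        by (simp only: blinfun.sum_right blinfun.scaleR_right real_scaleR_def)
      also have "(\<Sum>b\<in>Basis. (v \<bullet> b) * f' x b) = g x \<bullet> v"
        unfolding g_def inner_sum_left by (simp add: mult.commute inner_commute)
      finally show ?thesis by (simp only: euclidean_representation)
    qed
    then show "(f has_derivative (\<lambda>v. g x \<bullet> v)) (at x)" using d1[OF x] by (metis (no_types, lifting) ext)
    show "(g has_derivative H x) (at x)"
      unfolding g_def[abs_def] H_def[abs_def]
      by (intro has_derivative_sum has_derivative_scaleR_left bounded_linear.has_derivative[OF blinfun.bounded_linear_left] d2 x)
  next
    show "continuous_on U (\<lambda>x. H x v)" for v
      unfolding H_def by (intro continuous_intros cf)
  qed
  then show thesis by (rule that)
qed

lemma C2_grad_imp_C2_on:
  fixes f :: "'a::euclidean_space \<Rightarrow> real"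
  assumes C: "C2_grad U f g H"
  shows "C2_on U f"
  unfolding C2_on_def
proof (intro conjI C2_gradD(1)[OF C] exI ballI)
  define f'' where "f'' x = Blinfun (\<lambda>v. blinfun_inner_right (H x v))" for x
  have ap: "blinfun_apply (f'' x) v = blinfun_inner_right (H x v)" if "x \<in> U" for x v
    unfolding f''_def
    by (subst bounded_linear_Blinfun_apply)
      (use bounded_linear_compose[OF bounded_linear_blinfun_inner_right has_derivative_bounded_linear[OF C2_gradD(3)[OF C that]]] in
        \<open>simp_all add: o_def\<close>)
  show "(f has_derivative blinfun_apply (blinfun_inner_right (g x))) (at x)" if "x \<in> U" for x
    using C2_gradD(2)[OF C that] by (simp add: blinfun_inner_right.rep_eq)
  show "((\<lambda>x. blinfun_inner_right (g x)) has_derivative blinfun_apply (f'' x)) (at x)" if x: "x \<in> U" for x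
  proof -
    have "((\<lambda>x. blinfun_inner_right (g x)) has_derivative (\<lambda>v. blinfun_inner_right (H x v))) (at x)"
      by (rule bounded_linear.has_derivative[OF bounded_linear_blinfun_inner_right C2_gradD(3)[OF C x]])
    moreover have "(\<lambda>v. blinfun_inner_right (H x v)) = blinfun_apply (f'' x)" using ap[OF x] by auto
    ultimately show ?thesis by simp
  qed
  show "continuous_on U f''"
  proof (rule continuous_on_blinfun_componentwise)
    fix i :: 'a assume "i \<in> Basis"
    have "continuous_on U (\<lambda>x. blinfun_inner_right (H x i))"
      by (rule bounded_linear.continuous_on[OF bounded_linear_blinfun_inner_right C2_gradD(4)[OF C]])
    then show "continuous_on U (\<lambda>x. blinfun_apply (f'' x) i)"
      by (rule continuous_on_eq) (simp add: ap)
  qed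
qed

lemma C2_grad_sum:
  assumes "finite I" "\<And>i. i \<in> I \<Longrightarrow> C2_grad UNIV (f i) (g i) (H i)"
  shows "C2_grad UNIV (\<lambda>x. \<Sum>i\<in>I. f i x) (\<lambda>x. \<Sum>i\<in>I. g i x) (\<lambda>x v. \<Sum>i\<in>I. H i x v)"
  unfolding C2_grad_def
proof (intro conjI open_UNIV ballI allI)
  show "((\<lambda>x. \<Sum>i\<in>I. f i x) has_derivative (\<lambda>v. (\<Sum>i\<in>I. g i x) \<bullet> v)) (at x)" for x
    unfolding inner_sum_left by (intro has_derivative_sum C2_gradD(2)[OF assms(2)]) auto
  show "((\<lambda>x. \<Sum>i\<in>I. g i x) has_derivative (\<lambda>v. \<Sum>i\<in>I. H i x v)) (at x)" for x
    by (intro has_derivative_sum C2_gradD(3)[OF assms(2)]) auto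
  show "continuous_on UNIV (\<lambda>x. \<Sum>i\<in>I. H i x v)" for v
    by (intro continuous_intros C2_gradD(4)[OF assms(2)])
qed

text \<open>The third power of the positive part is the lowest one of class C^2.\<close>

definition bump :: "'a::euclidean_space \<Rightarrow> real \<Rightarrow> 'a \<Rightarrow> real" where
  "bump p r x = max 0 (r\<^sup>2 - (x - p) \<bullet> (x - p)) ^ 3"

lemma bump_pos_iff: "r > 0 \<Longrightarrow> bump p r x > 0 \<longleftrightarrow> x \<in> ball p r"
proof -
  assume r: "r > 0"
  have "bump p r x > 0 \<longleftrightarrow> (norm (x - p))\<^sup>2 < r\<^sup>2"
    by (auto simp: bump_def power2_norm_eq_inner zero_less_power_eq)
  also have "\<dots> \<longleftrightarrow> norm (x - p) < r"
    using r by (auto intro: power_strict_mono power_less_imp_less_base)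
  finally show ?thesis by (simp add: dist_norm norm_minus_commute)
qed

lemma bump_nonneg: "bump p r x \<ge> 0"
  by (simp add: bump_def)

lemma C2_grad_bump:
  "C2_grad UNIV (bump p r) (\<lambda>x. (- 6 * max 0 (r\<^sup>2 - (x - p) \<bullet> (x - p)) ^ 2) *\<^sub>R (x - p))
    (\<lambda>x v. (- 6 * max 0 (r\<^sup>2 - (x - p) \<bullet> (x - p)) ^ 2) *\<^sub>R v
       + (24 * max 0 (r\<^sup>2 - (x - p) \<bullet> (x - p)) * ((x - p) \<bullet> v)) *\<^sub>R (x - p))"
  unfolding C2_grad_def
proof (intro conjI open_UNIV ballI allI)
  define q where "q x = r\<^sup>2 - (x - p) \<bullet> (x - p)" for x
  have dq: "(q has_derivative (\<lambda>v. - 2 * ((x - p) \<bullet> v))) (at x)" for x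
    unfolding q_def[abs_def] by (auto intro!: derivative_eq_intros simp: inner_commute)
  have pw: "((\<lambda>x. max 0 (q x) ^ Suc (Suc n)) has_derivative (\<lambda>v. (- 2 * ((x - p) \<bullet> v)) * (real (Suc (Suc n)) * max 0 (q x) ^ Suc n))) (at x)" for x n
    using has_derivative_compose[OF dq DERIV_pos_part_power[unfolded has_field_derivative_def]]
    by (simp add: mult.commute)
  show "(bump p r has_derivative (\<lambda>v. ((- 6 * max 0 (r\<^sup>2 - (x - p) \<bullet> (x - p)) ^ 2) *\<^sub>R (x - p)) \<bullet> v)) (at x)" for x
    using pw[of 1 x] unfolding bump_def[abs_def] q_def by (simp add: eval_nat_numeral algebra_simps)
  have DD: "((\<lambda>x. (- 6 * max 0 (q x) ^ 2) *\<^sub>R (x - p)) has_derivative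
      (\<lambda>v. (- 6 * max 0 (q x) ^ 2) *\<^sub>R v + (- 6 * ((- 2 * ((x - p) \<bullet> v)) * (2 * max 0 (q x)))) *\<^sub>R (x - p))) (at x)" for x
    using pw[of 0 x] by (intro has_derivative_scaleR has_derivative_mult_right) (auto intro!: derivative_eq_intros simp: numeral_2_eq_2)
  have eq: "- 6 * ((- 2 * ((x - p) \<bullet> v)) * (2 * max 0 (q x))) = 24 * max 0 (q x) * ((x - p) \<bullet> v)" for x v
    by simp
  show "((\<lambda>x. (- 6 * max 0 (r\<^sup>2 - (x - p) \<bullet> (x - p)) ^ 2) *\<^sub>R (x - p)) has_derivative
     (\<lambda>v. (- 6 * max 0 (r\<^sup>2 - (x - p) \<bullet> (x - p)) ^ 2) *\<^sub>R v
       + (24 * max 0 (r\<^sup>2 - (x - p) \<bullet> (x - p)) * ((x - p) \<bullet> v)) *\<^sub>R (x - p))) (at x)" for x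
    using DD[unfolded eq] unfolding q_def .
  show "continuous_on UNIV (\<lambda>x. (- 6 * max 0 (r\<^sup>2 - (x - p) \<bullet> (x - p)) ^ 2) *\<^sub>R v
       + (24 * max 0 (r\<^sup>2 - (x - p) \<bullet> (x - p)) * ((x - p) \<bullet> v)) *\<^sub>R (x - p))" for v
    by (intro continuous_intros)
qed

text \<open>Nothing is known about f outside U, but the bump vanishes there with all derivatives in
  play, because U contains the closed ball. The gradient formula at zeros of f is what survives of
  the product rule.\<close>

lemma C2_grad_bump_mult:
  fixes f :: "'a::euclidean_space \<Rightarrow> real"
  assumes C: "C2_grad U f g H" and U: "cball p r \<subseteq> U" and r: "r > 0"
  obtains g' H' where "C2_grad UNIV (\<lambda>x. bump p r x * f x) g' H'"
    "\<And>x. f x = 0 \<Longrightarrow> g' x = bump p r x *\<^sub>R g x" "\<And>x. x \<notin> ball p r \<Longrightarrow> g' x = 0"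
proof -
  define b where "b = bump p r"
  define gb where "gb x = (- 6 * max 0 (r\<^sup>2 - (x - p) \<bullet> (x - p)) ^ 2) *\<^sub>R (x - p)" for x
  define Hb where "Hb x v = (- 6 * max 0 (r\<^sup>2 - (x - p) \<bullet> (x - p)) ^ 2) *\<^sub>R v
       + (24 * max 0 (r\<^sup>2 - (x - p) \<bullet> (x - p)) * ((x - p) \<bullet> v)) *\<^sub>R (x - p)" for x v
  have B: "C2_grad UNIV b gb Hb" unfolding b_def gb_def[abs_def] Hb_def[abs_def] by (rule C2_grad_bump)
  have off: "b x = 0" "gb x = 0" "Hb x v = 0" if "x \<notin> ball p r" for x v
  proof -
    have "norm (x - p) \<ge> r" using that by (simp add: dist_norm norm_minus_commute)
    then have "r\<^sup>2 \<le> (norm (x - p))\<^sup>2" using r by (intro power_mono) auto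
    then have "max 0 (r\<^sup>2 - (x - p) \<bullet> (x - p)) = 0" by (simp add: power2_norm_eq_inner)
    then show "b x = 0" "gb x = 0" "Hb x v = 0" by (simp_all add: b_def bump_def gb_def Hb_def)
  qed
  define g' where "g' x = b x *\<^sub>R g x + f x *\<^sub>R gb x" for x
  define H' where "H' x v = (b x *\<^sub>R H x v + (gb x \<bullet> v) *\<^sub>R g x) + (f x *\<^sub>R Hb x v + (g x \<bullet> v) *\<^sub>R gb x)" for x v
  have oc: "open (- cball p r)" by (simp add: open_Compl)
  have cov: "U \<union> - cball p r = UNIV" using U by blast
  have cU: "continuous_on U f" "continuous_on U g"
    using C2_gradD(2,3)[OF C] has_derivative_continuous continuous_at_imp_continuous_on by metis+
  have cB: "continuous_on U b" "continuous_on U gb"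
    using C2_gradD(2,3)[OF B] has_derivative_continuous continuous_at_imp_continuous_on by (metis UNIV_I)+
  have "C2_grad UNIV (\<lambda>x. b x * f x) g' H'" unfolding C2_grad_def
  proof (intro conjI open_UNIV ballI allI)
    show "((\<lambda>x. b x * f x) has_derivative (\<lambda>v. g' x \<bullet> v)) (at x)" for x
    proof (cases "x \<in> U")
      case True
      have "((\<lambda>x. b x * f x) has_derivative (\<lambda>v. b x * (g x \<bullet> v) + (gb x \<bullet> v) * f x)) (at x)"
        by (intro has_derivative_mult C2_gradD(2)[OF B] C2_gradD(2)[OF C True]) auto
      then show ?thesis unfolding g'_def by (simp add: inner_add_left mult.commute)
    next
      case False
      then have xn: "x \<in> - cball p r" using U by blast
      have "((\<lambda>x. b x * f x) has_derivative (\<lambda>v. 0)) (at x)"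
        by (rule has_derivative_transform_within_open[OF has_derivative_const oc xn]) (simp add: off)
      then show ?thesis unfolding g'_def using off xn by simp
    qed
    show "(g' has_derivative H' x) (at x)" for x
    proof (cases "x \<in> U")
      case True
      show ?thesis unfolding g'_def[abs_def] H'_def[abs_def]
        by (intro has_derivative_add has_derivative_scaleR C2_gradD(2,3)[OF B] C2_gradD(2,3)[OF C True]) auto
    next
      case False
      then have xn: "x \<in> - cball p r" using U by blast
      have "(g' has_derivative (\<lambda>v. 0)) (at x)"
        by (rule has_derivative_transform_within_open[OF has_derivative_const oc xn]) (simp add: off g'_def)
      then show ?thesis unfolding H'_def[abs_def] using off xn by simp
    qed
    show "continuous_on UNIV (\<lambda>x. H' x v)" for v
    proof (rule continuous_on_UNIV_cover[OF C2_gradD(1)[OF C] oc cov])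
      show "continuous_on U (\<lambda>x. H' x v)" unfolding H'_def
        by (intro continuous_intros cU cB C2_gradD(4)[OF C] continuous_on_subset[OF C2_gradD(4)[OF B]]) auto
      have "continuous_on (- cball p r) (\<lambda>_. 0::'a)" by simp
      then show "continuous_on (- cball p r) (\<lambda>x. H' x v)"
        by (rule continuous_on_eq) (use off in \<open>simp add: H'_def\<close>)
    qed
  qed
  then show thesis by (rule that[unfolded b_def[symmetric]]) (simp_all add: g'_def off)
qed

text \<open>A direction that decreases f1 leads into f1 < 0 and so cannot increase f2; the half
  space lemma does the rest. Gradients of different defining functions at a frontier point thus
  never point against each other.\<close>

lemma defining_gradients_aligned:
  assumes f1: "(f1 has_derivative (\<lambda>v. g1 \<bullet> v)) (at x)" and f2: "(f2 has_derivative (\<lambda>v. g2 \<bullet> v)) (at x)"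
    and z: "f1 x = 0" "f2 x = (0::real)" and g1: "g1 \<noteq> 0"
    and U: "open U" "x \<in> U" and neg: "\<And>y. y \<in> U \<Longrightarrow> f1 y < 0 \<Longrightarrow> f2 y \<le> 0"
  shows "\<exists>l\<ge>0. g2 = l *\<^sub>R (g1 :: 'a::euclidean_space)"
proof (rule nonneg_multiple_of_halfspace[OF g1])
  fix v assume v: "g1 \<bullet> v < 0"
  obtain e where e: "e > 0" "ball x e \<subseteq> U" using U open_contains_ball by blast
  have "((\<lambda>t. f1 (x + t *\<^sub>R v)) has_real_derivative (g1 \<bullet> v)) (at 0)"
    by (rule has_real_derivative_along_line) (use f1 in simp)
  from DERIV_neg_dec_right[OF this v] obtain d where d: "d > 0" "\<And>h. 0 < h \<Longrightarrow> h < d \<Longrightarrow> f1 (x + h *\<^sub>R v) < 0"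
    using z by auto
  define k where "k = min d (e / (norm v + 1))"
  show "g2 \<bullet> v \<le> 0"
  proof (rule derivative_nonpos_if_nonpos_right[OF f2 z(2)])
    show "k > 0" unfolding k_def using d e by (auto intro!: divide_pos_pos add_nonneg_pos)
    fix t assume t: "0 < t" "t < k"
    have "t * (norm v + 1) < e"
      using t pos_less_divide_eq[of "norm v + 1" t e] by (simp add: k_def add_nonneg_pos)
    then have "norm (t *\<^sub>R v) < e" using t by (simp add: algebra_simps)
    then have "x + t *\<^sub>R v \<in> U" using e(2) by (auto simp: dist_norm subset_iff)
    then show "f2 (x + t *\<^sub>R v) \<le> 0" using neg d(2)[of t] t by (simp add: k_def)
  qed
qed

text \<open>A finite sum of local defining functions weighted by bumps. Only signs matter, so the
  weights are not normalised to a partition of unity. At a frontier point the gradients of the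
  summands are nonnegative multiples of a common vector, and one of them is nonzero, so the sum
  cannot vanish.\<close>

lemma global_defining_function:
  fixes D :: "'a::euclidean_space set"
  assumes D: "open D" "bounded D"
    and loc: "\<And>p. p \<in> frontier D \<Longrightarrow> \<exists>U f g H. p \<in> U \<and> C2_grad U f g H \<and>
       (\<forall>x\<in>U. (x \<in> D \<longleftrightarrow> f x < 0) \<and> (x \<in> frontier D \<longleftrightarrow> f x = 0) \<and> (x \<in> frontier D \<longrightarrow> g x \<noteq> 0))"
  obtains U f g H where "C2_grad UNIV f g H" "open U" "closure D \<subseteq> U"
    "\<forall>x\<in>U. (x \<in> D \<longleftrightarrow> f x < 0) \<and> (x \<in> frontier D \<longleftrightarrow> f x = 0) \<and> (x \<in> frontier D \<longrightarrow> g x \<noteq> 0)"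
proof -
  have fd: "x \<notin> D" if "x \<in> frontier D" for x using that D(1) by (auto simp: frontier_def interior_open)
  have loc': "\<exists>r f g H U. r > 0 \<and> cball p r \<subseteq> U \<and> C2_grad U f g H \<and>
       (\<forall>x\<in>U. (x \<in> D \<longleftrightarrow> f x < 0) \<and> (x \<in> frontier D \<longleftrightarrow> f x = 0) \<and> (x \<in> frontier D \<longrightarrow> g x \<noteq> 0))"
    if p: "p \<in> closure D" for p
  proof (cases "p \<in> D")
    case True
    then obtain r where r: "r > 0" "cball p r \<subseteq> D" using D(1) open_contains_cball by blast
    \<comment> \<open>The constant -1 is a defining function around interior points, since no
      frontier point lies in \<open>D\<close>.\<close>
    have "C2_grad D (\<lambda>_. - 1) (\<lambda>_. 0) (\<lambda>_ _. 0)" using D(1) by (simp add: C2_grad_def)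
    then show ?thesis using r fd
      by (intro exI[of _ r] exI[of _ "\<lambda>_. - 1"] exI[of _ "\<lambda>_. 0"] exI[of _ "\<lambda>_ _. 0"] exI[of _ D]) auto
  next
    case False
    then have "p \<in> frontier D" using p D(1) by (simp add: frontier_def interior_open)
    from loc[OF this] obtain U f g H where U: "p \<in> U" "C2_grad U f g H"
       "\<forall>x\<in>U. (x \<in> D \<longleftrightarrow> f x < 0) \<and> (x \<in> frontier D \<longleftrightarrow> f x = 0) \<and> (x \<in> frontier D \<longrightarrow> g x \<noteq> 0)" by blast
    obtain r where "r > 0" "cball p r \<subseteq> U" using C2_gradD(1)[OF U(2)] U(1) open_contains_cball by blast
    then show ?thesis using U by blast
  qed
  then have "\<forall>p. \<exists>r f g H U. p \<in> closure D \<longrightarrow> r > 0 \<and> cball p r \<subseteq> U \<and> C2_grad U f g H \<and>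
       (\<forall>x\<in>U. (x \<in> D \<longleftrightarrow> f x < 0) \<and> (x \<in> frontier D \<longleftrightarrow> f x = 0) \<and> (x \<in> frontier D \<longrightarrow> g x \<noteq> 0))"
    by blast
  then have "\<exists>r F G HH U. \<forall>p. p \<in> closure D \<longrightarrow> r p > 0 \<and> cball p (r p) \<subseteq> U p \<and> C2_grad (U p) (F p) (G p) (HH p) \<and>
       (\<forall>x\<in>U p. (x \<in> D \<longleftrightarrow> F p x < 0) \<and> (x \<in> frontier D \<longleftrightarrow> F p x = 0) \<and> (x \<in> frontier D \<longrightarrow> G p x \<noteq> 0))"
    by (simp only: choice_iff)
  then obtain r F G HH U where RR: "\<forall>p. p \<in> closure D \<longrightarrow> r p > 0 \<and> cball p (r p) \<subseteq> U p \<and> C2_grad (U p) (F p) (G p) (HH p) \<and>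
       (\<forall>x\<in>U p. (x \<in> D \<longleftrightarrow> F p x < 0) \<and> (x \<in> frontier D \<longleftrightarrow> F p x = 0) \<and> (x \<in> frontier D \<longrightarrow> G p x \<noteq> 0))"
    by (elim exE) (rule that)
  have R1: "r p > 0" "cball p (r p) \<subseteq> U p" "C2_grad (U p) (F p) (G p) (HH p)"
    "\<forall>x\<in>U p. (x \<in> D \<longleftrightarrow> F p x < 0) \<and> (x \<in> frontier D \<longleftrightarrow> F p x = 0) \<and> (x \<in> frontier D \<longrightarrow> G p x \<noteq> 0)"
    if "p \<in> closure D" for p
  proof -
    note 1 = mp[OF spec[OF RR, of p] that]
    note 2 = conjunct2[OF 1]
    note 3 = conjunct2[OF 2]
    show "r p > 0" by (rule conjunct1[OF 1])
    show "cball p (r p) \<subseteq> U p" by (rule conjunct1[OF 2])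
    show "C2_grad (U p) (F p) (G p) (HH p)" by (rule conjunct1[OF 3])
    show "\<forall>x\<in>U p. (x \<in> D \<longleftrightarrow> F p x < 0) \<and> (x \<in> frontier D \<longleftrightarrow> F p x = 0) \<and> (x \<in> frontier D \<longrightarrow> G p x \<noteq> 0)"
      by (rule conjunct2[OF 3])
  qed
  have R: "\<And>p. p \<in> closure D \<Longrightarrow> r p > 0" "\<And>p. p \<in> closure D \<Longrightarrow> cball p (r p) \<subseteq> U p"
    "\<And>p. p \<in> closure D \<Longrightarrow> C2_grad (U p) (F p) (G p) (HH p)"
    "\<And>p x. p \<in> closure D \<Longrightarrow> x \<in> U p \<Longrightarrow> (x \<in> D \<longleftrightarrow> F p x < 0) \<and> (x \<in> frontier D \<longleftrightarrow> F p x = 0) \<and> (x \<in> frontier D \<longrightarrow> G p x \<noteq> 0)"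
       apply (fact R1)+
    apply (rule bspec[OF R1(4)], assumption, assumption)
    done
  have cmp: "compact (closure D)" using D(2) by (simp add: compact_closure)
  have cov: "closure D \<subseteq> (\<Union>p\<in>closure D. ball p (r p))" using R(1) by fastforce
  obtain I where I: "I \<subseteq> closure D" "finite I" "closure D \<subseteq> (\<Union>p\<in>I. ball p (r p))"
    by (rule compactE_image[OF cmp _ cov]) simp_all
  have "\<forall>p. \<exists>g' H'. p \<in> I \<longrightarrow> C2_grad UNIV (\<lambda>x. bump p (r p) x * F p x) g' H' \<and>
      (\<forall>x. F p x = 0 \<longrightarrow> g' x = bump p (r p) x *\<^sub>R G p x) \<and> (\<forall>x. x \<notin> ball p (r p) \<longrightarrow> g' x = 0)"
  proof
    fix p
    show "\<exists>g' H'. p \<in> I \<longrightarrow> C2_grad UNIV (\<lambda>x. bump p (r p) x * F p x) g' H' \<and>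
      (\<forall>x. F p x = 0 \<longrightarrow> g' x = bump p (r p) x *\<^sub>R G p x) \<and> (\<forall>x. x \<notin> ball p (r p) \<longrightarrow> g' x = 0)"
    proof (cases "p \<in> I")
      case True
      then have p: "p \<in> closure D" using I by blast
      show ?thesis by (rule C2_grad_bump_mult[OF R(3)[OF p] R(2)[OF p] R(1)[OF p]]) blast
    qed simp
  qed
  then have "\<exists>g' H'. \<forall>p. p \<in> I \<longrightarrow> C2_grad UNIV (\<lambda>x. bump p (r p) x * F p x) (g' p) (H' p) \<and>
      (\<forall>x. F p x = 0 \<longrightarrow> g' p x = bump p (r p) x *\<^sub>R G p x) \<and> (\<forall>x. x \<notin> ball p (r p) \<longrightarrow> g' p x = 0)"
    by (simp only: choice_iff)
  then obtain g' H' where gH': "\<forall>p. p \<in> I \<longrightarrow> C2_grad UNIV (\<lambda>x. bump p (r p) x * F p x) (g' p) (H' p) \<and>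
      (\<forall>x. F p x = 0 \<longrightarrow> g' p x = bump p (r p) x *\<^sub>R G p x) \<and> (\<forall>x. x \<notin> ball p (r p) \<longrightarrow> g' p x = 0)"
    by (elim exE) (rule that)
  have gH: "C2_grad UNIV (\<lambda>x. bump p (r p) x * F p x) (g' p) (H' p)"
    "F p x = 0 \<Longrightarrow> g' p x = bump p (r p) x *\<^sub>R G p x"
    "x \<notin> ball p (r p) \<Longrightarrow> g' p x = 0" if "p \<in> I" for p x
    using mp[OF spec[OF gH', of p] that] by auto
  define f where "f x = (\<Sum>p\<in>I. bump p (r p) x * F p x)" for x
  define g where "g x = (\<Sum>p\<in>I. g' p x)" for x
  define H where "H x v = (\<Sum>p\<in>I. H' p x v)" for x v
  have C: "C2_grad UNIV f g H" unfolding f_def[abs_def] g_def[abs_def] H_def[abs_def]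
    by (rule C2_grad_sum[OF I(2) gH(1)])
  define W where "W = (\<Union>p\<in>I. ball p (r p))"
  have bz: "bump p (r p) x = 0" if "p \<in> I" "x \<notin> ball p (r p)" for p x
    using bump_pos_iff[of "r p" p x] bump_nonneg[of p "r p" x] R(1)[of p] that I(1) by fastforce
  have inU: "x \<in> U p" if "p \<in> I" "x \<in> ball p (r p)" for p x using R(2)[of p] that I(1) by (auto simp: subset_iff)
  have props: "(x \<in> D \<longleftrightarrow> f x < 0) \<and> (x \<in> frontier D \<longleftrightarrow> f x = 0) \<and> (x \<in> frontier D \<longrightarrow> g x \<noteq> 0)" if x: "x \<in> W" for x
  proof -
    obtain p0 where p0: "p0 \<in> I" "x \<in> ball p0 (r p0)" using x by (auto simp: W_def)
    have b0: "bump p0 (r p0) x > 0" using p0 bump_pos_iff[of "r p0" p0 x] R(1)[of p0] I(1) by blast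
    have c1: "f x < 0" if "x \<in> D"
    proof -
      have Fneg: "F p x < 0" if "p \<in> I" "x \<in> ball p (r p)" for p
        using R(4)[of p x] inU that I(1) \<open>x \<in> D\<close> by blast
      have "f x < (\<Sum>p\<in>I. 0)" unfolding f_def
      proof (rule sum_strict_mono_ex1[OF I(2)])
        show "\<forall>p\<in>I. bump p (r p) x * F p x \<le> 0"
        proof
          fix p assume p: "p \<in> I"
          show "bump p (r p) x * F p x \<le> 0"
            using bz[OF p] Fneg[OF p] bump_nonneg[of p "r p" x] by (cases "x \<in> ball p (r p)") (auto simp: mult_nonneg_nonpos less_imp_le)
        qed
        show "\<exists>p\<in>I. bump p (r p) x * F p x < 0" using p0 b0 Fneg by (intro bexI[of _ p0]) (auto simp: mult_pos_neg)
      qed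
      then show ?thesis by simp
    qed
    have c2: "f x > 0" if "x \<notin> D" "x \<notin> frontier D"
    proof -
      have Fpos: "F p x > 0" if "p \<in> I" "x \<in> ball p (r p)" for p
        using R(4)[of p x] inU that I(1) \<open>x \<notin> D\<close> \<open>x \<notin> frontier D\<close> by (meson linorder_neqE_linordered_idom subsetD)
      have "(\<Sum>p\<in>I. 0) < f x" unfolding f_def
      proof (rule sum_strict_mono_ex1[OF I(2)])
        show "\<forall>p\<in>I. 0 \<le> bump p (r p) x * F p x"
        proof
          fix p assume p: "p \<in> I"
          show "0 \<le> bump p (r p) x * F p x"
            using bz[OF p] Fpos[OF p] bump_nonneg[of p "r p" x] by (cases "x \<in> ball p (r p)") auto
        qed
        show "\<exists>p\<in>I. 0 < bump p (r p) x * F p x" using p0 b0 Fpos by (intro bexI[of _ p0]) auto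
      qed
      then show ?thesis by simp
    qed
    have c3: "f x = 0 \<and> g x \<noteq> 0" if xf: "x \<in> frontier D"
    proof -
      have Fz: "F p x = 0" "G p x \<noteq> 0" if "p \<in> I" "x \<in> ball p (r p)" for p
        using R(4)[of p x] inU that I(1) xf by blast+
      have "bump p (r p) x * F p x = 0" if "p \<in> I" for p
        using bz[OF that] Fz(1)[OF that] by (cases "x \<in> ball p (r p)") auto
      then have f0: "f x = 0" unfolding f_def by (intro sum.neutral) auto
      define a where "a = G p0 x"
      have a: "a \<bullet> a > 0" using Fz(2)[OF p0] by (simp add: a_def)
      have dot: "g' p x \<bullet> a \<ge> 0" if p: "p \<in> I" for p
      proof (cases "x \<in> ball p (r p)")
        case True
        have xU: "x \<in> U p" "x \<in> U p0" using inU p True p0 by auto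
        have oo: "open (U p \<inter> U p0)" using C2_gradD(1)[OF R(3)] p p0 I(1) by blast
        have "\<exists>l\<ge>0. G p x = l *\<^sub>R G p0 x"
        proof (rule defining_gradients_aligned[where x = x and ?f1.0 = "F p0" and ?f2.0 = "F p", OF _ _ Fz(1)[OF p0] Fz(1)[OF p True] Fz(2)[OF p0] oo])
          show "(F p0 has_derivative (\<bullet>) (G p0 x)) (at x)" by (rule C2_gradD(2)[OF R(3)]) (use p0 I(1) xU in auto)
          show "(F p has_derivative (\<bullet>) (G p x)) (at x)" by (rule C2_gradD(2)[OF R(3)]) (use p I(1) xU in auto)
          show "x \<in> U p \<inter> U p0" using xU by simp
          show "F p y \<le> 0" if "y \<in> U p \<inter> U p0" "F p0 y < 0" for y
            using R(4)[of p0 y] R(4)[of p y] that p p0 I(1) by (meson IntD1 IntD2 less_imp_le subsetD)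
        qed
        then obtain l where "l \<ge> 0" "G p x = l *\<^sub>R a" unfolding a_def by blast
        then show ?thesis using gH(2)[OF p Fz(1)[OF p True]] bump_nonneg[of p "r p" x] a by simp
      next
        case False
        then show ?thesis using gH(3)[OF p] by simp
      qed
      have "g x \<bullet> a = (\<Sum>p\<in>I. g' p x \<bullet> a)" by (simp add: g_def inner_sum_left)
      also have "\<dots> \<ge> g' p0 x \<bullet> a" by (rule member_le_sum[OF p0(1)]) (use dot I(2) in auto)
      also have "g' p0 x \<bullet> a = bump p0 (r p0) x * (a \<bullet> a)" using gH(2)[OF p0(1) Fz(1)[OF p0]] by (simp add: a_def)
      finally have "g x \<bullet> a > 0" using a b0 by (smt (verit) mult_pos_pos)
      then show ?thesis using f0 by auto
    qed
    show ?thesis using c1 c2 c3 fd by (metis less_irrefl less_asym)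
  qed
  show thesis
  proof (rule that[OF C, of W])
    show "open W" unfolding W_def by auto
    show "closure D \<subseteq> W" using I(3) by (simp add: W_def)
  qed (use props in blast)
qed

text \<open>Adding the reflected function keeps all signs, because \<open>D\<close> is symmetric,
  and keeps the gradient nonzero on the frontier by the alignment of gradients.\<close>

lemma even_global_defining_function:
  fixes D :: "(real \<times> 'v::euclidean_space) set"
  assumes D: "open D" "bounded D" and even: "\<And>\<xi> \<sigma>. (- \<xi>, \<sigma>) \<in> D \<longleftrightarrow> (\<xi>, \<sigma>) \<in> D"
    and loc: "\<And>p. p \<in> frontier D \<Longrightarrow> \<exists>U f g H. p \<in> U \<and> C2_grad U f g H \<and>
       (\<forall>x\<in>U. (x \<in> D \<longleftrightarrow> f x < 0) \<and> (x \<in> frontier D \<longleftrightarrow> f x = 0) \<and> (x \<in> frontier D \<longrightarrow> g x \<noteq> 0))"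
  obtains U f g H where "C2_grad UNIV f g H" "open U" "closure D \<subseteq> U" "\<And>\<xi> \<sigma>. f (- \<xi>, \<sigma>) = f (\<xi>, \<sigma>)"
    "\<forall>x\<in>U. (x \<in> D \<longleftrightarrow> f x < 0) \<and> (x \<in> frontier D \<longleftrightarrow> f x = 0) \<and> (x \<in> frontier D \<longrightarrow> g x \<noteq> 0)"
proof -
  obtain W f g H where C: "C2_grad UNIV f g H" and W: "open W" "closure D \<subseteq> W"
    and fW': "\<forall>x\<in>W. (x \<in> D \<longleftrightarrow> f x < 0) \<and> (x \<in> frontier D \<longleftrightarrow> f x = 0) \<and> (x \<in> frontier D \<longrightarrow> g x \<noteq> 0)"
    by (rule global_defining_function[OF D loc], assumption, rule that)
  note fW = bspec[OF fW']
  define R where "R x = (- fst x, snd x)" for x :: "real \<times> 'v"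
  have R: "(R has_derivative R) (at x)" for x
    unfolding R_def[abs_def] by (intro has_derivative_Pair has_derivative_minus has_derivative_fst has_derivative_snd has_derivative_ident)
  have RR: "R (R x) = x" for x by (simp add: R_def)
  have Ri: "R x \<bullet> y = x \<bullet> R y" for x y by (simp add: R_def inner_prod_def)
  have cR: "continuous_on S R" for S
    by (rule continuous_at_imp_continuous_on) (blast intro: has_derivative_continuous[OF R])
  have RD: "R x \<in> D \<longleftrightarrow> x \<in> D" "R x \<in> frontier D \<longleftrightarrow> x \<in> frontier D" "R x \<in> closure D \<longleftrightarrow> x \<in> closure D" for x
    using even[of "fst x" "snd x"] frontier_reflect[OF D(1) even] closure_reflect[OF even] by (simp_all add: R_def)
  have df: "((\<lambda>x. f (R x)) has_derivative (\<lambda>v. R (g (R x)) \<bullet> v)) (at x)" for x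
    using has_derivative_compose[OF R C2_gradD(2)[OF C UNIV_I]] by (simp add: Ri)
  define f2 where "f2 x = f x + f (R x)" for x
  define g2 where "g2 x = g x + R (g (R x))" for x
  define H2 where "H2 x v = H x v + R (H (R x) (R v))" for x v
  have C2: "C2_grad UNIV f2 g2 H2" unfolding C2_grad_def
  proof (intro conjI open_UNIV ballI allI)
    show "(f2 has_derivative (\<lambda>v. g2 x \<bullet> v)) (at x)" for x
      unfolding f2_def[abs_def] g2_def inner_add_left by (intro has_derivative_add df C2_gradD(2)[OF C UNIV_I])
    have "((\<lambda>x. R (g (R x))) has_derivative (\<lambda>v. R (H (R x) (R v)))) (at x)" for x
      by (rule has_derivative_compose[OF has_derivative_compose[OF R C2_gradD(3)[OF C UNIV_I]] R])
    then show "(g2 has_derivative H2 x) (at x)" for x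
      unfolding g2_def[abs_def] H2_def[abs_def] by (intro has_derivative_add C2_gradD(3)[OF C UNIV_I])
    show "continuous_on UNIV (\<lambda>x. H2 x v)" for v unfolding H2_def
      by (intro continuous_on_add C2_gradD(4)[OF C] continuous_on_compose2[OF cR[of UNIV]]
          continuous_on_compose2[OF C2_gradD(4)[OF C] cR]) auto
  qed
  define W2 where "W2 = W \<inter> R -` W"
  have oW2: "open W2" unfolding W2_def using W(1) continuous_on_open_vimage[of UNIV R] cR by auto
  have cW2: "closure D \<subseteq> W2" using W(2) RD(3) by (auto simp: W2_def)
  have props: "(x \<in> D \<longleftrightarrow> f2 x < 0) \<and> (x \<in> frontier D \<longleftrightarrow> f2 x = 0) \<and> (x \<in> frontier D \<longrightarrow> g2 x \<noteq> 0)" if x: "x \<in> W2" for x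
  proof -
    have w: "x \<in> W" "R x \<in> W" using x by (auto simp: W2_def)
    note 1 = fW[OF w(1)] and 2 = fW[OF w(2), unfolded RD]
    have "g2 x \<noteq> 0" if xf: "x \<in> frontier D"
    proof -
      have gx: "g x \<noteq> 0" using 1 xf by blast
      have "\<exists>l\<ge>0. R (g (R x)) = l *\<^sub>R g x"
      proof (rule defining_gradients_aligned[OF C2_gradD(2)[OF C UNIV_I] df _ _ gx oW2 x])
        show "f x = 0" "f (R x) = 0" using 1 2 xf by auto
        show "f (R y) \<le> 0" if "y \<in> W2" "f y < 0" for y
          using fW[of y] fW[of "R y"] that RD(1)[of y] by (auto simp: W2_def less_imp_le)
      qed
      then obtain l where l: "l \<ge> 0" "R (g (R x)) = l *\<^sub>R g x" by blast
      have "g2 x = (1 + l) *\<^sub>R g x" unfolding g2_def l(2) by (simp add: scaleR_add_left)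
      then show ?thesis using gx l(1) by simp
    qed
    moreover have "x \<in> D \<longleftrightarrow> f2 x < 0" "x \<in> frontier D \<longleftrightarrow> f2 x = 0"
      unfolding f2_def using 1 2 by linarith+
    ultimately show ?thesis by blast
  qed
  have "f2 (- \<xi>, \<sigma>) = f2 (\<xi>, \<sigma>)" for \<xi> \<sigma> by (simp add: f2_def R_def)
  from that[OF C2 oW2 cW2 this] props show thesis by blast
qed

section \<open>Reduction from the group\<close>

definition Phi :: "'h::euclidean_space \<times> 'v::euclidean_space \<Rightarrow> real \<times> 'v" where
  "Phi y = ((norm (fst y))\<^sup>2 / 4, snd y)"

text \<open>A right inverse of \<open>Phi\<close> on \<open>\<xi> \<ge> 0\<close>, extended evenly in \<open>\<xi>\<close>.\<close>

definition sec :: "'h::euclidean_space \<Rightarrow> real \<times> 'v::euclidean_space \<Rightarrow> 'h \<times> 'v" where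
  "sec w x = ((2 * sqrt \<bar>fst x\<bar>) *\<^sub>R w, snd x)"

lemma Phi_sec: "norm w = 1 \<Longrightarrow> Phi (sec w x) = (\<bar>fst x\<bar>, snd x)"
  by (simp add: Phi_def sec_def power_mult_distrib)

lemma sec_Phi: "fst y = norm (fst y) *\<^sub>R w \<Longrightarrow> sec w (Phi y) = y"
  by (simp add: Phi_def sec_def real_sqrt_divide prod_eq_iff)

lemma unit_direction: obtains w where "norm w = 1" "z = norm z *\<^sub>R (w :: 'h::euclidean_space)"
proof (cases "z = 0")
  case True
  obtain w :: 'h where "w \<in> Basis" using nonempty_Basis by blast
  then show ?thesis using that[of w] True by simp
next
  case False
  then show ?thesis using that[of "(1 / norm z) *\<^sub>R z"] by simp
qed

lemma Phi_deriv: "(Phi has_derivative (\<lambda>v. ((fst y \<bullet> fst v) / 2, snd v))) (at y)"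
proof -
  have "((\<lambda>y. (fst y \<bullet> fst y) / 4) has_derivative (\<lambda>v. (fst y \<bullet> fst v) / 2)) (at y)"
    by (auto intro!: derivative_eq_intros simp: inner_commute)
  then have "((\<lambda>y. ((fst y \<bullet> fst y) / 4, snd y)) has_derivative (\<lambda>v. ((fst y \<bullet> fst v) / 2, snd v))) (at y)"
    by (intro has_derivative_Pair has_derivative_snd has_derivative_ident)
  then show ?thesis unfolding Phi_def[abs_def] power2_norm_eq_inner .
qed

lemma continuous_Phi: "continuous_on S Phi"
  unfolding Phi_def[abs_def] by (intro continuous_intros) auto

lemma continuous_sec: "continuous_on S (sec w)"
  unfolding sec_def[abs_def] by (intro continuous_intros)

lemma C2_grad_comp_Phi:
  fixes f :: "real \<times> 'v::euclidean_space \<Rightarrow> real"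
  assumes C: "C2_grad UNIV f g H"
  shows "C2_grad UNIV (\<lambda>y::'h::euclidean_space \<times> 'v. f (Phi y)) (\<lambda>y. ((fst (g (Phi y)) / 2) *\<^sub>R fst y, snd (g (Phi y))))
    (\<lambda>y v. ((fst (g (Phi y)) / 2) *\<^sub>R fst v + (fst (H (Phi y) ((fst y \<bullet> fst v) / 2, snd v)) / 2) *\<^sub>R fst y,
       snd (H (Phi y) ((fst y \<bullet> fst v) / 2, snd v))))"
  unfolding C2_grad_def
proof (intro conjI open_UNIV ballI allI)
  fix y :: "'h \<times> 'v"
  have "((\<lambda>y. f (Phi y)) has_derivative (\<lambda>v. g (Phi y) \<bullet> ((fst y \<bullet> fst v) / 2, snd v))) (at y)"
    by (rule has_derivative_compose[OF Phi_deriv C2_gradD(2)[OF C UNIV_I]])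
  then show "((\<lambda>y. f (Phi y)) has_derivative (\<lambda>v. ((fst (g (Phi y)) / 2) *\<^sub>R fst y, snd (g (Phi y))) \<bullet> v)) (at y)"
    by (simp add: inner_prod_def)
  have dg: "((\<lambda>y. g (Phi y)) has_derivative (\<lambda>v. H (Phi y) ((fst y \<bullet> fst v) / 2, snd v))) (at y)"
    by (rule has_derivative_compose[OF Phi_deriv C2_gradD(3)[OF C UNIV_I]])
  have "((\<lambda>y. fst (g (Phi y)) / 2) has_derivative (\<lambda>v. fst (H (Phi y) ((fst y \<bullet> fst v) / 2, snd v)) / 2)) (at y)"
    using has_derivative_mult_right[OF has_derivative_fst[OF dg], of "1/2"] by simp
  then show "((\<lambda>y. ((fst (g (Phi y)) / 2) *\<^sub>R fst y, snd (g (Phi y)))) has_derivative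
     (\<lambda>v. ((fst (g (Phi y)) / 2) *\<^sub>R fst v + (fst (H (Phi y) ((fst y \<bullet> fst v) / 2, snd v)) / 2) *\<^sub>R fst y,
       snd (H (Phi y) ((fst y \<bullet> fst v) / 2, snd v))))) (at y)"
    by (intro has_derivative_Pair has_derivative_scaleR has_derivative_fst has_derivative_snd has_derivative_ident dg)
next
  fix v :: "'h \<times> 'v"
  have cg: "continuous_on UNIV (\<lambda>y::'h \<times> 'v. g (Phi y))"
  proof -
    have "continuous_on UNIV g"
      by (rule continuous_at_imp_continuous_on) (blast intro: has_derivative_continuous[OF C2_gradD(3)[OF C UNIV_I]])
    then show ?thesis by (rule continuous_on_compose2[OF _ continuous_Phi]) auto
  qed
  have "continuous_on UNIV (\<lambda>y. H (Phi y) ((fst y \<bullet> fst v) / 2, snd v))"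
    by (rule continuous_on_hessian_apply[OF C continuous_Phi]) (auto intro!: continuous_intros)
  then show "continuous_on UNIV (\<lambda>y. ((fst (g (Phi y)) / 2) *\<^sub>R fst v + (fst (H (Phi y) ((fst y \<bullet> fst v) / 2, snd v)) / 2) *\<^sub>R fst y,
       snd (H (Phi y) ((fst y \<bullet> fst v) / 2, snd v))))"
    by (intro continuous_intros cg) auto
qed

text \<open>The image of \<open>X_field br e\<close> at a point \<open>(z, \<sigma>)\<close> under the derivative of \<open>Phi\<close>, and the adjoint map.\<close>

definition lift_vec :: "('h::euclidean_space \<times> 'v::euclidean_space \<Rightarrow> 'h \<times> 'v \<Rightarrow> 'h \<times> 'v) \<Rightarrow> 'h \<Rightarrow> 'h \<Rightarrow> real \<times> 'v" where
  "lift_vec br z e = ((z \<bullet> e) / 2, (1/2) *\<^sub>R hbr br z e)"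

definition lift_adj :: "('h::euclidean_space \<times> 'v::euclidean_space \<Rightarrow> 'h \<times> 'v \<Rightarrow> 'h \<times> 'v) \<Rightarrow> 'h \<Rightarrow> real \<times> 'v \<Rightarrow> 'h" where
  "lift_adj br z x = (1/2) *\<^sub>R (fst x *\<^sub>R z + J br (snd x) z)"

section \<open>Heisenberg type algebra and horizontal operators on functions of \<xi> and
  \<sigma>\<close>

context
  fixes br :: "'h::euclidean_space \<times> 'v::euclidean_space \<Rightarrow> 'h \<times> 'v \<Rightarrow> 'h \<times> 'v"
  assumes ht: "heisenberg_type br"
begin

lemma hbr_self: "hbr br z z = 0"
  using ht by (simp add: heisenberg_type_def lie_bracket_def hbr_def)

lemma hbr_add: "hbr br z (v + w) = hbr br z v + hbr br z w" "hbr br (v + w) z = hbr br v z + hbr br w z"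
  using bilinear_radd[OF bilinear_hbr[OF ht]] bilinear_ladd[OF bilinear_hbr[OF ht]] by auto

lemma hbr_antisym: "hbr br z w = - hbr br w z"
  using hbr_self[of "z + w"] unfolding hbr_add by (simp add: hbr_self eq_neg_iff_add_eq_0 add.commute)

lemma J_J: "J br \<sigma> (J br \<sigma> z) = - ((norm \<sigma>)\<^sup>2 *\<^sub>R z)"
  using ht unfolding heisenberg_type_def by blast

lemma J_self: "J br \<sigma> z \<bullet> z = 0"
  by (simp add: J_inner[OF ht] hbr_self)

lemma J_norm: "J br \<sigma> z \<bullet> J br \<sigma> z = (\<sigma> \<bullet> \<sigma>) * (z \<bullet> z)"
proof -
  have "J br \<sigma> z \<bullet> J br \<sigma> z = hbr br z (J br \<sigma> z) \<bullet> \<sigma>" by (rule J_inner[OF ht])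
  also have "\<dots> = - (hbr br (J br \<sigma> z) z \<bullet> \<sigma>)" by (subst hbr_antisym) simp
  also have "\<dots> = - (J br \<sigma> (J br \<sigma> z) \<bullet> z)" by (simp add: J_inner[OF ht])
  finally show ?thesis unfolding J_J by (simp add: power2_norm_eq_inner)
qed

lemma J_add: "J br (\<sigma> + \<tau>) z = J br \<sigma> z + J br \<tau> z"
  by (rule vector_eq_rdot[THEN iffD1]) (simp add: inner_add_left inner_add_right J_inner[OF ht])

lemma J_inner_J: "J br \<sigma> z \<bullet> J br \<tau> z = (\<sigma> \<bullet> \<tau>) * (z \<bullet> z)"
proof -
  have "2 * (J br \<sigma> z \<bullet> J br \<tau> z) = J br (\<sigma> + \<tau>) z \<bullet> J br (\<sigma> + \<tau>) z - J br \<sigma> z \<bullet> J br \<sigma> z - J br \<tau> z \<bullet> J br \<tau> z"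
    unfolding J_add by (simp add: inner_add_left inner_add_right inner_commute)
  then show ?thesis unfolding J_norm by (simp add: inner_add_left inner_add_right inner_commute algebra_simps)
qed

lemma lift_vec_inner: "lift_vec br z e \<bullet> x = e \<bullet> lift_adj br z x"
proof -
  have "e \<bullet> J br (snd x) z = snd x \<bullet> hbr br z e" by (simp add: J_inner[OF ht] inner_commute[of e] inner_commute[of "snd x"])
  then show ?thesis
    by (simp add: lift_vec_def lift_adj_def inner_prod_def inner_add_right inner_commute)
qed

text \<open>Here the Heisenberg type condition is felt: J \<sigma> z is orthogonal to z and has norm
  |\<sigma>| |z|. So the horizontal differential of \<open>Phi\<close> is, up to the factor \<xi> in
  squared norms, a coisometry onto the Euclidean space of \<xi> and \<sigma>, and horizontal
  quantities become Euclidean ones.\<close>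

lemma lift_adj_inner: "lift_adj br z x \<bullet> lift_adj br z y = (norm z)\<^sup>2 / 4 * (x \<bullet> y)"
  using J_self[of "snd x" z] J_self[of "snd y" z]
  by (simp add: lift_adj_def inner_prod_def inner_add_left inner_add_right J_inner_J power2_norm_eq_inner inner_commute algebra_simps)

lemma sum_lift_vec_inner:
  "(\<Sum>e\<in>Basis. (x \<bullet> lift_vec br z e) * (y \<bullet> lift_vec br z e)) = (norm z)\<^sup>2 / 4 * (x \<bullet> y)"
proof -
  have "(\<Sum>e\<in>Basis. (x \<bullet> lift_vec br z e) * (y \<bullet> lift_vec br z e)) = (\<Sum>e\<in>Basis. (lift_adj br z x \<bullet> e) * (lift_adj br z y \<bullet> e))"
  proof (intro sum.cong refl)
    fix e
    have "w \<bullet> lift_vec br z e = lift_adj br z w \<bullet> e" for w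
      using lift_vec_inner[of z e w] by (simp add: inner_commute)
    then show "(x \<bullet> lift_vec br z e) * (y \<bullet> lift_vec br z e) = (lift_adj br z x \<bullet> e) * (lift_adj br z y \<bullet> e)" by simp
  qed
  then show ?thesis by (simp only: euclidean_inner[symmetric] lift_adj_inner)
qed

lemma sum_lift_vec_linear:
  assumes T: "linear T"
  shows "(\<Sum>e\<in>Basis. T (lift_vec br z e) \<bullet> lift_vec br z e) = (norm z)\<^sup>2 / 4 * (\<Sum>b\<in>Basis. T b \<bullet> b)"
proof -
  have "T (lift_vec br z e) = (\<Sum>b\<in>Basis. (lift_vec br z e \<bullet> b) *\<^sub>R T b)" for e
    by (rule sum_Basis_inner_scaleR_linear[OF T, symmetric])
  then have "(\<Sum>e\<in>Basis. T (lift_vec br z e) \<bullet> lift_vec br z e)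
    = (\<Sum>e\<in>Basis. \<Sum>b\<in>Basis. (T b \<bullet> lift_vec br z e) * (b \<bullet> lift_vec br z e))"
  proof (intro sum.cong refl)
    fix e
    assume "\<And>e. T (lift_vec br z e) = (\<Sum>b\<in>Basis. (lift_vec br z e \<bullet> b) *\<^sub>R T b)"
    then have "T (lift_vec br z e) \<bullet> lift_vec br z e = (\<Sum>b\<in>Basis. (lift_vec br z e \<bullet> b) *\<^sub>R T b) \<bullet> lift_vec br z e" by simp
    also have "\<dots> = (\<Sum>b\<in>Basis. (T b \<bullet> lift_vec br z e) * (b \<bullet> lift_vec br z e))"
      unfolding inner_sum_left by (simp add: inner_commute[of "lift_vec br z e"] mult.commute)
    finally show "T (lift_vec br z e) \<bullet> lift_vec br z e = (\<Sum>b\<in>Basis. (T b \<bullet> lift_vec br z e) * (b \<bullet> lift_vec br z e))" .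
  qed
  also have "\<dots> = (\<Sum>b\<in>Basis. \<Sum>e\<in>Basis. (T b \<bullet> lift_vec br z e) * (b \<bullet> lift_vec br z e))" by (rule sum.swap)
  also have "\<dots> = (norm z)\<^sup>2 / 4 * (\<Sum>b\<in>Basis. T b \<bullet> b)" by (simp only: sum_lift_vec_inner sum_distrib_left)
  finally show ?thesis .
qed

text \<open>On a line, orthogonality of J \<sigma> z to z would force J \<sigma> z = 0, against its
  norm. This yields a > 0 for the exponent of the weight.\<close>

lemma DIM_ge_2: "DIM('h) \<ge> 2"
proof (rule ccontr)
  assume "\<not> DIM('h) \<ge> 2"
  then have "DIM('h) = 1" using DIM_positive[where 'a='h] by linarith
  then obtain e where B: "(Basis :: 'h set) = {e}" using card_1_singletonE by blast
  then have e: "e \<in> Basis" using B by blast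
  obtain s :: 'v where s: "s \<in> Basis" using nonempty_Basis by blast
  have "J br s e = 0"
  proof (rule euclidean_eqI)
    fix b :: 'h assume "b \<in> Basis"
    then have "b = e" using B by blast
    then show "J br s e \<bullet> b = 0 \<bullet> b" using J_self[of s e] by simp
  qed
  then show False using J_norm[of s e] e s by simp
qed

lemma X_deriv_comp_Phi:
  assumes "(h has_derivative (\<lambda>v. q \<bullet> v)) (at (Phi y))"
  shows "X_deriv br e (\<lambda>y. h (Phi y)) y = q \<bullet> lift_vec br (fst y) e"
proof -
  have "((\<lambda>y. h (Phi y)) has_derivative (\<lambda>v. q \<bullet> ((fst y \<bullet> fst v) / 2, snd v))) (at y)"
    by (rule has_derivative_compose[OF Phi_deriv assms])
  from frechet_derivative_at[OF this, symmetric] show ?thesis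
    by (simp add: X_deriv_def X_field_eq[OF ht] lift_vec_def)
qed

lemma metric_hgrad: "metric br x (hgrad br f x) (hgrad br k x) = (\<Sum>e\<in>Basis. X_deriv br e f x * X_deriv br e k x)"
proof -
  have "linear (pull_back br x)"
    unfolding pull_back_def using bilinear_hbr[OF ht]
    by (intro linearI) (auto simp: hbr_add bilinear_rmul algebra_simps)
  then have "pull_back br x (hgrad br f x) = (\<Sum>e\<in>Basis. X_deriv br e f x *\<^sub>R (e, 0))" for f
    unfolding hgrad_def by (simp only: linear_sum linear_cmul pull_back_X[OF ht])
  also have "(\<Sum>e\<in>Basis. X_deriv br e f x *\<^sub>R (e, 0)) = ((\<Sum>e\<in>Basis. X_deriv br e f x *\<^sub>R e), 0)" for f
    by (simp add: prod_eq_iff fst_sum snd_sum)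
  finally show ?thesis
    unfolding metric_def inner_prod_def
    by (simp add: euclidean_inner[of "sum (\<lambda>e. X_deriv br e f x *\<^sub>R e) Basis" "sum (\<lambda>e. X_deriv br e k x *\<^sub>R e) Basis"])
qed

text \<open>Squared horizontal gradients pick up the factor \<xi>. Each basis vector e adds half the
  \<xi>-derivative to the Laplacian, since differentiating \<open>lift_vec\<close> along e gives
  (1/2, 0) because the bracket of e with itself is 0; hence m / 2. In the infinity Laplacian the
  first summand comes from differentiating the factor \<xi>.\<close>

lemma
  fixes f :: "real \<times> 'v \<Rightarrow> real"
  assumes C: "C2_grad UNIV f g H"
  shows hgrad_norm_comp_Phi: "(hgrad_norm br (\<lambda>y. f (Phi y)) y)\<^sup>2 = (norm (fst y))\<^sup>2 / 4 * (g (Phi y) \<bullet> g (Phi y))"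
    and hlaplacian_comp_Phi: "hlaplacian br (\<lambda>y. f (Phi y)) y
       = (norm (fst y))\<^sup>2 / 4 * (\<Sum>b\<in>Basis. H (Phi y) b \<bullet> b) + real DIM('h) / 2 * fst (g (Phi y))"
    and hinf_laplacian_comp_Phi: "hinf_laplacian br (\<lambda>y. f (Phi y)) y
       = 1/2 * ((norm (fst y))\<^sup>2 / 4) * (fst (g (Phi y)) * (g (Phi y) \<bullet> g (Phi y))
           + 2 * ((norm (fst y))\<^sup>2 / 4) * (H (Phi y) (g (Phi y)) \<bullet> g (Phi y)))"
proof -
  have X: "X_deriv br e (\<lambda>y. f (Phi y)) y = g (Phi y) \<bullet> lift_vec br (fst y) e" for e y
    by (rule X_deriv_comp_Phi[OF C2_gradD(2)[OF C UNIV_I]])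
  show hn: "(hgrad_norm br (\<lambda>y. f (Phi y)) y)\<^sup>2 = (norm (fst y))\<^sup>2 / 4 * (g (Phi y) \<bullet> g (Phi y))" for y
  proof -
    have "metric br y (hgrad br (\<lambda>y. f (Phi y)) y) (hgrad br (\<lambda>y. f (Phi y)) y) = (norm (fst y))\<^sup>2 / 4 * (g (Phi y) \<bullet> g (Phi y))"
      unfolding metric_hgrad X by (rule sum_lift_vec_inner)
    moreover have "metric br y v v \<ge> 0" for v by (simp add: metric_def)
    ultimately show ?thesis unfolding hgrad_norm_def by (metis real_sqrt_pow2)
  qed
  have XX: "X_deriv br e (X_deriv br e (\<lambda>y. f (Phi y))) y
     = H (Phi y) (lift_vec br (fst y) e) \<bullet> lift_vec br (fst y) e + fst (g (Phi y)) / 2" if e: "e \<in> Basis" for e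
  proof -
    have bl: "bounded_linear (hbr br w)" "bounded_linear (\<lambda>z. hbr br z w)" for w
      using bilinear_hbr[OF ht] linear_conv_bounded_linear unfolding bilinear_def by blast+
    have dl: "((\<lambda>y::'h \<times> 'v. lift_vec br (fst y) e) has_derivative (\<lambda>v. lift_vec br (fst v) e)) (at y)"
      unfolding lift_vec_def
      by (intro has_derivative_Pair has_derivative_scaleR_right bounded_linear.has_derivative[OF bl(2)] has_derivative_fst has_derivative_ident)
        (auto intro!: derivative_eq_intros)
    have dg: "((\<lambda>y. g (Phi y)) has_derivative (\<lambda>v. H (Phi y) ((fst y \<bullet> fst v) / 2, snd v))) (at y)"
      by (rule has_derivative_compose[OF Phi_deriv C2_gradD(3)[OF C UNIV_I]])
    have "((\<lambda>y. g (Phi y) \<bullet> lift_vec br (fst y) e) has_derivative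
       (\<lambda>v. g (Phi y) \<bullet> lift_vec br (fst v) e + H (Phi y) ((fst y \<bullet> fst v) / 2, snd v) \<bullet> lift_vec br (fst y) e)) (at y)"
      by (rule has_derivative_inner[OF dg dl])
    from frechet_derivative_at[OF this, symmetric]
    have "X_deriv br e (\<lambda>y. g (Phi y) \<bullet> lift_vec br (fst y) e) y
       = g (Phi y) \<bullet> lift_vec br e e + H (Phi y) (lift_vec br (fst y) e) \<bullet> lift_vec br (fst y) e"
      unfolding X_deriv_def X_field_eq[OF ht] by (simp add: lift_vec_def)
    moreover have "lift_vec br e e = (1/2, 0)" using e by (simp add: lift_vec_def hbr_self)
    ultimately show ?thesis unfolding X[abs_def] by (simp add: inner_prod_def)
  qed
  show "hlaplacian br (\<lambda>y. f (Phi y)) y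
       = (norm (fst y))\<^sup>2 / 4 * (\<Sum>b\<in>Basis. H (Phi y) b \<bullet> b) + real DIM('h) / 2 * fst (g (Phi y))"
    unfolding hlaplacian_def
    by (simp add: XX sum.distrib sum_lift_vec_linear[OF C2_grad_linear[OF C UNIV_I]] cong: sum.cong)
  define q where "q = (g (Phi y) \<bullet> g (Phi y), 0) + (2 * fst (Phi y)) *\<^sub>R H (Phi y) (g (Phi y))"
  have "((\<lambda>x. fst x * (g x \<bullet> g x)) has_derivative
      (\<lambda>v. fst x * (g x \<bullet> H x v + H x v \<bullet> g x) + fst v * (g x \<bullet> g x))) (at x)" for x
    by (intro has_derivative_mult has_derivative_inner C2_gradD(3)[OF C UNIV_I] has_derivative_fst has_derivative_ident)
  moreover have "fst (Phi y) * (g (Phi y) \<bullet> H (Phi y) v + H (Phi y) v \<bullet> g (Phi y)) + fst v * (g (Phi y) \<bullet> g (Phi y)) = q \<bullet> v" for v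
    using C2_grad_symmetric[OF C UNIV_I, of "Phi y" v "g (Phi y)"]
    by (simp add: q_def inner_add_left inner_prod_def inner_commute algebra_simps)
  ultimately have dh: "((\<lambda>x. fst x * (g x \<bullet> g x)) has_derivative (\<lambda>v. q \<bullet> v)) (at (Phi y))"
    by (metis (no_types, lifting) ext)
  have "(\<lambda>y. (hgrad_norm br (\<lambda>y. f (Phi y)) y)\<^sup>2) = (\<lambda>y. (\<lambda>x. fst x * (g x \<bullet> g x)) (Phi y))"
    unfolding hn by (simp add: Phi_def)
  then have X2: "X_deriv br e (\<lambda>y. (hgrad_norm br (\<lambda>y. f (Phi y)) y)\<^sup>2) y = q \<bullet> lift_vec br (fst y) e" for e
    using X_deriv_comp_Phi[OF dh, of e] by simp
  have "hinf_laplacian br (\<lambda>y. f (Phi y)) y = 1/2 * ((norm (fst y))\<^sup>2 / 4 * (q \<bullet> g (Phi y)))"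
    unfolding hinf_laplacian_def metric_hgrad X2 X sum_lift_vec_inner ..
  also have "q \<bullet> g (Phi y) = fst (g (Phi y)) * (g (Phi y) \<bullet> g (Phi y)) + 2 * ((norm (fst y))\<^sup>2 / 4) * (H (Phi y) (g (Phi y)) \<bullet> g (Phi y))"
    by (simp add: q_def inner_add_left inner_prod_def Phi_def algebra_simps)
  finally show "hinf_laplacian br (\<lambda>y. f (Phi y)) y
       = 1/2 * ((norm (fst y))\<^sup>2 / 4) * (fst (g (Phi y)) * (g (Phi y) \<bullet> g (Phi y))
           + 2 * ((norm (fst y))\<^sup>2 / 4) * (H (Phi y) (g (Phi y)) \<bullet> g (Phi y)))" by simp
qed

end

text \<open>One inclusion is continuity of \<open>Phi\<close>. For the other, the section in the
  direction of fst y passes through y and, by evenness, maps \<open>D\<close> into the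
  preimage.\<close>

lemma closure_preimage_Phi:
  fixes D :: "(real \<times> 'v::euclidean_space) set" and y :: "'h::euclidean_space \<times> 'v"
  assumes even: "\<And>\<xi> \<sigma>. (- \<xi>, \<sigma>) \<in> D \<longleftrightarrow> (\<xi>, \<sigma>) \<in> D"
  shows "y \<in> closure {y. Phi y \<in> D} \<longleftrightarrow> Phi y \<in> closure D"
proof
  assume "y \<in> closure {y. Phi y \<in> D}"
  moreover have "Phi ` closure {y::'h \<times> 'v. Phi y \<in> D} \<subseteq> closure D"
    by (rule image_closure_subset[OF continuous_Phi closed_closure]) (use closure_subset[of D] in blast)
  ultimately show "Phi y \<in> closure D" by blast
next
  assume p: "Phi y \<in> closure D"
  obtain w where w: "norm w = 1" "fst y = norm (fst y) *\<^sub>R w" by (rule unit_direction)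
  have "sec w ` D \<subseteq> {y. Phi y \<in> D}"
  proof (rule image_subsetI)
    fix x assume "x \<in> D"
    then show "sec w x \<in> {y. Phi y \<in> D}" using even[of "fst x" "snd x"] by (simp add: Phi_sec[OF w(1)] abs_if)
  qed
  then have "sec w ` closure D \<subseteq> closure {y. Phi y \<in> D}"
    by (intro image_closure_subset[OF continuous_sec closed_closure]) (use closure_subset in blast)
  then show "y \<in> closure {y. Phi y \<in> D}" using p sec_Phi[OF w(2)] by (metis image_subset_iff)
qed

lemma open_preimage_Phi:
  assumes "open D"
  shows "open {y::'h::euclidean_space \<times> 'v::euclidean_space. Phi y \<in> D}"
  using open_vimage[OF assms continuous_Phi] by (simp add: vimage_def)

lemma frontier_preimage_Phi:
  fixes D :: "(real \<times> 'v::euclidean_space) set" and y :: "'h::euclidean_space \<times> 'v"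
  assumes "open D" "\<And>\<xi> \<sigma>. (- \<xi>, \<sigma>) \<in> D \<longleftrightarrow> (\<xi>, \<sigma>) \<in> D"
  shows "y \<in> frontier {y. Phi y \<in> D} \<longleftrightarrow> Phi y \<in> frontier D"
  using closure_preimage_Phi[of D y, OF assms(2)] assms(1) open_preimage_Phi[OF assms(1), where 'h='h]
  by (simp add: frontier_def interior_open)

text \<open>The regularity assumption speaks of functions f o Phi in the group. Restricting to a
  section, f itself describes \<open>D\<close> near p, also for \<xi> < 0 because f and its domain
  are even. Its gradient is nonzero on the frontier, as otherwise the chain rule would make the
  derivative of f o Phi vanish.\<close>

lemma section_defining_function:
  fixes D :: "(real \<times> 'v::euclidean_space) set" and \<Omega> :: "('h::euclidean_space \<times> 'v) set"
  assumes D: "open D" and even: "\<And>\<xi> \<sigma>. (- \<xi>, \<sigma>) \<in> D \<longleftrightarrow> (\<xi>, \<sigma>) \<in> D"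
    and Om: "\<Omega> = {y. Phi y \<in> D}" and ps: "partially_symmetric_C2 \<Omega>" and p: "p \<in> frontier D"
  shows "\<exists>U f g H. p \<in> U \<and> C2_grad U f g H \<and>
       (\<forall>x\<in>U. (x \<in> D \<longleftrightarrow> f x < 0) \<and> (x \<in> frontier D \<longleftrightarrow> f x = 0) \<and> (x \<in> frontier D \<longrightarrow> g x \<noteq> 0))"
proof -
  obtain w :: 'h where w: "norm w = 1" by (rule unit_direction)
  have abs: "Phi (sec w x) \<in> D \<longleftrightarrow> x \<in> D" "Phi (sec w x) \<in> frontier D \<longleftrightarrow> x \<in> frontier D" for x
    using even[of "fst x" "snd x"] frontier_reflect[OF D even, of x]
    by (auto simp: Phi_sec[OF w] abs_if)
  have sec: "sec w x \<in> \<Omega> \<longleftrightarrow> x \<in> D" "sec w x \<in> frontier \<Omega> \<longleftrightarrow> x \<in> frontier D" for x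
    unfolding Om frontier_preimage_Phi[OF D even] mem_Collect_eq by (rule abs)+
  obtain U and V :: "(real \<times> 'v) set" and f where
    C: "C2_on V f" and Ve: "\<forall>\<xi> \<sigma>. (\<xi>, \<sigma>) \<in> V \<longrightarrow> (- \<xi>, \<sigma>) \<in> V \<and> f (- \<xi>, \<sigma>) = f (\<xi>, \<sigma>)"
    and UV: "\<forall>(z, \<sigma>)\<in>U. ((norm z)\<^sup>2 / 4, \<sigma>) \<in> V"
    and ldf: "local_defining_function \<Omega> (sec w p) U (\<lambda>(z, \<sigma>). f ((norm z)\<^sup>2 / 4, \<sigma>))"
    using bspec[OF ps[unfolded partially_symmetric_C2_def] sec(2)[THEN iffD2, OF p]] by blast
  have eF: "(\<lambda>(z, \<sigma>). f ((norm z)\<^sup>2 / 4, \<sigma>)) = (\<lambda>y. f (Phi y))"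
    by (auto simp: Phi_def)
  note L = ldf[unfolded eF local_defining_function_def]
  have oU: "open U" using L unfolding C2_on_def by blast
  have PV: "Phi y \<in> V" if "y \<in> U" for y using UV that unfolding Phi_def by (cases y) auto
  obtain g H where g: "C2_grad V f g H" using C2_on_imp_C2_grad[OF C] .
  define W where "W = sec w -` U"
  have oW: "open W" unfolding W_def by (rule open_vimage[OF oU continuous_sec])
  have WV: "(\<bar>fst x\<bar>, snd x) \<in> V \<and> x \<in> V \<and> f (\<bar>fst x\<bar>, snd x) = f x" if "x \<in> W" for x
  proof -
    have "(\<bar>fst x\<bar>, snd x) \<in> V" using PV[of "sec w x"] that by (simp add: W_def Phi_sec[OF w])
    then show ?thesis using Ve[rule_format, of "\<bar>fst x\<bar>" "snd x"] by (auto simp: abs_if split: if_splits)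
  qed
  have gW: "C2_grad W f g H" using g oW WV unfolding C2_grad_def by (meson continuous_on_subset subsetI)
  have "g x \<noteq> 0" if x: "x \<in> W" "x \<in> frontier D" for x
  proof
    assume 0: "g x = 0"
    have dx: "(f has_derivative (\<lambda>v. 0)) (at x)" using C2_gradD(2)[OF gW x(1)] 0 by simp
    \<comment> \<open>The section only reaches \<xi> \<ge> 0, so a critical point in \<xi> < 0 is
      first reflected.\<close>
    have "(f has_derivative (\<lambda>v. 0)) (at (\<bar>fst x\<bar>, snd x))"
    proof (cases "fst x \<ge> 0")
      case True
      then show ?thesis using dx by simp
    next
      case False
      let ?y = "(- fst x, snd x)"
      have "((\<lambda>y. (- fst y, snd y)) has_derivative (\<lambda>y. (- fst y, snd y))) (at ?y)"
        by (intro has_derivative_Pair has_derivative_minus has_derivative_fst has_derivative_snd has_derivative_ident)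
      from has_derivative_compose[OF this, of f "\<lambda>_. 0"] dx
      have "((\<lambda>y. f (- fst y, snd y)) has_derivative (\<lambda>_. 0)) (at ?y)" by simp
      then have "(f has_derivative (\<lambda>_. 0)) (at ?y)"
      proof (rule has_derivative_transform_within_open)
        show "open V" using g by (rule C2_gradD(1))
        show "?y \<in> V" using WV[OF x(1)] False by simp
        show "f (- fst y, snd y) = f y" if "y \<in> V" for y
          using Ve[rule_format, of "fst y" "snd y"] that by simp
      qed
      then show ?thesis using False by simp
    qed
    then have "(f has_derivative (\<lambda>v. 0)) (at (Phi (sec w x)))" by (simp add: Phi_sec[OF w])
    from has_derivative_compose[OF Phi_deriv this]
    have "frechet_derivative (\<lambda>y. f (Phi y)) (at (sec w x)) = (\<lambda>_. 0)"
      by (rule frechet_derivative_at[symmetric])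
    then show False using L x sec(2) by (auto simp: W_def)
  qed
  moreover have "(x \<in> D \<longleftrightarrow> f x < 0) \<and> (x \<in> frontier D \<longleftrightarrow> f x = 0)" if "x \<in> W" for x
  proof -
    have "f (Phi (sec w x)) = f x" using WV[OF that] by (simp add: Phi_sec[OF w])
    moreover have "sec w x \<in> U" using that by (simp add: W_def)
    ultimately show ?thesis using L sec by metis
  qed
  moreover have "p \<in> W" using L by (simp add: W_def)
  ultimately show ?thesis using gW by blast
qed

text \<open>The normal in \<open>characteristic_set\<close> may come from another defining function.
  Aligned gradients transfer the vanishing of its horizontal derivatives to f o Phi, whose
  horizontal gradient has squared norm \<xi> |q|^2, not 0 for z \<noteq> 0.\<close>

lemma noncharacteristic:
  fixes br :: "'h::euclidean_space \<times> 'v::euclidean_space \<Rightarrow> 'h \<times> 'v \<Rightarrow> 'h \<times> 'v"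
  assumes ht: "heisenberg_type br"
    and ldf: "local_defining_function \<Omega> y U (\<lambda>y. f (Phi y))"
    and df: "(f has_derivative (\<lambda>v. q \<bullet> v)) (at (Phi y))" and q: "q \<noteq> 0" and z: "fst y \<noteq> 0"
  shows "y \<notin> characteristic_set br \<Omega>"
proof
  assume "y \<in> characteristic_set br \<Omega>"
  then obtain \<nu> where yf: "y \<in> frontier \<Omega>" and nu: "outer_unit_normal br \<Omega> y \<nu>"
    and s0: "(\<Sum>e\<in>Basis. (metric br y \<nu> (X_field br e y))\<^sup>2) = 0"
    unfolding characteristic_set_def by blast
  have m0: "metric br y \<nu> (X_field br e y) = 0" if "e \<in> Basis" for e
    using s0 that by (simp add: sum_nonneg_eq_0_iff)
  obtain U2 f2 c where l2: "local_defining_function \<Omega> y U2 f2"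
    and fr: "\<And>w. frechet_derivative f2 (at y) w = c * metric br y \<nu> w"
    using nu unfolding outer_unit_normal_def by blast
  note L1 = ldf[unfolded local_defining_function_def] and L2 = l2[unfolded local_defining_function_def]
  obtain g2 H2 where g2: "C2_grad U2 f2 g2 H2" using C2_on_imp_C2_grad L2 by blast
  have y: "y \<in> U" "y \<in> U2" using L1 L2 by auto
  have oU: "open U" "open U2" using L1 L2 unfolding C2_on_def by auto
  have d2: "(f2 has_derivative (\<lambda>v. g2 y \<bullet> v)) (at y)" by (rule C2_gradD(2)[OF g2 y(2)])
  note fr2 = frechet_derivative_at[OF d2]
  have "g2 y \<noteq> 0"
  proof
    assume "g2 y = 0"
    then have "frechet_derivative f2 (at y) = (\<lambda>_. 0)" unfolding fr2[symmetric] by auto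
    then show False using L2 yf by blast
  qed
  define G where "G = ((fst q / 2) *\<^sub>R fst y, snd q)"
  have dF: "((\<lambda>y. f (Phi y)) has_derivative (\<lambda>v. G \<bullet> v)) (at y)"
    using has_derivative_compose[OF Phi_deriv df] by (simp add: G_def inner_prod_def)
  have "\<exists>l\<ge>0. G = l *\<^sub>R g2 y"
  proof (rule defining_gradients_aligned[OF d2 dF _ _ \<open>g2 y \<noteq> 0\<close>])
    show "f2 y = 0" "f (Phi y) = 0" using L1 L2 yf by auto
    show "open (U \<inter> U2)" "y \<in> U \<inter> U2" using oU y by auto
    show "f (Phi x) \<le> 0" if "x \<in> U \<inter> U2" "f2 x < 0" for x
      using L1 L2 that by (metis IntD1 IntD2 less_imp_le)
  qed
  then obtain l where l: "G = l *\<^sub>R g2 y" by blast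
  have "q \<bullet> lift_vec br (fst y) e = 0" if e: "e \<in> Basis" for e
  proof -
    have "g2 y \<bullet> X_field br e y = 0" using fr[of "X_field br e y"] m0[OF e] fr2 by (metis mult_zero_right)
    then have "G \<bullet> X_field br e y = 0" by (simp add: l)
    then have "X_deriv br e (\<lambda>y. f (Phi y)) y = 0"
      unfolding X_deriv_def frechet_derivative_at[OF dF, symmetric] .
    then show ?thesis by (simp only: X_deriv_comp_Phi[OF ht df])
  qed
  then have "(norm (fst y))\<^sup>2 / 4 * (q \<bullet> q) = 0"
    unfolding sum_lift_vec_inner[OF ht, symmetric] by simp
  then show False using q z by simp
qed

theorem proposition6p3:
  fixes br :: "'h::euclidean_space \<times> 'v::euclidean_space \<Rightarrow> 'h \<times> 'v \<Rightarrow> 'h \<times> 'v"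
    and \<Omega> :: "('h \<times> 'v) set" and \<alpha> :: real
  assumes "heisenberg_type br"
    and "open \<Omega>" and "connected \<Omega>" and "\<Omega> \<noteq> {}" and "bounded \<Omega>"
    and "partial_symmetry \<Omega>" and "partially_symmetric_C2 \<Omega>"
    and "\<alpha> > 0"
    and "\<And>z \<sigma>. (z, \<sigma>) \<in> frontier \<Omega> - characteristic_set br \<Omega> \<Longrightarrow>
           has_horizontal_mean_curvature br \<Omega> (z, \<sigma>) (\<alpha> * norm z)"
  shows "\<exists>(\<sigma>0::'v) R. R > 0 \<and>
           \<Omega> = {(z, \<sigma>). norm z ^ 4 + 16 * (norm (\<sigma> - \<sigma>0))\<^sup>2 < R ^ 4}"
proof -
  note ht = assms(1)
  obtain D :: "(real \<times> 'v) set" where oD: "open D" and even': "\<forall>\<xi> \<sigma>. (\<xi>, \<sigma>) \<in> D \<longleftrightarrow> (- \<xi>, \<sigma>) \<in> D"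
    and Om': "\<Omega> = {(z, \<sigma>). ((norm z)\<^sup>2 / 4, \<sigma>) \<in> {(\<xi>, \<tau>) \<in> D. \<xi> \<ge> 0}}"
    using assms(6) unfolding partial_symmetry_def by blast
  have even: "(- \<xi>, \<sigma>) \<in> D \<longleftrightarrow> (\<xi>, \<sigma>) \<in> D" for \<xi> \<sigma> using even' by blast
  have Om: "\<Omega> = {y. Phi y \<in> D}" unfolding Om' by (auto simp: Phi_def)
  obtain w :: 'h where w: "norm w = 1" by (rule unit_direction)
  have abs: "Phi (sec w x) \<in> D \<longleftrightarrow> x \<in> D" for x
    using even[of "fst x" "snd x"] by (auto simp: Phi_sec[OF w] abs_if)
  have bD: "bounded D"
  proof -
    obtain B where B: "\<And>y. y \<in> \<Omega> \<Longrightarrow> norm y \<le> B" using assms(5) bounded_iff by blast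
    have "norm x \<le> B\<^sup>2 + B" if x: "x \<in> D" for x
    proof -
      have "sec w x \<in> \<Omega>" using x abs by (simp add: Om)
      then have n: "norm (sec w x) \<le> B" by (rule B)
      have 1: "2 * sqrt \<bar>fst x\<bar> \<le> norm (sec w x)" "norm (snd x) \<le> norm (sec w x)"
        using norm_fst_le[of "fst (sec w x)" "snd (sec w x)"] norm_snd_le[of "snd (sec w x)" "fst (sec w x)"] w
        by (simp_all add: sec_def)
      then have "sqrt \<bar>fst x\<bar> \<le> B" using n real_sqrt_ge_zero[of "\<bar>fst x\<bar>"] by linarith
      then have "(sqrt \<bar>fst x\<bar>)\<^sup>2 \<le> B\<^sup>2" by (intro power_mono) auto
      then have "\<bar>fst x\<bar> \<le> B\<^sup>2" by simp
      then show ?thesis using 1(2) n norm_Pair_le[of "fst x" "snd x"] by simp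
    qed
    then show ?thesis unfolding bounded_iff by blast
  qed
  have neD: "D \<noteq> {}" using assms(4) Om by auto
  have "{x \<in> D. fst x \<ge> 0} = Phi ` \<Omega>"
  proof
    show "{x \<in> D. fst x \<ge> 0} \<subseteq> Phi ` \<Omega>"
    proof
      fix x assume "x \<in> {x \<in> D. fst x \<ge> 0}"
      then have "x = Phi (sec w x)" "x \<in> D" by (auto simp: Phi_sec[OF w])
      then show "x \<in> Phi ` \<Omega>" unfolding Om by force
    qed
    show "Phi ` \<Omega> \<subseteq> {x \<in> D. fst x \<ge> 0}" unfolding Om by (auto simp: Phi_def)
  qed
  then have con: "connected {x \<in> D. fst x \<ge> 0}"
    using connected_continuous_image[OF continuous_Phi assms(3)] by simp
  obtain U f g H where C: "C2_grad UNIV f g H" and oU: "open U" and cU: "closure D \<subseteq> U"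
    and fe: "\<And>\<xi> \<sigma>. f (- \<xi>, \<sigma>) = f (\<xi>, \<sigma>)"
    and fU: "\<forall>x\<in>U. (x \<in> D \<longleftrightarrow> f x < 0) \<and> (x \<in> frontier D \<longleftrightarrow> f x = 0) \<and> (x \<in> frontier D \<longrightarrow> g x \<noteq> 0)"
    by (rule even_global_defining_function[OF oD bD even section_defining_function[OF oD even Om assms(7)]], assumption, rule that)
  have fDU: "x \<in> U" if "x \<in> frontier D" for x using that cU by (auto simp: frontier_def)
  have frOm: "y \<in> frontier \<Omega> \<longleftrightarrow> Phi y \<in> frontier D" for y
    unfolding Om by (rule frontier_preimage_Phi[OF oD even])
  define U' where "U' = {y :: 'h \<times> 'v. Phi y \<in> U}"
  have oU': "open U'" unfolding U'_def by (rule open_preimage_Phi[OF oU])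
  define F where "F = (\<lambda>y :: 'h \<times> 'v. f (Phi y))"
  have C2F: "C2_on U' F"
  proof -
    obtain g' H' where G: "C2_grad UNIV F g' H'" unfolding F_def using C2_grad_comp_Phi[OF C] by blast
    have "C2_grad U' F g' H'" using G oU' unfolding C2_grad_def by (meson UNIV_I continuous_on_subset subset_UNIV)
    then show ?thesis by (rule C2_grad_imp_C2_on)
  qed
  have g_axis: "fst (g (0, \<sigma>)) = 0" for \<sigma>
  proof -
    have d: "(f has_derivative (\<lambda>v. g (0, \<sigma>) \<bullet> v)) (at (0, \<sigma>))" by (rule C2_gradD(2)[OF C UNIV_I])
    have "((\<lambda>y. (- fst y, snd y)) has_derivative (\<lambda>y. (- fst y, snd y))) (at (0, \<sigma>))"
      by (intro has_derivative_Pair has_derivative_minus has_derivative_fst has_derivative_snd has_derivative_ident)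
    from has_derivative_compose[OF this, of f "\<lambda>v. g (0, \<sigma>) \<bullet> v"] d
    have "((\<lambda>y. f (- fst y, snd y)) has_derivative (\<lambda>v. g (0, \<sigma>) \<bullet> (- fst v, snd v))) (at (0, \<sigma>))" by simp
    moreover have "(\<lambda>y. f (- fst y, snd y)) = f" using fe by auto
    ultimately have "(\<lambda>v. g (0, \<sigma>) \<bullet> (- fst v, snd v)) = (\<lambda>v. g (0, \<sigma>) \<bullet> v)"
      using d has_derivative_unique by metis
    from fun_cong[OF this, of "(1, 0)"] show ?thesis by (simp add: inner_prod_def)
  qed
  have ldf: "local_defining_function \<Omega> y U' F" if y: "y \<in> frontier \<Omega>" for y
    unfolding local_defining_function_def
  proof (intro conjI C2F)
    show "y \<in> U'" using fDU y by (simp add: U'_def frOm)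
    have "Phi x \<in> U" if "x \<in> U'" for x using that by (simp add: U'_def)
    note FU = bspec[OF fU this]
    show "\<forall>x\<in>U'. (x \<in> \<Omega>) = (F x < 0)"
      unfolding Om F_def mem_Collect_eq using FU by blast
    show "\<forall>x\<in>U'. (x \<in> frontier \<Omega>) = (F x = 0)"
      unfolding frOm F_def using FU by blast
    show "\<forall>x\<in>U' \<inter> frontier \<Omega>. frechet_derivative F (at x) \<noteq> (\<lambda>_. 0)"
    proof (intro ballI notI)
      fix x assume "x \<in> U' \<inter> frontier \<Omega>" and fr0: "frechet_derivative F (at x) = (\<lambda>_. 0)"
      then have gx: "g (Phi x) \<noteq> 0" using fU by (auto simp: U'_def frOm)
      have "(F has_derivative (\<lambda>v. g (Phi x) \<bullet> ((fst x \<bullet> fst v) / 2, snd v))) (at x)"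
        unfolding F_def by (rule has_derivative_compose[OF Phi_deriv C2_gradD(2)[OF C UNIV_I]])
      from frechet_derivative_at[OF this] fr0
      have 0: "g (Phi x) \<bullet> ((fst x \<bullet> fst v) / 2, snd v) = 0" for v by (metis (no_types, lifting))
      have "snd (g (Phi x)) = 0" using 0[of "(0, snd (g (Phi x)))"] by (simp add: inner_prod_def)
      moreover have "fst (g (Phi x)) = 0"
      \<comment> \<open>Over z = 0 the derivative of \<open>Phi\<close> has no \<xi>-component and
        the chain rule is silent about fst g; evenness of f supplies the missing value.\<close>
      proof (cases "fst x = 0")
        case True
        then show ?thesis using g_axis by (simp add: Phi_def)
      next
        case False
        then show ?thesis using 0[of "(fst x, 0)"] by (simp add: inner_prod_def)
      qed
      ultimately show False using gx by (simp add: prod_eq_iff)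
    qed
  qed
  define m where "m = real DIM('h)"
  have m: "m \<ge> 2" unfolding m_def using DIM_ge_2[OF ht] by simp
  \<comment> \<open>The exponent is the m / 2 of the horizontal Laplacian less the 1 / 2 contributed
    by the infinity Laplacian. The constant is 2 \<alpha> because |z| = 2 sqrt \<xi>, and a common
    factor \<xi>^2 cancels.\<close>
  interpret weighted_cmc_domain D f g H "(m - 1) / 2" "2 * \<alpha>"
  proof
    show "open D" "bounded D" "D \<noteq> {}" "C2_grad UNIV f g H" by (rule oD bD neD C)+
    show "f x < 0" if "x \<in> D" for x using fU cU closure_subset that by blast
    show "f x = 0" "g x \<noteq> 0" if "x \<in> frontier D" for x using fU fDU[OF that] that by blast+
    show "\<exists>s>0. \<forall>y\<in>ball x s. (f y < 0 \<longleftrightarrow> y \<in> D) \<and> (f y = 0 \<longleftrightarrow> y \<in> frontier D)" if "x \<in> frontier D" for x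
      using fU oU fDU[OF that] open_contains_ball by (metis subsetD)
    show "f (- \<xi>, \<sigma>) = f (\<xi>, \<sigma>)" "(- \<xi>, \<sigma>) \<in> D \<longleftrightarrow> (\<xi>, \<sigma>) \<in> D" for \<xi> \<sigma> by (rule fe even)+
    show "(m - 1) / 2 > 0" "2 * \<alpha> > 0" using m assms(8) by auto
    fix x assume x: "x \<in> frontier D" "fst x > 0"
    define y where "y = sec w x"
    have Py: "Phi y = x" using x(2) by (simp add: y_def Phi_sec[OF w])
    have ny: "norm (fst y) = 2 * sqrt (fst x)" using x(2) w by (simp add: y_def sec_def)
    have yf: "y \<in> frontier \<Omega>" using x Py by (simp add: frOm)
    have "y \<notin> characteristic_set br \<Omega>"
    proof (rule noncharacteristic[OF ht ldf[OF yf, unfolded F_def] C2_gradD(2)[OF C UNIV_I]])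
      show "g (Phi y) \<noteq> 0" using fU fDU[OF x(1)] x(1) Py by auto
      show "fst y \<noteq> 0" using ny x(2) by auto
    qed
    then have "has_horizontal_mean_curvature br \<Omega> (fst y, snd y) (\<alpha> * norm (fst y))"
      by (intro assms(9)) (simp add: yf)
    then have eq: "hgrad_norm br F y ^ 3 * (\<alpha> * norm (fst y))
        = (hgrad_norm br F y)\<^sup>2 * hlaplacian br F y - hinf_laplacian br F y"
      unfolding has_horizontal_mean_curvature_def using ldf[OF yf] by simp
    define s n t L q where "s = sqrt (fst x)" and "n = norm (g x)" and "t = (\<Sum>b\<in>Basis. H x b \<bullet> b)"
      and "L = H x (g x) \<bullet> g x" and "q = fst (g x)"
    have s: "s > 0" "fst x = s\<^sup>2" using x(2) by (auto simp: s_def)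
    have n: "g x \<bullet> g x = n\<^sup>2" "n \<ge> 0" by (auto simp: n_def power2_norm_eq_inner)
    have r: "(norm (fst y))\<^sup>2 / 4 = s\<^sup>2" unfolding ny s_def by (simp add: power_mult_distrib)
    have h2: "(hgrad_norm br F y)\<^sup>2 = (s * n)\<^sup>2"
      unfolding F_def hgrad_norm_comp_Phi[OF ht C] r Py n by (simp add: power_mult_distrib)
    have h1: "hgrad_norm br F y = s * n"
      by (rule power2_eq_imp_eq[OF h2]) (use s n in \<open>auto simp: hgrad_norm_def metric_def\<close>)
    have hl: "hlaplacian br F y = s\<^sup>2 * t + m / 2 * q"
      unfolding F_def hlaplacian_comp_Phi[OF ht C] r Py t_def q_def m_def ..
    have hi: "hinf_laplacian br F y = 1/2 * s\<^sup>2 * (q * n\<^sup>2 + 2 * s\<^sup>2 * L)"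
      unfolding F_def hinf_laplacian_comp_Phi[OF ht C] r Py n q_def L_def ..
    have "(s * n) ^ 3 * (\<alpha> * (2 * s)) = (s * n)\<^sup>2 * (s\<^sup>2 * t + m / 2 * q) - 1/2 * s\<^sup>2 * (q * n\<^sup>2 + 2 * s\<^sup>2 * L)"
      using eq unfolding h1 hl hi ny s_def[symmetric] .
    then have "s ^ 4 * (2 * \<alpha> * n ^ 3) = s ^ 4 * (n\<^sup>2 * t - L) + s\<^sup>2 * ((m - 1) / 2 * q * n\<^sup>2)"
      by (simp add: power_mult_distrib power2_eq_square power3_eq_cube power4_eq_xxxx algebra_simps diff_divide_distrib)
    also have "\<dots> = s ^ 4 * (n\<^sup>2 * t - L + (m - 1) / 2 / s\<^sup>2 * q * n\<^sup>2)"
      using s(1) by (simp add: field_simps power2_eq_square power4_eq_xxxx)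
    finally have "2 * \<alpha> * n ^ 3 = n\<^sup>2 * t - L + (m - 1) / 2 / s\<^sup>2 * q * n\<^sup>2"
      using s(1) by simp
    then show "(norm (g x))\<^sup>2 * (\<Sum>b\<in>Basis. H x b \<bullet> b) - H x (g x) \<bullet> g x + (m - 1) / 2 / fst x * fst (g x) * (norm (g x))\<^sup>2
        = 2 * \<alpha> * norm (g x) ^ 3"
      unfolding s(2) n_def[symmetric] t_def[symmetric] L_def[symmetric] q_def[symmetric] by simp
  qed
  obtain \<sigma>0 where ball: "D = ball (0, \<sigma>0) (1 / c)" using D_eq_ball[OF con] by blast
  \<comment> \<open>In the group |z|^4 / 16 + |\<sigma> - \<sigma>0|^2 < 1 / c^2 is the ball;
    multiplying by 16 gives R^4 = 16 / c^2.\<close>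
  define R where "R = 2 * sqrt (1 / c)"
  have R: "R > 0" "R ^ 4 = 16 * (1 / c)\<^sup>2"
  proof -
    have "R ^ 4 = 16 * ((sqrt (1 / c))\<^sup>2)\<^sup>2" by (simp add: R_def power_mult_distrib flip: power_mult)
    then show "R ^ 4 = 16 * (1 / c)\<^sup>2" using c_pos by simp
  qed (use c_pos in \<open>simp add: R_def\<close>)
  have "(z, \<sigma>) \<in> \<Omega> \<longleftrightarrow> norm z ^ 4 + 16 * (norm (\<sigma> - \<sigma>0))\<^sup>2 < R ^ 4" for z \<sigma>
  proof -
    have "(z, \<sigma>) \<in> \<Omega> \<longleftrightarrow> norm (Phi (z, \<sigma>) - (0, \<sigma>0)) < 1 / c"
      unfolding Om ball by (simp add: dist_norm norm_minus_commute)
    also have "\<dots> \<longleftrightarrow> (norm (Phi (z, \<sigma>) - (0, \<sigma>0)))\<^sup>2 < (1 / c)\<^sup>2"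
      using c_pos by (auto intro: power_strict_mono power_less_imp_less_base)
    also have "(norm (Phi (z, \<sigma>) - (0, \<sigma>0)))\<^sup>2 = norm z ^ 4 / 16 + (norm (\<sigma> - \<sigma>0))\<^sup>2"
      by (simp add: Phi_def norm_Pair power_divide flip: power_mult)
    also have "\<dots> < (1 / c)\<^sup>2 \<longleftrightarrow> norm z ^ 4 + 16 * (norm (\<sigma> - \<sigma>0))\<^sup>2 < R ^ 4"
      unfolding R(2) by linarith
    finally show ?thesis .
  qed
  then have "\<Omega> = {(z, \<sigma>). norm z ^ 4 + 16 * (norm (\<sigma> - \<sigma>0))\<^sup>2 < R ^ 4}" by auto
  then show ?thesis using R(1) by blast
qed

end
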